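(* Let $\pi$ be a finite group containing a cyclic normal subgroup $\langle\sigma\rangle\simeq C_m$, where $m\ge 1$ is an integer, such that for every $\lambda\in\pi$ one has $\lambda\sigma\lambda^{-1}=\sigma^{\epsilon(\lambda)}$ with $\epsilon(\lambda)\in\{1,-1\}$. Let $M$ be an invertible $\pi$-lattice and let $M^*$ be the $\pi$-lattice obtained by twisting $M$ by $\epsilon$. Suppose that $n\mid m$. Let $\mu$ be the Möbius function. The following equalities hold in $F_\pi$. (i) If $n=1$, or $n=2$ (when $m$ is even), then $$[M/(\sigma^n-1)M]^{fl}=\sum_{d\mid n}[(M/\Phi_d(\sigma)M)_0]^{fl},\qquad [(M/\Phi_n(\sigma)M)_0]^{fl}=\sum_{d\mid n}\mu\left(\frac nd\right)[M/(\sigma^d-1)M]^{fl}.$$ (ii) If $n\ge 3$, then $$[M/(\sigma^n-1)M]^{fl}=[(M/\Phi_1(\sigma)M)_0]^{fl}+\sum_{d\mid n,\ d\ge 3}[(M^*/\Phi_d(\sigma)M^* )_0]^{fl}\quad\text{if } n \text{ is odd},$$ $$[M/(\sigma^n-1)M]^{fl}=[(M/\Phi_1(\sigma)M)_0]^{fl}+[(M/\Phi_2(\sigma)M)_0]^{fl}+\sum_{d\mid n,\ d\ge 3}[(M^*/\Phi_d(\sigma)M^* )_0]^{fl}\quad\text{if } n \text{ is even},$$ and $$[(M^*/\Phi_n(\sigma)M^* )_0]^{fl}=\sum_{d\mid n}\mu\left(\frac nd\right)[M/(\sigma^d-1)M]^{fl}.$$ In particular, $$[\mathbb{Z}\pi/\langle\sigma^n-1\rangle]^{fl}=\sum_{d\mid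 n}[\mathbb{Z}\pi/\langle\Phi_d(\sigma)\rangle]^{fl},\qquad [\mathbb{Z}\pi/\langle\Phi_n(\sigma)\rangle]^{fl}=\sum_{d\mid n}\mu\left(\frac nd\right)[\mathbb{Z}\pi/\langle\sigma^d-1\rangle]^{fl}.$$
   Context: A $\pi$-lattice is a finitely generated $\mathbb{Z}\pi$-module that is torsion-free as an abelian group. It is a permutation lattice if it has a $\mathbb{Z}$-basis permuted by $\pi$; invertible if it is a direct summand of a permutation lattice; flabby if $\widehat H^{-1}(\pi',M)=0$ (Tate cohomology) for all subgroups $\pi'\subset\pi$. Two $\pi$-lattices $M_1,M_2$ are similar if $M_1\oplus P_1\simeq M_2\oplus P_2$ for some permutation lattices $P_1,P_2$. $F_\pi$ is the commutative monoid of similarity classes $[M]$ of flabby $\pi$-lattices, with $[M_1]+[M_2]=[M_1\oplus M_2]$ and with identity $0$ the class of permutation lattices. Every $\pi$-lattice $M$ has a flabby resolution $0\to M\to P\to E\to 0$ with $P$ permutation and $E$ flabby, and $[M]^{fl}:=[E]\in F_\pi$ depends only on $M$. For an invertible lattice $E$, the class $[E]$ has an inverse in $F_\pi$. For a $\mathbb{Z}\pi$-module $M$, $(M)_0:=M/t(M)$, where $t(M)$ is the torsion submodule. $\Phi_d(X)\in\mathbb{Z}[X]$ is the $d$-th cyclotomic polynomial. For $f(X)\in\mathbb{Z}[X]$ dividing $X^m-1$, the right ideal $f(\sigma)\cdot\mathbb{Z}\pi$ is two-sided and is written $\langle f(\sigma)\rangle$; likewise $f(\sigma)M$ is a $\mathbb{Z}\pi$-submodule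 of any $\pi$-lattice $M$. The twist $M^*$: the map $\epsilon:\pi\to\{\pm1\}$ is a group homomorphism (it is uniquely determined when $m\ge3$, which is the only case in which $M^*$ occurs in the statement). As an abelian group $M^*=M$, and $\lambda\in\pi$ acts on $x\in M^*$ by $\lambda*x=\epsilon(\lambda)\,(\lambda\cdot x)$, where $\lambda\cdot x$ is the action in $M$. *)

theory Defs
  imports
    Complex_Main
    "HOL-Algebra.Multiplicative_Group"
    "HOL-Algebra.Elementary_Groups"
    "HOL-Library.Countable_Set"
    "HOL-Computational_Algebra.Polynomial"
    "HOL-Computational_Algebra.Squarefree"
begin

text \<open>
  A \<open>\<pi>\<close>-module is represented by an abelian group with an additive left action of the group
  \<open>G = \<pi>\<close>.  As elsewhere in HOL-Algebra (e.g. \<open>free_Abelian_group\<close>), the abelian group is a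
  \<^const>\<open>comm_group\<close>, so that \<open>x \<otimes>\<^bsub>M\<^esub> y\<close> is the sum \<open>x + y\<close> in \<open>M\<close>, \<open>\<one>\<^bsub>M\<^esub>\<close> is its zero and
  \<open>x [^]\<^bsub>M\<^esub> k\<close> is the multiple \<open>k x\<close>.
\<close>

record ('g, 'a) gmodule = "'a monoid" +
  act :: "'g \<Rightarrow> 'a \<Rightarrow> 'a"

locale gmodule = G: group G + M: comm_group M
  for G :: "('g, 'c) monoid_scheme" and M :: "('g, 'a) gmodule" +
  assumes act_closed: "\<lbrakk>g \<in> carrier G; x \<in> carrier M\<rbrakk> \<Longrightarrow> act M g x \<in> carrier M"
    and act_add: "\<lbrakk>g \<in> carrier G; x \<in> carrier M; y \<in> carrier M\<rbrakk>
      \<Longrightarrow> act M g (x \<otimes>\<^bsub>M\<^esub> y) = act M g x \<otimes>\<^bsub>M\<^esub> act M g y"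
    and act_mult: "\<lbrakk>g \<in> carrier G; h \<in> carrier G; x \<in> carrier M\<rbrakk>
      \<Longrightarrow> act M (g \<otimes>\<^bsub>G\<^esub> h) x = act M g (act M h x)"
    and act_one: "x \<in> carrier M \<Longrightarrow> act M \<one>\<^bsub>G\<^esub> x = x"

definition gmodule_hom ::
  "('g, 'c) monoid_scheme \<Rightarrow> ('g, 'a) gmodule \<Rightarrow> ('g, 'b) gmodule \<Rightarrow> ('a \<Rightarrow> 'b) set" where
  "gmodule_hom G M N =
     {f \<in> hom M N. \<forall>g\<in>carrier G. \<forall>x\<in>carrier M. f (act M g x) = act N g (f x)}"

definition gmodule_iso ::
  "('g, 'c) monoid_scheme \<Rightarrow> ('g, 'a) gmodule \<Rightarrow> ('g, 'b) gmodule \<Rightarrow> bool" where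
  "gmodule_iso G M N \<longleftrightarrow> (\<exists>f\<in>gmodule_hom G M N. bij_betw f (carrier M) (carrier N))"

definition direct_sum :: "('g, 'a) gmodule \<Rightarrow> ('g, 'b) gmodule \<Rightarrow> ('g, 'a \<times> 'b) gmodule" where
  "direct_sum M N =
     monoid.extend (M \<times>\<times> N) (gmodule.fields (\<lambda>g (x, y). (act M g x, act N g y)))"

text \<open>For a submodule \<open>N\<close> the action on the cosets of \<open>N\<close> is elementwise.\<close>

definition quot_module :: "('g, 'a) gmodule \<Rightarrow> 'a set \<Rightarrow> ('g, 'a set) gmodule" where
  "quot_module M N = monoid.extend (M Mod N) (gmodule.fields (\<lambda>g C. act M g ` C))"

definition torsion_part :: "('a, 'm) monoid_scheme \<Rightarrow> 'a set" where
  "torsion_part M = {x \<in> carrier M. \<exists>k::nat. k > 0 \<and> x [^]\<^bsub>M\<^esub> k = \<one>\<^bsub>M\<^esub>}"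

text \<open>\<open>(M)\<^sub>0 = M / t(M)\<close>\<close>

definition mod_torsion :: "('g, 'a) gmodule \<Rightarrow> ('g, 'a set) gmodule" where
  "mod_torsion M = quot_module M (torsion_part M)"

definition twist :: "('g \<Rightarrow> int) \<Rightarrow> ('g, 'a) gmodule \<Rightarrow> ('g, 'a) gmodule" where
  "twist \<epsilon> M = M\<lparr>act := (\<lambda>g x. act M g x [^]\<^bsub>M\<^esub> \<epsilon> g)\<rparr>"


text \<open>The \<open>\<int>\<pi>\<close>-span of \<open>S\<close> is the additive subgroup generated by the translates of \<open>S\<close>.\<close>

definition fin_gen_gmodule :: "('g, 'c) monoid_scheme \<Rightarrow> ('g, 'a) gmodule \<Rightarrow> bool" where
  "fin_gen_gmodule G M \<longleftrightarrow> (\<exists>S. finite S \<and> S \<subseteq> carrier M \<and>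
     generate M {act M g s | g s. g \<in> carrier G \<and> s \<in> S} = carrier M)"

definition pi_lattice :: "('g, 'c) monoid_scheme \<Rightarrow> ('g, 'a) gmodule \<Rightarrow> bool" where
  "pi_lattice G M \<longleftrightarrow> gmodule G M \<and> fin_gen_gmodule G M \<and> torsion_part M = {\<one>\<^bsub>M\<^esub>}"

definition int_basis :: "('a, 'm) monoid_scheme \<Rightarrow> 'a set \<Rightarrow> bool" where
  "int_basis M B \<longleftrightarrow> finite B \<and> B \<subseteq> carrier M \<and>
     bij_betw (\<lambda>c. \<Otimes>\<^bsub>M\<^esub>b\<in>B. b [^]\<^bsub>M\<^esub> (c b :: int)) (B \<rightarrow>\<^sub>E UNIV) (carrier M)"

definition permutation_lattice :: "('g, 'c) monoid_scheme \<Rightarrow> ('g, 'a) gmodule \<Rightarrow> bool" where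
  "permutation_lattice G M \<longleftrightarrow> pi_lattice G M \<and>
     (\<exists>B. int_basis M B \<and> (\<forall>g\<in>carrier G. act M g ` B = B))"

text \<open>
  A definition cannot quantify over lattices on arbitrary types.  Wherever the mathematics says
  "there is a lattice" or "the class of all lattices", the carriers range over the subsets of the
  following fixed type; as lattices are countable and this type is infinite, every
  \<open>\<pi>\<close>-lattice, on whatever type, is isomorphic to one of these (lemma \<open>lattice_univ_copy\<close>).
\<close>

type_synonym univ = "nat \<Rightarrow> int"

lemma countable_generate:
  assumes "countable T"
  shows "countable (generate M T)"
proof -
  define L where "L = rec_nat (insert \<one>\<^bsub>M\<^esub> (T \<union> m_inv M ` T))
    (\<lambda>_ A. A \<union> (\<lambda>(x, y). x \<otimes>\<^bsub>M\<^esub> y) ` (A \<times> A))"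
  have L_0: "L 0 = insert \<one>\<^bsub>M\<^esub> (T \<union> m_inv M ` T)"
    by (simp add: L_def)
  have L_Suc: "L (Suc k) = L k \<union> (\<lambda>(x, y). x \<otimes>\<^bsub>M\<^esub> y) ` (L k \<times> L k)" for k
    by (simp add: L_def)
  have mono: "L i \<subseteq> L j" if "i \<le> j" for i j
    using that by (induction rule: dec_induct) (auto simp: L_Suc)
  have count: "countable (L k)" for k
  proof (induction k)
    case 0
    then show ?case using assms by (simp add: L_0)
  next
    case (Suc k)
    then show ?case by (simp only: L_Suc countable_Un countable_image countable_SIGMA)
  qed
  have "\<exists>k. x \<in> L k" if "x \<in> generate M T" for x
    using that
  proof induction
    case one
    then show ?case by (intro exI[of _ 0]) (simp add: L_0)
  next
    case (incl h)
    then show ?case by (intro exI[of _ 0]) (simp add: L_0)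
  next
    case (inv h)
    then show ?case by (intro exI[of _ 0]) (simp add: L_0)
  next
    case (eng x y)
    then obtain i j where "x \<in> L i" "y \<in> L j" by blast
    then have "x \<in> L (max i j)" "y \<in> L (max i j)"
      using mono[of i "max i j"] mono[of j "max i j"] by auto
    then have "x \<otimes>\<^bsub>M\<^esub> y \<in> L (Suc (max i j))"
      unfolding L_Suc by (intro UnI2 image_eqI[where x = "(x, y)"]) simp_all
    then show ?case by (rule exI)
  qed
  then have "generate M T \<subseteq> \<Union> (range L)"
    by (simp add: subset_iff)
  moreover have "countable (\<Union> (range L))"
    using count by simp
  ultimately show ?thesis
    by (rule countable_subset)
qed

lemma lattice_univ_copy:
  fixes G :: "('g, 'c) monoid_scheme" and M :: "('g, 'a) gmodule"
  assumes "finite (carrier G)" and "pi_lattice G M"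
  shows "\<exists>N :: ('g, univ) gmodule. pi_lattice G N \<and> gmodule_iso G M N"
proof -
  interpret gmodule G M using assms(2) unfolding pi_lattice_def by (rule conjunct1)
  obtain S where S: "finite S" "S \<subseteq> carrier M"
    "generate M {act M g s | g s. g \<in> carrier G \<and> s \<in> S} = carrier M"
    using assms(2)[unfolded pi_lattice_def, THEN conjunct2, THEN conjunct1]
    unfolding fin_gen_gmodule_def by (elim exE conjE) (rule that)
  let ?T = "{act M g s | g s. g \<in> carrier G \<and> s \<in> S}"
  have T: "?T = (\<lambda>(g, s). act M g s) ` (carrier G \<times> S)" by auto
  have "finite ?T" unfolding T using S(1) assms(1) by simp
  then have "countable (generate M ?T)"
    by (intro countable_generate countable_finite)
  then have "countable (carrier M)"
    by (simp only: S(3))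
  then obtain f0 :: "'a \<Rightarrow> nat" where f0: "inj_on f0 (carrier M)" by (auto simp: countable_def)
  define f :: "'a \<Rightarrow> univ" where "f x = (\<lambda>_. int (f0 x))" for x
  have f: "inj_on f (carrier M)" using f0 by (auto simp: inj_on_def f_def fun_eq_iff)
  define k where "k = inv_into (carrier M) f"
  have kf [simp]: "k (f x) = x" if "x \<in> carrier M" for x using f that by (simp add: k_def)
  define N :: "('g, univ) gmodule" where
    "N = \<lparr>carrier = f ` carrier M, monoid.mult = (\<lambda>x y. f (k x \<otimes>\<^bsub>M\<^esub> k y)), one = f \<one>\<^bsub>M\<^esub>,
          act = (\<lambda>g x. f (act M g (k x)))\<rparr>"
  have N: "carrier N = f ` carrier M" "x \<otimes>\<^bsub>N\<^esub> y = f (k x \<otimes>\<^bsub>M\<^esub> k y)" "\<one>\<^bsub>N\<^esub> = f \<one>\<^bsub>M\<^esub>"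
    "act N g x = f (act M g (k x))" for x y g by (auto simp: N_def)
  interpret N: comm_group N
  proof (rule comm_groupI)
    fix x assume "x \<in> carrier N"
    then obtain a where a: "a \<in> carrier M" "x = f a" by (auto simp: N)
    then show "\<exists>y\<in>carrier N. y \<otimes>\<^bsub>N\<^esub> x = \<one>\<^bsub>N\<^esub>"
      by (intro bexI[of _ "f (inv\<^bsub>M\<^esub> a)"]) (auto simp: N)
  next
    fix x y assume "x \<in> carrier N" "y \<in> carrier N"
    then have "k x \<in> carrier M" "k y \<in> carrier M" by (auto simp: N(1))
    then show "x \<otimes>\<^bsub>N\<^esub> y = y \<otimes>\<^bsub>N\<^esub> x" by (simp only: N(2) M.m_comm)
  qed (auto simp: N M.m_assoc)
  have gN: "gmodule G N"
    by unfold_locales (auto simp: N act_closed act_add act_mult act_one)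
  have fh: "f \<in> gmodule_hom G M N"
    by (auto simp: gmodule_hom_def hom_def N act_closed)
  interpret f: group_hom M N f
    using fh by unfold_locales (auto simp: gmodule_hom_def)
  have pw: "f x [^]\<^bsub>N\<^esub> (n::nat) = f (x [^]\<^bsub>M\<^esub> n)" if "x \<in> carrier M" for x n
    by (rule f.hom_nat_pow[OF that, symmetric])
  have "torsion_part N = f ` torsion_part M"
  proof -
    have "f x [^]\<^bsub>N\<^esub> (n::nat) = \<one>\<^bsub>N\<^esub> \<longleftrightarrow> x [^]\<^bsub>M\<^esub> n = \<one>\<^bsub>M\<^esub>" if "x \<in> carrier M" for x n
      unfolding pw[OF that] N(3) using that by (intro inj_on_eq_iff[OF f]) simp_all
    then show ?thesis by (force simp: torsion_part_def N(1))
  qed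
  then have tN: "torsion_part N = {\<one>\<^bsub>N\<^esub>}"
    using assms(2) by (simp add: pi_lattice_def)
  have sub: "?T \<subseteq> carrier M" using S(2) by (auto intro!: act_closed)
  have "act N g (f s) = f (act M g s)" if "s \<in> S" for g s
    using S(2) that by (simp add: N(4) subset_iff)
  then have "(\<lambda>(g, s). act N g (f s)) ` (carrier G \<times> S) = f ` ?T"
    unfolding T image_image by (intro image_cong) auto
  moreover have "{act N g s | g s. g \<in> carrier G \<and> s \<in> f ` S} =
      (\<lambda>(g, s). act N g (f s)) ` (carrier G \<times> S)"
    by auto
  ultimately have "generate N {act N g s | g s. g \<in> carrier G \<and> s \<in> f ` S} = carrier N"
    using f.generate_img[OF sub] by (simp only: S(3) N(1))
  moreover have "finite (f ` S)"
    using S(1) by (rule finite_imageI)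
  moreover have "f ` S \<subseteq> carrier N"
    unfolding N(1) using S(2) by (rule image_mono)
  ultimately have "fin_gen_gmodule G N"
    unfolding fin_gen_gmodule_def by (intro exI[of _ "f ` S"] conjI)
  moreover have "gmodule_iso G M N"
    unfolding gmodule_iso_def N(1) using fh inj_on_imp_bij_betw[OF f] by blast
  ultimately show ?thesis
    using gN tN unfolding pi_lattice_def by (intro exI[of _ N] conjI)
qed

definition invertible_lattice :: "('g, 'c) monoid_scheme \<Rightarrow> ('g, 'a) gmodule \<Rightarrow> bool" where
  "invertible_lattice G M \<longleftrightarrow> pi_lattice G M \<and>
     (\<exists>(M' :: ('g, univ) gmodule) (P :: ('g, univ) gmodule).
        pi_lattice G M' \<and> permutation_lattice G P \<and> gmodule_iso G (direct_sum M M') P)"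

text \<open>
  Tate cohomology in degree \<open>-1\<close>: the kernel of the norm \<open>x \<mapsto> \<Sum>h\<in>H. h x\<close> modulo \<open>I\<^sub>H M\<close>,
  the subgroup generated by all \<open>h x - x\<close>.
\<close>

definition norm_kernel :: "'g set \<Rightarrow> ('g, 'a) gmodule \<Rightarrow> 'a set" where
  "norm_kernel H M = {x \<in> carrier M. (\<Otimes>\<^bsub>M\<^esub>h\<in>H. act M h x) = \<one>\<^bsub>M\<^esub>}"

definition augmentation_image :: "'g set \<Rightarrow> ('g, 'a) gmodule \<Rightarrow> 'a set" where
  "augmentation_image H M =
     generate M {act M h x \<otimes>\<^bsub>M\<^esub> inv\<^bsub>M\<^esub> x | h x. h \<in> H \<and> x \<in> carrier M}"

definition tate_Hm1 :: "'g set \<Rightarrow> ('g, 'a) gmodule \<Rightarrow> 'a set monoid" where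
  "tate_Hm1 H M = (M\<lparr>carrier := norm_kernel H M\<rparr>) Mod (augmentation_image H M)"

definition flabby_lattice :: "('g, 'c) monoid_scheme \<Rightarrow> ('g, 'a) gmodule \<Rightarrow> bool" where
  "flabby_lattice G M \<longleftrightarrow> pi_lattice G M \<and> (\<forall>H. subgroup H G \<longrightarrow> trivial_group (tate_Hm1 H M))"

definition similar ::
  "('g, 'c) monoid_scheme \<Rightarrow> ('g, 'a) gmodule \<Rightarrow> ('g, 'b) gmodule \<Rightarrow> bool" where
  "similar G M N \<longleftrightarrow>
     (\<exists>(P :: ('g, univ) gmodule) (Q :: ('g, univ) gmodule).
        permutation_lattice G P \<and> permutation_lattice G Q \<and>
        gmodule_iso G (direct_sum M P) (direct_sum N Q))"

definition sim_class ::
  "('g, 'c) monoid_scheme \<Rightarrow> ('g, 'a) gmodule \<Rightarrow> ('g, univ) gmodule set" where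
  "sim_class G M = {E. flabby_lattice G E \<and> similar G M E}"

text \<open>
  The commutative monoid \<open>F\<^sub>\<pi>\<close>, written multiplicatively: \<open>\<otimes>\<close> is \<open>[A] + [B] = [A \<oplus> B]\<close> and
  \<open>\<one>\<close> is the class \<open>0\<close> of the permutation lattices.
\<close>

definition flabby_monoid :: "('g, 'c) monoid_scheme \<Rightarrow> ('g, univ) gmodule set monoid" where
  "flabby_monoid G =
     \<lparr>carrier = {sim_class G E | E :: ('g, univ) gmodule. flabby_lattice G E},
      monoid.mult = (\<lambda>a b. {E. \<exists>A\<in>a. \<exists>B\<in>b. E \<in> sim_class G (direct_sum A B)}),
      one = {E. \<exists>P :: ('g, univ) gmodule. permutation_lattice G P \<and> E \<in> sim_class G P}\<rparr>"

definition flabby_resolution ::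
  "('g, 'c) monoid_scheme \<Rightarrow> ('g, 'a) gmodule \<Rightarrow> ('g, 'p) gmodule \<Rightarrow> ('g, 'e) gmodule
     \<Rightarrow> ('a \<Rightarrow> 'p) \<Rightarrow> ('p \<Rightarrow> 'e) \<Rightarrow> bool" where
  "flabby_resolution G M P E i q \<longleftrightarrow>
     permutation_lattice G P \<and> flabby_lattice G E \<and>
     i \<in> gmodule_hom G M P \<and> inj_on i (carrier M) \<and>
     q \<in> gmodule_hom G P E \<and> q ` carrier P = carrier E \<and>
     kernel P E q = i ` carrier M"

definition flabby_class ::
  "('g, 'c) monoid_scheme \<Rightarrow> ('g, 'a) gmodule \<Rightarrow> ('g, univ) gmodule set" where
  "flabby_class G M =
     (THE c. \<exists>(P :: ('g, univ) gmodule) (E :: ('g, univ) gmodule) i q.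
        flabby_resolution G M P E i q \<and> c = sim_class G E)"


definition cyclotomic :: "nat \<Rightarrow> int poly" where
  "cyclotomic d = (THE p. map_poly of_int p =
     (\<Prod>k\<in>{k\<in>{1..d}. coprime k d}. [:- cis (2 * pi * real k / real d), 1:]))"

definition moebius_mu :: "nat \<Rightarrow> int" where
  "moebius_mu k = (if squarefree k then (- 1) ^ card (prime_factors k) else 0)"

text \<open>
  The prefixes \<open>Polynomial.\<close> below are needed because HOL-Algebra has its own \<open>degree\<close> and \<open>coeff\<close>.

  \<open>f(\<sigma>) x\<close> for \<open>f \<in> \<int>[X]\<close> and \<open>x \<in> M\<close>, and the quotient \<open>M / f(\<sigma>) M\<close>:
\<close>

definition poly_act ::
  "('g, 'c) monoid_scheme \<Rightarrow> ('g, 'a) gmodule \<Rightarrow> 'g \<Rightarrow> int poly \<Rightarrow> 'a \<Rightarrow> 'a" where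
  "poly_act G M \<sigma> f x = (\<Otimes>\<^bsub>M\<^esub>i\<in>{..Polynomial.degree f}. act M (\<sigma> [^]\<^bsub>G\<^esub> i) x [^]\<^bsub>M\<^esub> Polynomial.coeff f i)"

definition poly_quot ::
  "('g, 'c) monoid_scheme \<Rightarrow> ('g, 'a) gmodule \<Rightarrow> 'g \<Rightarrow> int poly \<Rightarrow> ('g, 'a set) gmodule" where
  "poly_quot G M \<sigma> f = quot_module M (poly_act G M \<sigma> f ` carrier M)"


text \<open>The integral group ring \<open>\<int>\<pi>\<close> of a finite group\<close>

definition group_ring :: "('g, 'c) monoid_scheme \<Rightarrow> ('g \<Rightarrow> int) ring" where
  "group_ring G =
     \<lparr>carrier = {a. \<forall>g. g \<notin> carrier G \<longrightarrow> a g = 0},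
      monoid.mult = (\<lambda>a b g. if g \<in> carrier G
                then \<Sum>h\<in>carrier G. a h * b (inv\<^bsub>G\<^esub> h \<otimes>\<^bsub>G\<^esub> g) else 0),
      one = (\<lambda>g. of_bool (g = \<one>\<^bsub>G\<^esub>)),
      zero = (\<lambda>g. 0),
      add = (\<lambda>a b g. a g + b g)\<rparr>"

definition group_ring_module :: "('g, 'c) monoid_scheme \<Rightarrow> ('g, 'g \<Rightarrow> int) gmodule" where
  "group_ring_module G =
     monoid.extend (add_monoid (group_ring G))
       (gmodule.fields (\<lambda>g a. (\<lambda>h. of_bool (h = g)) \<otimes>\<^bsub>group_ring G\<^esub> a))"

text \<open>The element \<open>f(\<sigma>)\<close> of \<open>\<int>\<pi>\<close> and the right ideal \<open>\<langle>f(\<sigma>)\<rangle> = f(\<sigma>) \<cdot> \<int>\<pi>\<close>\<close>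

definition poly_elem :: "('g, 'c) monoid_scheme \<Rightarrow> 'g \<Rightarrow> int poly \<Rightarrow> 'g \<Rightarrow> int" where
  "poly_elem G \<sigma> f = (\<lambda>g. \<Sum>i | i \<le> Polynomial.degree f \<and> \<sigma> [^]\<^bsub>G\<^esub> i = g. Polynomial.coeff f i)"

definition poly_ideal :: "('g, 'c) monoid_scheme \<Rightarrow> 'g \<Rightarrow> int poly \<Rightarrow> ('g \<Rightarrow> int) set" where
  "poly_ideal G \<sigma> f = (\<lambda>a. poly_elem G \<sigma> f \<otimes>\<^bsub>group_ring G\<^esub> a) ` carrier (group_ring G)"

end

theory Submission
  imports Defs "HOL-Number_Theory.Totient"
begin

text \<open>
  For a set \<open>D\<close> of divisors of \<open>m\<close> that contains all divisors of its elements, let \<open>\<Psi>\<^sub>D\<close> be the product of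
  the \<open>\<Phi>\<^sub>d\<close>, \<open>d \<in> D\<close>.  The theorem follows from a study of the modules \<open>M/\<Psi>\<^sub>D(\<sigma>)M\<close>.

  They are invertible lattices.  When \<open>D\<close> consists of all divisors of \<open>n\<close>, so that \<open>\<Psi>\<^sub>D = X\<^sup>n - 1\<close>, this is
  because \<open>P/(\<sigma>\<^sup>n - 1)P\<close> is a permutation lattice for every permutation lattice \<open>P\<close> (lemmas
  \<open>permutation_PQ_xpow1\<close>, \<open>invertible_PQ_xpow1\<close>).  In general, let \<open>n\<close> be the greatest element of \<open>D\<close>, let
  \<open>D' = D - {n}\<close>, and let \<open>P \<subseteq> D'\<close> be the set of proper divisors of \<open>n\<close>.  In \<open>\<int>[X]\<close> the polynomial \<open>\<Phi>\<^sub>n\<close> is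
  comaximal with \<open>\<Phi>\<^sub>e\<close> for \<open>e \<in> D' - P\<close>, since neither of \<open>n\<close> and \<open>e\<close> divides the other.  This gives an
  isomorphism over \<open>\<langle>\<sigma>\<rangle>\<close>
  \<open>M/\<Psi>\<^bsub>D'\<^esub>(\<sigma>)M \<oplus> M/(\<sigma>\<^sup>n - 1)M \<cong> M/\<Psi>\<^sub>D(\<sigma>)M \<oplus> M/\<Psi>\<^sub>P(\<sigma>)M\<close>.
  An element \<open>\<lambda>\<close> of \<open>\<pi>\<close> satisfies \<open>\<lambda> f(\<sigma>) = f(\<sigma>\<^bsup>\<epsilon>(\<lambda>)\<^esup>) \<lambda>\<close>, so the isomorphism is one of \<open>\<pi>\<close>-modules if the
  polynomials that describe it are invariant under \<open>X \<mapsto> 1/X\<close> modulo \<open>X\<^sup>m - 1\<close>, and they can be chosen so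
  (lemma \<open>quotient_splitting\<close>).

  Induction on \<open>D\<close> now shows that \<open>M/\<Psi>\<^sub>D(\<sigma>)M\<close> is invertible and that its class is \<open>-\<Sum>\<^bsub>d \<in> D\<^esub> \<phi>\<^sub>d\<close>, where
  \<open>\<phi>\<^sub>n = [M/g(\<sigma>)M] - [M/(\<sigma>\<^sup>n - 1)M]\<close> for \<open>g = (X\<^sup>n - 1)/\<Phi>\<^sub>n\<close> (lemma \<open>divisor_closed_quotient\<close>).  Since \<open>[E]\<^sup>f\<^sup>l = -[E]\<close>
  for an invertible lattice \<open>E\<close>, it follows that \<open>[M/(\<sigma>\<^sup>n - 1)M]\<^sup>f\<^sup>l = \<Sum>\<^bsub>d | n\<^esub> \<phi>\<^sub>d\<close>, and by Moebius inversion that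
  \<open>\<phi>\<^sub>n = \<Sum>\<^bsub>d | n\<^esub> \<mu>(n/d) [M/(\<sigma>\<^sup>d - 1)M]\<^sup>f\<^sup>l\<close>.

  It remains to recognise \<open>\<phi>\<^sub>n\<close> (lemma \<open>flabby_class_phi_part\<close>).  Multiplication by \<open>g(\<sigma>)\<close> induces an exact
  sequence \<open>0 \<rightarrow> (M/\<Phi>\<^sub>n(\<sigma>)M)\<^sub>0 \<rightarrow> M/(\<sigma>\<^sup>n - 1)M \<rightarrow> M/g(\<sigma>)M \<rightarrow> 0\<close> over \<open>\<langle>\<sigma>\<rangle>\<close> with invertible middle and
  right terms, and for such a sequence of \<open>\<pi>\<close>-modules the flabby class of the left term is \<open>\<phi>\<^sub>n\<close>.  For
  \<open>n \<ge> 3\<close>, modulo \<open>X\<^sup>n - 1\<close> some \<open>X\<^sup>e g\<close> changes sign under \<open>X \<mapsto> 1/X\<close>, so that the left-hand map is \<open>\<pi>\<close>-linear on the twist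
  \<open>M\<^sup>*\<close>.  For \<open>n \<le> 2\<close> there is no sign, and \<open>M\<close> itself appears.  The module \<open>\<int>\<pi>/\<langle>\<Phi>\<^sub>n(\<sigma>)\<rangle>\<close> is torsion-free,
  because \<open>\<int>\<pi>\<close> is free over \<open>\<int>[X]/(X\<^sup>m - 1)\<close>, and \<open>\<int>\<pi>\<close> is isomorphic to its own twist.

  All this presupposes that \<open>[M]\<^sup>f\<^sup>l\<close> does not depend on the flabby resolution (lemma \<open>flabby_class_eq\<close>).
  The proof is Schanuel's, once homomorphisms into permutation lattices are known to extend along
  embeddings with flabby cokernel; this comes down to extending functionals invariant under a
  subgroup \<open>H\<close>, and works because \<open>E/I\<^sub>H E\<close> is torsion-free for flabby \<open>E\<close>.
\<close>

section \<open>Modules over a group\<close>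

lemma direct_sum_simps [simp]:
  "carrier (direct_sum M N) = carrier M \<times> carrier N"
  "x \<otimes>\<^bsub>direct_sum M N\<^esub> y = (fst x \<otimes>\<^bsub>M\<^esub> fst y, snd x \<otimes>\<^bsub>N\<^esub> snd y)"
  "\<one>\<^bsub>direct_sum M N\<^esub> = (\<one>\<^bsub>M\<^esub>, \<one>\<^bsub>N\<^esub>)"
  "act (direct_sum M N) g x = (act M g (fst x), act N g (snd x))"
  by (auto simp: direct_sum_def monoid.defs gmodule.defs DirProd_def split: prod.splits)

lemma quot_module_simps [simp]:
  "carrier (quot_module M N) = rcosets\<^bsub>M\<^esub> N"
  "C \<otimes>\<^bsub>quot_module M N\<^esub> D = C <#>\<^bsub>M\<^esub> D"
  "\<one>\<^bsub>quot_module M N\<^esub> = N"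
  "act (quot_module M N) g C = act M g ` C"
  by (auto simp: quot_module_def monoid.defs gmodule.defs FactGroup_def)

lemma gmodule_homI:
  assumes "\<And>x. x \<in> carrier M \<Longrightarrow> f x \<in> carrier N"
    and "\<And>x y. x \<in> carrier M \<Longrightarrow> y \<in> carrier M \<Longrightarrow> f (x \<otimes>\<^bsub>M\<^esub> y) = f x \<otimes>\<^bsub>N\<^esub> f y"
    and "\<And>g x. g \<in> carrier G \<Longrightarrow> x \<in> carrier M \<Longrightarrow> f (act M g x) = act N g (f x)"
  shows "f \<in> gmodule_hom G M N"
  using assms by (auto simp: gmodule_hom_def hom_def)

lemma gmodule_homD:
  assumes "f \<in> gmodule_hom G M N"
  shows "x \<in> carrier M \<Longrightarrow> f x \<in> carrier N"
    and "x \<in> carrier M \<Longrightarrow> y \<in> carrier M \<Longrightarrow> f (x \<otimes>\<^bsub>M\<^esub> y) = f x \<otimes>\<^bsub>N\<^esub> f y"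
    and "g \<in> carrier G \<Longrightarrow> x \<in> carrier M \<Longrightarrow> f (act M g x) = act N g (f x)"
  using assms by (auto simp: gmodule_hom_def hom_def)

lemma gmodule_hom_comp:
  "f \<in> gmodule_hom G L M \<Longrightarrow> h \<in> gmodule_hom G M N \<Longrightarrow> (\<lambda>x. h (f x)) \<in> gmodule_hom G L N"
  by (intro gmodule_homI) (simp_all add: gmodule_homD)

lemma gmodule_hom_group_hom:
  assumes "gmodule G M" "gmodule G N" "f \<in> gmodule_hom G M N"
  shows "group_hom M N f"
proof -
  interpret M: gmodule G M by fact
  interpret N: gmodule G N by fact
  show ?thesis using assms(3) by unfold_locales (auto simp: gmodule_hom_def)
qed

lemma gmoduleI:
  assumes "group G" "comm_group M"
    and "\<And>g x. \<lbrakk>g \<in> carrier G; x \<in> carrier M\<rbrakk> \<Longrightarrow> act M g x \<in> carrier M"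
    and "\<And>g x y. \<lbrakk>g \<in> carrier G; x \<in> carrier M; y \<in> carrier M\<rbrakk>
      \<Longrightarrow> act M g (x \<otimes>\<^bsub>M\<^esub> y) = act M g x \<otimes>\<^bsub>M\<^esub> act M g y"
    and "\<And>g h x. \<lbrakk>g \<in> carrier G; h \<in> carrier G; x \<in> carrier M\<rbrakk>
      \<Longrightarrow> act M (g \<otimes>\<^bsub>G\<^esub> h) x = act M g (act M h x)"
    and "\<And>x. x \<in> carrier M \<Longrightarrow> act M \<one>\<^bsub>G\<^esub> x = x"
  shows "gmodule G M"
  using assms by (simp add: gmodule_def gmodule_axioms_def)

context gmodule
begin

lemma act_group_hom: "g \<in> carrier G \<Longrightarrow> group_hom M M (act M g)"
  by unfold_locales (auto simp: hom_def act_closed act_add)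

lemma act_zero [simp]: "g \<in> carrier G \<Longrightarrow> act M g \<one>\<^bsub>M\<^esub> = \<one>\<^bsub>M\<^esub>"
  by (rule group_hom.hom_one[OF act_group_hom])

lemma act_inv: "g \<in> carrier G \<Longrightarrow> x \<in> carrier M \<Longrightarrow> act M g (inv\<^bsub>M\<^esub> x) = inv\<^bsub>M\<^esub> act M g x"
  by (rule group_hom.hom_inv[OF act_group_hom])

lemma act_nat_pow: "g \<in> carrier G \<Longrightarrow> x \<in> carrier M \<Longrightarrow> act M g (x [^]\<^bsub>M\<^esub> (k::nat)) = act M g x [^]\<^bsub>M\<^esub> k"
  by (rule group_hom.hom_nat_pow[OF act_group_hom])

lemma act_int_pow: "g \<in> carrier G \<Longrightarrow> x \<in> carrier M \<Longrightarrow> act M g (x [^]\<^bsub>M\<^esub> (k::int)) = act M g x [^]\<^bsub>M\<^esub> k"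
  by (rule group_hom.hom_int_pow[OF act_group_hom])

lemma act_cancel [simp]:
  assumes "g \<in> carrier G" "x \<in> carrier M"
  shows "act M g (act M (inv\<^bsub>G\<^esub> g) x) = x" "act M (inv\<^bsub>G\<^esub> g) (act M g x) = x"
  using assms by (simp_all add: act_mult[symmetric] act_one)

end

lemma (in gmodule) zero_hom: "gmodule G N \<Longrightarrow> (\<lambda>x. \<one>\<^bsub>M\<^esub>) \<in> gmodule_hom G N M"
  by (rule gmodule_homI) auto

lemma group_hom_kernel_eq:
  assumes "group_hom M N f" "x \<in> carrier M" "y \<in> carrier M"
  shows "f x = f y \<longleftrightarrow> f (x \<otimes>\<^bsub>M\<^esub> inv\<^bsub>M\<^esub> y) = \<one>\<^bsub>N\<^esub>"
proof -
  interpret group_hom M N f by fact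
  show ?thesis using assms(2,3)
    by (simp add: H.inv_solve_right' H.inv_equality)
qed

lemma gmodule_hom_factor:
  assumes W: "gmodule G W" and X: "gmodule G X" and Y: "gmodule G Y"
    and s: "s \<in> gmodule_hom G W X" "s ` carrier W = carrier X"
    and f: "f \<in> gmodule_hom G W Y" and ker: "kernel W X s \<subseteq> kernel W Y f"
  obtains h where "h \<in> gmodule_hom G X Y" "\<And>w. w \<in> carrier W \<Longrightarrow> h (s w) = f w"
proof -
  interpret W: gmodule G W by fact
  interpret s: group_hom W X s using W X s(1) by (rule gmodule_hom_group_hom)
  interpret f: group_hom W Y f using W Y f by (rule gmodule_hom_group_hom)
  define h where "h y = f (SOME w. w \<in> carrier W \<and> s w = y)" for y
  have h: "h (s w) = f w" if w: "w \<in> carrier W" for w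
  proof -
    let ?v = "SOME v. v \<in> carrier W \<and> s v = s w"
    have v: "?v \<in> carrier W" "s ?v = s w"
      using someI[of "\<lambda>v. v \<in> carrier W \<and> s v = s w" w] w by auto
    then have "?v \<otimes>\<^bsub>W\<^esub> inv\<^bsub>W\<^esub> w \<in> kernel W X s"
      using w by (simp add: kernel_def)
    then have "f (?v \<otimes>\<^bsub>W\<^esub> inv\<^bsub>W\<^esub> w) = \<one>\<^bsub>Y\<^esub>"
      using ker by (auto simp: kernel_def)
    then show ?thesis
      unfolding h_def using group_hom_kernel_eq[OF f.group_hom_axioms v(1) w] by simp
  qed
  have "h \<in> gmodule_hom G X Y"
  proof (rule gmodule_homI)
    fix x assume "x \<in> carrier X"
    then obtain w where "w \<in> carrier W" "x = s w" using s(2) by auto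
    then show "h x \<in> carrier Y" by (simp add: h)
  next
    fix x y assume "x \<in> carrier X" "y \<in> carrier X"
    then obtain v w where "v \<in> carrier W" "x = s v" "w \<in> carrier W" "y = s w"
      unfolding s(2)[symmetric] by blast
    then show "h (x \<otimes>\<^bsub>X\<^esub> y) = h x \<otimes>\<^bsub>Y\<^esub> h y"
      by (simp add: h flip: s.hom_mult)
  next
    fix g x assume g: "g \<in> carrier G" and "x \<in> carrier X"
    then obtain w where w: "w \<in> carrier W" "x = s w" using s(2) by auto
    have "h (act X g x) = h (s (act W g w))"
      using w g gmodule_homD(3)[OF s(1)] by simp
    also have "\<dots> = act Y g (h x)"
      using w g gmodule_homD(3)[OF f] by (simp add: h W.act_closed)
    finally show "h (act X g x) = act Y g (h x)" .
  qed
  with h show ?thesis using that by blast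
qed

lemma gmodule_isoI:
  "f \<in> gmodule_hom G M N \<Longrightarrow> bij_betw f (carrier M) (carrier N) \<Longrightarrow> gmodule_iso G M N"
  unfolding gmodule_iso_def by blast

lemma gmodule_iso_inverseI:
  assumes f: "f \<in> gmodule_hom G M N" and h: "h \<in> gmodule_hom G N M"
    and "\<And>x. x \<in> carrier M \<Longrightarrow> h (f x) = x" "\<And>y. y \<in> carrier N \<Longrightarrow> f (h y) = y"
  shows "gmodule_iso G M N"
  by (rule gmodule_isoI[OF f], rule bij_betw_byWitness[where f' = h])
    (use assms gmodule_homD(1)[OF f] gmodule_homD(1)[OF h] in auto)

lemma gmodule_isoE:
  assumes "gmodule_iso G M N" and M: "gmodule G M"
  obtains f h where "f \<in> gmodule_hom G M N" "h \<in> gmodule_hom G N M"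
    "\<And>x. x \<in> carrier M \<Longrightarrow> h (f x) = x" "\<And>y. y \<in> carrier N \<Longrightarrow> f (h y) = y"
proof -
  interpret gmodule G M by fact
  obtain f where f: "f \<in> gmodule_hom G M N" and b: "bij_betw f (carrier M) (carrier N)"
    using assms(1) unfolding gmodule_iso_def by blast
  define h where "h = inv_into (carrier M) f"
  have 1: "h (f x) = x" if "x \<in> carrier M" for x
    using b that by (simp add: h_def bij_betw_def)
  have 2: "f (h y) = y" "h y \<in> carrier M" if "y \<in> carrier N" for y
    using b that by (auto simp: h_def bij_betw_def f_inv_into_f inv_into_into)
  have "h \<in> gmodule_hom G N M"
  proof (rule gmodule_homI)
    fix x y assume *: "x \<in> carrier N" "y \<in> carrier N"
    then have "h (x \<otimes>\<^bsub>N\<^esub> y) = h (f (h x \<otimes>\<^bsub>M\<^esub> h y))" by (simp add: 2 gmodule_homD[OF f])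
    then show "h (x \<otimes>\<^bsub>N\<^esub> y) = h x \<otimes>\<^bsub>M\<^esub> h y" using * by (simp add: 1 2)
  next
    fix g x assume *: "g \<in> carrier G" "x \<in> carrier N"
    then have "h (act N g x) = h (f (act M g (h x)))" by (simp add: 2 gmodule_homD[OF f])
    then show "h (act N g x) = act M g (h x)" using * by (simp add: 1 2 act_closed)
  qed (rule 2)
  with f 1 2 that show ?thesis by blast
qed

lemma gmodule_iso_refl: "gmodule_iso G M M"
  by (rule gmodule_isoI[of "\<lambda>x. x"]) (auto simp: gmodule_hom_def hom_def bij_betw_def inj_on_def)

lemma gmodule_iso_sym: "gmodule_iso G M N \<Longrightarrow> gmodule G M \<Longrightarrow> gmodule_iso G N M"
  by (metis gmodule_isoE gmodule_iso_inverseI)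

lemma gmodule_iso_trans [trans]: "gmodule_iso G L M \<Longrightarrow> gmodule_iso G M N \<Longrightarrow> gmodule_iso G L N"
  unfolding gmodule_iso_def
proof (elim bexE)
  fix f h assume "f \<in> gmodule_hom G L M" "bij_betw f (carrier L) (carrier M)"
    "h \<in> gmodule_hom G M N" "bij_betw h (carrier M) (carrier N)"
  then show "\<exists>f\<in>gmodule_hom G L N. bij_betw f (carrier L) (carrier N)"
    using gmodule_hom_comp[of f G L M h N] bij_betw_trans[of f _ _ h]
    by (intro bexI[of _ "\<lambda>x. h (f x)"]) (simp_all add: comp_def)
qed

text \<open>Isomorphisms between quotients are obtained in this form throughout: comparing two maps out of one
  module \<open>W\<close> avoids defining a map on cosets and checking that it is well-defined.\<close>

lemma gmodule_iso_of_same_kernel: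
  assumes W: "gmodule G W" and X: "gmodule G X" and Y: "gmodule G Y"
    and s: "s \<in> gmodule_hom G W X" "s ` carrier W = carrier X"
    and t: "t \<in> gmodule_hom G W Y" "t ` carrier W = carrier Y"
    and ker: "kernel W X s = kernel W Y t"
  shows "gmodule_iso G X Y"
proof -
  obtain h where h: "h \<in> gmodule_hom G X Y" "\<And>w. w \<in> carrier W \<Longrightarrow> h (s w) = t w"
    using gmodule_hom_factor[OF W X Y s t(1)] ker by auto
  obtain k where k: "k \<in> gmodule_hom G Y X" "\<And>w. w \<in> carrier W \<Longrightarrow> k (t w) = s w"
    using gmodule_hom_factor[OF W Y X t s(1)] ker by auto
  show ?thesis
  proof (rule gmodule_iso_inverseI[OF h(1) k(1)])
    fix x assume "x \<in> carrier X"
    then show "k (h x) = x" unfolding s(2)[symmetric] by (auto simp: h(2) k(2))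
  next
    fix y assume "y \<in> carrier Y"
    then show "h (k y) = y" unfolding t(2)[symmetric] by (auto simp: h(2) k(2))
  qed
qed

lemma gmodule_direct_sum:
  assumes "gmodule G M" "gmodule G N"
  shows "gmodule G (direct_sum M N)"
proof -
  interpret M: gmodule G M by fact
  interpret N: gmodule G N by fact
  have "comm_group (direct_sum M N)"
  proof (rule comm_groupI)
    fix x assume "x \<in> carrier (direct_sum M N)"
    then show "\<exists>y\<in>carrier (direct_sum M N). y \<otimes>\<^bsub>direct_sum M N\<^esub> x = \<one>\<^bsub>direct_sum M N\<^esub>"
      by (intro bexI[of _ "(inv\<^bsub>M\<^esub> fst x, inv\<^bsub>N\<^esub> snd x)"]) (auto simp: mem_Times_iff)
  qed (auto simp: M.M.m_ac N.M.m_ac)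
  then show ?thesis
    by (intro gmoduleI) (auto simp: M.act_closed N.act_closed M.act_add N.act_add M.act_mult N.act_mult
        M.act_one N.act_one M.G.group_axioms)
qed

lemma fst_gmodule_hom: "fst \<in> gmodule_hom G (direct_sum M N) M"
  and snd_gmodule_hom: "snd \<in> gmodule_hom G (direct_sum M N) N"
  by (auto intro!: gmodule_homI)

lemma gmodule_hom_pair:
  "f \<in> gmodule_hom G L M \<Longrightarrow> h \<in> gmodule_hom G L N \<Longrightarrow> (\<lambda>x. (f x, h x)) \<in> gmodule_hom G L (direct_sum M N)"
  by (intro gmodule_homI) (simp_all add: gmodule_homD)

lemma gmodule_hom_map_prod:
  "f \<in> gmodule_hom G L M \<Longrightarrow> h \<in> gmodule_hom G K N \<Longrightarrow>
    map_prod f h \<in> gmodule_hom G (direct_sum L K) (direct_sum M N)"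
  by (intro gmodule_homI) (auto simp add: gmodule_homD)

lemma gmodule_hom_id: "(\<lambda>x. x) \<in> gmodule_hom G M M"
  by (intro gmodule_homI) auto

lemma direct_sum_iso_cong:
  assumes "gmodule_iso G M M'" "gmodule_iso G N N'"
  shows "gmodule_iso G (direct_sum M N) (direct_sum M' N')"
proof -
  obtain f h where "f \<in> gmodule_hom G M M'" "bij_betw f (carrier M) (carrier M')"
    "h \<in> gmodule_hom G N N'" "bij_betw h (carrier N) (carrier N')"
    using assms unfolding gmodule_iso_def by blast
  then show ?thesis
    by (intro gmodule_isoI[of "map_prod f h"] gmodule_hom_map_prod)
      (auto simp: bij_betw_map_prod)
qed

lemma direct_sum_iso_comm: "gmodule_iso G (direct_sum M N) (direct_sum N M)"
  by (rule gmodule_iso_inverseI[of "\<lambda>(x, y). (y, x)" _ _ _ "\<lambda>(x, y). (y, x)"]; (rule gmodule_homI)?) auto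

lemma direct_sum_iso_assoc:
  "gmodule_iso G (direct_sum (direct_sum L M) N) (direct_sum L (direct_sum M N))"
  by (rule gmodule_iso_inverseI[of "\<lambda>((x, y), z). (x, y, z)" _ _ _ "\<lambda>(x, y, z). ((x, y), z)"];
      (rule gmodule_homI)?) auto

lemma direct_sum_iso_swap_right:
  "gmodule_iso G (direct_sum (direct_sum L M) N) (direct_sum (direct_sum L N) M)"
  by (rule gmodule_iso_inverseI[of "\<lambda>((x, y), z). ((x, z), y)" _ _ _ "\<lambda>((x, y), z). ((x, z), y)"];
      (rule gmodule_homI)?) auto

lemma direct_sum_iso_interchange:
  "gmodule_iso G (direct_sum (direct_sum K L) (direct_sum M N))
     (direct_sum (direct_sum K M) (direct_sum L N))"
  by (rule gmodule_iso_inverseI[of "\<lambda>((x, y), (z, w)). ((x, z), (y, w))" _ _ _ "\<lambda>((x, y), (z, w)). ((x, z), (y, w))"];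
      (rule gmodule_homI)?) auto

section \<open>Quotients\<close>

definition submodule :: "('g, 'c) monoid_scheme \<Rightarrow> ('g, 'a) gmodule \<Rightarrow> 'a set \<Rightarrow> bool" where
  "submodule G M N \<longleftrightarrow> subgroup N M \<and> (\<forall>g\<in>carrier G. \<forall>x\<in>N. act M g x \<in> N)"

lemma (in gmodule) quot_module_proj:
  assumes "submodule G M N"
  shows gmodule_quot_module: "gmodule G (quot_module M N)"
    and quot_proj_hom: "(\<lambda>x. N #>\<^bsub>M\<^esub> x) \<in> gmodule_hom G M (quot_module M N)"
    and quot_proj_surj: "(\<lambda>x. N #>\<^bsub>M\<^esub> x) ` carrier M = carrier (quot_module M N)"
    and quot_proj_kernel: "kernel M (quot_module M N) (\<lambda>x. N #>\<^bsub>M\<^esub> x) = N"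
proof -
  have N: "subgroup N M" and stable: "\<And>g x. g \<in> carrier G \<Longrightarrow> x \<in> N \<Longrightarrow> act M g x \<in> N"
    using assms by (auto simp: submodule_def)
  interpret N: normal N M using N by (rule M.subgroup_imp_normal)
  have NC: "N \<subseteq> carrier M" by (rule N.subset)
  show surj: "(\<lambda>x. N #>\<^bsub>M\<^esub> x) ` carrier M = carrier (quot_module M N)"
    by (auto simp: RCOSETS_def)
  have mult: "(N #>\<^bsub>M\<^esub> x) \<otimes>\<^bsub>quot_module M N\<^esub> (N #>\<^bsub>M\<^esub> y) = N #>\<^bsub>M\<^esub> (x \<otimes>\<^bsub>M\<^esub> y)"
    if "x \<in> carrier M" "y \<in> carrier M" for x y
    using that by (simp add: N.rcos_sum)
  have act: "act (quot_module M N) g (N #>\<^bsub>M\<^esub> x) = N #>\<^bsub>M\<^esub> (act M g x)"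
    if g: "g \<in> carrier G" and x: "x \<in> carrier M" for g x
  proof -
    have "act M g ` N = N"
    proof
      show "act M g ` N \<subseteq> N" using g stable by auto
      show "N \<subseteq> act M g ` N"
      proof
        fix y assume y: "y \<in> N"
        then have "y = act M g (act M (inv\<^bsub>G\<^esub> g) y)" using g NC by auto
        then show "y \<in> act M g ` N" using y g stable by blast
      qed
    qed
    moreover have "act M g ` (N #>\<^bsub>M\<^esub> x) = (act M g ` N) #>\<^bsub>M\<^esub> (act M g x)"
      using NC g x by (auto simp: r_coset_def act_add subset_iff image_iff)
    ultimately show ?thesis by simp
  qed
  have one: "N = N #>\<^bsub>M\<^esub> \<one>\<^bsub>M\<^esub>" using NC by simp
  have C: "\<exists>x\<in>carrier M. C = N #>\<^bsub>M\<^esub> x" if "C \<in> carrier (quot_module M N)" for C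
    using that surj by auto
  have group: "comm_group (M Mod N)" using N by (rule M.abelian_FactGroup)
  then have cg: "comm_group (quot_module M N)"
  proof -
    interpret Q: comm_group "M Mod N" by fact
    show ?thesis
      by (rule comm_groupI)
        (use Q.m_closed Q.m_assoc Q.m_comm Q.l_one Q.one_closed Q.l_inv_ex in \<open>auto simp: FactGroup_def\<close>)
  qed
  show gm: "gmodule G (quot_module M N)"
  proof (rule gmoduleI[OF G.group_axioms cg])
    fix g C assume g: "g \<in> carrier G" and "C \<in> carrier (quot_module M N)"
    then obtain x where "x \<in> carrier M" "C = N #>\<^bsub>M\<^esub> x" using C by blast
    then show "act (quot_module M N) g C \<in> carrier (quot_module M N)"
      unfolding surj[symmetric] using g by (auto simp only: act act_closed)
  next
    fix g C D assume g: "g \<in> carrier G" and "C \<in> carrier (quot_module M N)" "D \<in> carrier (quot_module M N)"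
    then obtain x y where "x \<in> carrier M" "C = N #>\<^bsub>M\<^esub> x" "y \<in> carrier M" "D = N #>\<^bsub>M\<^esub> y" using C by blast
    then show "act (quot_module M N) g (C \<otimes>\<^bsub>quot_module M N\<^esub> D) =
        act (quot_module M N) g C \<otimes>\<^bsub>quot_module M N\<^esub> act (quot_module M N) g D"
      using g by (simp only: act act_closed mult act_add M.m_closed)
  next
    fix g h C assume g: "g \<in> carrier G" "h \<in> carrier G" and "C \<in> carrier (quot_module M N)"
    then obtain x where "x \<in> carrier M" "C = N #>\<^bsub>M\<^esub> x" using C by blast
    then show "act (quot_module M N) (g \<otimes>\<^bsub>G\<^esub> h) C =
        act (quot_module M N) g (act (quot_module M N) h C)"
      using g by (simp only: act act_closed act_mult G.m_closed)
  next
    fix C assume "C \<in> carrier (quot_module M N)"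
    then obtain x where "x \<in> carrier M" "C = N #>\<^bsub>M\<^esub> x" using C by blast
    then show "act (quot_module M N) \<one>\<^bsub>G\<^esub> C = C" by (simp only: act act_one G.one_closed)
  qed
  show "(\<lambda>x. N #>\<^bsub>M\<^esub> x) \<in> gmodule_hom G M (quot_module M N)"
    by (rule gmodule_homI) (use surj in \<open>auto simp only: act mult\<close>)
  show "kernel M (quot_module M N) (\<lambda>x. N #>\<^bsub>M\<^esub> x) = N"
  proof -
    have "N #>\<^bsub>M\<^esub> x = N \<longleftrightarrow> x \<in> N" if "x \<in> carrier M" for x
      using M.coset_join1[of N x] M.coset_join2[OF that N] N that by (intro iffI)
    then show ?thesis using NC by (auto simp: kernel_def)
  qed
qed

section \<open>Lattices\<close>

lemma fin_gen_gmodule_iff: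
  assumes fin: "finite (carrier G)" and M: "gmodule G M"
  shows "fin_gen_gmodule G M \<longleftrightarrow> (\<exists>T. finite T \<and> T \<subseteq> carrier M \<and> generate M T = carrier M)"
proof -
  interpret gmodule G M by fact
  define tr where "tr S = {act M g s | g s. g \<in> carrier G \<and> s \<in> S}" for S
  have tr: "tr S = (\<lambda>(g, s). act M g s) ` (carrier G \<times> S)" for S
    by (auto simp: tr_def)
  have fg: "fin_gen_gmodule G M \<longleftrightarrow> (\<exists>S. finite S \<and> S \<subseteq> carrier M \<and> generate M (tr S) = carrier M)"
    by (simp only: fin_gen_gmodule_def tr_def)
  have trM: "tr S \<subseteq> carrier M" if "S \<subseteq> carrier M" for S
    using that by (auto simp: tr_def subset_iff intro: act_closed)
  have trf: "finite (tr S)" if "finite S" for S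
    unfolding tr by (intro finite_imageI finite_cartesian_product that fin)
  show ?thesis
  proof
    assume "fin_gen_gmodule G M"
    then obtain S where S: "finite S" "S \<subseteq> carrier M" "generate M (tr S) = carrier M"
      unfolding fg by blast
    show "\<exists>T. finite T \<and> T \<subseteq> carrier M \<and> generate M T = carrier M"
      by (intro exI[of _ "tr S"] conjI trf trM S)
  next
    assume "\<exists>T. finite T \<and> T \<subseteq> carrier M \<and> generate M T = carrier M"
    then obtain S where S: "finite S" "S \<subseteq> carrier M" "generate M S = carrier M" by blast
    have "S \<subseteq> tr S"
    proof
      fix x assume "x \<in> S"
      then show "x \<in> tr S" unfolding tr_def using S(2) act_one[of x]
        by (intro CollectI exI[of _ "\<one>\<^bsub>G\<^esub>"] exI[of _ x]) auto
    qed
    then have "carrier M \<subseteq> generate M (tr S)" using M.mono_generate[of S "tr S"] S(3) by simp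
    moreover have "generate M (tr S) \<subseteq> carrier M" using M.generate_incl[OF trM[OF S(2)]] .
    ultimately have "generate M (tr S) = carrier M" by (rule equalityI[rotated])
    with S(1,2) show "fin_gen_gmodule G M"
      unfolding fg by (intro exI[of _ S] conjI)
  qed
qed

lemma pi_latticeD:
  assumes "pi_lattice G M"
  shows "gmodule G M"
    and "x \<in> carrier M \<Longrightarrow> k > 0 \<Longrightarrow> x [^]\<^bsub>M\<^esub> (k::nat) = \<one>\<^bsub>M\<^esub> \<Longrightarrow> x = \<one>\<^bsub>M\<^esub>"
  using assms unfolding pi_lattice_def torsion_part_def by blast+

lemma pi_lattice_gens:
  assumes "finite (carrier G)" "pi_lattice G M"
  obtains T where "finite T" "T \<subseteq> carrier M" "generate M T = carrier M"
proof -
  have "gmodule G M" "fin_gen_gmodule G M" using assms(2) by (simp_all add: pi_lattice_def)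
  then show ?thesis using that fin_gen_gmodule_iff[OF assms(1), of M] by blast
qed

lemma pi_latticeI:
  assumes fin: "finite (carrier G)" and M: "gmodule G M"
    and "finite T" "T \<subseteq> carrier M" "generate M T = carrier M"
    and tf: "\<And>x k. x \<in> carrier M \<Longrightarrow> k > 0 \<Longrightarrow> x [^]\<^bsub>M\<^esub> (k::nat) = \<one>\<^bsub>M\<^esub> \<Longrightarrow> x = \<one>\<^bsub>M\<^esub>"
  shows "pi_lattice G M"
proof -
  interpret gmodule G M by fact
  have "torsion_part M = {\<one>\<^bsub>M\<^esub>}"
  proof (intro equalityI subsetI)
    fix x assume "x \<in> torsion_part M"
    then obtain k :: nat where "x \<in> carrier M" "k > 0" "x [^]\<^bsub>M\<^esub> k = \<one>\<^bsub>M\<^esub>"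
      unfolding torsion_part_def by blast
    then show "x \<in> {\<one>\<^bsub>M\<^esub>}" using tf by blast
  next
    fix x assume "x \<in> {\<one>\<^bsub>M\<^esub>}"
    then show "x \<in> torsion_part M" unfolding torsion_part_def by (intro CollectI conjI exI[of _ "1::nat"]) simp_all
  qed
  moreover have "fin_gen_gmodule G M" unfolding fin_gen_gmodule_iff[OF fin M] using assms(3-5) by blast
  ultimately show ?thesis unfolding pi_lattice_def using M by simp
qed

text \<open>Direct summands and isomorphic copies are both instances of retracts.\<close>

definition retract :: "('g, 'c) monoid_scheme \<Rightarrow> ('g, 'a) gmodule \<Rightarrow> ('g, 'b) gmodule \<Rightarrow> bool" where
  "retract G X Z \<longleftrightarrow> (\<exists>i\<in>gmodule_hom G X Z. \<exists>r\<in>gmodule_hom G Z X. \<forall>x\<in>carrier X. r (i x) = x)"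

lemma retract_of_iso: "gmodule_iso G X Z \<Longrightarrow> gmodule G X \<Longrightarrow> retract G X Z"
proof -
  assume "gmodule_iso G X Z" "gmodule G X"
  then obtain f h where "f \<in> gmodule_hom G X Z" "h \<in> gmodule_hom G Z X"
    "\<And>x. x \<in> carrier X \<Longrightarrow> h (f x) = x" "\<And>y. y \<in> carrier Z \<Longrightarrow> f (h y) = y" by (rule gmodule_isoE) (rule that)
  then show ?thesis unfolding retract_def by (intro bexI[of _ f] bexI[of _ h] ballI)
qed

lemma retract_direct_sum_fst: "gmodule G X \<Longrightarrow> gmodule G Y \<Longrightarrow> retract G X (direct_sum X Y)"
  unfolding retract_def
  by (intro bexI[of _ "\<lambda>x. (x, \<one>\<^bsub>Y\<^esub>)"] bexI[of _ fst] fst_gmodule_hom gmodule_hom_pair gmodule_hom_id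
      gmodule.zero_hom) auto

lemma retract_trans: "retract G X Y \<Longrightarrow> retract G Y Z \<Longrightarrow> retract G X Z"
proof -
  assume "retract G X Y" "retract G Y Z"
  then obtain i r j s where i: "i \<in> gmodule_hom G X Y" "r \<in> gmodule_hom G Y X" "\<forall>x\<in>carrier X. r (i x) = x"
    "j \<in> gmodule_hom G Y Z" "s \<in> gmodule_hom G Z Y" "\<forall>x\<in>carrier Y. s (j x) = x"
    unfolding retract_def by blast
  then show ?thesis
    unfolding retract_def using gmodule_hom_comp[OF i(1,4)] gmodule_hom_comp[OF i(5,2)] gmodule_homD(1)[OF i(1)]
    by (intro bexI[of _ "\<lambda>x. j (i x)"] bexI[of _ "\<lambda>x. r (s x)"]) auto
qed

lemma retract_of_summand_iso:
  assumes "gmodule_iso G (direct_sum X Y) Z" "gmodule G X" "gmodule G Y"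
  shows "retract G X Z"
  using retract_trans[OF retract_direct_sum_fst[OF assms(2,3)] retract_of_iso[OF assms(1) gmodule_direct_sum[OF assms(2,3)]]] .

text \<open>Generators are projected to \<open>X\<close>, and torsion elements are embedded into \<open>Z\<close>.\<close>

lemma pi_lattice_retract:
  assumes fin: "finite (carrier G)" and X: "gmodule G X" and Z: "pi_lattice G Z" and "retract G X Z"
  shows "pi_lattice G X"
proof -
  note Zm = pi_latticeD(1)[OF Z]
  obtain i r where i: "i \<in> gmodule_hom G X Z" and r: "r \<in> gmodule_hom G Z X"
    and ri: "\<And>x. x \<in> carrier X \<Longrightarrow> r (i x) = x"
    using assms(4) unfolding retract_def by blast
  interpret i: group_hom X Z i by (rule gmodule_hom_group_hom[OF X Zm i])
  interpret r: group_hom Z X r by (rule gmodule_hom_group_hom[OF Zm X r])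
  obtain T where T: "finite T" "T \<subseteq> carrier Z" "generate Z T = carrier Z"
    using fin Z by (rule pi_lattice_gens)
  show ?thesis
  proof (rule pi_latticeI[OF fin X, of "r ` T"])
    show "generate X (r ` T) = carrier X"
    proof -
      have "generate X (r ` T) = r ` carrier Z" using r.generate_img[OF T(2)] T(3) by simp
      also have "\<dots> = carrier X" using ri[symmetric] i.hom_closed by (auto intro!: image_eqI)
      finally show ?thesis .
    qed
    fix x k assume x: "x \<in> carrier X" "(k::nat) > 0" "x [^]\<^bsub>X\<^esub> k = \<one>\<^bsub>X\<^esub>"
    then have "i x [^]\<^bsub>Z\<^esub> k = \<one>\<^bsub>Z\<^esub>" using i.hom_nat_pow[OF x(1), of k] by simp
    then have "i x = \<one>\<^bsub>Z\<^esub>" by (rule pi_latticeD(2)[OF Z i.hom_closed[OF x(1)] x(2)])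
    then show "x = \<one>\<^bsub>X\<^esub>" using ri[OF x(1)] by simp
  qed (use T in auto)
qed

lemma pi_lattice_direct_sum:
  assumes fin: "finite (carrier G)" and X: "pi_lattice G X" and Y: "pi_lattice G Y"
  shows "pi_lattice G (direct_sum X Y)"
proof -
  note Xm = pi_latticeD(1)[OF X] and Ym = pi_latticeD(1)[OF Y]
  interpret X: gmodule G X by fact
  interpret Y: gmodule G Y by fact
  interpret Z: gmodule G "direct_sum X Y" using Xm Ym by (rule gmodule_direct_sum)
  obtain S where S: "finite S" "S \<subseteq> carrier X" "generate X S = carrier X"
    using fin X by (rule pi_lattice_gens)
  obtain T where T: "finite T" "T \<subseteq> carrier Y" "generate Y T = carrier Y"
    using fin Y by (rule pi_lattice_gens)
  interpret i: group_hom X "direct_sum X Y" "\<lambda>x. (x, \<one>\<^bsub>Y\<^esub>)"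
    by unfold_locales (auto simp: hom_def)
  interpret j: group_hom Y "direct_sum X Y" "\<lambda>y. (\<one>\<^bsub>X\<^esub>, y)"
    by unfold_locales (auto simp: hom_def)
  let ?U = "(\<lambda>x. (x, \<one>\<^bsub>Y\<^esub>)) ` S \<union> (\<lambda>y. (\<one>\<^bsub>X\<^esub>, y)) ` T"
  have U: "?U \<subseteq> carrier (direct_sum X Y)" using S(2) T(2) by auto
  show ?thesis
  proof (rule pi_latticeI[OF fin Z.gmodule_axioms _ U])
    show "generate (direct_sum X Y) ?U = carrier (direct_sum X Y)"
    proof
      show "generate (direct_sum X Y) ?U \<subseteq> carrier (direct_sum X Y)" using U by (rule Z.M.generate_incl)
      show "carrier (direct_sum X Y) \<subseteq> generate (direct_sum X Y) ?U"
      proof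
        fix z assume "z \<in> carrier (direct_sum X Y)"
        then obtain x y where z: "z = (x, y)" "x \<in> carrier X" "y \<in> carrier Y" by auto
        have "(x, \<one>\<^bsub>Y\<^esub>) \<in> generate (direct_sum X Y) ((\<lambda>x. (x, \<one>\<^bsub>Y\<^esub>)) ` S)"
          unfolding i.generate_img[OF S(2)] S(3) using z(2) by (rule imageI)
        then have 1: "(x, \<one>\<^bsub>Y\<^esub>) \<in> generate (direct_sum X Y) ?U"
          by (rule subsetD[OF Z.M.mono_generate[OF Un_upper1]])
        have "(\<one>\<^bsub>X\<^esub>, y) \<in> generate (direct_sum X Y) ((\<lambda>y. (\<one>\<^bsub>X\<^esub>, y)) ` T)"
          unfolding j.generate_img[OF T(2)] T(3) using z(3) by (rule imageI)
        then have 2: "(\<one>\<^bsub>X\<^esub>, y) \<in> generate (direct_sum X Y) ?U"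
          by (rule subsetD[OF Z.M.mono_generate[OF Un_upper2]])
        show "z \<in> generate (direct_sum X Y) ?U"
          using generate.eng[OF 1 2] z by simp
      qed
    qed
    interpret p: group_hom "direct_sum X Y" X fst
      by (rule gmodule_hom_group_hom[OF Z.gmodule_axioms Xm fst_gmodule_hom])
    interpret q: group_hom "direct_sum X Y" Y snd
      by (rule gmodule_hom_group_hom[OF Z.gmodule_axioms Ym snd_gmodule_hom])
    fix z k assume z: "z \<in> carrier (direct_sum X Y)" and k: "(k::nat) > 0"
      and eq: "z [^]\<^bsub>direct_sum X Y\<^esub> k = \<one>\<^bsub>direct_sum X Y\<^esub>"
    have "fst z [^]\<^bsub>X\<^esub> k = \<one>\<^bsub>X\<^esub>"
      unfolding p.hom_nat_pow[OF z, symmetric] eq by (rule p.hom_one)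
    then have 1: "fst z = \<one>\<^bsub>X\<^esub>" by (rule pi_latticeD(2)[OF X p.hom_closed[OF z] k])
    have "snd z [^]\<^bsub>Y\<^esub> k = \<one>\<^bsub>Y\<^esub>"
      unfolding q.hom_nat_pow[OF z, symmetric] eq by (rule q.hom_one)
    then have "snd z = \<one>\<^bsub>Y\<^esub>" by (rule pi_latticeD(2)[OF Y q.hom_closed[OF z] k])
    with 1 show "z = \<one>\<^bsub>direct_sum X Y\<^esub>" by (simp only: direct_sum_simps prod_eq_iff fst_conv snd_conv)
  qed (use S(1) T(1) in simp_all)
qed

section \<open>Integral functionals and bases\<close>

definition functional :: "('a, 'm) monoid_scheme \<Rightarrow> ('a \<Rightarrow> int) set" where
  "functional M = {\<phi>. \<forall>x\<in>carrier M. \<forall>y\<in>carrier M. \<phi> (x \<otimes>\<^bsub>M\<^esub> y) = \<phi> x + \<phi> y}"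

lemma functionalI: "(\<And>x y. x \<in> carrier M \<Longrightarrow> y \<in> carrier M \<Longrightarrow> \<phi> (x \<otimes>\<^bsub>M\<^esub> y) = \<phi> x + \<phi> y) \<Longrightarrow> \<phi> \<in> functional M"
  by (simp add: functional_def)

lemma functional_mult:
  "\<phi> \<in> functional M \<Longrightarrow> x \<in> carrier M \<Longrightarrow> y \<in> carrier M \<Longrightarrow> \<phi> (x \<otimes>\<^bsub>M\<^esub> y) = \<phi> x + \<phi> y"
  by (simp add: functional_def)

lemma (in monoid) functional_one: "\<phi> \<in> functional G \<Longrightarrow> \<phi> \<one> = 0"
  using functional_mult[of \<phi> G \<one> \<one>] by simp

lemma (in group) functional_inv: "\<phi> \<in> functional G \<Longrightarrow> x \<in> carrier G \<Longrightarrow> \<phi> (inv x) = - \<phi> x"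
  using functional_mult[of \<phi> G x "inv x"] by (simp add: functional_one)

lemma (in monoid) functional_nat_pow: "\<phi> \<in> functional G \<Longrightarrow> x \<in> carrier G \<Longrightarrow> \<phi> (x [^] (k::nat)) = int k * \<phi> x"
  by (induction k) (simp_all add: functional_one functional_mult algebra_simps)

lemma (in group) functional_int_pow: "\<phi> \<in> functional G \<Longrightarrow> x \<in> carrier G \<Longrightarrow> \<phi> (x [^] (k::int)) = k * \<phi> x"
  by (cases k rule: int_cases2) (simp_all add: int_pow_int int_pow_neg_int functional_nat_pow functional_inv)

lemma (in comm_monoid) functional_finprod:
  assumes "\<phi> \<in> functional G" "f \<in> A \<rightarrow> carrier G"
  shows "\<phi> (finprod G f A) = (\<Sum>a\<in>A. \<phi> (f a))"
  using assms(2)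
  by (induction A rule: infinite_finite_induct) (simp_all add: functional_one[OF assms(1)] functional_mult[OF assms(1)] Pi_iff)

lemma (in group) functional_eq_on_generate:
  assumes "\<phi> \<in> functional G" "\<psi> \<in> functional G" "S \<subseteq> carrier G" "x \<in> generate G S"
    and "\<And>s. s \<in> S \<Longrightarrow> \<phi> s = \<psi> s"
  shows "\<phi> x = \<psi> x"
  using assms(4)
proof induction
  case one
  show ?case using assms(1,2) by (simp add: functional_one)
next
  case (incl h)
  then show ?case using assms by simp
next
  case (inv h)
  moreover from this have "h \<in> carrier G" using assms(3) by auto
  ultimately show ?case using assms by (simp add: functional_inv)
next
  case (eng h1 h2)
  moreover have "h1 \<in> carrier G" "h2 \<in> carrier G"
    using eng generate_in_carrier assms(3) by blast+
  ultimately show ?case using assms by (simp add: functional_mult)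
qed

lemma (in comm_group) finprod_in_subgroup:
  assumes "subgroup K G" "\<And>a. a \<in> A \<Longrightarrow> f a \<in> K"
  shows "finprod G f A \<in> K"
  using assms(2)
proof (induction A rule: infinite_finite_induct)
  case (insert a A)
  have "f \<in> A \<rightarrow> carrier G" "f a \<in> carrier G"
    using insert.prems assms(1) subgroup.mem_carrier by fastforce+
  then show ?case using insert subgroup.m_closed[OF assms(1)] by simp
qed (use subgroup.one_closed[OF assms(1)] in simp_all)

lemma (in group) int_pow_in_subgroup: "subgroup K G \<Longrightarrow> x \<in> K \<Longrightarrow> x [^] (k::int) \<in> K"
  using subgroup_int_pow_closed by blast

lemma (in comm_group) generate_finprod:
  assumes fin: "finite B" and B: "B \<subseteq> carrier G" and x: "x \<in> generate G B"
  shows "\<exists>c. x = (\<Otimes>b\<in>B. b [^] (c b :: int))"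
  using x
proof induction
  case one
  then show ?case by (intro exI[of _ "\<lambda>_. 0"]) simp
next
  case (incl h)
  have "(\<Otimes>b\<in>B. b [^] (if h = b then 1 else 0 :: int)) = (\<Otimes>b\<in>B. if h = b then b else \<one>)"
    using B by (intro finprod_cong') auto
  also have "\<dots> = h" using finprod_singleton[of h B "\<lambda>b. b"] incl fin B by auto
  finally show ?case by (intro exI[of _ "\<lambda>b. if h = b then 1 else 0"]) simp
next
  case (inv h)
  have "(\<Otimes>b\<in>B. b [^] (if h = b then -1 else 0 :: int)) = (\<Otimes>b\<in>B. if h = b then inv b else \<one>)"
    using B by (intro finprod_cong') (auto simp: int_pow_neg)
  also have "\<dots> = inv h" using finprod_singleton[of h B "\<lambda>b. inv b"] inv fin B by auto
  finally show ?case by (intro exI[of _ "\<lambda>b. if h = b then -1 else 0"]) simp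
next
  case (eng h1 h2)
  then obtain c d where "h1 = (\<Otimes>b\<in>B. b [^] (c b :: int))" "h2 = (\<Otimes>b\<in>B. b [^] (d b :: int))" by blast
  then have "h1 \<otimes> h2 = (\<Otimes>b\<in>B. b [^] (c b :: int) \<otimes> b [^] (d b :: int))"
    using B by (auto intro!: finprod_multf[symmetric])
  also have "\<dots> = (\<Otimes>b\<in>B. b [^] (c b + d b))"
    using B by (intro finprod_cong') (auto simp: int_pow_mult)
  finally show ?case by (intro exI[of _ "\<lambda>b. c b + d b"])
qed

text \<open>A generating set with dual functionals is a basis; both conditions are easy to transport
  along homomorphisms.\<close>

lemma (in comm_group) int_basisI:
  assumes fin: "finite B" and B: "B \<subseteq> carrier G" and gen: "generate G B = carrier G"
    and funct: "\<And>b. b \<in> B \<Longrightarrow> \<phi> b \<in> functional G"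
    and dual: "\<And>b b'. b \<in> B \<Longrightarrow> b' \<in> B \<Longrightarrow> \<phi> b b' = (if b' = b then 1 else 0)"
  shows "int_basis G B"
proof -
  let ?f = "\<lambda>c. \<Otimes>b\<in>B. b [^] (c b :: int)"
  have coord: "\<phi> b (?f c) = c b" if b: "b \<in> B" for b c
  proof -
    have "\<phi> b (?f c) = (\<Sum>b'\<in>B. \<phi> b (b' [^] (c b')))"
      using B by (intro functional_finprod funct b) auto
    also have "\<dots> = (\<Sum>b'\<in>B. if b' = b then c b' else 0)"
      using B b by (intro sum.cong) (auto simp: functional_int_pow funct dual)
    finally show ?thesis using b fin by simp
  qed
  have "bij_betw ?f (B \<rightarrow>\<^sub>E UNIV) (carrier G)"
  proof (rule bij_betwI')
    fix c d assume cd: "c \<in> B \<rightarrow>\<^sub>E (UNIV::int set)" "d \<in> B \<rightarrow>\<^sub>E (UNIV::int set)"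
    show "(?f c = ?f d) = (c = d)"
    proof
      assume eq: "?f c = ?f d"
      have "c b = d b" if "b \<in> B" for b
        using coord[OF that, of c] coord[OF that, of d] eq by simp
      then show "c = d" using cd by (intro PiE_ext)
    qed simp
  next
    fix c show "?f c \<in> carrier G" using B by (intro finprod_closed) auto
  next
    fix x assume "x \<in> carrier G"
    then obtain c where c: "x = ?f c" using generate_finprod[OF fin B] gen by blast
    have "?f (restrict c B) = ?f c" using B by (intro finprod_cong') auto
    then show "\<exists>c\<in>B \<rightarrow>\<^sub>E UNIV. x = ?f c" using c by (intro bexI[of _ "restrict c B"]) auto
  qed
  then show ?thesis using fin B by (simp add: int_basis_def)
qed

lemma (in comm_group) int_basis_coords:
  assumes basis: "int_basis G B"
  obtains \<phi> where "finite B" "B \<subseteq> carrier G" "generate G B = carrier G"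
    "\<And>b. b \<in> B \<Longrightarrow> \<phi> b \<in> functional G"
    "\<And>b b'. b \<in> B \<Longrightarrow> b' \<in> B \<Longrightarrow> \<phi> b b' = (if b' = b then 1 else 0)"
    "\<And>x. x \<in> carrier G \<Longrightarrow> x = (\<Otimes>b\<in>B. b [^] (\<phi> b x :: int))"
proof -
  let ?f = "\<lambda>c. \<Otimes>b\<in>B. b [^] (c b :: int)"
  have fin: "finite B" and B: "B \<subseteq> carrier G" and bij: "bij_betw ?f (B \<rightarrow>\<^sub>E UNIV) (carrier G)"
    using basis by (auto simp: int_basis_def)
  have inj: "\<And>b. b \<in> B \<Longrightarrow> c b = d b" if "?f c = ?f d" for c d
  proof -
    have "?f (restrict c B) = ?f c" "?f (restrict d B) = ?f d"
      using B by (intro finprod_cong'; auto)+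
    then have "?f (restrict c B) = ?f (restrict d B)" using that by simp
    moreover have "restrict c B \<in> B \<rightarrow>\<^sub>E UNIV" "restrict d B \<in> B \<rightarrow>\<^sub>E UNIV" by auto
    ultimately have "restrict c B = restrict d B"
      using bij unfolding bij_betw_def inj_on_def by blast
    then show "\<And>b. b \<in> B \<Longrightarrow> c b = d b" by (metis restrict_apply')
  qed
  define \<phi> where "\<phi> b x = (SOME c. x = ?f c) b" for b x
  have rep: "x = ?f (\<lambda>b. \<phi> b x)" if "x \<in> carrier G" for x
  proof -
    have "\<exists>c. x = ?f c" using that bij unfolding bij_betw_def by blast
    then show ?thesis unfolding \<phi>_def by (rule someI_ex)
  qed
  have gen: "generate G B = carrier G"
  proof
    show "generate G B \<subseteq> carrier G" using B by (rule generate_incl)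
    have sub: "subgroup (generate G B) G" using B by (rule generate_is_subgroup)
    have "?f c \<in> generate G B" for c
      by (intro finprod_in_subgroup[OF sub] int_pow_in_subgroup[OF sub] generate.incl)
    then show "carrier G \<subseteq> generate G B" using rep by (metis subsetI)
  qed
  have add: "\<phi> b \<in> functional G" if b: "b \<in> B" for b
  proof (rule functionalI)
    fix x y assume xy: "x \<in> carrier G" "y \<in> carrier G"
    have "?f (\<lambda>b. \<phi> b (x \<otimes> y)) = ?f (\<lambda>b. \<phi> b x) \<otimes> ?f (\<lambda>b. \<phi> b y)"
      using rep[OF xy(1)] rep[OF xy(2)] rep[of "x \<otimes> y"] xy by simp
    also have "\<dots> = (\<Otimes>b\<in>B. b [^] \<phi> b x \<otimes> b [^] \<phi> b y)"
      using B by (intro finprod_multf[symmetric]) auto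
    also have "\<dots> = ?f (\<lambda>b. \<phi> b x + \<phi> b y)"
      using B by (intro finprod_cong') (auto simp: int_pow_mult)
    finally show "\<phi> b (x \<otimes> y) = \<phi> b x + \<phi> b y"
      using inj[of "\<lambda>b. \<phi> b (x \<otimes> y)" "\<lambda>b. \<phi> b x + \<phi> b y"] b by simp
  qed
  have dual: "\<phi> b b' = (if b' = b then 1 else 0)" if "b \<in> B" "b' \<in> B" for b b'
  proof -
    have "?f (\<lambda>b. if b' = b then 1 else 0) = (\<Otimes>b\<in>B. if b' = b then b else \<one>)"
      using B by (intro finprod_cong') auto
    also have "\<dots> = b'" using finprod_singleton[of b' B "\<lambda>b. b"] that fin B by auto
    finally have "?f (\<lambda>b. \<phi> b b') = ?f (\<lambda>b. if b' = b then 1 else 0)"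
      using rep[of b'] that B by auto
    then show ?thesis using inj[of "\<lambda>b. \<phi> b b'" "\<lambda>b. if b' = b then 1 else 0"] that(1) by simp
  qed
  show ?thesis by (rule that[OF fin B gen add dual rep])
qed

section \<open>Permutation lattices\<close>

lemma permutation_latticeI:
  assumes finG: "finite (carrier G)" and M: "gmodule G M" and basis: "int_basis M B"
    and stable: "\<And>g b. g \<in> carrier G \<Longrightarrow> b \<in> B \<Longrightarrow> act M g b \<in> B"
  shows "permutation_lattice G M"
proof -
  interpret gmodule G M by fact
  obtain \<phi> where fin: "finite B" and B: "B \<subseteq> carrier M" and gen: "generate M B = carrier M"
    and funct: "\<And>b. b \<in> B \<Longrightarrow> \<phi> b \<in> functional M"
    and rep: "\<And>x. x \<in> carrier M \<Longrightarrow> x = (\<Otimes>\<^bsub>M\<^esub>b\<in>B. b [^]\<^bsub>M\<^esub> (\<phi> b x :: int))"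
    using M.int_basis_coords[OF basis] by metis
  have "pi_lattice G M"
  proof (rule pi_latticeI[OF finG M fin B gen])
    fix x and k :: nat assume x: "x \<in> carrier M" "k > 0" and eq: "x [^]\<^bsub>M\<^esub> k = \<one>\<^bsub>M\<^esub>"
    have "\<phi> b x = 0" if "b \<in> B" for b
    proof -
      have "int k * \<phi> b x = \<phi> b (x [^]\<^bsub>M\<^esub> k)" by (rule M.functional_nat_pow[OF funct[OF that] x(1), symmetric])
      also have "\<dots> = 0" unfolding eq by (rule M.functional_one[OF funct[OF that]])
      finally show ?thesis using x(2) by simp
    qed
    then have "(\<Otimes>\<^bsub>M\<^esub>b\<in>B. b [^]\<^bsub>M\<^esub> (\<phi> b x :: int)) = \<one>\<^bsub>M\<^esub>"
      by (intro M.finprod_one_eqI) simp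
    then show "x = \<one>\<^bsub>M\<^esub>" by (subst rep[OF x(1)])
  qed
  moreover have "act M g ` B = B" if "g \<in> carrier G" for g
  proof (rule card_subset_eq[OF fin])
    show "act M g ` B \<subseteq> B" using stable that by auto
    have "inj_on (act M g) B" using B that by (intro inj_on_inverseI[of _ "act M (inv\<^bsub>G\<^esub> g)"]) auto
    then show "card (act M g ` B) = card B" by (rule card_image)
  qed
  ultimately show ?thesis using basis unfolding permutation_lattice_def by blast
qed

lemma permutation_latticeE:
  assumes "permutation_lattice G M"
  obtains B \<phi> where "finite B" "B \<subseteq> carrier M" "generate M B = carrier M"
    "\<And>b. b \<in> B \<Longrightarrow> \<phi> b \<in> functional M"
    "\<And>b b'. b \<in> B \<Longrightarrow> b' \<in> B \<Longrightarrow> \<phi> b b' = (if b' = b then 1 else 0)"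
    "\<And>x. x \<in> carrier M \<Longrightarrow> x = (\<Otimes>\<^bsub>M\<^esub>b\<in>B. b [^]\<^bsub>M\<^esub> (\<phi> b x :: int))"
    "\<And>g b. g \<in> carrier G \<Longrightarrow> b \<in> B \<Longrightarrow> act M g b \<in> B"
proof -
  obtain B where "int_basis M B" and stable: "\<forall>g\<in>carrier G. act M g ` B = B" and "pi_lattice G M"
    using assms unfolding permutation_lattice_def by blast
  then interpret gmodule G M by (intro pi_latticeD(1))
  have "act M g b \<in> B" if "g \<in> carrier G" "b \<in> B" for g b
    using bspec[OF stable that(1)] that(2) by blast
  note st = this
  show ?thesis
    by (rule M.int_basis_coords[OF \<open>int_basis M B\<close>]) (rule that[OF _ _ _ _ _ _ st])
qed

lemma permutation_lattice_pi_lattice: "permutation_lattice G M \<Longrightarrow> pi_lattice G M"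
  by (simp add: permutation_lattice_def)

lemma permutation_lattice_gmodule: "permutation_lattice G M \<Longrightarrow> gmodule G M"
  by (simp add: permutation_lattice_def pi_lattice_def)

lemma functional_comp_hom:
  "\<phi> \<in> functional N \<Longrightarrow> f \<in> gmodule_hom G M N \<Longrightarrow> (\<lambda>x. \<phi> (f x)) \<in> functional M"
  by (intro functionalI) (simp add: gmodule_homD functional_mult)

lemma permutation_lattice_iso:
  assumes fin: "finite (carrier G)" and P: "permutation_lattice G P" and iso: "gmodule_iso G P Q"
    and Q: "gmodule G Q"
  shows "permutation_lattice G Q"
proof -
  note Pm = permutation_lattice_gmodule[OF P]
  obtain f h where f: "f \<in> gmodule_hom G P Q" and h: "h \<in> gmodule_hom G Q P"
    and hf: "\<And>x. x \<in> carrier P \<Longrightarrow> h (f x) = x" and fh: "\<And>y. y \<in> carrier Q \<Longrightarrow> f (h y) = y"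
    using iso Pm by (rule gmodule_isoE) (rule that)
  interpret f: group_hom P Q f by (rule gmodule_hom_group_hom[OF Pm Q f])
  interpret Q: gmodule G Q by fact
  obtain B \<phi> where B: "finite B" "B \<subseteq> carrier P" "generate P B = carrier P"
    and \<phi>: "\<And>b. b \<in> B \<Longrightarrow> \<phi> b \<in> functional P"
    "\<And>b b'. b \<in> B \<Longrightarrow> b' \<in> B \<Longrightarrow> \<phi> b b' = (if b' = b then 1 else 0)"
    and st: "\<And>g b. g \<in> carrier G \<Longrightarrow> b \<in> B \<Longrightarrow> act P g b \<in> B"
    using P by (rule permutation_latticeE) (rule that)
  have "int_basis Q (f ` B)"
  proof (rule Q.M.int_basisI[where \<phi> = "\<lambda>b x. \<phi> (h b) (h x)"])
    show "generate Q (f ` B) = carrier Q"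
    proof -
      have "generate Q (f ` B) = f ` carrier P" using f.generate_img[OF B(2)] B(3) by simp
      also have "\<dots> = carrier Q"
      proof (intro equalityI subsetI)
        fix y assume "y \<in> carrier Q"
        then show "y \<in> f ` carrier P" using fh[of y] gmodule_homD(1)[OF h, of y] by (metis imageI)
      qed auto
      finally show ?thesis .
    qed
    fix b assume "b \<in> f ` B"
    then obtain a where a: "a \<in> B" "b = f a" by auto
    then have hb: "h b = a" using hf[of a] subsetD[OF B(2), of a] by simp
    then show "(\<lambda>x. \<phi> (h b) (h x)) \<in> functional Q"
      using \<phi>(1)[OF a(1)] h by (simp add: functional_comp_hom)
    fix b' assume "b' \<in> f ` B"
    then obtain a' where a': "a' \<in> B" "b' = f a'" by auto
    then have hb': "h b' = a'" using hf[of a'] subsetD[OF B(2), of a'] by simp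
    have "b' = b \<longleftrightarrow> a' = a" using hb hb' a(2) a'(2) by metis
    then show "\<phi> (h b) (h b') = (if b' = b then 1 else 0)"
      unfolding hb hb' using \<phi>(2)[OF a(1) a'(1)] by simp
  qed (use B in auto)
  then show ?thesis
  proof (rule permutation_latticeI[OF fin Q])
    fix g b assume g: "g \<in> carrier G" and "b \<in> f ` B"
    then obtain a where a: "a \<in> B" "b = f a" by auto
    then show "act Q g b \<in> f ` B"
      using gmodule_homD(3)[OF f g, of a, symmetric] st[OF g a(1)] subsetD[OF B(2) a(1)] by simp
  qed
qed

lemma permutation_lattice_univ_copy:
  fixes P :: "('g, 'a) gmodule"
  assumes fin: "finite (carrier G)" and P: "permutation_lattice G P"
  obtains Q :: "('g, univ) gmodule" where "permutation_lattice G Q" "gmodule_iso G P Q"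
  using lattice_univ_copy[OF fin permutation_lattice_pi_lattice[OF P]]
    permutation_lattice_iso[OF fin P] pi_latticeD(1) by blast

lemma permutation_lattice_direct_sum:
  fixes P :: "('g, 'a) gmodule" and Q :: "('g, 'b) gmodule"
  assumes fin: "finite (carrier G)" and P: "permutation_lattice G P" and Q: "permutation_lattice G Q"
  shows "permutation_lattice G (direct_sum P Q)"
proof -
  note Pm = permutation_lattice_gmodule[OF P] and Qm = permutation_lattice_gmodule[OF Q]
  interpret P: gmodule G P by fact
  interpret Q: gmodule G Q by fact
  interpret Z: gmodule G "direct_sum P Q" using Pm Qm by (rule gmodule_direct_sum)
  obtain B \<phi> where B: "finite B" "B \<subseteq> carrier P" "generate P B = carrier P"
    and \<phi>: "\<And>b. b \<in> B \<Longrightarrow> \<phi> b \<in> functional P"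
    "\<And>b b'. b \<in> B \<Longrightarrow> b' \<in> B \<Longrightarrow> \<phi> b b' = (if b' = b then 1 else 0)"
    and B_st: "\<And>g b. g \<in> carrier G \<Longrightarrow> b \<in> B \<Longrightarrow> act P g b \<in> B"
    using P by (rule permutation_latticeE) (rule that)
  obtain C \<psi> where C: "finite C" "C \<subseteq> carrier Q" "generate Q C = carrier Q"
    and \<psi>: "\<And>b. b \<in> C \<Longrightarrow> \<psi> b \<in> functional Q"
    "\<And>b b'. b \<in> C \<Longrightarrow> b' \<in> C \<Longrightarrow> \<psi> b b' = (if b' = b then 1 else 0)"
    and C_st: "\<And>g b. g \<in> carrier G \<Longrightarrow> b \<in> C \<Longrightarrow> act Q g b \<in> C"
    using Q by (rule permutation_latticeE) (rule that)
  define i where "i x = (x, \<one>\<^bsub>Q\<^esub>)" for x :: 'a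
  define j where "j y = (\<one>\<^bsub>P\<^esub>, y)" for y :: 'b
  have i: "i \<in> gmodule_hom G P (direct_sum P Q)" unfolding i_def
    by (intro gmodule_homI) auto
  have j: "j \<in> gmodule_hom G Q (direct_sum P Q)" unfolding j_def
    by (intro gmodule_homI) auto
  interpret i: group_hom P "direct_sum P Q" i by (rule gmodule_hom_group_hom[OF Pm Z.gmodule_axioms i])
  interpret j: group_hom Q "direct_sum P Q" j by (rule gmodule_hom_group_hom[OF Qm Z.gmodule_axioms j])
  let ?U = "i ` B \<union> j ` C"
  have U: "?U \<subseteq> carrier (direct_sum P Q)" using B(2) C(2) i.hom_closed j.hom_closed by blast
  have one_B: "\<one>\<^bsub>P\<^esub> \<notin> B"
  proof
    assume 1: "\<one>\<^bsub>P\<^esub> \<in> B"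
    show False using \<phi>(2)[OF 1 1] P.M.functional_one[OF \<phi>(1)[OF 1]] by simp
  qed
  have one_C: "\<one>\<^bsub>Q\<^esub> \<notin> C"
  proof
    assume 1: "\<one>\<^bsub>Q\<^esub> \<in> C"
    show False using \<psi>(2)[OF 1 1] Q.M.functional_one[OF \<psi>(1)[OF 1]] by simp
  qed
  have "int_basis (direct_sum P Q) ?U"
  proof (rule Z.M.int_basisI[where \<phi> = "\<lambda>b x. if snd b = \<one>\<^bsub>Q\<^esub> then \<phi> (fst b) (fst x) else \<psi> (snd b) (snd x)"])
    show "generate (direct_sum P Q) ?U = carrier (direct_sum P Q)"
    proof
      show "generate (direct_sum P Q) ?U \<subseteq> carrier (direct_sum P Q)" using U by (rule Z.M.generate_incl)
      show "carrier (direct_sum P Q) \<subseteq> generate (direct_sum P Q) ?U"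
      proof
        fix z assume "z \<in> carrier (direct_sum P Q)"
        then obtain x y where z: "z = (x, y)" "x \<in> carrier P" "y \<in> carrier Q" by auto
        have "i x \<in> generate (direct_sum P Q) (i ` B)"
          unfolding i.generate_img[OF B(2)] B(3) using z(2) by (rule imageI)
        then have 1: "i x \<in> generate (direct_sum P Q) ?U"
          by (rule subsetD[OF Z.M.mono_generate[OF Un_upper1]])
        have "j y \<in> generate (direct_sum P Q) (j ` C)"
          unfolding j.generate_img[OF C(2)] C(3) using z(3) by (rule imageI)
        then have 2: "j y \<in> generate (direct_sum P Q) ?U"
          by (rule subsetD[OF Z.M.mono_generate[OF Un_upper2]])
        have "i x \<otimes>\<^bsub>direct_sum P Q\<^esub> j y = z" using z by (simp add: i_def j_def)
        with generate.eng[OF 1 2] show "z \<in> generate (direct_sum P Q) ?U" by simp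
      qed
    qed
    fix b assume b: "b \<in> ?U"
    have U_cases: "(\<exists>x\<in>B. u = (x, \<one>\<^bsub>Q\<^esub>)) \<or> (\<exists>y\<in>C. u = (\<one>\<^bsub>P\<^esub>, y) \<and> y \<noteq> \<one>\<^bsub>Q\<^esub>)"
      if "u \<in> ?U" for u using that one_C by (auto simp: i_def j_def)
    show "(\<lambda>x. if snd b = \<one>\<^bsub>Q\<^esub> then \<phi> (fst b) (fst x) else \<psi> (snd b) (snd x)) \<in> functional (direct_sum P Q)"
      using U_cases[OF b]
    proof (elim disjE bexE conjE)
      fix x assume "x \<in> B" "b = (x, \<one>\<^bsub>Q\<^esub>)"
      then show ?thesis using functional_comp_hom[OF \<phi>(1) fst_gmodule_hom] by simp
    next
      fix y assume "y \<in> C" "b = (\<one>\<^bsub>P\<^esub>, y)" "y \<noteq> \<one>\<^bsub>Q\<^esub>"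
      then show ?thesis using functional_comp_hom[OF \<psi>(1) snd_gmodule_hom] by simp
    qed
    fix b' assume b': "b' \<in> ?U"
    show "(if snd b = \<one>\<^bsub>Q\<^esub> then \<phi> (fst b) (fst b') else \<psi> (snd b) (snd b')) = (if b' = b then 1 else 0)"
      using U_cases[OF b] U_cases[OF b']
    proof (elim disjE bexE conjE)
      fix x x' assume "x \<in> B" "b = (x, \<one>\<^bsub>Q\<^esub>)" "x' \<in> B" "b' = (x', \<one>\<^bsub>Q\<^esub>)"
      then show ?thesis by (simp add: \<phi>(2))
    next
      fix x y assume "x \<in> B" "b = (x, \<one>\<^bsub>Q\<^esub>)" "y \<in> C" "b' = (\<one>\<^bsub>P\<^esub>, y)" "y \<noteq> \<one>\<^bsub>Q\<^esub>"
      then show ?thesis by (simp add: P.M.functional_one[OF \<phi>(1)])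
    next
      fix x y assume "x \<in> B" "b' = (x, \<one>\<^bsub>Q\<^esub>)" "y \<in> C" "b = (\<one>\<^bsub>P\<^esub>, y)" "y \<noteq> \<one>\<^bsub>Q\<^esub>"
      then show ?thesis by (simp add: Q.M.functional_one[OF \<psi>(1)])
    next
      fix y y' assume "y \<in> C" "b = (\<one>\<^bsub>P\<^esub>, y)" "y \<noteq> \<one>\<^bsub>Q\<^esub>" "y' \<in> C" "b' = (\<one>\<^bsub>P\<^esub>, y')"
      then show ?thesis by (simp add: \<psi>(2))
    qed
  qed (use B(1) C(1) U in simp_all)
  then show ?thesis
  proof (rule permutation_latticeI[OF fin Z.gmodule_axioms])
    fix g b assume "g \<in> carrier G" "b \<in> ?U"
    then show "act (direct_sum P Q) g b \<in> ?U"
      using B_st C_st P.act_zero Q.act_zero by (auto simp: i_def j_def)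
  qed
qed

definition zero_lattice :: "('g, univ) gmodule" where
  "zero_lattice = \<lparr>carrier = {\<lambda>_. 0}, monoid.mult = (\<lambda>_ _ _. 0), one = (\<lambda>_. 0), act = (\<lambda>_ x. x)\<rparr>"

lemma permutation_lattice_zero:
  fixes G :: "('g, 'c) monoid_scheme"
  assumes "group G" "finite (carrier G)"
  shows "permutation_lattice G (zero_lattice :: ('g, univ) gmodule)"
proof -
  interpret comm_group "zero_lattice :: ('g, univ) gmodule"
    by (rule comm_groupI) (auto simp: zero_lattice_def)
  have "gmodule G (zero_lattice :: ('g, univ) gmodule)"
    using assms(1) comm_group_axioms by (rule gmoduleI) (auto simp: zero_lattice_def)
  moreover have "carrier (zero_lattice :: ('g, univ) gmodule) = {\<one>\<^bsub>zero_lattice :: ('g, univ) gmodule\<^esub>}"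
    by (simp add: zero_lattice_def)
  then have "int_basis (zero_lattice :: ('g, univ) gmodule) {}"
    using generate_empty by (intro int_basisI[where \<phi> = "\<lambda>_ _. 0"]) auto
  ultimately show ?thesis by (intro permutation_latticeI[OF assms(2)]) auto
qed

section \<open>Flabby lattices\<close>

lemma hom_finprod_comm_group:
  assumes "comm_group M" "comm_group N" "f \<in> hom M N" "u \<in> A \<rightarrow> carrier M"
  shows "f (finprod M u A) = finprod N (\<lambda>a. f (u a)) A"
proof -
  interpret M: comm_group M by fact
  interpret N: comm_group N by fact
  interpret f: group_hom M N f using assms(3) by unfold_locales
  show ?thesis using assms(4)
    by (induction A rule: infinite_finite_induct) (simp_all add: Pi_iff)
qed

context gmodule
begin

lemma norm_group_hom:
  assumes "H \<subseteq> carrier G"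
  shows "group_hom M M (\<lambda>x. \<Otimes>\<^bsub>M\<^esub>h\<in>H. act M h x)"
proof unfold_locales
  show "(\<lambda>x. \<Otimes>\<^bsub>M\<^esub>h\<in>H. act M h x) \<in> hom M M"
  proof (rule homI)
    fix x assume "x \<in> carrier M"
    then show "(\<Otimes>\<^bsub>M\<^esub>h\<in>H. act M h x) \<in> carrier M"
      using assms by (intro M.finprod_closed) (auto intro: act_closed)
  next
    fix x y assume xy: "x \<in> carrier M" "y \<in> carrier M"
    have "(\<Otimes>\<^bsub>M\<^esub>h\<in>H. act M h (x \<otimes>\<^bsub>M\<^esub> y)) = (\<Otimes>\<^bsub>M\<^esub>h\<in>H. act M h x \<otimes>\<^bsub>M\<^esub> act M h y)"
      using assms xy by (intro M.finprod_cong') (auto intro!: act_closed M.m_closed simp: act_add subset_iff)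
    also have "\<dots> = (\<Otimes>\<^bsub>M\<^esub>h\<in>H. act M h x) \<otimes>\<^bsub>M\<^esub> (\<Otimes>\<^bsub>M\<^esub>h\<in>H. act M h y)"
      using assms xy by (intro M.finprod_multf) (auto intro: act_closed)
    finally show "(\<Otimes>\<^bsub>M\<^esub>h\<in>H. act M h (x \<otimes>\<^bsub>M\<^esub> y)) =
      (\<Otimes>\<^bsub>M\<^esub>h\<in>H. act M h x) \<otimes>\<^bsub>M\<^esub> (\<Otimes>\<^bsub>M\<^esub>h\<in>H. act M h y)" .
  qed
qed

lemma norm_kernel_subgroup: "H \<subseteq> carrier G \<Longrightarrow> subgroup (norm_kernel H M) M"
  using group_hom.subgroup_kernel[OF norm_group_hom] by (simp add: norm_kernel_def kernel_def)

lemma augmentation_gens: "H \<subseteq> carrier G \<Longrightarrow>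
    {act M h x \<otimes>\<^bsub>M\<^esub> inv\<^bsub>M\<^esub> x | h x. h \<in> H \<and> x \<in> carrier M} \<subseteq> carrier M"
  by (auto simp: subset_iff intro!: M.m_closed act_closed)

lemma augmentation_subgroup: "H \<subseteq> carrier G \<Longrightarrow> subgroup (augmentation_image H M) M"
  unfolding augmentation_image_def by (rule M.generate_is_subgroup[OF augmentation_gens])

lemma augmentation_incl:
  "h \<in> H \<Longrightarrow> x \<in> carrier M \<Longrightarrow> act M h x \<otimes>\<^bsub>M\<^esub> inv\<^bsub>M\<^esub> x \<in> augmentation_image H M"
  unfolding augmentation_image_def by (intro generate.incl) blast

lemma norm_act:
  assumes H: "subgroup H G" and h: "h \<in> H" and x: "x \<in> carrier M"
  shows "(\<Otimes>\<^bsub>M\<^esub>k\<in>H. act M k (act M h x)) = (\<Otimes>\<^bsub>M\<^esub>k\<in>H. act M k x)"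
proof -
  note HG = subgroup.subset[OF H]
  have img: "(\<lambda>k. k \<otimes>\<^bsub>G\<^esub> h) ` H = H"
  proof (intro equalityI subsetI)
    fix k assume k: "k \<in> H"
    then have "k = (k \<otimes>\<^bsub>G\<^esub> inv\<^bsub>G\<^esub> h) \<otimes>\<^bsub>G\<^esub> h" using HG h by (simp add: subset_iff G.m_assoc)
    moreover have "k \<otimes>\<^bsub>G\<^esub> inv\<^bsub>G\<^esub> h \<in> H" using H h k by (simp add: subgroup.m_closed subgroup.m_inv_closed)
    ultimately show "k \<in> (\<lambda>k. k \<otimes>\<^bsub>G\<^esub> h) ` H" by (rule image_eqI)
  qed (use H h subgroup.m_closed in fast)
  have inj: "inj_on (\<lambda>k. k \<otimes>\<^bsub>G\<^esub> h) H"
    using HG h by (auto simp: inj_on_def subset_iff)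
  have "(\<Otimes>\<^bsub>M\<^esub>k\<in>H. act M k x) = (\<Otimes>\<^bsub>M\<^esub>k\<in>(\<lambda>k. k \<otimes>\<^bsub>G\<^esub> h) ` H. act M k x)" by (simp only: img)
  also have "\<dots> = (\<Otimes>\<^bsub>M\<^esub>k\<in>H. act M (k \<otimes>\<^bsub>G\<^esub> h) x)"
    by (rule M.finprod_reindex[OF _ inj]) (use HG x img in \<open>auto simp: subset_iff intro: act_closed\<close>)
  also have "\<dots> = (\<Otimes>\<^bsub>M\<^esub>k\<in>H. act M k (act M h x))"
    using HG h x by (intro M.finprod_cong') (auto simp: subset_iff act_mult intro!: act_closed)
  finally show ?thesis by simp
qed

lemma augmentation_le_norm_kernel:
  assumes H: "subgroup H G"
  shows "augmentation_image H M \<subseteq> norm_kernel H M"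
  unfolding augmentation_image_def
proof (rule M.generate_subgroup_incl[OF _ norm_kernel_subgroup[OF subgroup.subset[OF H]]], rule subsetI)
  note HG = subgroup.subset[OF H]
  interpret N: group_hom M M "\<lambda>x. \<Otimes>\<^bsub>M\<^esub>h\<in>H. act M h x" by (rule norm_group_hom[OF HG])
  fix z assume "z \<in> {act M h x \<otimes>\<^bsub>M\<^esub> inv\<^bsub>M\<^esub> x | h x. h \<in> H \<and> x \<in> carrier M}"
  then obtain h x where hx: "h \<in> H" "x \<in> carrier M" and z: "z = act M h x \<otimes>\<^bsub>M\<^esub> inv\<^bsub>M\<^esub> x" by blast
  then have hx': "act M h x \<in> carrier M" using HG act_closed by blast
  have "(\<Otimes>\<^bsub>M\<^esub>k\<in>H. act M k z) = (\<Otimes>\<^bsub>M\<^esub>k\<in>H. act M k x) \<otimes>\<^bsub>M\<^esub> inv\<^bsub>M\<^esub> (\<Otimes>\<^bsub>M\<^esub>k\<in>H. act M k x)"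
    unfolding z N.hom_mult[OF hx' M.inv_closed[OF hx(2)]] N.hom_inv[OF hx(2)] norm_act[OF H hx] by (rule refl)
  then show "z \<in> norm_kernel H M"
    using hx hx' N.hom_closed[OF hx(2)] by (simp add: norm_kernel_def z)
qed

lemma trivial_tate_iff:
  assumes H: "subgroup H G"
  shows "trivial_group (tate_Hm1 H M) \<longleftrightarrow> norm_kernel H M \<subseteq> augmentation_image H M"
proof -
  note HG = subgroup.subset[OF H]
  let ?K = "norm_kernel H M" and ?I = "augmentation_image H M"
  let ?MK = "M\<lparr>carrier := ?K\<rparr>"
  have K: "subgroup ?K M" by (rule norm_kernel_subgroup[OF HG])
  interpret K: group ?MK by (rule subgroup.subgroup_is_group[OF K M.group_axioms])
  interpret K: comm_group ?MK
    using subgroup.mem_carrier[OF K] by unfold_locales (auto simp: M.m_comm)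
  have I: "subgroup ?I ?MK"
    by (rule M.subgroup_incl[OF augmentation_subgroup[OF HG] K augmentation_le_norm_kernel[OF H]])
  interpret I: normal ?I ?MK by (rule K.subgroup_imp_normal[OF I])
  have grp: "group (?MK Mod ?I)" by (rule I.factorgroup_is_group)
  have "carrier (?MK Mod ?I) = {\<one>\<^bsub>?MK Mod ?I\<^esub>} \<longleftrightarrow> ?K \<subseteq> ?I"
  proof
    assume *: "carrier (?MK Mod ?I) = {\<one>\<^bsub>?MK Mod ?I\<^esub>}"
    show "?K \<subseteq> ?I"
    proof
      fix x assume x: "x \<in> ?K"
      then have "?I #>\<^bsub>?MK\<^esub> x \<in> carrier (?MK Mod ?I)" by (auto simp: FactGroup_def RCOSETS_def)
      then have "?I #>\<^bsub>?MK\<^esub> x = ?I" using * by (simp add: FactGroup_def)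
      then show "x \<in> ?I" using K.rcos_self[OF _ I, of x] x by simp
    qed
  next
    assume *: "?K \<subseteq> ?I"
    have "?I #>\<^bsub>?MK\<^esub> x = ?I" if "x \<in> ?K" for x
      using K.coset_join2[OF _ I, of x] that * by auto
    then show "carrier (?MK Mod ?I) = {\<one>\<^bsub>?MK Mod ?I\<^esub>}"
      using subgroup.one_closed[OF K] by (auto simp: FactGroup_def RCOSETS_def)
  qed
  with grp show ?thesis by (simp add: trivial_group_def tate_Hm1_def)
qed

end

lemma flabby_lattice_iff:
  "flabby_lattice G M \<longleftrightarrow> pi_lattice G M \<and>
    (\<forall>H. subgroup H G \<longrightarrow> norm_kernel H M \<subseteq> augmentation_image H M)"
  unfolding flabby_lattice_def using gmodule.trivial_tate_iff[OF pi_latticeD(1)] by blast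

lemma flabby_lattice_pi_lattice: "flabby_lattice G M \<Longrightarrow> pi_lattice G M"
  by (simp add: flabby_lattice_def)

lemma flabby_lattice_gmodule: "flabby_lattice G M \<Longrightarrow> gmodule G M"
  by (simp add: flabby_lattice_def pi_lattice_def)

lemma hom_norm_kernel:
  assumes M: "gmodule G M" and N: "gmodule G N" and f: "f \<in> gmodule_hom G M N"
    and HG: "H \<subseteq> carrier G" and x: "x \<in> norm_kernel H M"
  shows "f x \<in> norm_kernel H N"
proof -
  interpret M: gmodule G M by fact
  interpret N: gmodule G N by fact
  interpret f: group_hom M N f by (rule gmodule_hom_group_hom[OF M N f])
  have xM: "x \<in> carrier M" and 1: "(\<Otimes>\<^bsub>M\<^esub>h\<in>H. act M h x) = \<one>\<^bsub>M\<^esub>"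
    using x by (auto simp: norm_kernel_def)
  have "(\<Otimes>\<^bsub>N\<^esub>h\<in>H. act N h (f x)) = (\<Otimes>\<^bsub>N\<^esub>h\<in>H. f (act M h x))"
    using HG xM f.hom_closed
    by (intro N.M.finprod_cong') (auto simp: subset_iff gmodule_homD(3)[OF f] intro!: M.act_closed N.act_closed)
  also have "\<dots> = f (\<Otimes>\<^bsub>M\<^esub>h\<in>H. act M h x)"
    by (rule hom_finprod_comm_group[OF M.M.comm_group_axioms N.M.comm_group_axioms f.homh, symmetric])
      (use HG xM in \<open>auto simp: subset_iff intro: M.act_closed\<close>)
  finally show ?thesis unfolding 1 using xM by (simp add: norm_kernel_def)
qed

lemma hom_augmentation_image:
  assumes M: "gmodule G M" and N: "gmodule G N" and f: "f \<in> gmodule_hom G M N"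
    and HG: "H \<subseteq> carrier G" and x: "x \<in> augmentation_image H M"
  shows "f x \<in> augmentation_image H N"
proof -
  interpret M: gmodule G M by fact
  interpret N: gmodule G N by fact
  interpret f: group_hom M N f by (rule gmodule_hom_group_hom[OF M N f])
  let ?S = "{act M h x \<otimes>\<^bsub>M\<^esub> inv\<^bsub>M\<^esub> x | h x. h \<in> H \<and> x \<in> carrier M}"
  have "f x \<in> f ` generate M ?S" using x unfolding augmentation_image_def by (rule imageI)
  then have "f x \<in> generate N (f ` ?S)"
    unfolding f.generate_img[OF M.augmentation_gens[OF HG]] .
  moreover have "f ` ?S \<subseteq> augmentation_image H N"
  proof
    fix z assume "z \<in> f ` ?S"
    then obtain h x where hx: "h \<in> H" "x \<in> carrier M" and z: "z = f (act M h x \<otimes>\<^bsub>M\<^esub> inv\<^bsub>M\<^esub> x)" by blast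
    have "z = act N h (f x) \<otimes>\<^bsub>N\<^esub> inv\<^bsub>N\<^esub> f x"
      unfolding z using hx HG M.act_closed[of h x] gmodule_homD(3)[OF f, of h x] by (auto simp: subset_iff)
    then show "z \<in> augmentation_image H N"
      using N.augmentation_incl[OF hx(1), of "f x"] hx by simp
  qed
  ultimately show ?thesis
    using N.M.generate_subgroup_incl[OF _ N.augmentation_subgroup[OF HG]] by blast
qed

lemma flabby_lattice_retract:
  assumes fin: "finite (carrier G)" and X: "gmodule G X" and Z: "flabby_lattice G Z" and ret: "retract G X Z"
  shows "flabby_lattice G X"
  unfolding flabby_lattice_iff
proof (intro conjI allI impI subsetI)
  show "pi_lattice G X" using pi_lattice_retract[OF fin X flabby_lattice_pi_lattice[OF Z] ret] .
  note Zm = flabby_lattice_gmodule[OF Z]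
  obtain i r where i: "i \<in> gmodule_hom G X Z" and r: "r \<in> gmodule_hom G Z X"
    and ri: "\<And>x. x \<in> carrier X \<Longrightarrow> r (i x) = x"
    using ret unfolding retract_def by blast
  fix H x assume H: "subgroup H G" and x: "x \<in> norm_kernel H X"
  note HG = subgroup.subset[OF H]
  have "i x \<in> augmentation_image H Z"
    using hom_norm_kernel[OF X Zm i HG x] Z H unfolding flabby_lattice_iff by blast
  then have "r (i x) \<in> augmentation_image H X" by (rule hom_augmentation_image[OF Zm X r HG])
  then show "x \<in> augmentation_image H X" using ri[of x] x by (simp add: norm_kernel_def)
qed

lemma flabby_lattice_direct_sum:
  assumes fin: "finite (carrier G)" and X: "flabby_lattice G X" and Y: "flabby_lattice G Y"
  shows "flabby_lattice G (direct_sum X Y)"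
  unfolding flabby_lattice_iff
proof (intro conjI allI impI subsetI)
  note Xm = flabby_lattice_gmodule[OF X] and Ym = flabby_lattice_gmodule[OF Y]
  note Zm = gmodule_direct_sum[OF Xm Ym]
  interpret X: gmodule G X by fact
  interpret Y: gmodule G Y by fact
  interpret Z: gmodule G "direct_sum X Y" by fact
  show "pi_lattice G (direct_sum X Y)"
    by (intro pi_lattice_direct_sum fin flabby_lattice_pi_lattice X Y)
  have i: "(\<lambda>x. (x, \<one>\<^bsub>Y\<^esub>)) \<in> gmodule_hom G X (direct_sum X Y)"
    and j: "(\<lambda>y. (\<one>\<^bsub>X\<^esub>, y)) \<in> gmodule_hom G Y (direct_sum X Y)"
    by (auto intro!: gmodule_homI)
  fix H z assume H: "subgroup H G" and z: "z \<in> norm_kernel H (direct_sum X Y)"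
  note HG = subgroup.subset[OF H]
  have "fst z \<in> augmentation_image H X"
    using hom_norm_kernel[OF Zm Xm fst_gmodule_hom HG z] X H unfolding flabby_lattice_iff by blast
  then have 1: "(fst z, \<one>\<^bsub>Y\<^esub>) \<in> augmentation_image H (direct_sum X Y)"
    by (rule hom_augmentation_image[OF Xm Zm i HG])
  have "snd z \<in> augmentation_image H Y"
    using hom_norm_kernel[OF Zm Ym snd_gmodule_hom HG z] Y H unfolding flabby_lattice_iff by blast
  then have 2: "(\<one>\<^bsub>X\<^esub>, snd z) \<in> augmentation_image H (direct_sum X Y)"
    by (rule hom_augmentation_image[OF Ym Zm j HG])
  have "z \<in> carrier (direct_sum X Y)" using z by (simp add: norm_kernel_def)
  then have "(fst z, \<one>\<^bsub>Y\<^esub>) \<otimes>\<^bsub>direct_sum X Y\<^esub> (\<one>\<^bsub>X\<^esub>, snd z) = z" by auto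
  then show "z \<in> augmentation_image H (direct_sum X Y)"
    using subgroup.m_closed[OF Z.augmentation_subgroup[OF HG] 1 2] by simp
qed

lemma (in comm_group) finprod_int_pow_same:
  "x \<in> carrier G \<Longrightarrow> (\<Otimes>a\<in>A. x [^] (c a :: int)) = x [^] (\<Sum>a\<in>A. c a)"
  by (induction A rule: infinite_finite_induct) (simp_all add: Pi_iff int_pow_mult)

lemma (in gmodule) orbit_in_orbit:
  assumes H: "subgroup H G" and b: "b \<in> carrier M" and "b' \<in> (\<lambda>h. act M h b) ` H"
  shows "(\<lambda>h. act M h b') ` H = (\<lambda>h. act M h b) ` H"
proof -
  note HG = subgroup.subset[OF H]
  have sub: "(\<lambda>h. act M h b') ` H \<subseteq> (\<lambda>h. act M h b) ` H" if bb: "b \<in> carrier M" "b' \<in> (\<lambda>h. act M h b) ` H" for b b'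
  proof
    fix y assume "y \<in> (\<lambda>h. act M h b') ` H"
    then obtain h where "h \<in> H" "y = act M h b'" by blast
    moreover obtain k where "k \<in> H" "b' = act M k b" using bb(2) by blast
    ultimately have hk: "h \<in> H" "k \<in> H" "y = act M h (act M k b)" by simp_all
    then have "y = act M (h \<otimes>\<^bsub>G\<^esub> k) b" using bb HG by (simp add: subset_iff act_mult)
    then show "y \<in> (\<lambda>h. act M h b) ` H" using subgroup.m_closed[OF H hk(1,2)] by blast
  qed
  obtain h where h: "h \<in> H" "b' = act M h b" using assms by auto
  have "b = act M (inv\<^bsub>G\<^esub> h) b'" using h b HG by (simp add: subset_iff)
  then have "b \<in> (\<lambda>h. act M h b') ` H" using subgroup.m_inv_closed[OF H h(1)] by blast
  moreover have "b' \<in> carrier M" using h b HG act_closed by blast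
  ultimately show ?thesis using sub[OF b assms(3)] sub[of b' b] by blast
qed

text \<open>Modulo the augmentation image a basis element may be replaced by a fixed representative of its
  orbit, so only the sum of the coordinates over each orbit matters.\<close>

lemma (in gmodule) in_augmentation_of_orbit_sums:
  assumes H: "subgroup H G" and fin: "finite B" and B: "B \<subseteq> carrier M"
    and stable: "\<And>h b. h \<in> H \<Longrightarrow> b \<in> B \<Longrightarrow> act M h b \<in> B"
    and x: "x = (\<Otimes>\<^bsub>M\<^esub>b\<in>B. b [^]\<^bsub>M\<^esub> (c b :: int))"
    and zero: "\<And>b. b \<in> B \<Longrightarrow> (\<Sum>b'\<in>(\<lambda>h. act M h b) ` H. c b') = 0"
  shows "x \<in> augmentation_image H M"
proof -
  note HG = subgroup.subset[OF H]
  define orb where "orb b = (\<lambda>h. act M h b) ` H" for b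
  define \<rho> where "\<rho> b = (SOME b'. b' \<in> orb b)" for b
  have orb_B: "orb b \<subseteq> B" if "b \<in> B" for b using stable that by (auto simp: orb_def)
  have self: "b \<in> orb b" if "b \<in> B" for b
    unfolding orb_def using subgroup.one_closed[OF H] act_one[of b] B that by force
  have \<rho>: "\<rho> b \<in> orb b" if "b \<in> B" for b
    unfolding \<rho>_def using self[OF that] by (rule someI)
  have orb_eq: "orb b' = orb b" if "b \<in> B" "b' \<in> orb b" for b b'
    using orbit_in_orbit[OF H] B that unfolding orb_def by blast
  have \<rho>_eq: "\<rho> b' = \<rho> b" if "b \<in> B" "b' \<in> orb b" for b b'
    unfolding \<rho>_def orb_eq[OF that] by (rule refl)
  have \<rho>M: "\<rho> b \<in> carrier M" if "b \<in> B" for b using \<rho>[OF that] orb_B[OF that] B by blast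
  have bM: "b \<in> carrier M" if "b \<in> B" for b using that B by blast
  let ?d = "\<lambda>b. b \<otimes>\<^bsub>M\<^esub> inv\<^bsub>M\<^esub> \<rho> b"
  have d: "?d b \<in> augmentation_image H M" if b: "b \<in> B" for b
  proof -
    have "b \<in> orb (\<rho> b)" using self[OF b] orb_eq[OF b \<rho>[OF b]] by simp
    then obtain h where h: "h \<in> H" "b = act M h (\<rho> b)" unfolding orb_def by blast
    show ?thesis using augmentation_incl[OF h(1) \<rho>M[OF b]] h(2) by simp
  qed
  have "x = (\<Otimes>\<^bsub>M\<^esub>b\<in>B. ?d b [^]\<^bsub>M\<^esub> c b \<otimes>\<^bsub>M\<^esub> \<rho> b [^]\<^bsub>M\<^esub> c b)"
    unfolding x
  proof (rule M.finprod_cong'[OF refl])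
    fix b assume b: "b \<in> B"
    have "?d b [^]\<^bsub>M\<^esub> c b \<otimes>\<^bsub>M\<^esub> \<rho> b [^]\<^bsub>M\<^esub> c b = (?d b \<otimes>\<^bsub>M\<^esub> \<rho> b) [^]\<^bsub>M\<^esub> c b"
      using \<rho>M[OF b] bM[OF b] by (intro M.int_pow_mult_distrib[symmetric] M.m_comm) simp_all
    also have "?d b \<otimes>\<^bsub>M\<^esub> \<rho> b = b" using \<rho>M[OF b] bM[OF b] by (simp add: M.m_assoc)
    finally show "b [^]\<^bsub>M\<^esub> c b = ?d b [^]\<^bsub>M\<^esub> c b \<otimes>\<^bsub>M\<^esub> \<rho> b [^]\<^bsub>M\<^esub> c b" by simp
  qed (use \<rho>M bM in auto)
  also have "\<dots> = (\<Otimes>\<^bsub>M\<^esub>b\<in>B. ?d b [^]\<^bsub>M\<^esub> c b) \<otimes>\<^bsub>M\<^esub> (\<Otimes>\<^bsub>M\<^esub>b\<in>B. \<rho> b [^]\<^bsub>M\<^esub> c b)"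
    using \<rho>M bM by (intro M.finprod_multf) auto
  also have "(\<Otimes>\<^bsub>M\<^esub>b\<in>B. \<rho> b [^]\<^bsub>M\<^esub> c b) = \<one>\<^bsub>M\<^esub>"
  proof -
    have U: "\<Union> (orb ` B) = B" using orb_B self by blast
    have "(\<Otimes>\<^bsub>M\<^esub>b\<in>B. \<rho> b [^]\<^bsub>M\<^esub> c b) = (\<Otimes>\<^bsub>M\<^esub>Q\<in>orb ` B. \<Otimes>\<^bsub>M\<^esub>b\<in>Q. \<rho> b [^]\<^bsub>M\<^esub> c b)"
    proof (subst U[symmetric], rule M.finprod_Union_disjoint)
      show "pairwise disjnt (orb ` B)"
      proof (rule pairwise_imageI)
        fix a b assume "a \<in> B" "b \<in> B" "orb a \<noteq> orb b"
        then show "disjnt (orb a) (orb b)" using orb_eq unfolding disjnt_iff by metis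
      qed
      fix Q assume "Q \<in> orb ` B"
      then have "Q \<subseteq> B" using orb_B by blast
      then show "finite Q \<and> (\<forall>x\<in>Q. \<rho> x [^]\<^bsub>M\<^esub> c x \<in> carrier M)"
        using fin \<rho>M finite_subset by blast
    qed (use fin in simp)
    also have "\<dots> = \<one>\<^bsub>M\<^esub>"
    proof (rule M.finprod_one_eqI)
      fix Q assume "Q \<in> orb ` B"
      then obtain b where b: "b \<in> B" "Q = orb b" by blast
      have "(\<Otimes>\<^bsub>M\<^esub>b'\<in>Q. \<rho> b' [^]\<^bsub>M\<^esub> c b') = (\<Otimes>\<^bsub>M\<^esub>b'\<in>Q. \<rho> b [^]\<^bsub>M\<^esub> c b')"
        using b \<rho>_eq[OF b(1)] \<rho>M[OF b(1)] by (intro M.finprod_cong') auto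
      also have "\<dots> = \<rho> b [^]\<^bsub>M\<^esub> (\<Sum>b'\<in>Q. c b')" by (rule M.finprod_int_pow_same[OF \<rho>M[OF b(1)]])
      also have "(\<Sum>b'\<in>Q. c b') = 0" using zero[OF b(1)] b(2) unfolding orb_def by simp
      finally show "(\<Otimes>\<^bsub>M\<^esub>b'\<in>Q. \<rho> b' [^]\<^bsub>M\<^esub> c b') = \<one>\<^bsub>M\<^esub>" by simp
    qed
    finally show ?thesis .
  qed
  finally have "x = (\<Otimes>\<^bsub>M\<^esub>b\<in>B. ?d b [^]\<^bsub>M\<^esub> c b)" using \<rho>M bM by simp
  moreover have "\<dots> \<in> augmentation_image H M"
    by (intro M.finprod_in_subgroup[OF augmentation_subgroup[OF HG]] M.int_pow_in_subgroup[OF augmentation_subgroup[OF HG]] d)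
  ultimately show ?thesis by simp
qed

lemma (in gmodule) coord_act:
  assumes B: "B \<subseteq> carrier M" "generate M B = carrier M"
    and \<phi>: "\<And>b. b \<in> B \<Longrightarrow> \<phi> b \<in> functional M"
    "\<And>b b'. b \<in> B \<Longrightarrow> b' \<in> B \<Longrightarrow> \<phi> b b' = (if b' = b then 1 else 0)"
    and st: "\<And>g b. g \<in> carrier G \<Longrightarrow> b \<in> B \<Longrightarrow> act M g b \<in> B"
    and g: "g \<in> carrier G" and b: "b \<in> B" and x: "x \<in> carrier M"
  shows "\<phi> b (act M g x) = \<phi> (act M (inv\<^bsub>G\<^esub> g) b) x"
proof (rule M.functional_eq_on_generate[where S = B and \<phi> = "\<lambda>x. \<phi> b (act M g x)"])
  show "(\<lambda>x. \<phi> b (act M g x)) \<in> functional M"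
    using g by (intro functionalI) (simp add: act_add act_closed functional_mult[OF \<phi>(1)[OF b]])
  show "\<phi> (act M (inv\<^bsub>G\<^esub> g) b) \<in> functional M" using st[of "inv\<^bsub>G\<^esub> g" b] g b by (intro \<phi>(1)) simp
  fix a assume a: "a \<in> B"
  have aM: "a \<in> carrier M" and bM: "b \<in> carrier M" using B a b by auto
  have "act M g a = b \<longleftrightarrow> a = act M (inv\<^bsub>G\<^esub> g) b"
    using act_cancel(1)[OF g bM] act_cancel(2)[OF g aM] by metis
  then show "\<phi> b (act M g a) = \<phi> (act M (inv\<^bsub>G\<^esub> g) b) a"
    using \<phi>(2)[OF b st[OF g a]] \<phi>(2)[OF st[of "inv\<^bsub>G\<^esub> g" b] a] g b by simp
qed (use B x in simp_all)

text \<open>The coefficient of the norm of \<open>x\<close> at a basis element \<open>b\<close> is the sum of the coordinates of \<open>x\<close> over the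
  orbit of \<open>b\<close>, multiplied by the order of the stabilizer of \<open>b\<close>.  If the norm vanishes, so do the sums over
  the orbits.\<close>

lemma flabby_lattice_permutation:
  assumes fin: "finite (carrier G)" and P: "permutation_lattice G P"
  shows "flabby_lattice G P"
  unfolding flabby_lattice_iff
proof (intro conjI allI impI subsetI)
  show "pi_lattice G P" by (rule permutation_lattice_pi_lattice[OF P])
  interpret P: gmodule G P by (rule permutation_lattice_gmodule[OF P])
  obtain B \<phi> where B: "finite B" "B \<subseteq> carrier P" "generate P B = carrier P"
    and \<phi>: "\<And>b. b \<in> B \<Longrightarrow> \<phi> b \<in> functional P"
    "\<And>b b'. b \<in> B \<Longrightarrow> b' \<in> B \<Longrightarrow> \<phi> b b' = (if b' = b then 1 else 0)"
    and rep: "\<And>x. x \<in> carrier P \<Longrightarrow> x = (\<Otimes>\<^bsub>P\<^esub>b\<in>B. b [^]\<^bsub>P\<^esub> (\<phi> b x :: int))"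
    and st: "\<And>g b. g \<in> carrier G \<Longrightarrow> b \<in> B \<Longrightarrow> act P g b \<in> B"
    using P by (rule permutation_latticeE) (rule that)
  fix H x assume H: "subgroup H G" and x: "x \<in> norm_kernel H P"
  note HG = subgroup.subset[OF H]
  have finH: "finite H" using HG fin finite_subset by blast
  have xP: "x \<in> carrier P" and N: "(\<Otimes>\<^bsub>P\<^esub>h\<in>H. act P h x) = \<one>\<^bsub>P\<^esub>"
    using x by (auto simp: norm_kernel_def)
  show "x \<in> augmentation_image H P"
  proof (rule P.in_augmentation_of_orbit_sums[OF H B(1,2) _ rep[OF xP]])
    fix b assume b: "b \<in> B"
    have bP: "b \<in> carrier P" using b B by blast
    let ?f = "\<lambda>h. act P h b"
    let ?n = "card {h \<in> H. ?f h = b}"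
    have "0 = \<phi> b (\<Otimes>\<^bsub>P\<^esub>h\<in>H. act P h x)"
      unfolding N by (simp add: P.M.functional_one[OF \<phi>(1)[OF b]])
    also have "\<dots> = (\<Sum>h\<in>H. \<phi> b (act P h x))"
      using HG xP by (intro P.M.functional_finprod \<phi>(1) b) (auto intro: P.act_closed)
    also have "\<dots> = (\<Sum>h\<in>H. \<phi> (?f (inv\<^bsub>G\<^esub> h)) x)"
      using HG by (intro sum.cong refl P.coord_act[OF B(2,3) \<phi> st _ b xP]) auto
    also have "\<dots> = (\<Sum>h\<in>H. \<phi> (?f h) x)"
      by (rule sum.reindex_bij_witness[of _ "m_inv G" "m_inv G"])
        (use HG subgroup.m_inv_closed[OF H] in \<open>auto simp: subset_iff\<close>)
    also have "\<dots> = (\<Sum>y\<in>?f ` H. int (card {h \<in> H. ?f h = y}) * \<phi> y x)"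
      by (rule sum_fun_comp) (use finH in auto)
    also have "\<dots> = (\<Sum>y\<in>?f ` H. int ?n * \<phi> y x)"
    proof (intro sum.cong refl arg_cong2[where f = "(*)"] arg_cong[where f = int])
      fix y assume "y \<in> ?f ` H"
      then obtain k where k: "k \<in> H" "y = ?f k" by blast
      have "bij_betw (\<lambda>h. inv\<^bsub>G\<^esub> k \<otimes>\<^bsub>G\<^esub> h) {h \<in> H. ?f h = y} {h \<in> H. ?f h = b}"
      proof (rule bij_betw_byWitness[where f' = "\<lambda>h. k \<otimes>\<^bsub>G\<^esub> h"])
        show "\<forall>h\<in>{h \<in> H. ?f h = y}. k \<otimes>\<^bsub>G\<^esub> (inv\<^bsub>G\<^esub> k \<otimes>\<^bsub>G\<^esub> h) = h"
          using k HG by (simp add: subset_iff flip: P.G.m_assoc)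
        show "\<forall>h\<in>{h \<in> H. ?f h = b}. inv\<^bsub>G\<^esub> k \<otimes>\<^bsub>G\<^esub> (k \<otimes>\<^bsub>G\<^esub> h) = h"
          using k HG by (simp add: subset_iff flip: P.G.m_assoc)
        show "(\<lambda>h. inv\<^bsub>G\<^esub> k \<otimes>\<^bsub>G\<^esub> h) ` {h \<in> H. ?f h = y} \<subseteq> {h \<in> H. ?f h = b}"
          using k HG bP subgroup.m_closed[OF H subgroup.m_inv_closed[OF H k(1)]]
          by (auto simp: subset_iff P.act_mult)
        show "(\<lambda>h. k \<otimes>\<^bsub>G\<^esub> h) ` {h \<in> H. ?f h = b} \<subseteq> {h \<in> H. ?f h = y}"
          using k HG bP subgroup.m_closed[OF H k(1)]
          by (auto simp: subset_iff P.act_mult)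
      qed
      then show "card {h \<in> H. ?f h = y} = ?n" by (rule bij_betw_same_card)
    qed
    finally have "int ?n * (\<Sum>y\<in>?f ` H. \<phi> y x) = 0" by (simp add: sum_distrib_left)
    moreover have "?n \<noteq> 0"
      using finH subgroup.one_closed[OF H] P.act_one[OF bP] by auto
    ultimately show "(\<Sum>y\<in>?f ` H. \<phi> y x) = 0" by simp
  qed (use st HG in blast)
qed

text \<open>The torsion of \<open>M / I\<^sub>H M\<close> is the Tate group in degree \<open>-1\<close>.\<close>

lemma flabby_augmentation_pure:
  assumes fin: "finite (carrier G)" and E: "flabby_lattice G E" and H: "subgroup H G"
    and x: "x \<in> carrier E" and k: "k > 0" and xk: "x [^]\<^bsub>E\<^esub> (k::nat) \<in> augmentation_image H E"
  shows "x \<in> augmentation_image H E"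
proof -
  interpret gmodule G E by (rule flabby_lattice_gmodule[OF E])
  note HG = subgroup.subset[OF H]
  interpret N: group_hom E E "\<lambda>x. \<Otimes>\<^bsub>E\<^esub>h\<in>H. act E h x" by (rule norm_group_hom[OF HG])
  have "(\<Otimes>\<^bsub>E\<^esub>h\<in>H. act E h (x [^]\<^bsub>E\<^esub> k)) = \<one>\<^bsub>E\<^esub>"
    using augmentation_le_norm_kernel[OF H] xk by (auto simp: norm_kernel_def)
  then have "(\<Otimes>\<^bsub>E\<^esub>h\<in>H. act E h x) [^]\<^bsub>E\<^esub> k = \<one>\<^bsub>E\<^esub>" unfolding N.hom_nat_pow[OF x] .
  then have "(\<Otimes>\<^bsub>E\<^esub>h\<in>H. act E h x) = \<one>\<^bsub>E\<^esub>"
    by (rule pi_latticeD(2)[OF flabby_lattice_pi_lattice[OF E] N.hom_closed[OF x] k])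
  then have "x \<in> norm_kernel H E" using x by (simp add: norm_kernel_def)
  then show ?thesis using E H unfolding flabby_lattice_iff by blast
qed

section \<open>Extending homomorphisms into permutation lattices\<close>

lemma (in comm_group) generate_union_subgroup:
  assumes T: "subgroup T G" and S: "finite S" "S \<subseteq> carrier G" and x: "x \<in> generate G (T \<union> S)"
  shows "\<exists>t\<in>T. \<exists>c. x = t \<otimes> (\<Otimes>s\<in>S. s [^] (c s :: int))"
  using x
proof induction
  case one
  show ?case by (intro bexI[of _ \<one>] exI[of _ "\<lambda>_. 0"]) (simp_all add: subgroup.one_closed[OF T])
next
  case (incl h)
  show ?case
  proof (cases "h \<in> T")
    case True
    then show ?thesis using subgroup.mem_carrier[OF T True]
      by (intro bexI[of _ h] exI[of _ "\<lambda>_. 0"]) simp_all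
  next
    case False
    then have "h \<in> generate G S" using incl by (auto intro: generate.incl)
    then obtain c where "h = (\<Otimes>s\<in>S. s [^] (c s :: int))" using generate_finprod[OF S] by blast
    then show ?thesis using S(2)
      by (intro bexI[of _ \<one>] exI[of _ c]) (auto simp: subgroup.one_closed[OF T] intro!: l_one[symmetric] finprod_closed)
  qed
next
  case (inv h)
  show ?case
  proof (cases "h \<in> T")
    case True
    then show ?thesis using subgroup.mem_carrier[OF T True]
      by (intro bexI[of _ "inv h"] exI[of _ "\<lambda>_. 0"]) (simp_all add: subgroup.m_inv_closed[OF T])
  next
    case False
    then have "inv h \<in> generate G S" using inv by (auto intro: generate.inv)
    then obtain c where "inv h = (\<Otimes>s\<in>S. s [^] (c s :: int))" using generate_finprod[OF S] by blast
    then show ?thesis using S(2)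
      by (intro bexI[of _ \<one>] exI[of _ c]) (auto simp: subgroup.one_closed[OF T] intro!: l_one[symmetric] finprod_closed)
  qed
next
  case (eng x y)
  then obtain t c u d where tu: "t \<in> T" "u \<in> T" and x: "x = t \<otimes> (\<Otimes>s\<in>S. s [^] (c s :: int))"
    and y: "y = u \<otimes> (\<Otimes>s\<in>S. s [^] (d s :: int))" by blast
  have tuG: "t \<in> carrier G" "u \<in> carrier G" using tu subgroup.mem_carrier[OF T] by auto
  have P: "(\<Otimes>s\<in>S. s [^] (c s :: int)) \<in> carrier G" "(\<Otimes>s\<in>S. s [^] (d s :: int)) \<in> carrier G"
    using S(2) by (auto intro!: finprod_closed)
  have "(\<Otimes>s\<in>S. s [^] (c s + d s)) = (\<Otimes>s\<in>S. s [^] c s \<otimes> s [^] d s)"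
    using S(2) by (intro finprod_cong') (auto simp: int_pow_mult)
  also have "\<dots> = (\<Otimes>s\<in>S. s [^] (c s :: int)) \<otimes> (\<Otimes>s\<in>S. s [^] (d s :: int))"
    using S(2) by (intro finprod_multf) auto
  finally have "x \<otimes> y = (t \<otimes> u) \<otimes> (\<Otimes>s\<in>S. s [^] (c s + d s))"
    unfolding x y using tuG P by (simp add: m_ac)
  then show ?case using subgroup.m_closed[OF T tu] by (intro bexI exI)
qed

lemma (in group) generate_eq_carrier_mono:
  assumes gen: "generate G (T \<union> S) = carrier G" and T: "T \<subseteq> carrier G" and S': "S' \<subseteq> carrier G"
    and S: "S \<subseteq> generate G (T \<union> S')"
  shows "generate G (T \<union> S') = carrier G"
proof
  have TS': "T \<union> S' \<subseteq> carrier G" using T S' by simp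
  show "generate G (T \<union> S') \<subseteq> carrier G" using TS' by (rule generate_incl)
  have "generate G (T \<union> S) \<subseteq> generate G (T \<union> S')"
    by (rule generate_subgroup_incl[OF _ generate_is_subgroup[OF TS']])
      (use S in \<open>auto intro: generate.incl\<close>)
  then show "carrier G \<subseteq> generate G (T \<union> S')" using gen by simp
qed

text \<open>Euclid's algorithm on the exponents of a relation: as long as two of them are nonzero, one can
  be lowered by a change of generators; once only one is left, purity makes that generator
  redundant.\<close>

lemma (in comm_group) drop_generator:
  assumes T: "subgroup T G"
    and pure: "\<And>x k. x \<in> carrier G \<Longrightarrow> k > 0 \<Longrightarrow> x [^] (k::nat) \<in> T \<Longrightarrow> x \<in> T"
    and S: "finite S" "S \<subseteq> carrier G" "generate G (T \<union> S) = carrier G"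
    and rel: "(\<Otimes>s\<in>S. s [^] (c s :: int)) \<in> T" "s \<in> S" "c s \<noteq> 0"
  shows "\<exists>S'. finite S' \<and> S' \<subseteq> carrier G \<and> generate G (T \<union> S') = carrier G \<and> card S' < card S"
  using S rel
proof (induction "\<Sum>s\<in>S. nat \<bar>c s\<bar>" arbitrary: S c s rule: less_induct)
  case less
  note finS = less.prems(1) and SG = less.prems(2) and gen = less.prems(3)
  note TG = subgroup.subset[OF T]
  have IH: "\<exists>S''. finite S'' \<and> S'' \<subseteq> carrier G \<and> generate G (T \<union> S'') = carrier G \<and> card S'' < card S'"
    if "(\<Sum>s\<in>S'. nat \<bar>c' s\<bar>) < (\<Sum>s\<in>S. nat \<bar>c s\<bar>)" "finite S'" "S' \<subseteq> carrier G"
      "generate G (T \<union> S') = carrier G" "(\<Otimes>s\<in>S'. s [^] (c' s :: int)) \<in> T" "s' \<in> S'" "c' s' \<noteq> 0" for S' c' s'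
    using less.hyps[OF that] .
  have "(\<exists>s\<in>S. c s \<noteq> 0 \<and> (\<forall>t\<in>S. t \<noteq> s \<longrightarrow> c t = 0)) \<or>
    (\<exists>s\<in>S. \<exists>t\<in>S. s \<noteq> t \<and> c t \<noteq> 0 \<and> \<bar>c t\<bar> \<le> \<bar>c s\<bar>)"
  proof (rule disjCI)
    assume no: "\<not> (\<exists>s\<in>S. \<exists>t\<in>S. s \<noteq> t \<and> c t \<noteq> 0 \<and> \<bar>c t\<bar> \<le> \<bar>c s\<bar>)"
    have "c t = 0" if "t \<in> S" "t \<noteq> s" for t
    proof (rule ccontr)
      assume "c t \<noteq> 0"
      then show False using no that less.prems(5,6) linear[of "\<bar>c s\<bar>" "\<bar>c t\<bar>"] by metis
    qed
    then show "\<exists>s\<in>S. c s \<noteq> 0 \<and> (\<forall>t\<in>S. t \<noteq> s \<longrightarrow> c t = 0)" using less.prems(5,6) by blast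
  qed
  then show ?case
  proof (elim disjE bexE conjE)
    fix s assume s: "s \<in> S" "c s \<noteq> 0" and only: "\<forall>t\<in>S. t \<noteq> s \<longrightarrow> c t = 0"
    have sG: "s \<in> carrier G" using s SG by blast
    have "(\<Otimes>t\<in>S. t [^] c t) = (\<Otimes>t\<in>S. if s = t then s [^] c s else \<one>)"
      using SG only by (intro finprod_cong') (auto simp: subset_iff)
    also have "\<dots> = s [^] c s"
      by (rule finprod_singleton[OF s(1) finS]) (use sG in simp)
    finally have "s [^] c s \<in> T" using less.prems(4) by simp
    then have "s [^] nat \<bar>c s\<bar> \<in> T"
    proof (cases "c s" rule: int_cases2)
      case (nonneg n)
      with \<open>s [^] c s \<in> T\<close> show ?thesis by (simp add: int_pow_int)
    next
      case (nonpos n)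
      with \<open>s [^] c s \<in> T\<close> have "inv (s [^] n) \<in> T" using sG by (simp add: int_pow_neg_int)
      then have "inv (inv (s [^] n)) \<in> T" by (rule subgroup.m_inv_closed[OF T])
      then show ?thesis using sG nonpos by simp
    qed
    then have "s \<in> T" using pure[OF sG, of "nat \<bar>c s\<bar>"] s(2) by simp
    then have "T \<union> (S - {s}) = T \<union> S" using s(1) by blast
    then show ?thesis
      using finS SG gen card_Diff1_less[OF finS s(1)] by (intro exI[of _ "S - {s}"] conjI) auto
  next
    \<comment> \<open>Replacing \<open>t\<close> by \<open>t s\<^sup>e\<close> changes the exponent \<open>c s\<close> of \<open>s\<close> to \<open>c s - e (c t)\<close>; the sign \<open>e\<close> is chosen so that
      the absolute value drops by that of \<open>c t\<close>.\<close>
    fix s t assume st: "s \<in> S" "t \<in> S" "s \<noteq> t" "c t \<noteq> 0" "\<bar>c t\<bar> \<le> \<bar>c s\<bar>"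
    define e where "e = sgn (c s) * sgn (c t)"
    have small: "\<bar>c s - e * c t\<bar> = \<bar>c s\<bar> - \<bar>c t\<bar>"
      using st(4,5) by (auto simp: e_def sgn_if abs_if split: if_splits)
    have sG: "s \<in> carrier G" and tG: "t \<in> carrier G" using st SG by auto
    define t' where "t' = t \<otimes> s [^] e"
    have t'G: "t' \<in> carrier G" using sG tG by (simp add: t'_def)
    have t: "t = t' \<otimes> s [^] (- e)" using sG tG by (simp add: t'_def m_assoc flip: int_pow_mult)
    let ?S1 = "S - {t}"
    let ?S' = "insert t' ?S1"
    have gen': "generate G (T \<union> ?S') = carrier G"
    proof (rule generate_eq_carrier_mono[OF gen TG])
      show S': "?S' \<subseteq> carrier G" using SG t'G by blast
      then have sub: "subgroup (generate G (T \<union> ?S')) G" using TG by (intro generate_is_subgroup) blast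
      have "t' \<in> generate G (T \<union> ?S')" "s \<in> generate G (T \<union> ?S')"
        using st by (auto intro!: generate.incl)
      then have "t \<in> generate G (T \<union> ?S')"
        by (subst t) (intro subgroup.m_closed[OF sub] int_pow_in_subgroup[OF sub])
      then show "S \<subseteq> generate G (T \<union> ?S')" by (auto intro: generate.incl)
    qed
    \<comment> \<open>If the new generator is not new, there is already one generator fewer.\<close>
    show ?thesis
    proof (cases "t' \<in> ?S1")
      case True
      then have "?S' = ?S1" by blast
      then show ?thesis
        using finS SG gen' card_Diff1_less[OF finS st(2)] by (intro exI[of _ ?S1] conjI) auto
    next
      case False
      define c' where "c' = (\<lambda>r. if r = t' then c t else if r = s then c s - e * c t else c r)"
      have t's: "t' \<noteq> s" using False st by blast
      define R where "R = S - {t} - {s}"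
      have S_split: "S = insert t (insert s R)" and S'_split: "?S' = insert t' (insert s R)"
        using st by (auto simp: R_def)
      have finR: "finite R" and RS: "R \<subseteq> S" and notR: "t \<notin> R" "s \<notin> R" "t' \<notin> R"
        using finS False by (auto simp: R_def)
      have RG': "r \<in> carrier G" if "r \<in> R" for r using that RS SG by blast
      have RG: "(\<Otimes>r\<in>R. r [^] c r) \<in> carrier G" using RG' by (intro finprod_closed) auto
      have R: "(\<Otimes>r\<in>R. r [^] c' r) = (\<Otimes>r\<in>R. r [^] c r)"
        using notR RG' by (intro finprod_cong') (auto simp: c'_def)
      have "(\<Otimes>r\<in>?S'. r [^] c' r) = t' [^] c t \<otimes> (s [^] (c s - e * c t) \<otimes> (\<Otimes>r\<in>R. r [^] c r))"
        unfolding S'_split R[symmetric] using notR t's t'G sG RG' finR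
        by (simp add: Pi_iff c'_def)
      also have "t' [^] c t = t [^] c t \<otimes> s [^] (e * c t)"
        unfolding t'_def using sG tG
        by (simp add: int_pow_mult_distrib[OF m_comm] int_pow_pow)
      also have "t [^] c t \<otimes> s [^] (e * c t) \<otimes> (s [^] (c s - e * c t) \<otimes> (\<Otimes>r\<in>R. r [^] c r)) =
        t [^] c t \<otimes> ((s [^] (e * c t) \<otimes> s [^] (c s - e * c t)) \<otimes> (\<Otimes>r\<in>R. r [^] c r))"
        using sG tG RG by (simp add: m_assoc)
      also have "s [^] (e * c t) \<otimes> s [^] (c s - e * c t) = s [^] c s"
        using sG by (simp flip: int_pow_mult)
      also have "t [^] c t \<otimes> (s [^] c s \<otimes> (\<Otimes>r\<in>R. r [^] c r)) = (\<Otimes>r\<in>S. r [^] c r)"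
        unfolding S_split using notR st(3) tG sG RG' finR by (simp add: Pi_iff)
      finally have rel': "(\<Otimes>r\<in>?S'. r [^] c' r) \<in> T" using less.prems(4) by simp
      have "(\<Sum>r\<in>R. nat \<bar>c' r\<bar>) = (\<Sum>r\<in>R. nat \<bar>c r\<bar>)"
        using notR by (intro sum.cong) (auto simp: c'_def)
      moreover have "(\<Sum>r\<in>?S'. nat \<bar>c' r\<bar>) = nat \<bar>c t\<bar> + (nat \<bar>c s - e * c t\<bar> + (\<Sum>r\<in>R. nat \<bar>c' r\<bar>))"
        unfolding S'_split using notR t's finR by (simp add: c'_def)
      moreover have "(\<Sum>r\<in>S. nat \<bar>c r\<bar>) = nat \<bar>c t\<bar> + (nat \<bar>c s\<bar> + (\<Sum>r\<in>R. nat \<bar>c r\<bar>))"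
        unfolding S_split using notR st(3) finR by simp
      moreover have "nat \<bar>c s - e * c t\<bar> < nat \<bar>c s\<bar>" using st(4,5) unfolding small by arith
      ultimately have "(\<Sum>r\<in>?S'. nat \<bar>c' r\<bar>) < (\<Sum>r\<in>S. nat \<bar>c r\<bar>)" by simp
      moreover have "card ?S' = card S"
        unfolding S'_split S_split using notR st(3) t's finR by simp
      moreover have "c' t' \<noteq> 0" using st(4) by (simp add: c'_def)
      moreover have "finite ?S'" "?S' \<subseteq> carrier G" "t' \<in> ?S'" using finS SG t'G by auto
      ultimately show ?thesis
        using IH[OF _ _ _ gen' rel', of t'] by simp
    qed
  qed
qed

text \<open>A functional on a subgroup with finitely generated torsion-free quotient extends: that
  quotient is free.\<close>

lemma (in comm_group) extend_functional:
  assumes T: "subgroup T G"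
    and pure: "\<And>x k. x \<in> carrier G \<Longrightarrow> k > 0 \<Longrightarrow> x [^] (k::nat) \<in> T \<Longrightarrow> x \<in> T"
    and S: "finite S" "S \<subseteq> carrier G" "generate G (T \<union> S) = carrier G"
    and \<phi>: "\<phi> \<in> functional (G\<lparr>carrier := T\<rparr>)"
  shows "\<exists>\<psi>\<in>functional G. \<forall>t\<in>T. \<psi> t = \<phi> t"
  using S
proof (induction "card S" arbitrary: S rule: less_induct)
  case less
  note finS = less.prems(1) and SG = less.prems(2) and gen = less.prems(3)
  let ?P = "\<lambda>c. \<Otimes>s\<in>S. s [^] (c s :: int)"
  show ?case
  proof (cases "\<exists>c s. ?P c \<in> T \<and> s \<in> S \<and> c s \<noteq> 0")
    case True
    then obtain c s where cs: "?P c \<in> T" "s \<in> S" "c s \<noteq> 0" by blast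
    have "\<exists>S'. finite S' \<and> S' \<subseteq> carrier G \<and> generate G (T \<union> S') = carrier G \<and> card S' < card S"
      by (rule drop_generator[OF T _ finS SG gen cs]) (rule pure)
    then obtain S' where "finite S'" "S' \<subseteq> carrier G" "generate G (T \<union> S') = carrier G" "card S' < card S"
      by (elim exE conjE) (rule that)
    then show ?thesis by (intro less.hyps[of S'])
  next
    case False
    have PG: "?P c \<in> carrier G" for c using SG by (intro finprod_closed) auto
    have P_diff: "?P c \<otimes> inv (?P d) = ?P (\<lambda>s. c s - d s)" for c d
    proof -
      have "?P (\<lambda>s. c s - d s) \<otimes> ?P d = (\<Otimes>s\<in>S. s [^] (c s - d s) \<otimes> s [^] d s)"
        using SG by (intro finprod_multf[symmetric]) auto
      also have "\<dots> = ?P c"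
        using SG by (intro finprod_cong') (auto simp: subset_iff simp flip: int_pow_mult)
      finally show ?thesis using PG by (metis inv_solve_right)
    qed
    have TG: "t \<in> carrier G" if "t \<in> T" for t using that subgroup.mem_carrier[OF T] by blast
    have unique: "t = u" if tu: "t \<in> T" "u \<in> T" and eq: "t \<otimes> ?P c = u \<otimes> ?P d" for t u c d
    proof -
      have "?P (\<lambda>s. d s - c s) = inv u \<otimes> t"
      proof -
        have "inv u \<otimes> t = inv u \<otimes> ((t \<otimes> ?P c) \<otimes> inv (?P c))"
          using PG TG[OF tu(1)] TG[OF tu(2)] by (simp add: m_assoc)
        also have "\<dots> = (inv u \<otimes> u) \<otimes> (?P d \<otimes> inv (?P c))"
          unfolding eq using PG TG[OF tu(2)] by (simp add: m_assoc[symmetric])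
        also have "\<dots> = ?P (\<lambda>s. d s - c s)" unfolding P_diff using PG TG[OF tu(2)] by simp
        finally show ?thesis by simp
      qed
      then have "?P (\<lambda>s. d s - c s) \<in> T"
        using subgroup.m_closed[OF T subgroup.m_inv_closed[OF T tu(2)] tu(1)] by simp
      then have "d s = c s" if "s \<in> S" for s using False that by force
      then have "?P d = ?P c" using SG by (intro finprod_cong') auto
      then show ?thesis using eq PG[of c] TG tu by simp
    qed
    \<comment> \<open>Without relations the group is the direct sum of \<open>T\<close> and a free group, and \<open>\<tau>\<close> is the projection to \<open>T\<close>.\<close>
    define \<tau> where "\<tau> x = (SOME t. t \<in> T \<and> (\<exists>c. x = t \<otimes> ?P c))" for x
    have \<tau>: "\<tau> x \<in> T \<and> (\<exists>c. x = \<tau> x \<otimes> ?P c)" if "x \<in> carrier G" for x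
      unfolding \<tau>_def
      by (rule someI_ex) (use generate_union_subgroup[OF T finS SG, of x] gen that in blast)
    have \<tau>_eq: "\<tau> (t \<otimes> ?P c) = t" if t: "t \<in> T" for t c
    proof -
      have "t \<otimes> ?P c \<in> carrier G" using TG[OF t] PG by simp
      from \<tau>[OF this] obtain d where "\<tau> (t \<otimes> ?P c) \<in> T" "t \<otimes> ?P c = \<tau> (t \<otimes> ?P c) \<otimes> ?P d" by blast
      then show ?thesis using unique[OF t, of "\<tau> (t \<otimes> ?P c)" c d] by simp
    qed
    show ?thesis
    proof (intro bexI[of _ "\<lambda>x. \<phi> (\<tau> x)"] functionalI ballI)
      fix t assume t: "t \<in> T"
      have "?P (\<lambda>_. 0) = \<one>" by simp
      then show "\<phi> (\<tau> t) = \<phi> t" using \<tau>_eq[OF t, of "\<lambda>_. 0"] TG[OF t] by simp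
    next
      fix x y assume "x \<in> carrier G" "y \<in> carrier G"
      then obtain c d where x: "\<tau> x \<in> T" "x = \<tau> x \<otimes> ?P c" and y: "\<tau> y \<in> T" "y = \<tau> y \<otimes> ?P d"
        using \<tau> by blast
      have "?P (\<lambda>s. c s + d s) = (\<Otimes>s\<in>S. s [^] c s \<otimes> s [^] d s)"
        using SG by (intro finprod_cong') (auto simp: subset_iff int_pow_mult)
      also have "\<dots> = ?P c \<otimes> ?P d" using SG by (intro finprod_multf) auto
      finally have sum: "?P (\<lambda>s. c s + d s) = ?P c \<otimes> ?P d" .
      have "x \<otimes> y = (\<tau> x \<otimes> ?P c) \<otimes> (\<tau> y \<otimes> ?P d)" using x(2) y(2) by simp
      also have "\<dots> = (\<tau> x \<otimes> \<tau> y) \<otimes> ?P (\<lambda>s. c s + d s)"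
        unfolding sum using TG[OF x(1)] TG[OF y(1)] PG[of c] PG[of d] by (simp add: m_ac)
      finally have "\<tau> (x \<otimes> y) = \<tau> x \<otimes> \<tau> y"
        using \<tau>_eq[OF subgroup.m_closed[OF T x(1) y(1)]] by simp
      then show "\<phi> (\<tau> (x \<otimes> y)) = \<phi> (\<tau> x) + \<phi> (\<tau> y)"
        using functional_mult[OF \<phi>] x(1) y(1) by simp
    qed
  qed
qed

text \<open>If the quotient \<open>E\<close> of \<open>P\<close> by \<open>L\<close> is flabby, every invariant functional on \<open>L\<close> extends: it
  extends by zero to \<open>L + I\<^sub>H P\<close>, because on \<open>L \<inter> I\<^sub>H P\<close> the norm vanishes, and
  \<open>P / (L + I\<^sub>H P) = E / I\<^sub>H E\<close> is torsion-free.\<close>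

lemma extend_invariant_functional:
  assumes fin: "finite (carrier G)" and L: "gmodule G L" and P: "pi_lattice G P" and E: "flabby_lattice G E"
    and i: "i \<in> gmodule_hom G L P" "inj_on i (carrier L)"
    and q: "q \<in> gmodule_hom G P E" "q ` carrier P = carrier E"
    and ker: "kernel P E q = i ` carrier L"
    and H: "subgroup H G" and \<phi>: "\<phi> \<in> functional L"
    and inv: "\<And>h x. h \<in> H \<Longrightarrow> x \<in> carrier L \<Longrightarrow> \<phi> (act L h x) = \<phi> x"
  shows "\<exists>\<psi>\<in>functional P. (\<forall>x\<in>carrier L. \<psi> (i x) = \<phi> x) \<and>
    (\<forall>h\<in>H. \<forall>x\<in>carrier P. \<psi> (act P h x) = \<psi> x)"
proof -
  note HG = subgroup.subset[OF H] and Pm = pi_latticeD(1)[OF P] and Em = flabby_lattice_gmodule[OF E]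
  have finH: "finite H" using HG fin finite_subset by blast
  interpret L: gmodule G L by fact
  interpret P: gmodule G P by fact
  interpret E: gmodule G E by fact
  interpret i: group_hom L P i by (rule gmodule_hom_group_hom[OF L Pm i(1)])
  interpret q: group_hom P E q by (rule gmodule_hom_group_hom[OF Pm Em q(1)])
  let ?I = "augmentation_image H P"
  have I: "subgroup ?I P" by (rule P.augmentation_subgroup[OF HG])
  have IP: "u \<in> carrier P" if "u \<in> ?I" for u using that subgroup.mem_carrier[OF I] by blast
  have qi: "q (i l) = \<one>\<^bsub>E\<^esub>" if "l \<in> carrier L" for l
    using ker that by (auto simp: kernel_def)
  \<comment> \<open>\<open>T = L + I\<^sub>H P\<close>\<close>
  define T where "T = {x \<in> carrier P. q x \<in> augmentation_image H E}"
  have IE: "subgroup (augmentation_image H E) E" by (rule E.augmentation_subgroup[OF HG])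
  have T: "subgroup T P"
    using IE[THEN subgroup.m_closed] IE[THEN subgroup.one_closed] IE[THEN subgroup.m_inv_closed]
    by (intro P.M.subgroupI) (auto simp: T_def)
  have T_split: "\<exists>l\<in>carrier L. \<exists>u\<in>?I. x = i l \<otimes>\<^bsub>P\<^esub> u" if x: "x \<in> T" for x
  proof -
    let ?S = "{act P h y \<otimes>\<^bsub>P\<^esub> inv\<^bsub>P\<^esub> y | h y. h \<in> H \<and> y \<in> carrier P}"
    have "{act E h z \<otimes>\<^bsub>E\<^esub> inv\<^bsub>E\<^esub> z | h z. h \<in> H \<and> z \<in> carrier E} \<subseteq> q ` ?S"
    proof (rule subsetI)
      fix w assume "w \<in> {act E h z \<otimes>\<^bsub>E\<^esub> inv\<^bsub>E\<^esub> z | h z. h \<in> H \<and> z \<in> carrier E}"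
      then obtain h z where w: "w = act E h z \<otimes>\<^bsub>E\<^esub> inv\<^bsub>E\<^esub> z" "h \<in> H" "z \<in> carrier E" by blast
      then obtain y where y: "y \<in> carrier P" "z = q y" using q(2) by blast
      have "w = q (act P h y \<otimes>\<^bsub>P\<^esub> inv\<^bsub>P\<^esub> y)"
        using w y HG P.act_closed[of h y] gmodule_homD(3)[OF q(1), of h y] by (auto simp: subset_iff)
      then show "w \<in> q ` ?S" using w(2) y(1) by blast
    qed
    then have "augmentation_image H E \<subseteq> generate E (q ` ?S)"
      unfolding augmentation_image_def by (rule E.M.mono_generate)
    also have "\<dots> = q ` ?I"
      unfolding augmentation_image_def by (rule q.generate_img[OF P.augmentation_gens[OF HG]])
    finally obtain u where u: "u \<in> ?I" "q x = q u" using x unfolding T_def by blast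
    have xP: "x \<in> carrier P" using x by (simp add: T_def)
    have "x \<otimes>\<^bsub>P\<^esub> inv\<^bsub>P\<^esub> u \<in> kernel P E q"
      using u IP[OF u(1)] xP by (simp add: kernel_def)
    then obtain l where l: "l \<in> carrier L" "x \<otimes>\<^bsub>P\<^esub> inv\<^bsub>P\<^esub> u = i l" unfolding ker by blast
    then have "x = i l \<otimes>\<^bsub>P\<^esub> u" using xP IP[OF u(1)] by (metis P.M.inv_solve_right i.hom_closed)
    with l u show ?thesis by blast
  qed
  have iT: "i l \<in> T" if "l \<in> carrier L" for l
    using that qi subgroup.one_closed[OF IE] by (simp add: T_def)
  have I_T: "u \<in> T" if "u \<in> ?I" for u
    using hom_augmentation_image[OF Pm Em q(1) HG that] IP[OF that] by (simp add: T_def)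
  \<comment> \<open>The norm of such an \<open>l\<close> is zero, and \<open>\<phi>\<close> maps it to \<open>card H\<close> times \<open>\<phi> l\<close>.\<close>
  have zero: "\<phi> l = 0" if l: "l \<in> carrier L" and il: "i l \<in> ?I" for l
  proof -
    have NL: "(\<Otimes>\<^bsub>L\<^esub>h\<in>H. act L h l) \<in> carrier L"
      using HG l by (auto simp: subset_iff intro!: L.M.finprod_closed L.act_closed)
    have "i (\<Otimes>\<^bsub>L\<^esub>h\<in>H. act L h l) = (\<Otimes>\<^bsub>P\<^esub>h\<in>H. i (act L h l))"
      by (rule hom_finprod_comm_group[OF L.M.comm_group_axioms P.M.comm_group_axioms i.homh])
        (use HG l in \<open>auto simp: subset_iff intro: L.act_closed\<close>)
    also have "\<dots> = (\<Otimes>\<^bsub>P\<^esub>h\<in>H. act P h (i l))"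
      using HG l by (intro P.M.finprod_cong') (auto simp: subset_iff gmodule_homD(3)[OF i(1)] intro!: P.act_closed)
    also have "\<dots> = \<one>\<^bsub>P\<^esub>"
      using P.augmentation_le_norm_kernel[OF H] il by (auto simp: norm_kernel_def)
    finally have "i (\<Otimes>\<^bsub>L\<^esub>h\<in>H. act L h l) = i \<one>\<^bsub>L\<^esub>" by simp
    then have "(\<Otimes>\<^bsub>L\<^esub>h\<in>H. act L h l) = \<one>\<^bsub>L\<^esub>" using inj_onD[OF i(2)] NL L.M.one_closed by blast
    then have "0 = \<phi> (\<Otimes>\<^bsub>L\<^esub>h\<in>H. act L h l)" using L.M.functional_one[OF \<phi>] by simp
    also have "\<dots> = (\<Sum>h\<in>H. \<phi> (act L h l))"
      using HG l by (intro L.M.functional_finprod \<phi>) (auto simp: subset_iff intro: L.act_closed)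
    also have "\<dots> = int (card H) * \<phi> l" using inv l by simp
    finally show ?thesis using finH subgroup.one_closed[OF H] by auto
  qed
  have unique: "\<phi> l = \<phi> l'" if l: "l \<in> carrier L" "l' \<in> carrier L" and u: "u \<in> ?I" "u' \<in> ?I"
    and eq: "i l \<otimes>\<^bsub>P\<^esub> u = i l' \<otimes>\<^bsub>P\<^esub> u'" for l l' u u'
  proof -
    have "i (l \<otimes>\<^bsub>L\<^esub> inv\<^bsub>L\<^esub> l') = (i l \<otimes>\<^bsub>P\<^esub> u) \<otimes>\<^bsub>P\<^esub> (inv\<^bsub>P\<^esub> u \<otimes>\<^bsub>P\<^esub> inv\<^bsub>P\<^esub> (i l'))"
      using l IP[OF u(1)] by (simp add: P.M.m_assoc[symmetric]) (simp add: P.M.m_assoc)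
    also have "\<dots> = (i l' \<otimes>\<^bsub>P\<^esub> inv\<^bsub>P\<^esub> (i l')) \<otimes>\<^bsub>P\<^esub> (u' \<otimes>\<^bsub>P\<^esub> inv\<^bsub>P\<^esub> u)"
      unfolding eq using i.hom_closed[OF l(2)] IP[OF u(1)] IP[OF u(2)] by (simp only: P.M.m_ac P.M.inv_closed P.M.m_closed)
    also have "\<dots> = u' \<otimes>\<^bsub>P\<^esub> inv\<^bsub>P\<^esub> u" using i.hom_closed[OF l(2)] IP[OF u(1)] IP[OF u(2)] by simp
    also have "\<dots> \<in> ?I" using u I by (simp add: subgroup.m_closed subgroup.m_inv_closed)
    finally have "\<phi> (l \<otimes>\<^bsub>L\<^esub> inv\<^bsub>L\<^esub> l') = 0" using l by (intro zero) simp_all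
    then show ?thesis using l by (simp add: functional_mult[OF \<phi>] L.M.functional_inv[OF \<phi>])
  qed
  define \<phi>' where "\<phi>' x = \<phi> (SOME l. l \<in> carrier L \<and> (\<exists>u\<in>?I. x = i l \<otimes>\<^bsub>P\<^esub> u))" for x
  have \<phi>': "\<phi>' (i l \<otimes>\<^bsub>P\<^esub> u) = \<phi> l" if "l \<in> carrier L" "u \<in> ?I" for l u
  proof -
    let ?l = "SOME l'. l' \<in> carrier L \<and> (\<exists>u'\<in>?I. i l \<otimes>\<^bsub>P\<^esub> u = i l' \<otimes>\<^bsub>P\<^esub> u')"
    have "?l \<in> carrier L \<and> (\<exists>u'\<in>?I. i l \<otimes>\<^bsub>P\<^esub> u = i ?l \<otimes>\<^bsub>P\<^esub> u')"
      by (rule someI[of _ l]) (use that in blast)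
    then obtain u' where "?l \<in> carrier L" "u' \<in> ?I" "i l \<otimes>\<^bsub>P\<^esub> u = i ?l \<otimes>\<^bsub>P\<^esub> u'" by blast
    then show ?thesis unfolding \<phi>'_def using unique[OF that(1) _ that(2), of ?l u'] by simp
  qed
  have \<phi>'_fun: "\<phi>' \<in> functional (P\<lparr>carrier := T\<rparr>)"
  proof (rule functionalI)
    fix x y assume "x \<in> carrier (P\<lparr>carrier := T\<rparr>)" "y \<in> carrier (P\<lparr>carrier := T\<rparr>)"
    then have xyT: "x \<in> T" "y \<in> T" by simp_all
    obtain l u where x: "l \<in> carrier L" "u \<in> ?I" "x = i l \<otimes>\<^bsub>P\<^esub> u" using T_split[OF xyT(1)] by blast
    obtain k v where y: "k \<in> carrier L" "v \<in> ?I" "y = i k \<otimes>\<^bsub>P\<^esub> v" using T_split[OF xyT(2)] by blast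
    have "x \<otimes>\<^bsub>P\<^esub> y = i (l \<otimes>\<^bsub>L\<^esub> k) \<otimes>\<^bsub>P\<^esub> (u \<otimes>\<^bsub>P\<^esub> v)"
      unfolding x y using x(1) y(1) IP[OF x(2)] IP[OF y(2)] by (simp add: P.M.m_ac)
    moreover have "u \<otimes>\<^bsub>P\<^esub> v \<in> ?I" by (rule subgroup.m_closed[OF I x(2) y(2)])
    ultimately have "\<phi>' (x \<otimes>\<^bsub>P\<^esub> y) = \<phi> l + \<phi> k"
      using \<phi>'[of "l \<otimes>\<^bsub>L\<^esub> k" "u \<otimes>\<^bsub>P\<^esub> v"] x(1) y(1) by (simp add: functional_mult[OF \<phi>])
    then show "\<phi>' (x \<otimes>\<^bsub>P\<lparr>carrier := T\<rparr>\<^esub> y) = \<phi>' x + \<phi>' y"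
      using \<phi>'[OF x(1,2)] \<phi>'[OF y(1,2)] x(3) y(3) by simp
  qed
  have pure: "x \<in> T" if x: "x \<in> carrier P" and k: "k > 0" "x [^]\<^bsub>P\<^esub> (k::nat) \<in> T" for x k
  proof -
    have "q x [^]\<^bsub>E\<^esub> k \<in> augmentation_image H E"
      using k(2) unfolding T_def q.hom_nat_pow[OF x, symmetric] by blast
    then show ?thesis
      using flabby_augmentation_pure[OF fin E H q.hom_closed[OF x] k(1)] x unfolding T_def by blast
  qed
  obtain S where S: "finite S" "S \<subseteq> carrier P" "generate P S = carrier P"
    using fin P by (rule pi_lattice_gens)
  have "generate P (T \<union> S) = carrier P"
  proof
    show "generate P (T \<union> S) \<subseteq> carrier P"
      using S(2) subgroup.subset[OF T] by (intro P.M.generate_incl) blast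
    show "carrier P \<subseteq> generate P (T \<union> S)" using P.M.mono_generate[of S "T \<union> S"] S(3) by simp
  qed
  with \<phi>'_fun have "\<exists>\<psi>\<in>functional P. \<forall>t\<in>T. \<psi> t = \<phi>' t"
    by (intro P.M.extend_functional[OF T pure S(1,2)])
  then obtain \<psi> where \<psi>: "\<psi> \<in> functional P" "\<And>t. t \<in> T \<Longrightarrow> \<psi> t = \<phi>' t"
    by blast
  have I0: "\<psi> u = 0" if "u \<in> ?I" for u
    using \<psi>(2)[OF I_T[OF that]] \<phi>'[OF L.M.one_closed that] IP[OF that] L.M.functional_one[OF \<phi>] by simp
  show ?thesis
  proof (intro bexI[OF _ \<psi>(1)] conjI ballI)
    fix x assume x: "x \<in> carrier L"
    show "\<psi> (i x) = \<phi> x"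
      using \<psi>(2)[OF iT[OF x]] \<phi>'[OF x subgroup.one_closed[OF I]] i.hom_closed[OF x] by simp
  next
    fix h x assume h: "h \<in> H" and x: "x \<in> carrier P"
    have hx: "act P h x \<in> carrier P" using h HG x P.act_closed by blast
    have "\<psi> (act P h x \<otimes>\<^bsub>P\<^esub> inv\<^bsub>P\<^esub> x) = 0" by (rule I0[OF P.augmentation_incl[OF h x]])
    then show "\<psi> (act P h x) = \<psi> x"
      using hx x by (simp add: functional_mult[OF \<psi>(1)] P.M.functional_inv[OF \<psi>(1)])
  qed
qed

definition stabilizer :: "('g, 'c) monoid_scheme \<Rightarrow> ('g, 'a) gmodule \<Rightarrow> 'a \<Rightarrow> 'g set" where
  "stabilizer G M b = {g \<in> carrier G. act M g b = b}"

lemma (in gmodule) stabilizer_subgroup: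
  assumes "b \<in> carrier M"
  shows "subgroup (stabilizer G M b) G"
proof (rule G.subgroupI)
  show "stabilizer G M b \<noteq> {}" using act_one[OF assms] unfolding stabilizer_def by blast
  fix g assume "g \<in> stabilizer G M b"
  then have g: "g \<in> carrier G" "act M g b = b" by (auto simp: stabilizer_def)
  then show "inv\<^bsub>G\<^esub> g \<in> stabilizer G M b" using act_cancel(2)[OF g(1) assms] by (simp add: stabilizer_def)
next
  fix g h assume "g \<in> stabilizer G M b" "h \<in> stabilizer G M b"
  then show "g \<otimes>\<^bsub>G\<^esub> h \<in> stabilizer G M b" using assms by (simp add: stabilizer_def act_mult)
qed (auto simp: stabilizer_def)

text \<open>By Shapiro's lemma a map into a permutation lattice is a family of functionals, one for each
  orbit of the basis, invariant under the stabilizer of a representative.\<close>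

lemma extend_into_permutation:
  assumes fin: "finite (carrier G)" and L: "gmodule G L" and P: "pi_lattice G P" and E: "flabby_lattice G E"
    and i: "i \<in> gmodule_hom G L P" "inj_on i (carrier L)"
    and q: "q \<in> gmodule_hom G P E" "q ` carrier P = carrier E"
    and ker: "kernel P E q = i ` carrier L"
    and Q: "permutation_lattice G Q" and f: "f \<in> gmodule_hom G L Q"
  obtains k where "k \<in> gmodule_hom G P Q" "\<And>x. x \<in> carrier L \<Longrightarrow> k (i x) = f x"
proof -
  note Pm = pi_latticeD(1)[OF P] and Qm = permutation_lattice_gmodule[OF Q]
  interpret L: gmodule G L by fact
  interpret P: gmodule G P by fact
  interpret Q: gmodule G Q by fact
  obtain B c where B: "finite B" "B \<subseteq> carrier Q" "generate Q B = carrier Q"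
    and c: "\<And>b. b \<in> B \<Longrightarrow> c b \<in> functional Q"
    "\<And>b b'. b \<in> B \<Longrightarrow> b' \<in> B \<Longrightarrow> c b b' = (if b' = b then 1 else 0)"
    and rep: "\<And>x. x \<in> carrier Q \<Longrightarrow> x = (\<Otimes>\<^bsub>Q\<^esub>b\<in>B. b [^]\<^bsub>Q\<^esub> (c b x :: int))"
    and st: "\<And>g b. g \<in> carrier G \<Longrightarrow> b \<in> B \<Longrightarrow> act Q g b \<in> B"
    using Q by (rule permutation_latticeE) (rule that)
  have BQ: "b \<in> carrier Q" if "b \<in> B" for b using that B by blast
  have fQ: "f x \<in> carrier Q" if "x \<in> carrier L" for x using gmodule_homD(1)[OF f that] .
  have coord: "c b (act Q g x) = c (act Q (inv\<^bsub>G\<^esub> g) b) x"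
    if "g \<in> carrier G" "b \<in> B" "x \<in> carrier Q" for g b x
    by (intro Q.coord_act[OF B(2,3) c st that])
  let ?ext = "\<lambda>b \<psi>. \<psi> \<in> functional P \<and> (\<forall>x\<in>carrier L. \<psi> (i x) = c b (f x)) \<and>
      (\<forall>h\<in>stabilizer G Q b. \<forall>x\<in>carrier P. \<psi> (act P h x) = \<psi> x)"
  have "\<exists>\<psi>. ?ext b \<psi>" if b: "b \<in> B" for b
  proof -
    have "c b (f (act L h x)) = c b (f x)" if h: "h \<in> stabilizer G Q b" and x: "x \<in> carrier L" for h x
    proof -
      have hG: "h \<in> carrier G" and hb: "act Q h b = b" using h by (auto simp: stabilizer_def)
      have "act Q (inv\<^bsub>G\<^esub> h) b = b" using Q.act_cancel(2)[OF hG BQ[OF b]] hb by simp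
      then show ?thesis
        unfolding gmodule_homD(3)[OF f hG x] coord[OF hG b fQ[OF x]] by simp
    qed
    then show ?thesis
      using extend_invariant_functional[OF fin L P E i q ker Q.stabilizer_subgroup[OF BQ[OF b]]
          functional_comp_hom[OF c(1)[OF b] f]] by blast
  qed
  then have "\<forall>b\<in>B. \<exists>\<psi>. ?ext b \<psi>" by blast
  then obtain \<psi> where "\<forall>b\<in>B. ?ext b (\<psi> b)" by (rule bchoice[THEN exE])
  then have \<psi>: "\<psi> b \<in> functional P" "\<And>x. x \<in> carrier L \<Longrightarrow> \<psi> b (i x) = c b (f x)"
    "\<And>h x. h \<in> stabilizer G Q b \<Longrightarrow> x \<in> carrier P \<Longrightarrow> \<psi> b (act P h x) = \<psi> b x" if "b \<in> B" for b
    using that by blast+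
  define orb where "orb b = (\<lambda>g. act Q g b) ` carrier G" for b
  define r where "r b = (SOME b'. b' \<in> orb b)" for b
  have self: "b \<in> orb b" if "b \<in> B" for b
    unfolding orb_def by (rule image_eqI[of _ _ "\<one>\<^bsub>G\<^esub>"]) (simp_all add: Q.act_one BQ that)
  have r: "r b \<in> orb b" if "b \<in> B" for b unfolding r_def using self[OF that] by (rule someI)
  have orb_eq: "orb b' = orb b" if "b \<in> B" "b' \<in> orb b" for b b'
    using Q.orbit_in_orbit[OF L.G.subgroup_self BQ[OF that(1)], of b'] that(2) unfolding orb_def by simp
  have rB: "r b \<in> B" if b: "b \<in> B" for b
  proof -
    obtain g where "g \<in> carrier G" "r b = act Q g b" using r[OF b] unfolding orb_def by blast
    then show ?thesis using st[of g b] b by simp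
  qed
  \<comment> \<open>\<open>\<gamma> b\<close> carries the representative \<open>r b\<close> of the orbit to \<open>b\<close>; by invariance of \<open>\<psi> (r b)\<close> its choice does not
    matter for \<open>\<chi> b\<close>, the coordinate at \<open>b\<close> of the extension.\<close>
  define \<gamma> where "\<gamma> b = (SOME g. g \<in> carrier G \<and> b = act Q g (r b))" for b
  have \<gamma>: "\<gamma> b \<in> carrier G" "b = act Q (\<gamma> b) (r b)" if b: "b \<in> B" for b
  proof -
    have "b \<in> orb (r b)" using self[OF b] orb_eq[OF b r[OF b]] by simp
    then have "\<exists>g. g \<in> carrier G \<and> b = act Q g (r b)" unfolding orb_def by blast
    then have "\<gamma> b \<in> carrier G \<and> b = act Q (\<gamma> b) (r b)" unfolding \<gamma>_def by (rule someI_ex)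
    then show "\<gamma> b \<in> carrier G" "b = act Q (\<gamma> b) (r b)" by simp_all
  qed
  define \<chi> where "\<chi> b x = \<psi> (r b) (act P (inv\<^bsub>G\<^esub> (\<gamma> b)) x)" for b x
  have \<chi>_fun: "\<chi> b \<in> functional P" if b: "b \<in> B" for b
    using \<gamma>(1)[OF b] unfolding \<chi>_def
    by (intro functionalI) (simp add: P.act_add P.act_closed functional_mult[OF \<psi>(1)[OF rB[OF b]]])
  have \<chi>_act: "\<chi> (act Q g b) (act P g x) = \<chi> b x" if g: "g \<in> carrier G" and b: "b \<in> B" and x: "x \<in> carrier P" for g b x
  proof -
    have gb: "act Q g b \<in> B" using st[OF g b] .
    have "act Q g b \<in> orb b" unfolding orb_def using g by blast
    from orb_eq[OF b this] have rr: "r (act Q g b) = r b" unfolding r_def by simp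
    let ?s = "inv\<^bsub>G\<^esub> (\<gamma> (act Q g b)) \<otimes>\<^bsub>G\<^esub> (g \<otimes>\<^bsub>G\<^esub> \<gamma> b)"
    have \<gamma>': "\<gamma> (act Q g b) \<in> carrier G" "act Q g b = act Q (\<gamma> (act Q g b)) (r b)"
      using \<gamma>[OF gb] unfolding rr by simp_all
    have rQ: "r b \<in> carrier Q" using BQ rB b by blast
    have "act Q ?s (r b) = act Q (inv\<^bsub>G\<^esub> (\<gamma> (act Q g b))) (act Q g (act Q (\<gamma> b) (r b)))"
      using g \<gamma>(1)[OF b] \<gamma>'(1) rQ by (simp add: Q.act_mult Q.act_closed)
    also have "\<dots> = act Q (inv\<^bsub>G\<^esub> (\<gamma> (act Q g b))) (act Q (\<gamma> (act Q g b)) (r b))"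
      using \<gamma>(2)[OF b] \<gamma>'(2) by simp
    also have "\<dots> = r b" using \<gamma>'(1) rQ by simp
    finally have s: "?s \<in> stabilizer G Q (r b)" using g \<gamma>(1)[OF b] \<gamma>'(1) by (simp add: stabilizer_def)
    have "act P (inv\<^bsub>G\<^esub> (\<gamma> (act Q g b))) (act P g x) = act P ?s (act P (inv\<^bsub>G\<^esub> (\<gamma> b)) x)"
      using g \<gamma>(1)[OF b] \<gamma>'(1) x by (simp add: P.act_mult P.act_closed)
    then show ?thesis
      unfolding \<chi>_def rr using \<psi>(3)[OF rB[OF b] s, of "act P (inv\<^bsub>G\<^esub> (\<gamma> b)) x"] \<gamma>(1)[OF b] x
      by (simp add: P.act_closed)
  qed
  have \<chi>_i: "\<chi> b (i x) = c b (f x)" if b: "b \<in> B" and x: "x \<in> carrier L" for b x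
  proof -
    have g: "inv\<^bsub>G\<^esub> (\<gamma> b) \<in> carrier G" using \<gamma>(1)[OF b] by simp
    have "\<chi> b (i x) = c (r b) (f (act L (inv\<^bsub>G\<^esub> (\<gamma> b)) x))"
      unfolding \<chi>_def gmodule_homD(3)[OF i(1) g x, symmetric]
      by (rule \<psi>(2)[OF rB[OF b] L.act_closed[OF g x]])
    also have "\<dots> = c (act Q (\<gamma> b) (r b)) (f x)"
      unfolding gmodule_homD(3)[OF f g x] coord[OF g rB[OF b] fQ[OF x]]
      using \<gamma>(1)[OF b] by simp
    finally show ?thesis using \<gamma>(2)[OF b] by simp
  qed
  define k where "k x = (\<Otimes>\<^bsub>Q\<^esub>b\<in>B. b [^]\<^bsub>Q\<^esub> \<chi> b x)" for x
  have "k \<in> gmodule_hom G P Q"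
  proof (rule gmodule_homI)
    fix x show "k x \<in> carrier Q" unfolding k_def using BQ by (intro Q.M.finprod_closed) auto
  next
    fix x y assume xy: "x \<in> carrier P" "y \<in> carrier P"
    have "k (x \<otimes>\<^bsub>P\<^esub> y) = (\<Otimes>\<^bsub>Q\<^esub>b\<in>B. b [^]\<^bsub>Q\<^esub> \<chi> b x \<otimes>\<^bsub>Q\<^esub> b [^]\<^bsub>Q\<^esub> \<chi> b y)"
      unfolding k_def using BQ xy
      by (intro Q.M.finprod_cong') (auto simp: functional_mult[OF \<chi>_fun] Q.M.int_pow_mult)
    also have "\<dots> = k x \<otimes>\<^bsub>Q\<^esub> k y"
      unfolding k_def using BQ by (intro Q.M.finprod_multf) auto
    finally show "k (x \<otimes>\<^bsub>P\<^esub> y) = k x \<otimes>\<^bsub>Q\<^esub> k y" .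
  next
    fix g x assume g: "g \<in> carrier G" and x: "x \<in> carrier P"
    have img: "act Q g ` B = B"
    proof (intro equalityI subsetI)
      fix b assume b: "b \<in> B"
      then have "b = act Q g (act Q (inv\<^bsub>G\<^esub> g) b)" "act Q (inv\<^bsub>G\<^esub> g) b \<in> B" using g BQ st by auto
      then show "b \<in> act Q g ` B" by blast
    qed (use st g in blast)
    have inj: "inj_on (act Q g) B"
      using g BQ by (intro inj_on_inverseI[of _ "act Q (inv\<^bsub>G\<^esub> g)"]) auto
    have "k (act P g x) = (\<Otimes>\<^bsub>Q\<^esub>b\<in>act Q g ` B. b [^]\<^bsub>Q\<^esub> \<chi> b (act P g x))"
      unfolding k_def img by (rule refl)
    also have "\<dots> = (\<Otimes>\<^bsub>Q\<^esub>b\<in>B. act Q g b [^]\<^bsub>Q\<^esub> \<chi> (act Q g b) (act P g x))"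
      by (rule Q.M.finprod_reindex[OF _ inj]) (use BQ st g in auto)
    also have "\<dots> = (\<Otimes>\<^bsub>Q\<^esub>b\<in>B. act Q g (b [^]\<^bsub>Q\<^esub> \<chi> b x))"
      using BQ g x by (intro Q.M.finprod_cong') (auto simp: \<chi>_act Q.act_int_pow intro!: Q.act_closed Q.M.int_pow_closed)
    also have "\<dots> = act Q g (k x)"
      unfolding k_def
      by (rule hom_finprod_comm_group[OF Q.M.comm_group_axioms Q.M.comm_group_axioms
            group_hom.homh[OF Q.act_group_hom[OF g]], symmetric]) (use BQ in auto)
    finally show "k (act P g x) = act Q g (k x)" .
  qed
  moreover have "k (i x) = f x" if x: "x \<in> carrier L" for x
  proof -
    have "k (i x) = (\<Otimes>\<^bsub>Q\<^esub>b\<in>B. b [^]\<^bsub>Q\<^esub> c b (f x))"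
      unfolding k_def using BQ x by (intro Q.M.finprod_cong') (auto simp: \<chi>_i)
    also have "\<dots> = f x" by (rule rep[OF fQ[OF x], symmetric])
    finally show ?thesis .
  qed
  ultimately show ?thesis using that by blast
qed

text \<open>Schanuel's lemma: the two sums are the quotients of \<open>P \<oplus> P'\<close> by the same antidiagonal copy
  of \<open>L\<close>.\<close>

lemma flabby_resolution_schanuel:
  assumes fin: "finite (carrier G)" and L: "gmodule G L"
    and res: "flabby_resolution G L P E i q" and res': "flabby_resolution G L P' E' i' q'"
  shows "gmodule_iso G (direct_sum E P') (direct_sum E' P)"
proof -
  have P: "permutation_lattice G P" and E: "flabby_lattice G E"
    and i: "i \<in> gmodule_hom G L P" "inj_on i (carrier L)"
    and q: "q \<in> gmodule_hom G P E" "q ` carrier P = carrier E" and ker: "kernel P E q = i ` carrier L"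
    using res unfolding flabby_resolution_def by simp_all
  have P': "permutation_lattice G P'" and E': "flabby_lattice G E'"
    and i': "i' \<in> gmodule_hom G L P'" "inj_on i' (carrier L)"
    and q': "q' \<in> gmodule_hom G P' E'" "q' ` carrier P' = carrier E'" and ker': "kernel P' E' q' = i' ` carrier L"
    using res' unfolding flabby_resolution_def by simp_all
  note Pm = permutation_lattice_gmodule[OF P] and Pm' = permutation_lattice_gmodule[OF P']
    and Em = flabby_lattice_gmodule[OF E] and Em' = flabby_lattice_gmodule[OF E']
  obtain k where k: "k \<in> gmodule_hom G P P'" "\<And>x. x \<in> carrier L \<Longrightarrow> k (i x) = i' x"
    by (rule extend_into_permutation[OF fin L permutation_lattice_pi_lattice[OF P] E i q ker P' i'(1)]) (rule that)
  obtain k' where k': "k' \<in> gmodule_hom G P' P" "\<And>x. x \<in> carrier L \<Longrightarrow> k' (i' x) = i x"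
    by (rule extend_into_permutation[OF fin L permutation_lattice_pi_lattice[OF P'] E' i' q' ker' P i(1)]) (rule that)
  interpret L: gmodule G L by fact
  interpret P: gmodule G P by fact
  interpret P': gmodule G P' by fact
  interpret E: gmodule G E by fact
  interpret E': gmodule G E' by fact
  interpret i: group_hom L P i by (rule gmodule_hom_group_hom[OF L Pm i(1)])
  interpret i': group_hom L P' i' by (rule gmodule_hom_group_hom[OF L Pm' i'(1)])
  interpret q: group_hom P E q by (rule gmodule_hom_group_hom[OF Pm Em q(1)])
  interpret q': group_hom P' E' q' by (rule gmodule_hom_group_hom[OF Pm' Em' q'(1)])
  interpret k: group_hom P P' k by (rule gmodule_hom_group_hom[OF Pm Pm' k(1)])
  interpret k': group_hom P' P k' by (rule gmodule_hom_group_hom[OF Pm' Pm k'(1)])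
  let ?W = "direct_sum P P'"
  \<comment> \<open>Both kernels consist of the pairs \<open>(i l, - i' l)\<close>.\<close>
  define s where "s = (\<lambda>(x, y). (q x, k x \<otimes>\<^bsub>P'\<^esub> y))"
  define t where "t = (\<lambda>(x, y). (q' y, k' y \<otimes>\<^bsub>P\<^esub> x))"
  have s: "s \<in> gmodule_hom G ?W (direct_sum E P')"
    unfolding s_def
    by (intro gmodule_homI) (auto simp: gmodule_homD(3)[OF q(1)] gmodule_homD(3)[OF k(1)] P'.act_add P'.act_closed P'.M.m_ac)
  have t: "t \<in> gmodule_hom G ?W (direct_sum E' P)"
    unfolding t_def
    by (intro gmodule_homI) (auto simp: gmodule_homD(3)[OF q'(1)] gmodule_homD(3)[OF k'(1)] P.act_add P.act_closed P.M.m_ac)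
  have s_surj: "s ` carrier ?W = carrier (direct_sum E P')"
  proof (intro equalityI subsetI)
    fix z assume "z \<in> carrier (direct_sum E P')"
    then obtain e y where e: "z = (e, y)" "e \<in> carrier E" "y \<in> carrier P'" by auto
    then obtain x where "x \<in> carrier P" "e = q x" using q(2)[symmetric] by blast
    with e have z: "z = (q x, y)" "x \<in> carrier P" "y \<in> carrier P'" by simp_all
    then have "z = s (x, inv\<^bsub>P'\<^esub> k x \<otimes>\<^bsub>P'\<^esub> y)" by (simp add: s_def P'.M.m_assoc[symmetric])
    then show "z \<in> s ` carrier ?W" using z by simp
  qed (use gmodule_homD(1)[OF s] in blast)
  have t_surj: "t ` carrier ?W = carrier (direct_sum E' P)"
  proof (intro equalityI subsetI)
    fix z assume "z \<in> carrier (direct_sum E' P)"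
    then obtain e x where e: "z = (e, x)" "e \<in> carrier E'" "x \<in> carrier P" by auto
    then obtain y where "y \<in> carrier P'" "e = q' y" using q'(2)[symmetric] by blast
    with e have z: "z = (q' y, x)" "y \<in> carrier P'" "x \<in> carrier P" by simp_all
    then have "z = t (inv\<^bsub>P\<^esub> k' y \<otimes>\<^bsub>P\<^esub> x, y)" by (simp add: t_def P.M.m_assoc[symmetric])
    then show "z \<in> t ` carrier ?W" using z by simp
  qed (use gmodule_homD(1)[OF t] in blast)
  have "kernel ?W (direct_sum E P') s = (\<lambda>l. (i l, inv\<^bsub>P'\<^esub> i' l)) ` carrier L"
  proof (intro equalityI subsetI)
    fix z assume "z \<in> kernel ?W (direct_sum E P') s"
    then obtain x y where z: "z = (x, y)" "x \<in> carrier P" "y \<in> carrier P'"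
      and "q x = \<one>\<^bsub>E\<^esub>" and y: "k x \<otimes>\<^bsub>P'\<^esub> y = \<one>\<^bsub>P'\<^esub>" by (auto simp: kernel_def s_def)
    then have "x \<in> kernel P E q" by (simp add: kernel_def)
    then obtain l where l: "l \<in> carrier L" "x = i l" unfolding ker by blast
    have "y \<otimes>\<^bsub>P'\<^esub> i' l = \<one>\<^bsub>P'\<^esub>" using y l z P'.M.m_comm[of y "i' l"] by (simp add: k(2))
    then have "y = inv\<^bsub>P'\<^esub> i' l" using z l P'.M.inv_equality by (metis i'.hom_closed)
    then show "z \<in> (\<lambda>l. (i l, inv\<^bsub>P'\<^esub> i' l)) ` carrier L" using z l by blast
  next
    fix z assume "z \<in> (\<lambda>l. (i l, inv\<^bsub>P'\<^esub> i' l)) ` carrier L"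
    then obtain l where l: "l \<in> carrier L" "z = (i l, inv\<^bsub>P'\<^esub> i' l)" by blast
    have "i l \<in> kernel P E q" unfolding ker using l(1) by (rule imageI)
    then show "z \<in> kernel ?W (direct_sum E P') s" using l by (simp add: kernel_def s_def k(2))
  qed
  moreover have "kernel ?W (direct_sum E' P) t = (\<lambda>l. (i l, inv\<^bsub>P'\<^esub> i' l)) ` carrier L"
  proof (intro equalityI subsetI)
    fix z assume "z \<in> kernel ?W (direct_sum E' P) t"
    then obtain x y where z: "z = (x, y)" "x \<in> carrier P" "y \<in> carrier P'"
      and "q' y = \<one>\<^bsub>E'\<^esub>" and x: "k' y \<otimes>\<^bsub>P\<^esub> x = \<one>\<^bsub>P\<^esub>" by (auto simp: kernel_def t_def)
    then have "y \<in> kernel P' E' q'" by (simp add: kernel_def)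
    then obtain l where l: "l \<in> carrier L" "y = i' l" unfolding ker' by blast
    have "x \<otimes>\<^bsub>P\<^esub> i l = \<one>\<^bsub>P\<^esub>" using x l z P.M.m_comm[of x "i l"] by (simp add: k'(2))
    then have "x = i (inv\<^bsub>L\<^esub> l)" using z l P.M.inv_equality by (metis i.hom_closed i.hom_inv)
    moreover have "y = inv\<^bsub>P'\<^esub> i' (inv\<^bsub>L\<^esub> l)" using l by simp
    ultimately show "z \<in> (\<lambda>l. (i l, inv\<^bsub>P'\<^esub> i' l)) ` carrier L"
      using z(1) l(1) by (intro image_eqI[of _ _ "inv\<^bsub>L\<^esub> l"]) (simp_all del: i.hom_inv i'.hom_inv)
  next
    fix z assume "z \<in> (\<lambda>l. (i l, inv\<^bsub>P'\<^esub> i' l)) ` carrier L"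
    then obtain l where l: "l \<in> carrier L" "z = (i l, inv\<^bsub>P'\<^esub> i' l)" by blast
    have "i' l \<in> kernel P' E' q'" unfolding ker' using l(1) by (rule imageI)
    then show "z \<in> kernel ?W (direct_sum E' P) t" using l by (simp add: kernel_def t_def k'(2))
  qed
  ultimately have "kernel ?W (direct_sum E P') s = kernel ?W (direct_sum E' P) t" by simp
  then show ?thesis
    using gmodule_iso_of_same_kernel[OF gmodule_direct_sum[OF Pm Pm'] gmodule_direct_sum[OF Em Pm']
        gmodule_direct_sum[OF Em' Pm] s s_surj t t_surj] by simp
qed

section \<open>The monoid of similarity classes\<close>

context
  fixes G :: "('g, 'c) monoid_scheme"
  assumes grp: "group G" and fin: "finite (carrier G)"
begin

text \<open>The permutation lattices of the hypotheses may live on any type; they are replaced by copies on the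
  type that the definition of similarity refers to.\<close>

lemma similarI:
  assumes X: "gmodule G X" and Y: "gmodule G Y" and P: "permutation_lattice G P" and Q: "permutation_lattice G Q"
    and iso: "gmodule_iso G (direct_sum X P) (direct_sum Y Q)"
  shows "similar G X Y"
proof -
  obtain P0 :: "('g, univ) gmodule" where P0: "permutation_lattice G P0" "gmodule_iso G P P0"
    using fin P by (rule permutation_lattice_univ_copy) (rule that)
  obtain Q0 :: "('g, univ) gmodule" where Q0: "permutation_lattice G Q0" "gmodule_iso G Q Q0"
    using fin Q by (rule permutation_lattice_univ_copy) (rule that)
  have "gmodule_iso G (direct_sum X P0) (direct_sum X P)"
    by (intro direct_sum_iso_cong gmodule_iso_refl gmodule_iso_sym[OF P0(2)] permutation_lattice_gmodule P)
  moreover have "gmodule_iso G (direct_sum Y Q) (direct_sum Y Q0)"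
    by (intro direct_sum_iso_cong gmodule_iso_refl Q0)
  ultimately have "gmodule_iso G (direct_sum X P0) (direct_sum Y Q0)"
    using iso by (blast intro: gmodule_iso_trans)
  then show ?thesis unfolding similar_def using P0 Q0 by blast
qed

lemmas zero_permutation = permutation_lattice_zero[OF grp fin]

lemma similar_of_iso: "gmodule G X \<Longrightarrow> gmodule G Y \<Longrightarrow> gmodule_iso G X Y \<Longrightarrow> similar G X Y"
  by (intro similarI[OF _ _ zero_permutation zero_permutation] direct_sum_iso_cong gmodule_iso_refl)

lemma similar_sym:
  assumes X: "gmodule G X" and "similar G X Y"
  shows "similar G Y X"
proof -
  obtain P Q :: "('g, univ) gmodule" where P: "permutation_lattice G P" "permutation_lattice G Q"
    and iso: "gmodule_iso G (direct_sum X P) (direct_sum Y Q)"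
    using assms(2) unfolding similar_def by blast
  have "gmodule_iso G (direct_sum Y Q) (direct_sum X P)"
    by (intro gmodule_iso_sym[OF iso] gmodule_direct_sum X permutation_lattice_gmodule P)
  with P show ?thesis unfolding similar_def by blast
qed

lemma similar_trans:
  assumes X: "gmodule G X" and Y: "gmodule G Y" and Z: "gmodule G Z"
    and "similar G X Y" "similar G Y Z"
  shows "similar G X Z"
proof -
  obtain P Q P' Q' :: "('g, univ) gmodule" where P: "permutation_lattice G P" "permutation_lattice G Q"
    "permutation_lattice G P'" "permutation_lattice G Q'"
    and 1: "gmodule_iso G (direct_sum X P) (direct_sum Y Q)"
    and 2: "gmodule_iso G (direct_sum Y P') (direct_sum Z Q')"
    using assms(4,5) unfolding similar_def by blast
  note Pm = P[THEN permutation_lattice_gmodule]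
  have "gmodule_iso G (direct_sum X (direct_sum P P')) (direct_sum (direct_sum X P) P')"
    by (intro gmodule_iso_sym[OF direct_sum_iso_assoc] gmodule_direct_sum X Pm)
  also have "gmodule_iso G \<dots> (direct_sum (direct_sum Y Q) P')"
    by (intro direct_sum_iso_cong 1 gmodule_iso_refl)
  also have "gmodule_iso G \<dots> (direct_sum (direct_sum Y P') Q)"
    by (rule direct_sum_iso_swap_right)
  also have "gmodule_iso G \<dots> (direct_sum (direct_sum Z Q') Q)"
    by (intro direct_sum_iso_cong 2 gmodule_iso_refl)
  also have "gmodule_iso G \<dots> (direct_sum Z (direct_sum Q' Q))"
    by (rule direct_sum_iso_assoc)
  finally show ?thesis
    by (rule similarI[OF X Z, rotated 2]) (intro permutation_lattice_direct_sum fin P)+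
qed

lemma similar_direct_sum:
  assumes X: "gmodule G X" and Y: "gmodule G Y" and X': "gmodule G X'" and Y': "gmodule G Y'"
    and "similar G X X'" "similar G Y Y'"
  shows "similar G (direct_sum X Y) (direct_sum X' Y')"
proof -
  obtain P Q P' Q' :: "('g, univ) gmodule" where P: "permutation_lattice G P" "permutation_lattice G Q"
    "permutation_lattice G P'" "permutation_lattice G Q'"
    and 1: "gmodule_iso G (direct_sum X P) (direct_sum X' Q)"
    and 2: "gmodule_iso G (direct_sum Y P') (direct_sum Y' Q')"
    using assms(5,6) unfolding similar_def by blast
  have "gmodule_iso G (direct_sum (direct_sum X Y) (direct_sum P P')) (direct_sum (direct_sum X P) (direct_sum Y P'))"
    by (rule direct_sum_iso_interchange)
  also have "gmodule_iso G \<dots> (direct_sum (direct_sum X' Q) (direct_sum Y' Q'))"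
    by (intro direct_sum_iso_cong 1 2)
  also have "gmodule_iso G \<dots> (direct_sum (direct_sum X' Y') (direct_sum Q Q'))"
    by (rule direct_sum_iso_interchange)
  finally show ?thesis
    by (rule similarI[OF gmodule_direct_sum[OF X Y] gmodule_direct_sum[OF X' Y'], rotated 2])
      (intro permutation_lattice_direct_sum fin P)+
qed

lemma similar_permutation:
  "permutation_lattice G P \<Longrightarrow> permutation_lattice G Q \<Longrightarrow> similar G P Q"
  by (intro similarI[of _ _ Q P] direct_sum_iso_comm permutation_lattice_gmodule)

lemma sim_class_eqI:
  assumes X: "gmodule G X" and Y: "gmodule G Y" and "similar G X Y"
  shows "sim_class G X = sim_class G Y"
  unfolding sim_class_def
  using similar_trans[OF X Y _ assms(3)] similar_trans[OF Y X _ similar_sym[OF X assms(3)]]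
    flabby_lattice_gmodule by blast

lemma flabby_lattice_univ_copy:
  assumes X: "flabby_lattice G X"
  obtains E :: "('g, univ) gmodule" where "flabby_lattice G E" "gmodule_iso G X E" "sim_class G X = sim_class G E"
proof -
  obtain E :: "('g, univ) gmodule" where E: "pi_lattice G E" "gmodule_iso G X E"
    using lattice_univ_copy[OF fin flabby_lattice_pi_lattice[OF X]] by blast
  note Xm = flabby_lattice_gmodule[OF X] and Em = pi_latticeD(1)[OF E(1)]
  have "flabby_lattice G E"
    by (rule flabby_lattice_retract[OF fin Em X retract_of_iso[OF gmodule_iso_sym[OF E(2) Xm] Em]])
  with E(2) show ?thesis
    using that sim_class_eqI[OF Xm Em similar_of_iso[OF Xm Em E(2)]] by blast
qed

lemma sim_class_in_carrier:
  assumes X: "flabby_lattice G X"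
  shows "sim_class G X \<in> carrier (flabby_monoid G)"
proof -
  obtain E :: "('g, univ) gmodule" where "flabby_lattice G E" "sim_class G X = sim_class G E"
    using X by (rule flabby_lattice_univ_copy) (rule that)
  then show ?thesis unfolding flabby_monoid_def by auto
qed

text \<open>Similarity is a congruence for direct sums, so the product of two classes may be computed on
  any representatives.\<close>

lemma sim_class_mult:
  assumes X: "flabby_lattice G X" and Y: "flabby_lattice G Y"
  shows "sim_class G X \<otimes>\<^bsub>flabby_monoid G\<^esub> sim_class G Y = sim_class G (direct_sum X Y)"
proof -
  note Xm = flabby_lattice_gmodule[OF X] and Ym = flabby_lattice_gmodule[OF Y]
  have eq: "sim_class G (direct_sum A B) = sim_class G (direct_sum X Y)"
    if "A \<in> sim_class G X" "B \<in> sim_class G Y" for A B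
  proof -
    have A: "gmodule G A" "similar G X A" and B: "gmodule G B" "similar G Y B"
      using that flabby_lattice_gmodule by (auto simp: sim_class_def)
    show ?thesis
      by (intro sim_class_eqI gmodule_direct_sum similar_direct_sum similar_sym[OF Xm A(2)]
          similar_sym[OF Ym B(2)] Xm Ym A B)
  qed
  obtain A :: "('g, univ) gmodule" where A: "flabby_lattice G A" "gmodule_iso G X A"
    using X by (rule flabby_lattice_univ_copy) (rule that)
  obtain B :: "('g, univ) gmodule" where B: "flabby_lattice G B" "gmodule_iso G Y B"
    using Y by (rule flabby_lattice_univ_copy) (rule that)
  have "A \<in> sim_class G X"
    using A similar_of_iso[OF Xm flabby_lattice_gmodule[OF A(1)]] by (simp add: sim_class_def)
  moreover have "B \<in> sim_class G Y"
    using B similar_of_iso[OF Ym flabby_lattice_gmodule[OF B(1)]] by (simp add: sim_class_def)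
  ultimately have "{E. \<exists>A\<in>sim_class G X. \<exists>B\<in>sim_class G Y. E \<in> sim_class G (direct_sum A B)} =
    sim_class G (direct_sum X Y)"
    using eq by blast
  then show ?thesis unfolding flabby_monoid_def by simp
qed

lemma sim_class_permutation:
  assumes P: "permutation_lattice G P"
  shows "sim_class G P = \<one>\<^bsub>flabby_monoid G\<^esub>"
proof -
  have eq: "sim_class G Q = sim_class G P" if "permutation_lattice G Q" for Q :: "('g, univ) gmodule"
    using that P by (intro sim_class_eqI similar_permutation permutation_lattice_gmodule)
  then have "{E. \<exists>Q :: ('g, univ) gmodule. permutation_lattice G Q \<and> E \<in> sim_class G Q} = sim_class G P"
    using zero_permutation by blast
  then show ?thesis unfolding flabby_monoid_def by simp
qed

lemma flabby_monoid_carrierE: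
  assumes "a \<in> carrier (flabby_monoid G)"
  obtains E :: "('g, univ) gmodule" where "flabby_lattice G E" "a = sim_class G E"
  using assms unfolding flabby_monoid_def by auto

lemma comm_monoid_flabby_monoid: "comm_monoid (flabby_monoid G)"
proof (rule comm_monoidI)
  let ?F = "flabby_monoid G"
  note fl = flabby_lattice_direct_sum[OF fin] flabby_lattice_permutation[OF fin zero_permutation]
  show "\<one>\<^bsub>?F\<^esub> \<in> carrier ?F"
    using sim_class_in_carrier[OF fl(2)] sim_class_permutation[OF zero_permutation] by simp
  fix a assume "a \<in> carrier ?F"
  then obtain A :: "('g, univ) gmodule" where A: "flabby_lattice G A" "a = sim_class G A"
    by (rule flabby_monoid_carrierE) (rule that)
  note Am = flabby_lattice_gmodule[OF A(1)]
  show "\<one>\<^bsub>?F\<^esub> \<otimes>\<^bsub>?F\<^esub> a = a"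
  proof -
    have "sim_class G (direct_sum zero_lattice A) = sim_class G A"
    proof (rule sim_class_eqI)
      show "similar G (direct_sum zero_lattice A) A"
      proof (rule similarI[OF _ Am zero_permutation])
        have "gmodule_iso G (direct_sum (direct_sum zero_lattice A) zero_lattice)
            (direct_sum (direct_sum A zero_lattice) zero_lattice)"
          by (intro direct_sum_iso_cong direct_sum_iso_comm gmodule_iso_refl)
        also have "gmodule_iso G \<dots> (direct_sum A (direct_sum zero_lattice zero_lattice))"
          by (rule direct_sum_iso_assoc)
        finally show "gmodule_iso G (direct_sum (direct_sum zero_lattice A) zero_lattice)
          (direct_sum A (direct_sum zero_lattice zero_lattice))" .
      qed (intro gmodule_direct_sum permutation_lattice_direct_sum fin Am
          permutation_lattice_gmodule zero_permutation)+
    qed (intro gmodule_direct_sum Am permutation_lattice_gmodule zero_permutation)+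
    then show ?thesis
      using sim_class_mult[OF fl(2) A(1)] sim_class_permutation[OF zero_permutation] A(2) by simp
  qed
  fix b assume "b \<in> carrier ?F"
  then obtain B :: "('g, univ) gmodule" where B: "flabby_lattice G B" "b = sim_class G B"
    by (rule flabby_monoid_carrierE) (rule that)
  note Bm = flabby_lattice_gmodule[OF B(1)]
  show "a \<otimes>\<^bsub>?F\<^esub> b \<in> carrier ?F"
    unfolding A(2) B(2) sim_class_mult[OF A(1) B(1)] by (rule sim_class_in_carrier[OF fl(1)[OF A(1) B(1)]])
  show "a \<otimes>\<^bsub>?F\<^esub> b = b \<otimes>\<^bsub>?F\<^esub> a"
    unfolding A(2) B(2) sim_class_mult[OF A(1) B(1)] sim_class_mult[OF B(1) A(1)]
    by (intro sim_class_eqI similar_of_iso gmodule_direct_sum Am Bm direct_sum_iso_comm)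
  fix c assume "c \<in> carrier ?F"
  then obtain C :: "('g, univ) gmodule" where C: "flabby_lattice G C" "c = sim_class G C"
    by (rule flabby_monoid_carrierE) (rule that)
  note Cm = flabby_lattice_gmodule[OF C(1)]
  show "a \<otimes>\<^bsub>?F\<^esub> b \<otimes>\<^bsub>?F\<^esub> c = a \<otimes>\<^bsub>?F\<^esub> (b \<otimes>\<^bsub>?F\<^esub> c)"
    unfolding A(2) B(2) C(2) sim_class_mult[OF A(1) B(1)] sim_class_mult[OF B(1) C(1)]
      sim_class_mult[OF fl(1)[OF A(1) B(1)] C(1)] sim_class_mult[OF A(1) fl(1)[OF B(1) C(1)]]
    by (intro sim_class_eqI similar_of_iso gmodule_direct_sum Am Bm Cm direct_sum_iso_assoc)
qed

lemma flabby_resolution_transport: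
  assumes L: "gmodule G L" and res: "flabby_resolution G L P E i q"
    and P': "permutation_lattice G P'" "gmodule_iso G P P'"
    and E': "flabby_lattice G E'" "gmodule_iso G E E'"
  obtains i' q' where "flabby_resolution G L P' E' i' q'"
proof -
  have P: "permutation_lattice G P" and E: "flabby_lattice G E"
    and i: "i \<in> gmodule_hom G L P" "inj_on i (carrier L)"
    and q: "q \<in> gmodule_hom G P E" "q ` carrier P = carrier E" and ker: "kernel P E q = i ` carrier L"
    using res unfolding flabby_resolution_def by simp_all
  note Pm = permutation_lattice_gmodule[OF P] and Em = flabby_lattice_gmodule[OF E]
    and Pm' = permutation_lattice_gmodule[OF P'(1)] and Em' = flabby_lattice_gmodule[OF E'(1)]
  obtain f h where f: "f \<in> gmodule_hom G P P'" "h \<in> gmodule_hom G P' P"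
    and hf: "\<And>x. x \<in> carrier P \<Longrightarrow> h (f x) = x" and fh: "\<And>x. x \<in> carrier P' \<Longrightarrow> f (h x) = x"
    using P'(2) Pm by (rule gmodule_isoE) (rule that)
  obtain e d where e: "e \<in> gmodule_hom G E E'" "d \<in> gmodule_hom G E' E"
    and de: "\<And>x. x \<in> carrier E \<Longrightarrow> d (e x) = x" and ed: "\<And>x. x \<in> carrier E' \<Longrightarrow> e (d x) = x"
    using E'(2) Em by (rule gmodule_isoE) (rule that)
  interpret e: group_hom E E' e by (rule gmodule_hom_group_hom[OF Em Em' e(1)])
  interpret d: group_hom E' E d by (rule gmodule_hom_group_hom[OF Em' Em e(2)])
  note iP = gmodule_homD(1)[OF i(1)] and qE = gmodule_homD(1)[OF q(1)]
    and fP = gmodule_homD(1)[OF f(1)] and hP = gmodule_homD(1)[OF f(2)]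
  have "flabby_resolution G L P' E' (\<lambda>x. f (i x)) (\<lambda>x. e (q (h x)))"
    unfolding flabby_resolution_def
  proof (intro conjI)
    show "inj_on (\<lambda>x. f (i x)) (carrier L)"
      using i(2) hf iP by (auto simp: inj_on_def) metis
    show "(\<lambda>x. e (q (h x))) ` carrier P' = carrier E'"
    proof (intro equalityI subsetI)
      fix y assume y: "y \<in> carrier E'"
      then obtain x where x: "x \<in> carrier P" "d y = q x" using q(2)[symmetric] d.hom_closed by blast
      then have "y = e (q (h (f x)))" using ed[OF y] by (simp add: hf)
      then show "y \<in> (\<lambda>x. e (q (h x))) ` carrier P'" using fP[OF x(1)] by blast
    qed (use hP qE e.hom_closed in blast)
    show "kernel P' E' (\<lambda>x. e (q (h x))) = (\<lambda>x. f (i x)) ` carrier L"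
    proof (intro equalityI subsetI)
      fix x assume "x \<in> kernel P' E' (\<lambda>x. e (q (h x)))"
      then have x: "x \<in> carrier P'" "e (q (h x)) = \<one>\<^bsub>E'\<^esub>" by (auto simp: kernel_def)
      then have "d (e (q (h x))) = \<one>\<^bsub>E\<^esub>" by simp
      then have "h x \<in> kernel P E q" using de[OF qE[OF hP[OF x(1)]]] hP[OF x(1)] by (simp add: kernel_def)
      then obtain l where l: "l \<in> carrier L" "h x = i l" unfolding ker by blast
      then have "x = f (i l)" using fh[OF x(1)] by simp
      then show "x \<in> (\<lambda>x. f (i x)) ` carrier L" using l(1) by blast
    next
      fix x assume "x \<in> (\<lambda>x. f (i x)) ` carrier L"
      then obtain l where l: "l \<in> carrier L" "x = f (i l)" by blast
      have "i l \<in> kernel P E q" unfolding ker using l(1) by (rule imageI)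
      then have "q (i l) = \<one>\<^bsub>E\<^esub>" by (simp add: kernel_def)
      then show "x \<in> kernel P' E' (\<lambda>x. e (q (h x)))"
        using l hf[OF iP[OF l(1)]] fP[OF iP[OF l(1)]] by (simp add: kernel_def)
    qed
  qed (intro P' E' gmodule_hom_comp[OF i(1) f(1)] gmodule_hom_comp[OF gmodule_hom_comp[OF f(2) q(1)] e(1)])+
  then show ?thesis by (rule that)
qed

text \<open>By Schanuel's lemma all flabby resolutions of \<open>L\<close> have similar cokernels, so that the description
  of \<open>[L]\<^sup>f\<^sup>l\<close> determines one class; and every resolution has a copy on the type of that description.\<close>

lemma flabby_class_eq:
  assumes L: "gmodule G L" and res: "flabby_resolution G L P E i q"
  shows "flabby_class G L = sim_class G E"
proof -
  have P: "permutation_lattice G P" and E: "flabby_lattice G E"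
    using res unfolding flabby_resolution_def by simp_all
  obtain P0 :: "('g, univ) gmodule" where P0: "permutation_lattice G P0" "gmodule_iso G P P0"
    using fin P by (rule permutation_lattice_univ_copy) (rule that)
  obtain E0 :: "('g, univ) gmodule" where E0: "flabby_lattice G E0" "gmodule_iso G E E0" "sim_class G E = sim_class G E0"
    using E by (rule flabby_lattice_univ_copy) (rule that)
  obtain i0 q0 where res0: "flabby_resolution G L P0 E0 i0 q0"
    by (rule flabby_resolution_transport[OF L res P0 E0(1,2)]) (rule that)
  show ?thesis
    unfolding flabby_class_def
  proof (rule the_equality)
    show "\<exists>(P :: ('g, univ) gmodule) (E' :: ('g, univ) gmodule) i q.
        flabby_resolution G L P E' i q \<and> sim_class G E = sim_class G E'"
      using res0 E0(3) by blast
  next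
    fix c assume "\<exists>(P :: ('g, univ) gmodule) (E :: ('g, univ) gmodule) i q.
        flabby_resolution G L P E i q \<and> c = sim_class G E"
    then obtain P' E' :: "('g, univ) gmodule" and i' q' where res': "flabby_resolution G L P' E' i' q'"
      and c: "c = sim_class G E'" by blast
    have P': "permutation_lattice G P'" and E': "flabby_lattice G E'"
      using res' unfolding flabby_resolution_def by simp_all
    have "similar G E' E"
      by (rule similarI[OF _ _ P P' flabby_resolution_schanuel[OF fin L res' res]])
        (intro flabby_lattice_gmodule E E')+
    then show "c = sim_class G E"
      unfolding c by (intro sim_class_eqI flabby_lattice_gmodule E E')
  qed
qed

section \<open>Invertible lattices\<close>

lemma invertible_pi_lattice: "invertible_lattice G X \<Longrightarrow> pi_lattice G X"
  by (simp add: invertible_lattice_def)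

lemma invertible_gmodule: "invertible_lattice G X \<Longrightarrow> gmodule G X"
  by (simp add: invertible_lattice_def pi_lattice_def)

lemma invertible_latticeE:
  assumes "invertible_lattice G X"
  obtains N P :: "('g, univ) gmodule" where "pi_lattice G N" "permutation_lattice G P"
    "gmodule_iso G (direct_sum X N) P"
  using assms unfolding invertible_lattice_def by blast

lemma invertible_summand_permutation:
  assumes X: "gmodule G X" and Y: "gmodule G Y" and P: "permutation_lattice G P"
    and iso: "gmodule_iso G (direct_sum X Y) P"
  shows "invertible_lattice G X"
proof -
  note Pl = permutation_lattice_pi_lattice[OF P]
  have Xl: "pi_lattice G X"
    by (rule pi_lattice_retract[OF fin X Pl retract_of_summand_iso[OF iso X Y]])
  have iso': "gmodule_iso G (direct_sum Y X) P"
    using direct_sum_iso_comm iso by (rule gmodule_iso_trans)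
  have Yl: "pi_lattice G Y"
    by (rule pi_lattice_retract[OF fin Y Pl retract_of_summand_iso[OF iso' Y X]])
  obtain N :: "('g, univ) gmodule" where N: "pi_lattice G N" "gmodule_iso G Y N"
    using lattice_univ_copy[OF fin Yl] by blast
  obtain Q :: "('g, univ) gmodule" where Q: "permutation_lattice G Q" "gmodule_iso G P Q"
    using fin P by (rule permutation_lattice_univ_copy) (rule that)
  have "gmodule_iso G (direct_sum X N) (direct_sum X Y)"
    by (intro direct_sum_iso_cong gmodule_iso_refl gmodule_iso_sym[OF N(2) Y])
  then have "gmodule_iso G (direct_sum X N) Q"
    using iso Q(2) by (blast intro: gmodule_iso_trans)
  then show ?thesis unfolding invertible_lattice_def using Xl N Q by blast
qed

lemma invertible_summand:
  assumes X: "gmodule G X" and Y: "gmodule G Y" and Z: "invertible_lattice G Z"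
    and iso: "gmodule_iso G (direct_sum X Y) Z"
  shows "invertible_lattice G X"
proof -
  obtain N P :: "('g, univ) gmodule" where N: "pi_lattice G N" "permutation_lattice G P"
    "gmodule_iso G (direct_sum Z N) P"
    using Z by (rule invertible_latticeE) (rule that)
  note Nm = pi_latticeD(1)[OF N(1)]
  have "gmodule_iso G (direct_sum X (direct_sum Y N)) (direct_sum (direct_sum X Y) N)"
    by (intro gmodule_iso_sym[OF direct_sum_iso_assoc] gmodule_direct_sum X Y Nm)
  also have "gmodule_iso G \<dots> (direct_sum Z N)"
    by (intro direct_sum_iso_cong iso gmodule_iso_refl)
  finally have "gmodule_iso G (direct_sum X (direct_sum Y N)) P"
    using N(3) by (rule gmodule_iso_trans)
  then show ?thesis by (intro invertible_summand_permutation[OF X gmodule_direct_sum[OF Y Nm] N(2)])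
qed

lemma invertible_direct_sum:
  assumes X: "invertible_lattice G X" and Y: "invertible_lattice G Y"
  shows "invertible_lattice G (direct_sum X Y)"
proof -
  obtain N P :: "('g, univ) gmodule" where N: "pi_lattice G N" "permutation_lattice G P"
    "gmodule_iso G (direct_sum X N) P"
    using X by (rule invertible_latticeE) (rule that)
  obtain N' P' :: "('g, univ) gmodule" where N': "pi_lattice G N'" "permutation_lattice G P'"
    "gmodule_iso G (direct_sum Y N') P'"
    using Y by (rule invertible_latticeE) (rule that)
  have "gmodule_iso G (direct_sum (direct_sum X Y) (direct_sum N N')) (direct_sum (direct_sum X N) (direct_sum Y N'))"
    by (rule direct_sum_iso_interchange)
  also have "gmodule_iso G \<dots> (direct_sum P P')"
    by (intro direct_sum_iso_cong N N')
  finally show ?thesis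
    by (rule invertible_summand_permutation[rotated 3])
      (intro gmodule_direct_sum permutation_lattice_direct_sum fin N N' pi_latticeD(1)[OF N(1)]
        pi_latticeD(1)[OF N'(1)] invertible_gmodule X Y)+
qed

lemma invertible_permutation:
  assumes P: "permutation_lattice G P"
  shows "invertible_lattice G P"
  by (rule invertible_summand_permutation[OF permutation_lattice_gmodule[OF P]
        permutation_lattice_gmodule[OF zero_permutation]
        permutation_lattice_direct_sum[OF fin P zero_permutation] gmodule_iso_refl])

lemma invertible_flabby:
  assumes X: "invertible_lattice G X"
  shows "flabby_lattice G X"
proof -
  obtain N P :: "('g, univ) gmodule" where N: "pi_lattice G N" "permutation_lattice G P"
    "gmodule_iso G (direct_sum X N) P"
    using X by (rule invertible_latticeE) (rule that)
  note Xm = invertible_gmodule[OF X]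
  show ?thesis
    by (rule flabby_lattice_retract[OF fin Xm flabby_lattice_permutation[OF fin N(2)]
          retract_of_summand_iso[OF N(3) Xm pi_latticeD(1)[OF N(1)]]])
qed

text \<open>The direct sum of \<open>X\<close> and its complement is a permutation lattice, whose class is \<open>0\<close>.\<close>

lemma invertible_complement:
  assumes X: "invertible_lattice G X"
  obtains N P :: "('g, univ) gmodule" where "invertible_lattice G N" "permutation_lattice G P"
    "gmodule_iso G (direct_sum X N) P"
    "sim_class G N = inv\<^bsub>flabby_monoid G\<^esub> sim_class G X" "sim_class G X \<in> Units (flabby_monoid G)"
proof -
  interpret F: comm_monoid "flabby_monoid G" by (rule comm_monoid_flabby_monoid)
  obtain N P :: "('g, univ) gmodule" where N: "pi_lattice G N" "permutation_lattice G P"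
    "gmodule_iso G (direct_sum X N) P"
    using X by (rule invertible_latticeE) (rule that)
  note Xm = invertible_gmodule[OF X] and Nm = pi_latticeD(1)[OF N(1)]
  have N': "invertible_lattice G N"
    using gmodule_iso_trans[OF direct_sum_iso_comm N(3)] by (rule invertible_summand_permutation[OF Nm Xm N(2)])
  have "sim_class G X \<otimes>\<^bsub>flabby_monoid G\<^esub> sim_class G N = sim_class G (direct_sum X N)"
    by (rule sim_class_mult) (intro invertible_flabby X N')+
  also have "\<dots> = sim_class G P"
    by (intro sim_class_eqI similar_of_iso N gmodule_direct_sum Xm Nm permutation_lattice_gmodule)
  also have "\<dots> = \<one>\<^bsub>flabby_monoid G\<^esub>" by (rule sim_class_permutation[OF N(2)])
  finally have 1: "sim_class G X \<otimes>\<^bsub>flabby_monoid G\<^esub> sim_class G N = \<one>\<^bsub>flabby_monoid G\<^esub>" .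
  have c: "sim_class G X \<in> carrier (flabby_monoid G)" "sim_class G N \<in> carrier (flabby_monoid G)"
    by (intro sim_class_in_carrier invertible_flabby X N')+
  have "sim_class G X \<in> Units (flabby_monoid G)"
    using 1 c F.m_comm[OF c] unfolding Units_def by auto
  moreover have "sim_class G N = inv\<^bsub>flabby_monoid G\<^esub> sim_class G X"
    using F.comm_inv_char[OF c 1] by simp
  ultimately show ?thesis using that N' N by blast
qed

lemma sim_class_invertible_Units: "invertible_lattice G X \<Longrightarrow> sim_class G X \<in> Units (flabby_monoid G)"
  by (rule invertible_complement)

text \<open>A lattice \<open>L\<close> with an exact sequence \<open>0 \<rightarrow> L \<rightarrow> I \<rightarrow> C \<rightarrow> 0\<close> of invertible \<open>I\<close> and \<open>C\<close> has a flabby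
  resolution by \<open>I \<oplus> N \<rightarrow> C \<oplus> N\<close>, where \<open>N\<close> is a complement of \<open>I\<close>.  Here \<open>L\<close> is presented as a
  quotient of \<open>W\<close>.\<close>

lemma flabby_class_invertible_resolution:
  assumes L: "gmodule G L" and W: "gmodule G W" and I: "invertible_lattice G I" and C: "invertible_lattice G C"
    and s: "s \<in> gmodule_hom G W L" "s ` carrier W = carrier L"
    and j: "j \<in> gmodule_hom G W I" and ker: "kernel W L s = kernel W I j"
    and q: "q \<in> gmodule_hom G I C" "q ` carrier I = carrier C" and exact: "kernel I C q = j ` carrier W"
  shows "flabby_class G L = sim_class G C \<otimes>\<^bsub>flabby_monoid G\<^esub> inv\<^bsub>flabby_monoid G\<^esub> sim_class G I"
proof -
  note Im = invertible_gmodule[OF I] and Cm = invertible_gmodule[OF C]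
  obtain N P :: "('g, univ) gmodule" where N: "invertible_lattice G N" and P: "permutation_lattice G P"
    and iso: "gmodule_iso G (direct_sum I N) P"
    and cls: "sim_class G N = inv\<^bsub>flabby_monoid G\<^esub> sim_class G I"
    using I by (rule invertible_complement) (rule that)
  note Nm = invertible_gmodule[OF N] and Pm = permutation_lattice_gmodule[OF P]
  interpret W: gmodule G W by fact
  interpret L: gmodule G L by fact
  interpret I: gmodule G I by fact
  interpret N: gmodule G N by fact
  interpret C: gmodule G C by fact
  obtain i where i: "i \<in> gmodule_hom G L I" "\<And>w. w \<in> carrier W \<Longrightarrow> i (s w) = j w"
    by (rule gmodule_hom_factor[OF W L Im s j]) (use ker that in auto)
  interpret i: group_hom L I i by (rule gmodule_hom_group_hom[OF L Im i(1)])
  have i_inj: "inj_on i (carrier L)"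
  proof -
    have "x = \<one>\<^bsub>L\<^esub>" if x: "x \<in> carrier L" "i x = \<one>\<^bsub>I\<^esub>" for x
    proof -
      obtain w where w: "w \<in> carrier W" "x = s w" using x(1) s(2) by blast
      then have "w \<in> kernel W I j" using x(2) i(2) by (simp add: kernel_def)
      then show ?thesis using w(2) unfolding ker[symmetric] by (simp add: kernel_def)
    qed
    then show ?thesis by (simp add: i.inj_on_one_iff)
  qed
  have i_img: "i ` carrier L = j ` carrier W"
    unfolding s(2)[symmetric] image_image by (rule image_cong) (simp_all add: i(2))
  obtain f h where f: "f \<in> gmodule_hom G (direct_sum I N) P" "h \<in> gmodule_hom G P (direct_sum I N)"
    and hf: "\<And>x. x \<in> carrier (direct_sum I N) \<Longrightarrow> h (f x) = x" and fh: "\<And>x. x \<in> carrier P \<Longrightarrow> f (h x) = x"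
    using iso gmodule_direct_sum[OF Im Nm] by (rule gmodule_isoE) (rule that)
  note fP = gmodule_homD(1)[OF f(1)] and hI = gmodule_homD(1)[OF f(2)]
  define i' where "i' x = f (i x, \<one>\<^bsub>N\<^esub>)" for x
  define q' where "q' y = map_prod q (\<lambda>x. x) (h y)" for y
  have "flabby_resolution G L P (direct_sum C N) i' q'"
    unfolding flabby_resolution_def
  proof (intro conjI P flabby_lattice_direct_sum fin invertible_flabby C N)
    have "(\<lambda>x. (i x, \<one>\<^bsub>N\<^esub>)) \<in> gmodule_hom G L (direct_sum I N)"
      by (intro gmodule_hom_pair i(1) N.zero_hom L)
    then show "i' \<in> gmodule_hom G L P" unfolding i'_def by (rule gmodule_hom_comp[OF _ f(1)])
    show "q' \<in> gmodule_hom G P (direct_sum C N)"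
      unfolding q'_def by (rule gmodule_hom_comp[OF f(2)]) (intro gmodule_hom_map_prod q(1) gmodule_hom_id)
    show "inj_on i' (carrier L)"
    proof (rule inj_onI)
      fix x y assume xy: "x \<in> carrier L" "y \<in> carrier L" "i' x = i' y"
      have "h (f (i x, \<one>\<^bsub>N\<^esub>)) = h (f (i y, \<one>\<^bsub>N\<^esub>))" using xy(3) unfolding i'_def by simp
      then have "i x = i y" using xy(1,2) by (simp add: hf)
      then show "x = y" using i_inj xy(1,2) by (simp add: inj_on_eq_iff)
    qed
    show "q' ` carrier P = carrier (direct_sum C N)"
    proof (intro equalityI subsetI)
      fix z assume "z \<in> q' ` carrier P"
      then obtain y where "y \<in> carrier P" "z = q' y" by blast
      then show "z \<in> carrier (direct_sum C N)"
        using hI[of y] gmodule_homD(1)[OF q(1)] by (auto simp: q'_def)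
    next
      fix z assume "z \<in> carrier (direct_sum C N)"
      then obtain c n where z: "z = (c, n)" "c \<in> carrier C" "n \<in> carrier N" by auto
      then obtain x where x: "x \<in> carrier I" "c = q x" using q(2)[symmetric] by blast
      have "z = q' (f (x, n))" using x z by (simp add: q'_def hf)
      then show "z \<in> q' ` carrier P" using fP[of "(x, n)"] x z by simp
    qed
    show "kernel P (direct_sum C N) q' = i' ` carrier L"
    proof (intro equalityI subsetI)
      fix y assume "y \<in> kernel P (direct_sum C N) q'"
      then have y: "y \<in> carrier P" "q' y = (\<one>\<^bsub>C\<^esub>, \<one>\<^bsub>N\<^esub>)" by (simp_all add: kernel_def)
      obtain x n where xn: "h y = (x, n)" "x \<in> carrier I" "n \<in> carrier N" using hI[OF y(1)] by auto
      then have "x \<in> kernel I C q" "n = \<one>\<^bsub>N\<^esub>" using y(2) by (simp_all add: q'_def kernel_def)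
      then obtain l where "l \<in> carrier L" "x = i l" unfolding exact i_img[symmetric] by blast
      then show "y \<in> i' ` carrier L" using fh[OF y(1)] xn(1) \<open>n = \<one>\<^bsub>N\<^esub>\<close> unfolding i'_def by auto
    next
      fix y assume "y \<in> i' ` carrier L"
      then obtain l where l: "l \<in> carrier L" "y = f (i l, \<one>\<^bsub>N\<^esub>)" unfolding i'_def by blast
      have "i l \<in> kernel I C q" unfolding exact i_img[symmetric] using l(1) by (rule imageI)
      then show "y \<in> kernel P (direct_sum C N) q'"
        using l fP[of "(i l, \<one>\<^bsub>N\<^esub>)"] by (simp add: kernel_def q'_def hf)
    qed
  qed
  from flabby_class_eq[OF L this] show ?thesis
    unfolding cls[symmetric] by (simp add: sim_class_mult invertible_flabby C N)
qed

end

section \<open>Cyclotomic polynomials\<close>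

abbreviation root_factor :: "nat \<Rightarrow> nat \<Rightarrow> complex poly" where
  "root_factor n k \<equiv> [:- cis (2 * pi * real k / real n), 1:]"

abbreviation complex_cyclotomic :: "nat \<Rightarrow> complex poly" where
  "complex_cyclotomic d \<equiv> (\<Prod>k\<in>{k\<in>{1..d}. coprime k d}. root_factor d k)"

lemma degree_prod_root_factor:
  "finite A \<Longrightarrow> Polynomial.degree (\<Prod>k\<in>A. root_factor n k) = card A"
  by (subst degree_prod_eq_sum_degree) simp_all

lemma lead_coeff_prod_root_factor: "lead_coeff (\<Prod>k\<in>A. root_factor n k) = 1"
  by (simp add: lead_coeff_prod)

text \<open>Both sides are monic of degree \<open>n\<close> and vanish at the \<open>n\<close>-th roots of unity.\<close>

lemma prod_all_root_factors:
  assumes n: "n > 0"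
  shows "(\<Prod>k\<in>{1..n}. root_factor n k) = Polynomial.monom 1 n - 1"
proof (rule poly_eqI_degree_lead_coeff[where n = n and A = "{z. z ^ n = 1}"])
  have deg: "Polynomial.degree (\<Prod>k\<in>{1..n}. root_factor n k) = n"
    by (subst degree_prod_root_factor) simp_all
  then show "Polynomial.degree (\<Prod>k\<in>{1..n}. root_factor n k) \<le> n" by simp
  show "Polynomial.degree (Polynomial.monom 1 n - 1 :: complex poly) \<le> n"
    by (intro degree_diff_le) (simp_all add: degree_monom_eq)
  show "Polynomial.coeff (\<Prod>k\<in>{1..n}. root_factor n k) n = Polynomial.coeff (Polynomial.monom 1 n - 1) n"
    using lead_coeff_prod_root_factor[of n "{1..n}"] n unfolding deg by simp
  show "card {z :: complex. z ^ n = 1} \<ge> n" using card_roots_unity_eq[OF n] by simp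
  fix z :: complex assume z: "z \<in> {z. z ^ n = 1}"
  then obtain k where k: "k < n" "z = cis (2 * pi * real k / real n)"
    using bij_betw_roots_unity[OF n] unfolding bij_betw_def by blast
  have "\<exists>j\<in>{1..n}. z = cis (2 * pi * real j / real n)"
  proof (cases "k = 0")
    case True
    then show ?thesis using k n by (intro bexI[of _ n]) auto
  next
    case False
    then show ?thesis using k by (intro bexI[of _ k]) auto
  qed
  then obtain j where j: "j \<in> {1..n}" "z = cis (2 * pi * real j / real n)" by blast
  then have "poly (\<Prod>k\<in>{1..n}. root_factor n k) z = 0"
    unfolding poly_prod by (intro prod_zero) auto
  moreover have "poly (Polynomial.monom 1 n - 1) z = 0"
    using z by (simp add: poly_monom)
  ultimately show "poly (\<Prod>k\<in>{1..n}. root_factor n k) z = poly (Polynomial.monom 1 n - 1) z" by simp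
qed

text \<open>Each of the fractions \<open>k/n\<close> with \<open>1 \<le> k \<le> n\<close> has exactly one reduced form.\<close>

lemma prod_complex_cyclotomic:
  assumes n: "n > 0"
  shows "(\<Prod>d\<in>{d. d dvd n}. complex_cyclotomic d) = Polynomial.monom 1 n - 1"
proof -
  have fin: "finite {d. d dvd n}" using n by simp
  have "(\<Prod>d\<in>{d. d dvd n}. complex_cyclotomic d) =
      (\<Prod>(d, k)\<in>Sigma {d. d dvd n} (\<lambda>d. {k\<in>{1..d}. coprime k d}). root_factor d k)"
    by (rule prod.Sigma) (use fin in auto)
  also have "\<dots> = (\<Prod>k\<in>{1..n}. root_factor n k)"
  proof (rule prod.reindex_bij_witness[of _ "\<lambda>k. (n div gcd k n, k div gcd k n)" "\<lambda>(d, k). k * (n div d)"])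
    fix a assume "a \<in> Sigma {d. d dvd n} (\<lambda>d. {k\<in>{1..d}. coprime k d})"
    then obtain d k where a: "a = (d, k)" "d dvd n" "1 \<le> k" "k \<le> d" "coprime k d" by auto
    obtain e where e: "n = d * e" using a(2) by blast
    have de: "d > 0" "e > 0" using n e by auto
    have nd: "n div d = e" using e de by simp
    have g: "gcd (k * e) n = e" using a(5) by (simp add: e gcd_mult_right coprime_iff_gcd_eq_1 gcd.commute[of d k])
    show "(\<lambda>k. (n div gcd k n, k div gcd k n)) ((\<lambda>(d, k). k * (n div d)) a) = a"
      using a de g by (simp add: nd) (simp add: e)
    show "(\<lambda>(d, k). k * (n div d)) a \<in> {1..n}"
      using a de by (simp add: nd) (simp add: e Suc_le_eq)
    have "2 * pi * real (k * e) / real n = 2 * pi * real k / real d"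
      using de by (simp add: e field_simps)
    then show "root_factor n ((\<lambda>(d, k). k * (n div d)) a) = (case a of (d, k) \<Rightarrow> root_factor d k)"
      unfolding a(1) by (simp add: nd)
  next
    fix k assume k: "k \<in> {1..n}"
    then have g: "gcd k n > 0" by simp
    have "k div gcd k n * (n div (n div gcd k n)) = k"
      using n g by (simp add: div_div_eq_right)
    then show "(\<lambda>(d, k). k * (n div d)) (n div gcd k n, k div gcd k n) = k" by simp
    have "coprime (k div gcd k n) (n div gcd k n)" using k by (intro div_gcd_coprime) simp
    moreover have "k div gcd k n \<ge> 1"
      using k g by (simp add: Suc_le_eq div_greater_zero_iff gcd_le1_nat)
    moreover have "k div gcd k n \<le> n div gcd k n" using k by (intro div_le_mono) simp
    moreover have "n div gcd k n dvd n" by (metis dvd_div_mult_self dvd_triv_left gcd_dvd2)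
    ultimately show "(n div gcd k n, k div gcd k n) \<in> Sigma {d. d dvd n} (\<lambda>d. {k\<in>{1..d}. coprime k d})"
      by simp
  qed
  also have "\<dots> = Polynomial.monom 1 n - 1" by (rule prod_all_root_factors[OF n])
  finally show ?thesis .
qed

lemma coeff_of_int_poly: "Polynomial.coeff (map_poly of_int p) i = of_int (Polynomial.coeff p i)"
  by (simp add: coeff_map_poly)

lemma of_int_poly_mult:
  "map_poly of_int (p * q) = (map_poly of_int p * map_poly of_int q :: complex poly)"
  by (rule poly_eqI) (simp add: coeff_of_int_poly coeff_mult)

lemma of_int_poly_diff:
  "map_poly of_int (p - q) = (map_poly of_int p - map_poly of_int q :: complex poly)"
  by (rule poly_eqI) (simp add: coeff_of_int_poly)

lemma of_int_poly_add:
  "map_poly of_int (p + q) = (map_poly of_int p + map_poly of_int q :: complex poly)"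
  by (rule poly_eqI) (simp add: coeff_of_int_poly)

lemma of_int_poly_prod:
  "map_poly of_int (prod f A) = (\<Prod>a\<in>A. map_poly of_int (f a) :: complex poly)"
  by (induction A rule: infinite_finite_induct) (simp_all add: of_int_poly_mult)

lemma of_int_poly_inj: "map_poly of_int p = (map_poly of_int q :: complex poly) \<Longrightarrow> p = q"
  by (rule poly_eqI) (metis coeff_of_int_poly of_int_eq_iff)

lemma degree_of_int_poly: "Polynomial.degree (map_poly of_int p :: complex poly) = Polynomial.degree p"
  by (cases "p = 0") (simp_all add: map_poly_degree_eq)

lemma divisors_split: "(n::nat) > 0 \<Longrightarrow> {d. d dvd n} = insert n {d. d dvd n \<and> d < n}"
  by (auto dest: dvd_imp_le)

text \<open>\<open>\<Phi>\<^sub>n\<close> is the quotient of \<open>X\<^sup>n - 1\<close> by the monic integral polynomial formed by the \<open>\<Phi>\<^sub>d\<close> of the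
  proper divisors, so division with remainder stays integral.\<close>

lemma ex_int_cyclotomic: "\<exists>p. map_poly of_int p = complex_cyclotomic n"
proof (induction n rule: less_induct)
  case (less n)
  show ?case
  proof (cases "n = 0")
    case True
    then show ?thesis by (intro exI[of _ 1]) simp
  next
    case False
    then have n: "n > 0" by simp
    let ?D = "{d. d dvd n \<and> d < n}"
    have "\<forall>d\<in>?D. \<exists>p. map_poly of_int p = complex_cyclotomic d" using less by blast
    then obtain p where p: "\<forall>d\<in>?D. map_poly of_int (p d) = complex_cyclotomic d"
      by (rule bchoice[THEN exE])
    define Q where "Q = (\<Prod>d\<in>?D. p d)"
    have Q: "map_poly of_int Q = (\<Prod>d\<in>?D. complex_cyclotomic d)"
      unfolding Q_def of_int_poly_prod using p by (intro prod.cong) auto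
    have "lead_coeff (map_poly of_int Q :: complex poly) = 1"
      unfolding Q lead_coeff_prod by (intro prod.neutral ballI) simp
    then have lc: "lead_coeff Q = 1" by (simp add: degree_of_int_poly coeff_of_int_poly)
    then have Q0: "Q \<noteq> 0" by auto
    \<comment> \<open>Pseudo-division by a monic polynomial is division with remainder.\<close>
    obtain S R where SR: "pseudo_divmod (Polynomial.monom 1 n - 1) Q = (S, R)" by fastforce
    have eq: "Polynomial.monom 1 n - 1 = Q * S + R" and deg: "R = 0 \<or> Polynomial.degree R < Polynomial.degree Q"
      using pseudo_divmod[OF Q0 SR] lc by simp_all
    let ?i = "map_poly of_int :: int poly \<Rightarrow> complex poly"
    have "(\<Prod>d\<in>{d. d dvd n}. complex_cyclotomic d) = complex_cyclotomic n * ?i Q"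
      unfolding Q by (subst divisors_split[OF n]) simp
    then have "?i Q * complex_cyclotomic n = ?i (Polynomial.monom 1 n - 1)"
      unfolding prod_complex_cyclotomic[OF n] by (simp add: of_int_poly_diff map_poly_monom mult.commute)
    also have "\<dots> = ?i Q * ?i S + ?i R" unfolding eq by (simp add: of_int_poly_mult of_int_poly_add)
    finally have *: "?i Q * (complex_cyclotomic n - ?i S) = ?i R" by (simp add: algebra_simps)
    have "complex_cyclotomic n - ?i S = 0"
    proof (rule ccontr)
      assume ne: "complex_cyclotomic n - ?i S \<noteq> 0"
      have iQ: "?i Q \<noteq> 0" using \<open>lead_coeff (?i Q) = 1\<close> by auto
      have "Polynomial.degree (?i R) = Polynomial.degree (?i Q) + Polynomial.degree (complex_cyclotomic n - ?i S)"
        unfolding *[symmetric] by (rule degree_mult_eq[OF iQ ne])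
      moreover have "?i R \<noteq> 0" unfolding *[symmetric] using iQ ne by simp
      then have "R \<noteq> 0" by auto
      ultimately show False using deg by (simp add: degree_of_int_poly)
    qed
    then show ?thesis by (intro exI[of _ S]) simp
  qed
qed

lemma of_int_cyclotomic: "map_poly of_int (cyclotomic n) = complex_cyclotomic n"
proof -
  have "\<exists>!p. map_poly of_int p = complex_cyclotomic n"
    using ex_int_cyclotomic[of n] of_int_poly_inj by metis
  then show ?thesis unfolding cyclotomic_def by (rule theI')
qed

lemma degree_cyclotomic: "Polynomial.degree (cyclotomic n) = totient n"
proof -
  have "Polynomial.degree (cyclotomic n) = card {k\<in>{1..n}. coprime k n}"
    unfolding degree_of_int_poly[symmetric] of_int_cyclotomic by (rule degree_prod_root_factor) simp
  also have "{k\<in>{1..n}. coprime k n} = totatives n" by (auto simp: totatives_def)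
  finally show ?thesis by (simp add: totient_def)
qed

lemma cyclotomic_nonzero: "cyclotomic n \<noteq> 0"
  using of_int_cyclotomic[of n] lead_coeff_prod_root_factor[of n "{k\<in>{1..n}. coprime k n}"] by auto

abbreviation xpow1 :: "nat \<Rightarrow> int poly" where
  "xpow1 n \<equiv> Polynomial.monom 1 n - 1"

abbreviation cyclotomic_prod :: "nat set \<Rightarrow> int poly" where
  "cyclotomic_prod D \<equiv> (\<Prod>d\<in>D. cyclotomic d)"

lemma cyclotomic_prod_divisors:
  assumes n: "n > 0"
  shows "cyclotomic_prod {d. d dvd n} = xpow1 n"
  by (rule of_int_poly_inj, unfold of_int_poly_prod of_int_cyclotomic prod_complex_cyclotomic[OF n])
    (simp add: of_int_poly_diff map_poly_monom)

lemma xpow1_split: "n > 0 \<Longrightarrow> xpow1 n = cyclotomic n * cyclotomic_prod {d. d dvd n \<and> d < n}"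
  by (subst cyclotomic_prod_divisors[symmetric], assumption, subst divisors_split) simp_all

lemma xpow1_nonzero: "n > 0 \<Longrightarrow> xpow1 n \<noteq> 0"
proof
  assume "n > 0" "xpow1 n = 0"
  then have "Polynomial.coeff (xpow1 n) n = 0" by simp
  with \<open>n > 0\<close> show False by simp
qed

lemma cyclotomic_prod_dvd: "finite D' \<Longrightarrow> D \<subseteq> D' \<Longrightarrow> cyclotomic_prod D dvd cyclotomic_prod D'"
  by (rule prod_dvd_prod_subset)

lemma cyclotomic_1: "cyclotomic 1 = xpow1 1"
  using cyclotomic_prod_divisors[of 1] by simp

text \<open>The involution \<open>f \<mapsto> X\<^bsup>deg f\<^esup> f(1/X)\<close> changes the sign of \<open>X\<^sup>n - 1\<close>, and by induction on \<open>n\<close> this sign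
  is carried by the factor \<open>\<Phi>\<^sub>1\<close> alone.\<close>

lemma reflect_xpow1:
  assumes n: "n > 0"
  shows "reflect_poly (xpow1 n) = - xpow1 n"
proof -
  have deg: "Polynomial.degree (xpow1 n) = n"
    using n by (subst diff_conv_add_uminus, subst degree_add_eq_left) (simp_all add: degree_monom_eq)
  show ?thesis
    by (rule poly_eqI) (use n in \<open>auto simp: coeff_reflect_poly deg coeff_1 split: if_splits\<close>)
qed

lemma reflect_cyclotomic:
  "n > 0 \<Longrightarrow> reflect_poly (cyclotomic n) = (if n = 1 then - cyclotomic n else cyclotomic n)"
proof (induction n rule: less_induct)
  case (less n)
  show ?case
  proof (cases "n = 1")
    case True
    then show ?thesis using reflect_xpow1[of 1] cyclotomic_1 by simp
  next
    case False
    let ?D = "{d. d dvd n \<and> d < n}"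
    have fin: "finite ?D" by simp
    have one: "1 \<in> ?D" using less.prems False by simp
    have "reflect_poly (cyclotomic_prod ?D) = (\<Prod>d\<in>?D. if d = 1 then - cyclotomic d else cyclotomic d)"
      unfolding reflect_poly_prod using less.IH by (intro prod.cong refl) (auto intro: dvd_pos_nat[OF less.prems])
    also have "\<dots> = - cyclotomic_prod ?D"
    proof -
      have "(\<Prod>d\<in>?D. if d = 1 then - cyclotomic d else cyclotomic d) =
          - cyclotomic 1 * (\<Prod>d\<in>?D - {1}. if d = 1 then - cyclotomic d else cyclotomic d)"
        by (subst prod.remove[OF fin one]) simp
      also have "(\<Prod>d\<in>?D - {1}. if d = 1 then - cyclotomic d else cyclotomic d) = cyclotomic_prod (?D - {1})"
        by (intro prod.cong) auto
      finally show ?thesis by (simp add: prod.remove[OF fin one])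
    qed
    finally have "reflect_poly (cyclotomic n) * (- cyclotomic_prod ?D) = - xpow1 n"
      using reflect_xpow1[OF less.prems] unfolding xpow1_split[OF less.prems] reflect_poly_mult by simp
    then have "reflect_poly (cyclotomic n) * cyclotomic_prod ?D = cyclotomic n * cyclotomic_prod ?D"
      using xpow1_split[OF less.prems] by simp
    moreover have "cyclotomic_prod ?D \<noteq> 0" using cyclotomic_nonzero fin by simp
    ultimately show ?thesis using False by simp
  qed
qed

lemma reflect_cyclotomic_prod:
  assumes "\<And>d. d \<in> D \<Longrightarrow> d > 0"
  shows "reflect_poly (cyclotomic_prod D) = cyclotomic_prod D \<or> reflect_poly (cyclotomic_prod D) = - cyclotomic_prod D"
  using assms
proof (induction D rule: infinite_finite_induct)
  case (insert d D)
  then show ?case using reflect_cyclotomic[of d] by (auto simp: reflect_poly_mult split: if_splits)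
qed simp_all

text \<open>For \<open>n > 1\<close> the factor \<open>\<Phi>\<^sub>1\<close>, and with it the sign, belongs to the proper divisors.\<close>

lemma reflect_proper_divisors:
  assumes n: "n > 1"
  shows "reflect_poly (cyclotomic_prod {d. d dvd n \<and> d < n}) = - cyclotomic_prod {d. d dvd n \<and> d < n}"
proof -
  let ?g = "cyclotomic_prod {d. d dvd n \<and> d < n}"
  have n0: "n > 0" using n by simp
  have "cyclotomic n * reflect_poly ?g = reflect_poly (cyclotomic n * ?g)"
    using n reflect_cyclotomic[of n] by (simp add: reflect_poly_mult)
  also have "\<dots> = - (cyclotomic n * ?g)"
    using reflect_xpow1[OF n0] unfolding xpow1_split[OF n0] .
  finally have "cyclotomic n * reflect_poly ?g = cyclotomic n * (- ?g)" by simp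
  then show ?thesis using cyclotomic_nonzero[of n] mult_left_cancel by blast
qed

lemma degree_proper_divisors:
  assumes n: "n > 0"
  shows "Polynomial.degree (cyclotomic_prod {d. d dvd n \<and> d < n}) + totient n = n"
proof -
  have "Polynomial.degree (xpow1 n) = n"
    using n by (subst diff_conv_add_uminus, subst degree_add_eq_left) (simp_all add: degree_monom_eq)
  moreover have "cyclotomic_prod {d. d dvd n \<and> d < n} \<noteq> 0" using cyclotomic_nonzero by simp
  ultimately show ?thesis
    using degree_mult_eq[OF cyclotomic_nonzero[of n], of "cyclotomic_prod {d. d dvd n \<and> d < n}"] xpow1_split[OF n]
    by (simp add: degree_cyclotomic)
qed

text \<open>\<open>k\<close> is an integer in the ideal generated by \<open>f\<close> and \<open>g\<close> in \<open>\<int>[X]\<close>.\<close>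

definition ideal_const :: "int poly \<Rightarrow> int poly \<Rightarrow> int \<Rightarrow> bool" where
  "ideal_const f g k \<longleftrightarrow> (\<exists>u v. u * f + v * g = [:k:])"

lemma ideal_const_mult:
  assumes "ideal_const f g k" "ideal_const f h l"
  shows "ideal_const f (g * h) (k * l)"
proof -
  obtain u v w z where "u * f + v * g = [:k:]" "w * f + z * h = [:l:]"
    using assms unfolding ideal_const_def by blast
  then have "[:k * l:] = (u * f + v * g) * (w * f + z * h)" by simp
  also have "\<dots> = (u * w * f + u * z * h + v * g * w) * f + (v * z) * (g * h)" by (simp add: algebra_simps)
  finally show ?thesis unfolding ideal_const_def by metis
qed

lemma ideal_const_1: "ideal_const f 1 1"
  unfolding ideal_const_def by (intro exI[of _ 0] exI[of _ 1]) (simp add: one_pCons)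

lemma ideal_const_prod:
  assumes "\<And>d. d \<in> D \<Longrightarrow> ideal_const f (g d) 1"
  shows "ideal_const f (prod g D) 1"
  using assms
proof (induction D rule: infinite_finite_induct)
  case (insert d D)
  then show ?case using ideal_const_mult[of f "g d" 1 "prod g D" 1] by simp
qed (simp_all add: ideal_const_1)

lemma ideal_const_prod_pos:
  assumes "\<And>d. d \<in> D \<Longrightarrow> \<exists>k>0. ideal_const f (g d) k"
  shows "\<exists>k>0. ideal_const f (prod g D) k"
  using assms
proof (induction D rule: infinite_finite_induct)
  case (insert d D)
  then obtain k l where "k > 0" "ideal_const f (g d) k" "l > 0" "ideal_const f (prod g D) l" by blast
  then show ?case using insert ideal_const_mult[of f "g d" k "prod g D" l]
    by (intro exI[of _ "k * l"]) simp
qed (auto intro!: exI[of _ 1] simp: ideal_const_1)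

text \<open>Euclid's algorithm on the exponents.\<close>

lemma xpow1_gcd: "\<exists>u v. u * xpow1 a + v * xpow1 b = xpow1 (gcd a b)"
proof (induction "a + b" arbitrary: a b rule: less_induct)
  case less
  have step: "\<exists>u v. u * xpow1 a + v * xpow1 b = xpow1 (gcd a b)" if ab: "a \<ge> b" "b > 0" "a + b = s"
    "\<And>a' b'. a' + b' < s \<Longrightarrow> \<exists>u v. u * xpow1 a' + v * xpow1 b' = xpow1 (gcd a' b')" for a b s
  proof -
    have "(a - b) + b < s" using ab by simp
    then obtain u v where uv: "u * xpow1 (a - b) + v * xpow1 b = xpow1 (gcd (a - b) b)" using ab(4) by blast
    have "xpow1 a = Polynomial.monom 1 (a - b) * xpow1 b + xpow1 (a - b)"
      using ab(1) by (simp add: algebra_simps mult_monom)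
    then have "u * xpow1 a + (v - u * Polynomial.monom 1 (a - b)) * xpow1 b = xpow1 (gcd (a - b) b)"
      using uv by (simp add: algebra_simps)
    moreover have "gcd (a - b) b = gcd a b" using ab(1) by (metis gcd_diff1_nat)
    ultimately show ?thesis by metis
  qed
  show ?case
  proof (cases "a = 0 \<or> b = 0")
    case True
    then show ?thesis
    proof
      assume "a = 0"
      then show ?thesis by (intro exI[of _ 0] exI[of _ 1]) simp
    next
      assume "b = 0"
      then show ?thesis by (intro exI[of _ 1] exI[of _ 0]) simp
    qed
  next
    case False
    show ?thesis
    proof (cases "a \<ge> b")
      case True
      then show ?thesis using step[of b a "a + b"] less False by blast
    next
      case F: False
      then obtain u v where "u * xpow1 b + v * xpow1 a = xpow1 (gcd b a)"
        using step[of a b "a + b"] less False by (metis add.commute less_imp_le_nat not_le bot_nat_0.not_eq_extremum)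
      then show ?thesis by (intro exI[of _ v] exI[of _ u]) (simp add: algebra_simps gcd.commute)
    qed
  qed
qed

lemma xpow1_dvd: "d dvd n \<Longrightarrow> n > 0 \<Longrightarrow> xpow1 d dvd xpow1 n"
  using cyclotomic_prod_dvd[of "{e. e dvd n}" "{e. e dvd d}"]
  by (auto simp: cyclotomic_prod_divisors dvd_pos_nat intro: dvd_trans)

text \<open>The quotient of \<open>X\<^sup>n - 1\<close> by \<open>X\<^sup>d - 1\<close> is the product of the \<open>\<Phi>\<^sub>e\<close> over those divisors \<open>e\<close> of \<open>n\<close> that do not
  divide \<open>d\<close>, and \<open>n\<close> is one of these.\<close>

lemma cyclotomic_dvd_quotient:
  assumes n: "n > 0" and d: "d dvd n" "d < n" and eq: "xpow1 n = xpow1 d * N"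
  shows "cyclotomic n dvd N"
proof -
  let ?E = "{e. e dvd n \<and> \<not> e dvd d}"
  have d0: "d > 0" using d(1) n by (rule dvd_pos_nat[rotated])
  have "cyclotomic_prod {e. e dvd n} = cyclotomic_prod {e. e dvd d} * cyclotomic_prod ?E"
    using n d by (subst prod.union_disjoint[symmetric]) (auto intro!: prod.cong intro: dvd_trans)
  then have "xpow1 d * N = xpow1 d * cyclotomic_prod ?E"
    unfolding eq[symmetric] by (simp add: cyclotomic_prod_divisors n d0)
  then have "N = cyclotomic_prod ?E" using xpow1_nonzero[OF d0] by simp
  moreover have "n \<in> ?E" using d d0 by (auto dest: dvd_imp_le)
  ultimately show ?thesis using n by (simp add: dvd_prodI)
qed

text \<open>A combination of \<open>X\<^sup>n - 1\<close> and \<open>X\<^sup>e - 1\<close> equals \<open>X\<^sup>c - 1\<close> for \<open>c = gcd n e\<close>.  Divided by \<open>X\<^sup>c - 1\<close> it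
  expresses \<open>1\<close> by multiples of \<open>\<Phi>\<^sub>n\<close> and \<open>\<Phi>\<^sub>e\<close>, because \<open>c\<close> is a proper divisor of both numbers.\<close>

lemma ideal_const_cyclotomic_coprime:
  assumes n: "n > 0" and e: "e > 0" and ne: "\<not> e dvd n" "\<not> n dvd e"
  shows "ideal_const (cyclotomic n) (cyclotomic e) 1"
proof -
  let ?c = "gcd n e"
  have c0: "?c > 0" using n by simp
  obtain u v where uv: "u * xpow1 n + v * xpow1 e = xpow1 ?c" using xpow1_gcd by blast
  obtain N where N: "xpow1 n = xpow1 ?c * N" using xpow1_dvd[of ?c n] n by (auto elim: dvdE)
  obtain E where E: "xpow1 e = xpow1 ?c * E" using xpow1_dvd[of ?c e] e by (auto elim: dvdE)
  have "?c < n" "?c < e"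
    using n e ne by (metis gcd_dvd1 gcd_dvd2 dvd_imp_le le_neq_implies_less)+
  then obtain N' E' where "N = cyclotomic n * N'" "E = cyclotomic e * E'"
    using cyclotomic_dvd_quotient[OF n _ _ N] cyclotomic_dvd_quotient[OF e _ _ E] by (auto elim!: dvdE)
  moreover have "xpow1 ?c * (u * N + v * E) = xpow1 ?c * 1"
    using uv unfolding N E by (simp add: algebra_simps)
  then have "u * N + v * E = 1" using xpow1_nonzero[OF c0] mult_left_cancel by blast
  ultimately have "(u * N') * cyclotomic n + (v * E') * cyclotomic e = [:1:]"
    by (simp add: algebra_simps one_pCons)
  then show ?thesis unfolding ideal_const_def by blast
qed

text \<open>The quotient \<open>(X\<^sup>n - 1)/(X\<^sup>d - 1) = 1 + X\<^sup>d + \<dots> + X\<^bsup>n-d\<^esup>\<close> is a multiple of \<open>\<Phi>\<^sub>n\<close> and is congruent to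
  \<open>n/d\<close> modulo \<open>X\<^sup>d - 1\<close>.\<close>

lemma ideal_const_cyclotomic_divisor:
  assumes n: "n > 0" and d: "d dvd n" "d < n"
  shows "\<exists>k>0. ideal_const (cyclotomic n) (cyclotomic d) k"
proof -
  have d0: "d > 0" using d(1) n by (rule dvd_pos_nat[rotated])
  define k where "k = n div d"
  have nk: "n = d * k" using d by (simp add: k_def)
  have k0: "k > 0" using n nk by simp
  let ?Y = "Polynomial.monom 1 d :: int poly"
  have pw: "?Y ^ i = Polynomial.monom 1 (d * i)" for i by (simp add: monom_power)
  define N where "N = (\<Sum>i<k. ?Y ^ i)"
  have N: "xpow1 n = xpow1 d * N"
    using power_diff_1_eq[of ?Y k] by (simp add: N_def pw nk)
  have "xpow1 d dvd ?Y ^ i - 1" for i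
    using power_diff_1_eq[of ?Y i] by simp
  then have "xpow1 d dvd (\<Sum>i<k. ?Y ^ i - 1)" by (intro dvd_sum)
  then have "xpow1 d dvd N - [:int k:]"
    by (simp add: N_def sum_subtractf of_nat_poly)
  then obtain w where w: "N - [:int k:] = xpow1 d * w" by (auto elim: dvdE)
  obtain N' where N': "N = cyclotomic n * N'" using cyclotomic_dvd_quotient[OF n d N] by (auto elim: dvdE)
  obtain r where r: "xpow1 d = cyclotomic d * r" using xpow1_split[OF d0] by blast
  have "N' * cyclotomic n + (- w * r) * cyclotomic d = [:int k:]"
    using w unfolding N' r by (simp add: algebra_simps)
  then have "ideal_const (cyclotomic n) (cyclotomic d) (int k)" unfolding ideal_const_def by blast
  then show ?thesis using k0 by (intro exI[of _ "int k"]) simp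
qed

section \<open>Moebius inversion\<close>

lemma moebius_mu_prime_mult:
  assumes p: "prime p" and e: "e > 0" "\<not> p dvd e"
  shows "moebius_mu (p * e) = - moebius_mu e"
proof -
  have cop: "coprime p e" using p e(2) by (simp add: prime_imp_coprime)
  have "squarefree (p * e) \<longleftrightarrow> squarefree e"
    using squarefree_mult_coprime[OF cop squarefree_prime] squarefree_multD(2)[of p e] p by blast
  moreover have "prime_factors (p * e) = insert p (prime_factors e)"
    using p e(1) by (simp add: prime_factors_product prime_prime_factors)
  moreover have "p \<notin> prime_factors e" using e(2) by auto
  ultimately show ?thesis by (simp add: moebius_mu_def)
qed

text \<open>For a prime \<open>p\<close> dividing \<open>n\<close>, the terms of \<open>d\<close> and \<open>pd\<close> cancel if \<open>p\<close> does not divide \<open>d\<close>; the remaining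
  divisors are not squarefree.\<close>

lemma sum_moebius_mu:
  assumes n: "n > 0"
  shows "(\<Sum>d | d dvd n. moebius_mu d) = (if n = 1 then 1 else 0)"
proof (cases "n = 1")
  case True
  then show ?thesis by (simp add: moebius_mu_def)
next
  case False
  then obtain p where p: "prime p" "p dvd n" using prime_factor_nat by blast
  let ?A = "{d. d dvd n \<and> \<not> p dvd d}" and ?B = "{d. d dvd n \<and> p dvd d}"
  have fin: "finite ?A" "finite ?B" using n by simp_all
  have inj: "inj_on (\<lambda>e. p * e) ?A" using prime_gt_0_nat[OF p(1)] by (auto simp: inj_on_def)
  have sub: "(\<lambda>e. p * e) ` ?A \<subseteq> ?B"
  proof
    fix d assume "d \<in> (\<lambda>e. p * e) ` ?A"
    then obtain e where e: "d = p * e" "e dvd n" "\<not> p dvd e" by blast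
    have "coprime p e" using p(1) e(3) by (simp add: prime_imp_coprime)
    then show "d \<in> ?B" using e p(2) by (simp add: divides_mult)
  qed
  have "(\<Sum>d\<in>?B. moebius_mu d) = (\<Sum>d\<in>(\<lambda>e. p * e) ` ?A. moebius_mu d)"
  proof (rule sum.mono_neutral_right[OF fin(2) sub], rule ballI)
    fix d assume d: "d \<in> ?B - (\<lambda>e. p * e) ` ?A"
    then obtain e where e: "d = p * e" by blast
    have "e dvd n" using d e by (auto intro: dvd_trans[of e "p * e"])
    then have "p dvd e" using d e by blast
    then have "p\<^sup>2 dvd d" using e by (simp add: power2_eq_square mult_dvd_mono)
    moreover have "\<not> p dvd 1" using p(1) prime_gt_1_nat by auto
    ultimately have "\<not> squarefree d" unfolding squarefree_def by blast
    then show "moebius_mu d = 0" by (simp add: moebius_mu_def)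
  qed
  also have "\<dots> = (\<Sum>e\<in>?A. moebius_mu (p * e))" by (rule sum.reindex[OF inj, simplified comp_def])
  also have "\<dots> = (\<Sum>e\<in>?A. - moebius_mu e)"
    using p(1) n by (intro sum.cong refl moebius_mu_prime_mult) (auto intro: dvd_pos_nat)
  also have "\<dots> = - (\<Sum>e\<in>?A. moebius_mu e)" by (rule sum_negf)
  finally have zero: "(\<Sum>d\<in>?A. moebius_mu d) + (\<Sum>d\<in>?B. moebius_mu d) = 0" by simp
  have U: "{d. d dvd n} = ?A \<union> ?B" by blast
  have "(\<Sum>d\<in>?A \<union> ?B. moebius_mu d) = (\<Sum>d\<in>?A. moebius_mu d) + (\<Sum>d\<in>?B. moebius_mu d)"
    by (rule sum.union_disjoint[OF fin]) auto
  then show ?thesis unfolding U zero using False by simp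
qed

lemma (in comm_monoid) finprod_swap:
  assumes "finite A" "finite B" "\<And>a b. a \<in> A \<Longrightarrow> b \<in> B \<Longrightarrow> f a b \<in> carrier G"
  shows "(\<Otimes>a\<in>A. \<Otimes>b\<in>B. f a b) = (\<Otimes>b\<in>B. \<Otimes>a\<in>A. f a b)"
  using assms(1,3)
proof (induction A rule: finite_induct)
  case empty
  then show ?case by simp
next
  case (insert x A)
  have "(\<Otimes>b\<in>B. \<Otimes>a\<in>insert x A. f a b) = (\<Otimes>b\<in>B. f x b \<otimes> (\<Otimes>a\<in>A. f a b))"
    using insert by (intro finprod_cong') (auto intro!: m_closed finprod_closed)
  also have "\<dots> = (\<Otimes>b\<in>B. f x b) \<otimes> (\<Otimes>b\<in>B. \<Otimes>a\<in>A. f a b)"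
    using insert by (intro finprod_multf) (auto intro!: finprod_closed)
  also have "\<dots> = (\<Otimes>a\<in>insert x A. \<Otimes>b\<in>B. f a b)"
    using insert by (subst finprod_insert) (auto intro!: finprod_closed)
  finally show ?case by simp
qed

lemma (in comm_group) finprod_int_pow:
  assumes "f \<in> A \<rightarrow> carrier G"
  shows "(\<Otimes>a\<in>A. f a) [^] (k::int) = (\<Otimes>a\<in>A. f a [^] k)"
  using assms
proof (induction A rule: infinite_finite_induct)
  case (insert a A)
  then show ?case by (simp add: Pi_iff int_pow_mult_distrib[OF m_comm])
qed simp_all

text \<open>After an exchange of the two products, the exponent of \<open>a e\<close> is the sum of the Moebius function over
  the divisors of \<open>n div e\<close>.\<close>

lemma (in comm_group) moebius_inversion:
  assumes n: "n > 0" and a: "\<And>d. d dvd n \<Longrightarrow> a d \<in> carrier G"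
    and b: "\<And>d. d dvd n \<Longrightarrow> b d = (\<Otimes>e\<in>{e. e dvd d}. a e)"
  shows "a n = (\<Otimes>d\<in>{d. d dvd n}. b d [^] moebius_mu (n div d))"
proof -
  let ?D = "{d. d dvd n}"
  have fin: "finite ?D" using n by simp
  have "(\<Otimes>d\<in>?D. b d [^] moebius_mu (n div d)) =
      (\<Otimes>d\<in>?D. \<Otimes>e\<in>?D. if e dvd d then a e [^] moebius_mu (n div d) else \<one>)"
  proof (rule finprod_cong'[OF refl])
    show "(\<lambda>d. \<Otimes>e\<in>?D. if e dvd d then a e [^] moebius_mu (n div d) else \<one>) \<in> ?D \<rightarrow> carrier G"
      using a by (auto intro!: finprod_closed)
    fix d assume d: "d \<in> ?D"
    have sub: "{e. e dvd d} \<subseteq> ?D" using d by (auto intro: dvd_trans)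
    have "b d [^] moebius_mu (n div d) = (\<Otimes>e\<in>{e. e dvd d}. a e [^] moebius_mu (n div d))"
      using d sub a by (simp add: b finprod_int_pow subset_iff Pi_iff)
    also have "\<dots> = (\<Otimes>e\<in>?D. if e dvd d then a e [^] moebius_mu (n div d) else \<one>)"
      using sub a fin by (intro finprod_mono_neutral_cong_left) auto
    finally show "b d [^] moebius_mu (n div d) = \<dots>" .
  qed
  also have "\<dots> = (\<Otimes>e\<in>?D. \<Otimes>d\<in>?D. if e dvd d then a e [^] moebius_mu (n div d) else \<one>)"
    using a by (intro finprod_swap fin) auto
  also have "\<dots> = (\<Otimes>e\<in>?D. if n = e then a e else \<one>)"
  proof (rule finprod_cong'[OF refl])
    show "(\<lambda>e. if n = e then a e else \<one>) \<in> ?D \<rightarrow> carrier G" using a by auto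
    fix e assume e: "e \<in> ?D"
    then have e0: "e > 0" using n by (auto intro: dvd_pos_nat)
    have "(\<Otimes>d\<in>?D. if e dvd d then a e [^] moebius_mu (n div d) else \<one>) =
        (\<Otimes>d\<in>?D. a e [^] (if e dvd d then moebius_mu (n div d) else 0))"
      using a e by (intro finprod_cong') auto
    also have "\<dots> = a e [^] (\<Sum>d\<in>?D. if e dvd d then moebius_mu (n div d) else 0)"
      using a e by (intro finprod_int_pow_same) auto
    also have "(\<Sum>d\<in>?D. if e dvd d then moebius_mu (n div d) else 0) =
        (\<Sum>d\<in>{d. d dvd n \<and> e dvd d}. moebius_mu (n div d))"
      using fin by (simp add: sum.inter_filter[symmetric])
    also have "\<dots> = (\<Sum>f\<in>{f. f dvd n div e}. moebius_mu f)"
    proof (rule sum.reindex_bij_witness[of _ "\<lambda>f. n div f" "\<lambda>d. n div d"])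
      fix d assume d: "d \<in> {d. d dvd n \<and> e dvd d}"
      then obtain k l where kl: "n = d * k" "d = e * l" by (auto elim!: dvdE)
      then have "k > 0" "l > 0" "d > 0" using n by auto
      then show "n div (n div d) = d" "n div d \<in> {f. f dvd n div e}"
        using kl e0 by simp_all
    next
      fix f assume f: "f \<in> {f. f dvd n div e}"
      from e obtain k where k: "n = e * k" by (auto elim: dvdE)
      with f e0 obtain l where l: "k = f * l" by (auto elim: dvdE)
      have "f > 0" "l > 0" using n k l by auto
      then show "n div (n div f) = f" "n div f \<in> {d. d dvd n \<and> e dvd d}"
        using k l e0 by simp_all
    qed simp
    also have "\<dots> = (if n = e then 1 else 0)"
    proof -
      obtain k where k: "n = e * k" using e by (auto elim: dvdE)
      then have "k > 0" using n by simp
      then show ?thesis using sum_moebius_mu[of k] k e0 by simp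
    qed
    finally show "(\<Otimes>d\<in>?D. if e dvd d then a e [^] moebius_mu (n div d) else \<one>) = (if n = e then a e else \<one>)"
      using a e by simp
  qed
  also have "\<dots> = a n"
    using finprod_singleton[of n ?D a] fin a by auto
  finally show ?thesis by simp
qed

text \<open>Inversion formulas are proved in the group of units of a monoid; these two lemmas carry them back to
  the monoid.\<close>

lemma (in comm_monoid) finprod_units_of:
  assumes "f \<in> A \<rightarrow> Units G"
  shows "finprod (units_of G) f A = finprod G f A"
proof -
  interpret U: comm_group "units_of G" by (rule units_comm_group)
  show ?thesis using assms
  proof (induction A rule: infinite_finite_induct)
    case (insert a A)
    then have "f \<in> A \<rightarrow> carrier (units_of G)" "f a \<in> carrier (units_of G)"
      "f \<in> A \<rightarrow> carrier G" "f a \<in> carrier G"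
      by (auto simp: units_of_carrier)
    then show ?case using insert by (simp add: units_of_mult)
  next
    case (infinite A)
    then show ?case by (simp add: units_of_one)
  qed (simp add: units_of_one)
qed

lemma (in monoid) int_pow_units_of:
  assumes x: "x \<in> Units G"
  shows "x [^]\<^bsub>units_of G\<^esub> (k::int) = x [^] k"
proof -
  have pw: "x [^]\<^bsub>units_of G\<^esub> (j::nat) = x [^] j" for j
    by (simp add: nat_pow_def units_of_mult units_of_one)
  have "x [^] j \<in> Units G" for j :: nat
    using x by (induction j) auto
  then show ?thesis unfolding int_pow_def2 pw by (simp only: units_of_inv split: if_splits)
qed

section \<open>The action of polynomials in \<open>\<sigma>\<close>\<close>

context gmodule
begin

lemma poly_act_bound:
  assumes s: "s \<in> carrier G" and x: "x \<in> carrier M" and n: "Polynomial.degree f \<le> n"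
  shows "poly_act G M s f x = (\<Otimes>\<^bsub>M\<^esub>i\<in>{..n}. act M (s [^]\<^bsub>G\<^esub> i) x [^]\<^bsub>M\<^esub> Polynomial.coeff f i)"
  unfolding poly_act_def
  by (rule M.finprod_mono_neutral_cong_left)
    (use s x n in \<open>auto simp: coeff_eq_0 intro!: M.int_pow_closed act_closed\<close>)

lemma poly_act_closed:
  "s \<in> carrier G \<Longrightarrow> x \<in> carrier M \<Longrightarrow> poly_act G M s f x \<in> carrier M"
  unfolding poly_act_def by (auto intro!: M.finprod_closed M.int_pow_closed act_closed)

lemma poly_act_add:
  assumes s: "s \<in> carrier G" and x: "x \<in> carrier M"
  shows "poly_act G M s (f + g) x = poly_act G M s f x \<otimes>\<^bsub>M\<^esub> poly_act G M s g x"
proof -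
  let ?n = "max (Polynomial.degree f) (Polynomial.degree g)"
  have "poly_act G M s (f + g) x = (\<Otimes>\<^bsub>M\<^esub>i\<in>{..?n}. act M (s [^]\<^bsub>G\<^esub> i) x [^]\<^bsub>M\<^esub> Polynomial.coeff f i
      \<otimes>\<^bsub>M\<^esub> act M (s [^]\<^bsub>G\<^esub> i) x [^]\<^bsub>M\<^esub> Polynomial.coeff g i)"
    unfolding poly_act_bound[OF s x degree_add_le_max] using s x
    by (intro M.finprod_cong') (auto simp: act_closed M.int_pow_mult)
  also have "\<dots> = (\<Otimes>\<^bsub>M\<^esub>i\<in>{..?n}. act M (s [^]\<^bsub>G\<^esub> i) x [^]\<^bsub>M\<^esub> Polynomial.coeff f i) \<otimes>\<^bsub>M\<^esub>
      (\<Otimes>\<^bsub>M\<^esub>i\<in>{..?n}. act M (s [^]\<^bsub>G\<^esub> i) x [^]\<^bsub>M\<^esub> Polynomial.coeff g i)"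
    using s x by (intro M.finprod_multf) (auto intro!: M.int_pow_closed act_closed)
  also have "\<dots> = poly_act G M s f x \<otimes>\<^bsub>M\<^esub> poly_act G M s g x"
    by (simp add: poly_act_bound[OF s x, of f ?n] poly_act_bound[OF s x, of g ?n])
  finally show ?thesis .
qed

lemma poly_act_monom:
  assumes s: "s \<in> carrier G" and x: "x \<in> carrier M"
  shows "poly_act G M s (Polynomial.monom c i) x = act M (s [^]\<^bsub>G\<^esub> i) x [^]\<^bsub>M\<^esub> c"
proof -
  have "poly_act G M s (Polynomial.monom c i) x =
      (\<Otimes>\<^bsub>M\<^esub>j\<in>{..i}. if i = j then act M (s [^]\<^bsub>G\<^esub> i) x [^]\<^bsub>M\<^esub> c else \<one>\<^bsub>M\<^esub>)"
    unfolding poly_act_bound[OF s x degree_monom_le] using s x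
    by (intro M.finprod_cong') (auto simp: act_closed)
  also have "\<dots> = act M (s [^]\<^bsub>G\<^esub> i) x [^]\<^bsub>M\<^esub> c"
    using s x by (intro M.finprod_singleton) (auto intro!: M.int_pow_closed act_closed)
  finally show ?thesis .
qed

lemma poly_act_zero_poly: "s \<in> carrier G \<Longrightarrow> x \<in> carrier M \<Longrightarrow> poly_act G M s 0 x = \<one>\<^bsub>M\<^esub>"
  unfolding poly_act_def by simp

lemma poly_act_sum:
  assumes s: "s \<in> carrier G" and x: "x \<in> carrier M"
  shows "poly_act G M s (\<Sum>j\<in>J. f j) x = (\<Otimes>\<^bsub>M\<^esub>j\<in>J. poly_act G M s (f j) x)"
proof (induction J rule: infinite_finite_induct)
  case (insert j J)
  then show ?case using s x by (simp add: poly_act_add Pi_iff poly_act_closed)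
qed (simp_all add: poly_act_zero_poly s x)

lemma poly_act_one: "s \<in> carrier G \<Longrightarrow> x \<in> carrier M \<Longrightarrow> poly_act G M s 1 x = x"
  using poly_act_monom[of s x 1 0] by (simp add: act_one monom_eq_1)

lemma poly_act_group_hom:
  assumes s: "s \<in> carrier G"
  shows "group_hom M M (poly_act G M s f)"
proof unfold_locales
  show "poly_act G M s f \<in> hom M M"
  proof (rule homI)
    fix x y assume xy: "x \<in> carrier M" "y \<in> carrier M"
    have "poly_act G M s f (x \<otimes>\<^bsub>M\<^esub> y) = (\<Otimes>\<^bsub>M\<^esub>i\<in>{..Polynomial.degree f}.
        act M (s [^]\<^bsub>G\<^esub> i) x [^]\<^bsub>M\<^esub> Polynomial.coeff f i \<otimes>\<^bsub>M\<^esub> act M (s [^]\<^bsub>G\<^esub> i) y [^]\<^bsub>M\<^esub> Polynomial.coeff f i)"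
      unfolding poly_act_def using s xy
      by (intro M.finprod_cong') (auto simp: act_closed act_add M.int_pow_mult_distrib[OF M.m_comm])
    also have "\<dots> = poly_act G M s f x \<otimes>\<^bsub>M\<^esub> poly_act G M s f y"
      unfolding poly_act_def using s xy
      by (intro M.finprod_multf) (auto intro!: M.int_pow_closed act_closed)
    finally show "poly_act G M s f (x \<otimes>\<^bsub>M\<^esub> y) = poly_act G M s f x \<otimes>\<^bsub>M\<^esub> poly_act G M s f y" .
  qed (rule poly_act_closed[OF s])
qed

lemma poly_act_monom_mult:
  assumes s: "s \<in> carrier G" and x: "x \<in> carrier M"
  shows "poly_act G M s (Polynomial.monom c i * g) x = act M (s [^]\<^bsub>G\<^esub> i) (poly_act G M s g x) [^]\<^bsub>M\<^esub> c"
proof -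
  let ?t = "\<lambda>j::nat. act M (s [^]\<^bsub>G\<^esub> j) x"
  have t: "?t j \<in> carrier M" for j using s x by (intro act_closed) auto
  have si: "s [^]\<^bsub>G\<^esub> i \<in> carrier G" using s by simp
  have "Polynomial.monom c i * g =
      (\<Sum>j\<le>Polynomial.degree g. Polynomial.monom (c * Polynomial.coeff g j) (i + j))"
    by (subst (1) poly_as_sum_of_monoms[of g, symmetric]) (simp add: sum_distrib_left mult_monom)
  then have "poly_act G M s (Polynomial.monom c i * g) x =
      (\<Otimes>\<^bsub>M\<^esub>j\<in>{..Polynomial.degree g}. ?t (i + j) [^]\<^bsub>M\<^esub> (c * Polynomial.coeff g j))"
    by (simp only: poly_act_sum[OF s x] poly_act_monom[OF s x])
  also have "\<dots> = (\<Otimes>\<^bsub>M\<^esub>j\<in>{..Polynomial.degree g}.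
      act M (s [^]\<^bsub>G\<^esub> i) (?t j [^]\<^bsub>M\<^esub> Polynomial.coeff g j) [^]\<^bsub>M\<^esub> c)"
  proof (rule M.finprod_cong'[OF refl])
    fix j
    have "?t (i + j) = act M (s [^]\<^bsub>G\<^esub> i) (?t j)"
      using s x by (simp add: act_mult[symmetric] G.nat_pow_mult)
    then show "?t (i + j) [^]\<^bsub>M\<^esub> (c * Polynomial.coeff g j) =
        act M (s [^]\<^bsub>G\<^esub> i) (?t j [^]\<^bsub>M\<^esub> Polynomial.coeff g j) [^]\<^bsub>M\<^esub> c"
      using t si by (simp add: act_int_pow M.int_pow_pow act_closed mult.commute)
  qed (simp add: Pi_iff t act_closed[OF si])
  also have "\<dots> = (\<Otimes>\<^bsub>M\<^esub>j\<in>{..Polynomial.degree g}.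
      act M (s [^]\<^bsub>G\<^esub> i) (?t j [^]\<^bsub>M\<^esub> Polynomial.coeff g j)) [^]\<^bsub>M\<^esub> c"
    by (rule M.finprod_int_pow[symmetric]) (simp add: Pi_iff t act_closed[OF si])
  also have "(\<Otimes>\<^bsub>M\<^esub>j\<in>{..Polynomial.degree g}. act M (s [^]\<^bsub>G\<^esub> i) (?t j [^]\<^bsub>M\<^esub> Polynomial.coeff g j)) =
      act M (s [^]\<^bsub>G\<^esub> i) (poly_act G M s g x)"
    unfolding poly_act_def
    by (rule hom_finprod_comm_group[OF M.comm_group_axioms M.comm_group_axioms
          group_hom.homh[OF act_group_hom[OF si]], symmetric]) (use t in auto)
  finally show ?thesis .
qed

lemma poly_act_mult:
  assumes s: "s \<in> carrier G" and x: "x \<in> carrier M"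
  shows "poly_act G M s (f * g) x = poly_act G M s f (poly_act G M s g x)"
proof -
  have "f * g = (\<Sum>i\<le>Polynomial.degree f. Polynomial.monom (Polynomial.coeff f i) i * g)"
    by (subst (1) poly_as_sum_of_monoms[of f, symmetric]) (simp add: sum_distrib_right)
  then have "poly_act G M s (f * g) x = (\<Otimes>\<^bsub>M\<^esub>i\<in>{..Polynomial.degree f}.
      act M (s [^]\<^bsub>G\<^esub> i) (poly_act G M s g x) [^]\<^bsub>M\<^esub> Polynomial.coeff f i)"
    by (simp only: poly_act_sum[OF s x] poly_act_monom_mult[OF s x])
  then show ?thesis unfolding poly_act_def[of G M s f] .
qed

lemma poly_act_const:
  "s \<in> carrier G \<Longrightarrow> x \<in> carrier M \<Longrightarrow> poly_act G M s [:k:] x = x [^]\<^bsub>M\<^esub> k"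
  using poly_act_monom[of s x k 0] by (simp add: act_one monom_0)

lemma poly_act_uminus:
  assumes s: "s \<in> carrier G" and x: "x \<in> carrier M"
  shows "poly_act G M s (- f) x = inv\<^bsub>M\<^esub> poly_act G M s f x"
proof -
  have "poly_act G M s (- f) x \<otimes>\<^bsub>M\<^esub> poly_act G M s f x = \<one>\<^bsub>M\<^esub>"
    unfolding poly_act_add[OF s x, symmetric] using poly_act_zero_poly[OF s x] by simp
  then show ?thesis using M.inv_equality poly_act_closed[OF s x] by metis
qed

lemma poly_act_diff:
  assumes s: "s \<in> carrier G" and x: "x \<in> carrier M"
  shows "poly_act G M s (f - g) x = poly_act G M s f x \<otimes>\<^bsub>M\<^esub> inv\<^bsub>M\<^esub> poly_act G M s g x"
  unfolding diff_conv_add_uminus poly_act_add[OF s x] poly_act_uminus[OF s x] by (rule refl)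

lemma poly_act_xpow1:
  assumes s: "s \<in> carrier G" and x: "x \<in> carrier M"
  shows "poly_act G M s (xpow1 n) x = act M (s [^]\<^bsub>G\<^esub> n) x \<otimes>\<^bsub>M\<^esub> inv\<^bsub>M\<^esub> x"
  unfolding poly_act_diff[OF s x] poly_act_monom[OF s x] poly_act_one[OF s x]
  using s x by (simp add: act_closed)

end

lemma hom_poly_act:
  assumes M: "gmodule G M" and N: "gmodule G N" and f: "f \<in> gmodule_hom G M N"
    and s: "s \<in> carrier G" and x: "x \<in> carrier M"
  shows "f (poly_act G M s p x) = poly_act G N s p (f x)"
proof -
  interpret M: gmodule G M by fact
  interpret N: gmodule G N by fact
  interpret f: group_hom M N f by (rule gmodule_hom_group_hom[OF M N f])
  have t: "act M (s [^]\<^bsub>G\<^esub> i) x \<in> carrier M" for i :: nat using s x by (intro M.act_closed) auto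
  have "f (poly_act G M s p x) = (\<Otimes>\<^bsub>N\<^esub>i\<in>{..Polynomial.degree p}. f (act M (s [^]\<^bsub>G\<^esub> i) x [^]\<^bsub>M\<^esub> Polynomial.coeff p i))"
    unfolding poly_act_def
    by (rule hom_finprod_comm_group[OF M.M.comm_group_axioms N.M.comm_group_axioms f.homh]) (use t in auto)
  also have "\<dots> = poly_act G N s p (f x)"
    unfolding poly_act_def
  proof (rule N.M.finprod_cong'[OF refl])
    fix i
    show "f (act M (s [^]\<^bsub>G\<^esub> i) x [^]\<^bsub>M\<^esub> Polynomial.coeff p i) = act N (s [^]\<^bsub>G\<^esub> i) (f x) [^]\<^bsub>N\<^esub> Polynomial.coeff p i"
      unfolding f.hom_int_pow[OF t] using s x by (simp add: gmodule_homD(3)[OF f])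
  qed (use s x in \<open>auto intro!: N.M.int_pow_closed N.act_closed\<close>)
  finally show ?thesis .
qed

section \<open>Inverting \<open>\<sigma>\<close>\<close>

text \<open>Substituting \<open>X\<^bsup>m-1\<^esup>\<close> for \<open>X\<close> is the involution \<open>X \<mapsto> 1/X\<close> modulo \<open>X\<^sup>m - 1\<close>.\<close>

definition invert_var :: "nat \<Rightarrow> int poly \<Rightarrow> int poly" where
  "invert_var m f = pcompose f (Polynomial.monom 1 (m - 1))"

lemma pcompose_monom:
  "pcompose f (Polynomial.monom 1 k) = (\<Sum>i\<le>Polynomial.degree f. Polynomial.monom (Polynomial.coeff f i) (k * i))"
  for f :: "int poly"
proof -
  have mon: "pcompose (Polynomial.monom c i) (Polynomial.monom 1 k) = Polynomial.monom c (k * i)" for c :: int and i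
  proof (induction i)
    case 0
    then show ?case by (simp add: monom_0)
  next
    case (Suc i)
    then show ?case by (simp add: monom_Suc pcompose_pCons mult_monom)
  qed
  show ?thesis
    by (subst (1) poly_as_sum_of_monoms[of f, symmetric]) (simp add: pcompose_sum mon)
qed

lemma invert_var_mult: "invert_var m (f * g) = invert_var m f * invert_var m g"
  by (simp add: invert_var_def pcompose_mult)

lemma invert_var_diff: "invert_var m (f - g) = invert_var m f - invert_var m g"
  by (simp add: invert_var_def pcompose_diff)

lemma invert_var_1: "invert_var m 1 = 1"
  by (simp add: invert_var_def pcompose_1)

lemma xpow1_dvd_monom_diff:
  "xpow1 m dvd Polynomial.monom c (m * k + j) - Polynomial.monom c j"
proof -
  have "Polynomial.monom c (m * k + j) - Polynomial.monom c j = Polynomial.monom c j * (Polynomial.monom 1 m ^ k - 1)"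
    by (simp add: monom_power mult_monom algebra_simps)
  also have "\<dots> = xpow1 m * (Polynomial.monom c j * (\<Sum>i<k. Polynomial.monom 1 m ^ i))"
    unfolding power_diff_1_eq by (simp add: algebra_simps)
  finally show ?thesis by simp
qed

lemma invert_var_involution:
  assumes m: "m > 0"
  shows "xpow1 m dvd invert_var m (invert_var m f) - f"
proof -
  have "invert_var m (invert_var m f) =
      pcompose f (pcompose (Polynomial.monom 1 (m - 1)) (Polynomial.monom 1 (m - 1)))"
    by (simp add: invert_var_def pcompose_assoc)
  also have "pcompose (Polynomial.monom 1 (m - 1)) (Polynomial.monom 1 (m - 1)) = (Polynomial.monom 1 ((m - 1) * (m - 1)) :: int poly)"
    unfolding pcompose_monom
    by (subst sum.mono_neutral_right[of _ "{m - 1}"]) (auto simp: degree_monom_eq)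
  finally have eq: "invert_var m (invert_var m f) - f =
      (\<Sum>i\<le>Polynomial.degree f. Polynomial.monom (Polynomial.coeff f i) ((m - 1) * (m - 1) * i) - Polynomial.monom (Polynomial.coeff f i) i)"
    by (simp add: pcompose_monom sum_subtractf poly_as_sum_of_monoms)
  have "xpow1 m dvd Polynomial.monom c ((m - 1) * (m - 1) * i) - Polynomial.monom c i" for c i
  proof (cases "m = 1")
    case True
    then show ?thesis using xpow1_dvd_monom_diff[of 1 c i 0] dvd_minus_iff[of "xpow1 1" "Polynomial.monom c i - [:c:]"]
      by (simp add: monom_0)
  next
    case False
    then obtain l where "m = Suc (Suc l)" using m by (metis One_nat_def Suc_pred' gr0_implies_Suc neq0_conv)
    then have "(m - 1) * (m - 1) * i = m * (l * i) + i" by (simp add: algebra_simps)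
    then show ?thesis using xpow1_dvd_monom_diff[of m c "l * i" i] by simp
  qed
  then show ?thesis unfolding eq by (intro dvd_sum)
qed

lemma invert_var_reflect:
  assumes m: "m > 0"
  shows "xpow1 m dvd invert_var m f * Polynomial.monom 1 (Polynomial.degree f) - reflect_poly f"
proof -
  let ?d = "Polynomial.degree f"
  have reflect_eq: "reflect_poly f = (\<Sum>i\<le>?d. Polynomial.monom (Polynomial.coeff f i) (?d - i))"
  proof (rule poly_eqI)
    fix j
    have "Polynomial.coeff (\<Sum>i\<le>?d. Polynomial.monom (Polynomial.coeff f i) (?d - i)) j =
        (\<Sum>i\<le>?d. if i = ?d - j \<and> j \<le> ?d then Polynomial.coeff f i else 0)"
      unfolding coeff_sum by (intro sum.cong) auto
    also have "\<dots> = (if j \<le> ?d then Polynomial.coeff f (?d - j) else 0)" by simp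
    finally show "Polynomial.coeff (reflect_poly f) j =
        Polynomial.coeff (\<Sum>i\<le>?d. Polynomial.monom (Polynomial.coeff f i) (?d - i)) j"
      by (simp add: coeff_reflect_poly not_less)
  qed
  have "invert_var m f * Polynomial.monom 1 ?d =
      (\<Sum>i\<le>?d. Polynomial.monom (Polynomial.coeff f i) (m * i + (?d - i)))"
    unfolding invert_var_def pcompose_monom sum_distrib_right
  proof (rule sum.cong[OF refl])
    fix i assume i: "i \<in> {..?d}"
    have "(m - 1) * i + ?d = m * i + (?d - i)" using i m by (cases m) auto
    then show "Polynomial.monom (Polynomial.coeff f i) ((m - 1) * i) * Polynomial.monom 1 ?d =
        Polynomial.monom (Polynomial.coeff f i) (m * i + (?d - i))" by (simp add: mult_monom)
  qed
  then have "invert_var m f * Polynomial.monom 1 ?d - reflect_poly f =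
      (\<Sum>i\<le>?d. Polynomial.monom (Polynomial.coeff f i) (m * i + (?d - i)) - Polynomial.monom (Polynomial.coeff f i) (?d - i))"
    unfolding reflect_eq by (simp add: sum_subtractf)
  then show ?thesis using xpow1_dvd_monom_diff by (simp only:) (intro dvd_sum)
qed

text \<open>Modulo \<open>X\<^sup>m - 1\<close>, where \<open>X\<close> is a unit, \<open>f(1/X)\<close> is the reflected polynomial multiplied by a power of \<open>X\<close>.\<close>

lemma dvd_invert_var:
  assumes m: "m > 0" and f: "f dvd xpow1 m" and refl: "reflect_poly f = f \<or> reflect_poly f = - f"
  shows "f dvd invert_var m f"
proof -
  let ?d = "Polynomial.degree f"
  have "f dvd reflect_poly f" using refl by auto
  then have "f dvd invert_var m f * Polynomial.monom 1 ?d"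
    using dvd_trans[OF f invert_var_reflect[OF m, of f]] dvd_diffD by (metis dvd_add diff_add_cancel)
  then have "f dvd invert_var m f * Polynomial.monom 1 ?d * Polynomial.monom 1 ((m - 1) * ?d)" by (rule dvd_mult2)
  moreover have "Polynomial.monom 1 ?d * Polynomial.monom 1 ((m - 1) * ?d) = (Polynomial.monom 1 (m * ?d + 0) :: int poly)"
    using m by (cases m) (simp_all add: mult_monom)
  ultimately have "f dvd invert_var m f * Polynomial.monom 1 (m * ?d + 0)" by (simp add: mult.assoc)
  moreover have "f dvd invert_var m f * (Polynomial.monom 1 (m * ?d + 0) - Polynomial.monom 1 0)"
    by (rule dvd_mult[OF dvd_trans[OF f xpow1_dvd_monom_diff]])
  ultimately have "f dvd invert_var m f * Polynomial.monom 1 (m * ?d + 0) -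
      invert_var m f * (Polynomial.monom 1 (m * ?d + 0) - Polynomial.monom 1 0)" by (rule dvd_diff)
  then show ?thesis by (simp add: algebra_simps monom_eq_1)
qed

lemma cyclotomic_prod_dvd_xpow1:
  assumes m: "m > 0" and D: "\<And>d. d \<in> D \<Longrightarrow> d dvd m"
  shows "cyclotomic_prod D dvd xpow1 m"
  unfolding cyclotomic_prod_divisors[OF m, symmetric] using m D by (intro cyclotomic_prod_dvd) auto

lemma cyclotomic_prod_dvd_invert_var:
  assumes m: "m > 0" and D: "\<And>d. d \<in> D \<Longrightarrow> d dvd m"
  shows "cyclotomic_prod D dvd invert_var m (cyclotomic_prod D)"
  using m D by (intro dvd_invert_var cyclotomic_prod_dvd_xpow1 reflect_cyclotomic_prod) (auto intro: dvd_pos_nat)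

locale cyclic_normal = group G for G :: "('g, 'c) monoid_scheme" (structure) +
  fixes \<sigma> :: 'g and \<epsilon> :: "'g \<Rightarrow> int" and m :: nat
  assumes fin: "finite (carrier G)" and \<sigma>: "\<sigma> \<in> carrier G" and m: "m > 0" and \<sigma>_pow: "\<sigma> [^] m = \<one>"
    and \<epsilon>: "\<And>g. g \<in> carrier G \<Longrightarrow> \<epsilon> g = 1 \<or> \<epsilon> g = - 1"
    and conj: "\<And>g. g \<in> carrier G \<Longrightarrow> g \<otimes> \<sigma> \<otimes> inv g = \<sigma> [^] \<epsilon> g"
begin

abbreviation PA :: "('g, 'a) gmodule \<Rightarrow> int poly \<Rightarrow> 'a \<Rightarrow> 'a" where
  "PA M \<equiv> poly_act G M \<sigma>"

abbreviation PQ :: "('g, 'a) gmodule \<Rightarrow> int poly \<Rightarrow> ('g, 'a set) gmodule" where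
  "PQ M \<equiv> poly_quot G M \<sigma>"

lemma PA_cong:
  assumes M: "gmodule G M" and x: "x \<in> carrier M" and dvd: "xpow1 m dvd f - g"
  shows "PA M f x = PA M g x"
proof -
  interpret M: gmodule G M by fact
  obtain w where "f - g = xpow1 m * w" using dvd by (rule dvdE)
  then have w: "f - g = w * xpow1 m" by (simp only: mult.commute)
  interpret w: group_hom M M "PA M w" by (rule M.poly_act_group_hom[OF \<sigma>])
  have "PA M (xpow1 m) x = \<one>\<^bsub>M\<^esub>"
    unfolding M.poly_act_xpow1[OF \<sigma> x] \<sigma>_pow M.act_one[OF x] using x by simp
  then have "PA M (f - g) x = \<one>\<^bsub>M\<^esub>" unfolding w M.poly_act_mult[OF \<sigma> x] by simp
  moreover have "PA M f x = PA M (f - g) x \<otimes>\<^bsub>M\<^esub> PA M g x"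
    unfolding M.poly_act_add[OF \<sigma> x, symmetric] by simp
  ultimately show ?thesis using M.poly_act_closed[OF \<sigma> x] by simp
qed

lemma conj_pow:
  assumes g: "g \<in> carrier G"
  shows "g \<otimes> \<sigma> [^] (i::nat) = \<sigma> [^] (if \<epsilon> g = 1 then i else (m - 1) * i) \<otimes> g"
proof -
  have \<sigma>_inv: "\<sigma> [^] (- 1 :: int) = \<sigma> [^] (m - 1)"
  proof -
    have "\<sigma> [^] (m - 1) \<otimes> \<sigma> = \<one>" using \<sigma>_pow m \<sigma> by (cases m) simp_all
    then have "inv \<sigma> = \<sigma> [^] (m - 1)" using \<sigma> by (intro inv_equality) simp_all
    then show ?thesis using \<sigma> int_pow_neg_int[OF \<sigma>, of 1] by simp
  qed
  define k where "k = (if \<epsilon> g = 1 then 1 else m - 1)"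
  have "\<sigma> [^] \<epsilon> g = \<sigma> [^] k"
    using \<epsilon>[OF g] \<sigma> \<sigma>_inv by (auto simp: k_def)
  then have c: "g \<otimes> \<sigma> = \<sigma> [^] k \<otimes> g"
    using conj[OF g] g \<sigma> by (metis inv_closed inv_solve_right m_closed nat_pow_closed)
  have "g \<otimes> \<sigma> [^] i = \<sigma> [^] (k * i) \<otimes> g"
  proof (induction i)
    case 0
    then show ?case using g by simp
  next
    case (Suc i)
    have "g \<otimes> \<sigma> [^] Suc i = (g \<otimes> \<sigma> [^] i) \<otimes> \<sigma>" using g \<sigma> by (simp add: m_assoc)
    also have "\<dots> = \<sigma> [^] (k * i) \<otimes> (g \<otimes> \<sigma>)" unfolding Suc using g \<sigma> by (simp add: m_assoc)
    also have "\<dots> = \<sigma> [^] (k * Suc i) \<otimes> g"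
      unfolding c using g \<sigma> by (simp add: m_assoc[symmetric] nat_pow_mult add.commute)
    finally show ?case .
  qed
  then show ?thesis by (simp add: k_def split: if_splits)
qed

text \<open>This commutation rule decides which polynomials in \<open>\<sigma>\<close> act by \<open>\<pi>\<close>-linear maps, and which of them have
  \<open>\<pi>\<close>-stable images.\<close>

lemma act_PA:
  assumes M: "gmodule G M" and g: "g \<in> carrier G" and x: "x \<in> carrier M"
  shows "act M g (PA M f x) = PA M (if \<epsilon> g = 1 then f else invert_var m f) (act M g x)"
proof -
  interpret M: gmodule G M by fact
  have gx: "act M g x \<in> carrier M" using g x by (rule M.act_closed)
  define k where "k = (if \<epsilon> g = 1 then 1 else m - 1)"
  have t: "act M (\<sigma> [^] i) x \<in> carrier M" for i :: nat using \<sigma> x by (intro M.act_closed) auto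
  have "act M g (PA M f x) = (\<Otimes>\<^bsub>M\<^esub>i\<in>{..Polynomial.degree f}. act M g (act M (\<sigma> [^] i) x [^]\<^bsub>M\<^esub> Polynomial.coeff f i))"
    unfolding poly_act_def
    by (rule hom_finprod_comm_group[OF M.M.comm_group_axioms M.M.comm_group_axioms
          group_hom.homh[OF M.act_group_hom[OF g]]]) (use t in auto)
  also have "\<dots> = (\<Otimes>\<^bsub>M\<^esub>i\<in>{..Polynomial.degree f}. act M (\<sigma> [^] (k * i)) (act M g x) [^]\<^bsub>M\<^esub> Polynomial.coeff f i)"
  proof (rule M.M.finprod_cong'[OF refl])
    fix i
    have "act M g (act M (\<sigma> [^] i) x) = act M (\<sigma> [^] (k * i)) (act M g x)"
      using g \<sigma> x conj_pow[OF g, of i] by (simp add: M.act_mult[symmetric] k_def)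
    then show "act M g (act M (\<sigma> [^] i) x [^]\<^bsub>M\<^esub> Polynomial.coeff f i) =
        act M (\<sigma> [^] (k * i)) (act M g x) [^]\<^bsub>M\<^esub> Polynomial.coeff f i"
      using M.act_int_pow[OF g t] by simp
  qed (use \<sigma> gx in \<open>auto intro!: M.M.int_pow_closed M.act_closed\<close>)
  also have "\<dots> = PA M (pcompose f (Polynomial.monom 1 k)) (act M g x)"
    by (simp only: pcompose_monom M.poly_act_sum[OF \<sigma> gx] M.poly_act_monom[OF \<sigma> gx])
  also have "pcompose f (Polynomial.monom 1 k) = (if \<epsilon> g = 1 then f else invert_var m f)"
    by (simp add: k_def invert_var_def pcompose_monom poly_as_sum_of_monoms)
  finally show ?thesis .
qed

lemma PA_endo:
  assumes M: "gmodule G M" and sym: "xpow1 m dvd invert_var m f - f"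
  shows "PA M f \<in> gmodule_hom G M M"
proof (rule gmodule_homI)
  interpret M: gmodule G M by fact
  interpret f: group_hom M M "PA M f" by (rule M.poly_act_group_hom[OF \<sigma>])
  show "PA M f x \<in> carrier M" if "x \<in> carrier M" for x using that by simp
  show "PA M f (x \<otimes>\<^bsub>M\<^esub> y) = PA M f x \<otimes>\<^bsub>M\<^esub> PA M f y" if "x \<in> carrier M" "y \<in> carrier M" for x y
    using that by simp
  fix g x assume "g \<in> carrier G" "x \<in> carrier M"
  then show "PA M f (act M g x) = act M g (PA M f x)"
    using act_PA[OF M, of g x f] PA_cong[OF M _ sym, of "act M g x"] M.act_closed by auto
qed

lemma PA_submodule:
  assumes M: "gmodule G M" and f: "f dvd invert_var m f"
  shows "submodule G M (PA M f ` carrier M)"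
  unfolding submodule_def
proof (intro conjI ballI)
  interpret M: gmodule G M by fact
  interpret f: group_hom M M "PA M f" by (rule M.poly_act_group_hom[OF \<sigma>])
  show "subgroup (PA M f ` carrier M) M" by (rule f.img_is_subgroup)
  fix g y assume g: "g \<in> carrier G" and "y \<in> PA M f ` carrier M"
  then obtain x where x: "x \<in> carrier M" "y = PA M f x" by blast
  then have gx: "act M g x \<in> carrier M" using M.act_closed g by blast
  obtain w where w: "invert_var m f = f * w" using f by (auto elim: dvdE)
  have "PA M (invert_var m f) (act M g x) = PA M f (PA M w (act M g x))"
    unfolding w by (rule M.poly_act_mult[OF \<sigma> gx])
  then show "act M g y \<in> PA M f ` carrier M"
    unfolding x(2) act_PA[OF M g x(1)] using gx M.poly_act_closed[OF \<sigma> gx] by auto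
qed

lemma PQ_module_projection:
  assumes M: "gmodule G M" and f: "f dvd invert_var m f"
  shows gmodule_PQ: "gmodule G (PQ M f)"
    and PQ_proj: "(\<lambda>x. PA M f ` carrier M #>\<^bsub>M\<^esub> x) \<in> gmodule_hom G M (PQ M f)"
    and PQ_surj: "(\<lambda>x. PA M f ` carrier M #>\<^bsub>M\<^esub> x) ` carrier M = carrier (PQ M f)"
    and PQ_kernel: "kernel M (PQ M f) (\<lambda>x. PA M f ` carrier M #>\<^bsub>M\<^esub> x) = PA M f ` carrier M"
  using gmodule.quot_module_proj[OF M PA_submodule[OF M f]] unfolding poly_quot_def by simp_all

lemma PQ_projE:
  assumes M: "gmodule G M" and f: "f dvd invert_var m f"
  obtains p where "p \<in> gmodule_hom G M (PQ M f)" "p ` carrier M = carrier (PQ M f)"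
    "\<And>x. x \<in> carrier M \<Longrightarrow> p x = \<one>\<^bsub>PQ M f\<^esub> \<longleftrightarrow> x \<in> PA M f ` carrier M"
proof (rule that[OF PQ_proj[OF M f] PQ_surj[OF M f]])
  fix x assume "x \<in> carrier M"
  then show "PA M f ` carrier M #>\<^bsub>M\<^esub> x = \<one>\<^bsub>PQ M f\<^esub> \<longleftrightarrow> x \<in> PA M f ` carrier M"
    by (subst (2) PQ_kernel[OF M f, symmetric]) (simp add: kernel_def)
qed

text \<open>For \<open>\<alpha>\<close> and \<open>\<beta>\<close> generating the unit ideal the sequence
  \<open>0 \<rightarrow> M/c\<alpha>\<beta>M \<rightarrow> M/c\<alpha>M \<oplus> M/c\<beta>M \<rightarrow> M/cM \<rightarrow> 0\<close> splits over \<open>\<langle>\<sigma>\<rangle>\<close> by \<open>1 = u\<alpha> + v\<beta>\<close>.  It splits over the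
  whole group because \<open>v\<beta>\<close> may be replaced by the symmetric \<open>V = v\<beta> \<cdot> (v\<beta>)(1/X)\<close>: \<open>V\<close> is still a
  multiple of \<open>\<beta>\<close>, and \<open>U = 1 - V\<close> one of \<open>\<alpha>\<close>.\<close>

lemma quotient_splitting:
  assumes M: "gmodule G M" and one: "ideal_const \<alpha> \<beta> 1" and \<alpha>: "\<alpha> dvd invert_var m \<alpha>"
    and c: "c dvd invert_var m c" "c * \<alpha> dvd invert_var m (c * \<alpha>)" "c * \<beta> dvd invert_var m (c * \<beta>)"
      "c * \<alpha> * \<beta> dvd invert_var m (c * \<alpha> * \<beta>)"
  shows "gmodule_iso G (direct_sum (PQ M (c * \<alpha>)) (PQ M (c * \<beta>))) (direct_sum (PQ M (c * \<alpha> * \<beta>)) (PQ M c))"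
proof -
  interpret M: gmodule G M by fact
  obtain u v where uv: "u * \<alpha> + v * \<beta> = 1" using one unfolding ideal_const_def by (auto simp: one_pCons)
  \<comment> \<open>\<open>V\<close> is symmetric modulo \<open>X\<^sup>m - 1\<close>, and \<open>1 - V\<close> is a multiple of \<open>\<alpha>\<close> because \<open>\<alpha>\<close> divides \<open>1 - V0\<close> and, being stable
    under \<open>X \<mapsto> 1/X\<close>, also \<open>1 - V0(1/X)\<close>.\<close>
  define V0 where "V0 = v * \<beta>"
  define V where "V = V0 * invert_var m V0"
  define U where "U = 1 - V"
  have V0: "1 - V0 = u * \<alpha>" using uv by (simp add: V0_def algebra_simps)
  have "\<alpha> dvd 1 - V0" unfolding V0 by simp
  moreover have "invert_var m (1 - V0) = 1 - invert_var m V0" by (simp add: invert_var_diff invert_var_1)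
  then have "\<alpha> dvd 1 - invert_var m V0" using \<alpha> unfolding V0 invert_var_mult by (metis dvd_mult)
  moreover have "U = (1 - invert_var m V0) + invert_var m V0 * (1 - V0)" by (simp add: U_def V_def algebra_simps)
  ultimately have "\<alpha> dvd U" by simp
  then obtain U' where U': "U = \<alpha> * U'" by (auto elim: dvdE)
  have V': "V = \<beta> * (v * invert_var m V0)" by (simp add: V_def V0_def)
  have "invert_var m V - V = invert_var m V0 * (invert_var m (invert_var m V0) - V0)"
    by (simp add: V_def invert_var_mult algebra_simps)
  then have symV: "xpow1 m dvd invert_var m V - V" using invert_var_involution[OF m, of V0] by simp
  have "invert_var m U - U = - (invert_var m V - V)" by (simp add: U_def invert_var_diff invert_var_1)
  then have symU: "xpow1 m dvd invert_var m U - U" using symV by (simp only: dvd_minus_iff)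
  have UV: "PA M U x \<otimes>\<^bsub>M\<^esub> PA M V x = x" if "x \<in> carrier M" for x
    unfolding M.poly_act_add[OF \<sigma> that, symmetric] using M.poly_act_one[OF \<sigma> that] by (simp add: U_def)
  interpret U: group_hom M M "PA M U" by (rule M.poly_act_group_hom[OF \<sigma>])
  interpret V: group_hom M M "PA M V" by (rule M.poly_act_group_hom[OF \<sigma>])
  define im where "im f = PA M f ` carrier M" for f
  have im_sub: "subgroup (im f) M" for f
    unfolding im_def by (rule group_hom.img_is_subgroup[OF M.poly_act_group_hom[OF \<sigma>]])
  have im_mult: "PA M h x \<in> im (f * h)" if "x \<in> im f" for f h x
  proof -
    obtain y where y: "y \<in> carrier M" "x = PA M f y" using \<open>x \<in> im f\<close> unfolding im_def by blast
    have "PA M h x = PA M (f * h) y" using M.poly_act_mult[OF \<sigma> y(1), of h f] y(2) by (simp add: mult.commute)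
    then show ?thesis unfolding im_def using y(1) by blast
  qed
  have im_mono: "im (f * h) \<subseteq> im f" for f h
  proof
    fix x assume "x \<in> im (f * h)"
    then obtain y where y: "y \<in> carrier M" "x = PA M (f * h) y" unfolding im_def by blast
    then have "x = PA M f (PA M h y)" using M.poly_act_mult[OF \<sigma> y(1)] by simp
    then show "x \<in> im f" unfolding im_def using M.poly_act_closed[OF \<sigma> y(1)] by blast
  qed
  obtain a where a: "a \<in> gmodule_hom G M (PQ M (c * \<alpha>))" "a ` carrier M = carrier (PQ M (c * \<alpha>))"
    "\<And>x. x \<in> carrier M \<Longrightarrow> a x = \<one>\<^bsub>PQ M (c * \<alpha>)\<^esub> \<longleftrightarrow> x \<in> im (c * \<alpha>)"
    by (rule PQ_projE[OF M c(2), folded im_def]) (rule that)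
  obtain b where b: "b \<in> gmodule_hom G M (PQ M (c * \<beta>))" "b ` carrier M = carrier (PQ M (c * \<beta>))"
    "\<And>x. x \<in> carrier M \<Longrightarrow> b x = \<one>\<^bsub>PQ M (c * \<beta>)\<^esub> \<longleftrightarrow> x \<in> im (c * \<beta>)"
    by (rule PQ_projE[OF M c(3), folded im_def]) (rule that)
  obtain l where l: "l \<in> gmodule_hom G M (PQ M (c * \<alpha> * \<beta>))" "l ` carrier M = carrier (PQ M (c * \<alpha> * \<beta>))"
    "\<And>x. x \<in> carrier M \<Longrightarrow> l x = \<one>\<^bsub>PQ M (c * \<alpha> * \<beta>)\<^esub> \<longleftrightarrow> x \<in> im (c * \<alpha> * \<beta>)"
    by (rule PQ_projE[OF M c(4), folded im_def]) (rule that)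
  obtain d where d: "d \<in> gmodule_hom G M (PQ M c)" "d ` carrier M = carrier (PQ M c)"
    "\<And>x. x \<in> carrier M \<Longrightarrow> d x = \<one>\<^bsub>PQ M c\<^esub> \<longleftrightarrow> x \<in> im c"
    by (rule PQ_projE[OF M c(1), folded im_def]) (rule that)
  let ?W = "direct_sum M M"
  let ?X = "direct_sum (PQ M (c * \<alpha>)) (PQ M (c * \<beta>))" and ?Y = "direct_sum (PQ M (c * \<alpha> * \<beta>)) (PQ M c)"
  have s: "map_prod a b \<in> gmodule_hom G ?W ?X" by (intro gmodule_hom_map_prod a b)
  \<comment> \<open>The matrix of \<open>t0\<close> has determinant \<open>-1\<close>, so \<open>t0\<close> is an automorphism of \<open>M \<oplus> M\<close>; it carries
    \<open>c\<alpha>M \<oplus> c\<beta>M\<close> to \<open>c\<alpha>\<beta>M \<oplus> cM\<close>.\<close>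
  define t0 where "t0 = (\<lambda>(x, y). (PA M V x \<otimes>\<^bsub>M\<^esub> PA M U y, x \<otimes>\<^bsub>M\<^esub> inv\<^bsub>M\<^esub> y))"
  have t0: "t0 \<in> gmodule_hom G ?W ?W"
    unfolding t0_def
  proof (rule gmodule_homI; clarsimp)
    fix x y x' y' assume xy: "x \<in> carrier M" "y \<in> carrier M" "x' \<in> carrier M" "y' \<in> carrier M"
    then show "PA M V x \<otimes>\<^bsub>M\<^esub> PA M V x' \<otimes>\<^bsub>M\<^esub> (PA M U y \<otimes>\<^bsub>M\<^esub> PA M U y') =
        PA M V x \<otimes>\<^bsub>M\<^esub> PA M U y \<otimes>\<^bsub>M\<^esub> (PA M V x' \<otimes>\<^bsub>M\<^esub> PA M U y') \<and>
        x \<otimes>\<^bsub>M\<^esub> x' \<otimes>\<^bsub>M\<^esub> inv\<^bsub>M\<^esub> (y \<otimes>\<^bsub>M\<^esub> y') = x \<otimes>\<^bsub>M\<^esub> inv\<^bsub>M\<^esub> y \<otimes>\<^bsub>M\<^esub> (x' \<otimes>\<^bsub>M\<^esub> inv\<^bsub>M\<^esub> y')"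
      by (simp add: M.M.inv_mult M.M.m_ac)
  next
    fix g x y assume g: "g \<in> carrier G" and xy: "x \<in> carrier M" "y \<in> carrier M"
    then show "PA M V (act M g x) \<otimes>\<^bsub>M\<^esub> PA M U (act M g y) = act M g (PA M V x \<otimes>\<^bsub>M\<^esub> PA M U y) \<and>
        act M g x \<otimes>\<^bsub>M\<^esub> inv\<^bsub>M\<^esub> act M g y = act M g (x \<otimes>\<^bsub>M\<^esub> inv\<^bsub>M\<^esub> y)"
      by (simp add: gmodule_homD(3)[OF PA_endo[OF M symV]] gmodule_homD(3)[OF PA_endo[OF M symU]]
          M.act_add M.act_inv)
  qed
  define t where "t z = map_prod l d (t0 z)" for z
  have t: "t \<in> gmodule_hom G ?W ?Y"
    unfolding t_def by (rule gmodule_hom_comp[OF t0]) (intro gmodule_hom_map_prod l d)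
  have cancel: "x \<otimes>\<^bsub>M\<^esub> (inv\<^bsub>M\<^esub> x \<otimes>\<^bsub>M\<^esub> y) = y" "x \<otimes>\<^bsub>M\<^esub> (y \<otimes>\<^bsub>M\<^esub> inv\<^bsub>M\<^esub> x) = y"
      "x \<otimes>\<^bsub>M\<^esub> (y \<otimes>\<^bsub>M\<^esub> (inv\<^bsub>M\<^esub> x \<otimes>\<^bsub>M\<^esub> z)) = y \<otimes>\<^bsub>M\<^esub> z"
    if xyz: "x \<in> carrier M" "y \<in> carrier M" "z \<in> carrier M" for x y z
  proof -
    show 1: "x \<otimes>\<^bsub>M\<^esub> (inv\<^bsub>M\<^esub> x \<otimes>\<^bsub>M\<^esub> y) = y" using xyz by (simp add: M.M.m_assoc[symmetric])
    show "x \<otimes>\<^bsub>M\<^esub> (y \<otimes>\<^bsub>M\<^esub> inv\<^bsub>M\<^esub> x) = y" using xyz 1 M.M.m_comm[of y "inv\<^bsub>M\<^esub> x"] by simp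
    have "x \<otimes>\<^bsub>M\<^esub> (inv\<^bsub>M\<^esub> x \<otimes>\<^bsub>M\<^esub> (y \<otimes>\<^bsub>M\<^esub> z)) = y \<otimes>\<^bsub>M\<^esub> z" using xyz by (simp add: M.M.m_assoc[symmetric])
    then show "x \<otimes>\<^bsub>M\<^esub> (y \<otimes>\<^bsub>M\<^esub> (inv\<^bsub>M\<^esub> x \<otimes>\<^bsub>M\<^esub> z)) = y \<otimes>\<^bsub>M\<^esub> z"
      using xyz M.M.m_lcomm[of y "inv\<^bsub>M\<^esub> x" z] by simp
  qed
  have inverse: "PA M V (z \<otimes>\<^bsub>M\<^esub> PA M U w) \<otimes>\<^bsub>M\<^esub> PA M U (z \<otimes>\<^bsub>M\<^esub> inv\<^bsub>M\<^esub> PA M V w) = z"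
      "(z \<otimes>\<^bsub>M\<^esub> PA M U w) \<otimes>\<^bsub>M\<^esub> inv\<^bsub>M\<^esub> (z \<otimes>\<^bsub>M\<^esub> inv\<^bsub>M\<^esub> PA M V w) = w"
    if zw: "z \<in> carrier M" "w \<in> carrier M" for z w
  proof -
    have comm: "PA M V (PA M U w) = PA M U (PA M V w)"
      using M.poly_act_mult[OF \<sigma> zw(2), of V U] M.poly_act_mult[OF \<sigma> zw(2), of U V] by (simp add: mult.commute)
    have "PA M V (z \<otimes>\<^bsub>M\<^esub> PA M U w) \<otimes>\<^bsub>M\<^esub> PA M U (z \<otimes>\<^bsub>M\<^esub> inv\<^bsub>M\<^esub> PA M V w) =
        (PA M U z \<otimes>\<^bsub>M\<^esub> PA M V z) \<otimes>\<^bsub>M\<^esub> (PA M U (PA M V w) \<otimes>\<^bsub>M\<^esub> inv\<^bsub>M\<^esub> PA M U (PA M V w))"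
      using zw by (simp add: comm M.M.m_ac cancel)
    then show "PA M V (z \<otimes>\<^bsub>M\<^esub> PA M U w) \<otimes>\<^bsub>M\<^esub> PA M U (z \<otimes>\<^bsub>M\<^esub> inv\<^bsub>M\<^esub> PA M V w) = z"
      using UV[OF zw(1)] zw by simp
    have "(z \<otimes>\<^bsub>M\<^esub> PA M U w) \<otimes>\<^bsub>M\<^esub> inv\<^bsub>M\<^esub> (z \<otimes>\<^bsub>M\<^esub> inv\<^bsub>M\<^esub> PA M V w) =
        (z \<otimes>\<^bsub>M\<^esub> inv\<^bsub>M\<^esub> z) \<otimes>\<^bsub>M\<^esub> (PA M U w \<otimes>\<^bsub>M\<^esub> PA M V w)"
      using zw by (simp add: M.M.inv_mult M.M.m_ac cancel)
    then show "(z \<otimes>\<^bsub>M\<^esub> PA M U w) \<otimes>\<^bsub>M\<^esub> inv\<^bsub>M\<^esub> (z \<otimes>\<^bsub>M\<^esub> inv\<^bsub>M\<^esub> PA M V w) = w"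
      using UV[OF zw(2)] zw by simp
  qed
  have inverse': "x = (PA M V x \<otimes>\<^bsub>M\<^esub> PA M U y) \<otimes>\<^bsub>M\<^esub> PA M U (x \<otimes>\<^bsub>M\<^esub> inv\<^bsub>M\<^esub> y)"
      "y = (PA M V x \<otimes>\<^bsub>M\<^esub> PA M U y) \<otimes>\<^bsub>M\<^esub> inv\<^bsub>M\<^esub> PA M V (x \<otimes>\<^bsub>M\<^esub> inv\<^bsub>M\<^esub> y)"
    if xy: "x \<in> carrier M" "y \<in> carrier M" for x y
  proof -
    have "(PA M V x \<otimes>\<^bsub>M\<^esub> PA M U y) \<otimes>\<^bsub>M\<^esub> PA M U (x \<otimes>\<^bsub>M\<^esub> inv\<^bsub>M\<^esub> y) =
        (PA M U x \<otimes>\<^bsub>M\<^esub> PA M V x) \<otimes>\<^bsub>M\<^esub> (PA M U y \<otimes>\<^bsub>M\<^esub> inv\<^bsub>M\<^esub> PA M U y)"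
      using xy by (simp add: M.M.m_ac cancel)
    then show "x = (PA M V x \<otimes>\<^bsub>M\<^esub> PA M U y) \<otimes>\<^bsub>M\<^esub> PA M U (x \<otimes>\<^bsub>M\<^esub> inv\<^bsub>M\<^esub> y)" using UV[OF xy(1)] xy by simp
    have "(PA M V x \<otimes>\<^bsub>M\<^esub> PA M U y) \<otimes>\<^bsub>M\<^esub> inv\<^bsub>M\<^esub> PA M V (x \<otimes>\<^bsub>M\<^esub> inv\<^bsub>M\<^esub> y) =
        (PA M U y \<otimes>\<^bsub>M\<^esub> PA M V y) \<otimes>\<^bsub>M\<^esub> (PA M V x \<otimes>\<^bsub>M\<^esub> inv\<^bsub>M\<^esub> PA M V x)"
      using xy by (simp add: M.M.inv_mult M.M.m_ac cancel)
    then show "y = (PA M V x \<otimes>\<^bsub>M\<^esub> PA M U y) \<otimes>\<^bsub>M\<^esub> inv\<^bsub>M\<^esub> PA M V (x \<otimes>\<^bsub>M\<^esub> inv\<^bsub>M\<^esub> y)" using UV[OF xy(2)] xy by simp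
  qed
  have s_surj: "map_prod a b ` carrier ?W = carrier ?X"
    using a(2) b(2) by (simp add: map_prod_surj_on)
  have t_surj: "t ` carrier ?W = carrier ?Y"
  proof (intro equalityI subsetI)
    fix y assume "y \<in> carrier ?Y"
    then obtain y1 y2 where "y = (y1, y2)" "y1 \<in> carrier (PQ M (c * \<alpha> * \<beta>))" "y2 \<in> carrier (PQ M c)" by auto
    then obtain z w where zw: "z \<in> carrier M" "w \<in> carrier M" "y = (l z, d w)"
      unfolding l(2)[symmetric] d(2)[symmetric] by blast
    then have "y = t (z \<otimes>\<^bsub>M\<^esub> PA M U w, z \<otimes>\<^bsub>M\<^esub> inv\<^bsub>M\<^esub> PA M V w)"
      unfolding t_def t0_def using inverse[OF zw(1,2)] by simp
    then show "y \<in> t ` carrier ?W" using zw by simp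
  qed (use gmodule_homD(1)[OF t] in blast)
  have "kernel ?W ?X (map_prod a b) = kernel ?W ?Y t"
  proof -
    have "x \<in> im (c * \<alpha>) \<and> y \<in> im (c * \<beta>) \<longleftrightarrow>
        PA M V x \<otimes>\<^bsub>M\<^esub> PA M U y \<in> im (c * \<alpha> * \<beta>) \<and> x \<otimes>\<^bsub>M\<^esub> inv\<^bsub>M\<^esub> y \<in> im c"
      if xy: "x \<in> carrier M" "y \<in> carrier M" for x y
    proof (intro iffI conjI; elim conjE)
      assume x: "x \<in> im (c * \<alpha>)" and y: "y \<in> im (c * \<beta>)"
      have "PA M V x \<in> im (c * \<alpha> * \<beta>)"
        using im_mult[OF x, of V] im_mono[of "c * \<alpha> * \<beta>"] unfolding V' by (auto simp: mult.assoc)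
      moreover have "PA M U y \<in> im (c * \<alpha> * \<beta>)"
        using im_mult[OF y, of U] im_mono[of "c * \<alpha> * \<beta>" U'] unfolding U' by (auto simp: mult_ac)
      ultimately show "PA M V x \<otimes>\<^bsub>M\<^esub> PA M U y \<in> im (c * \<alpha> * \<beta>)" by (rule subgroup.m_closed[OF im_sub])
      have "x \<in> im c" "y \<in> im c" using x y im_mono by blast+
      then show "x \<otimes>\<^bsub>M\<^esub> inv\<^bsub>M\<^esub> y \<in> im c"
        by (intro subgroup.m_closed[OF im_sub] subgroup.m_inv_closed[OF im_sub])
    next
      assume z: "PA M V x \<otimes>\<^bsub>M\<^esub> PA M U y \<in> im (c * \<alpha> * \<beta>)" and w: "x \<otimes>\<^bsub>M\<^esub> inv\<^bsub>M\<^esub> y \<in> im c"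
      have "PA M U (x \<otimes>\<^bsub>M\<^esub> inv\<^bsub>M\<^esub> y) \<in> im (c * \<alpha>)"
        using im_mult[OF w, of U] im_mono[of "c * \<alpha>" U'] unfolding U' by (auto simp: mult_ac)
      moreover have "PA M V x \<otimes>\<^bsub>M\<^esub> PA M U y \<in> im (c * \<alpha>)" using z im_mono by blast
      ultimately show "x \<in> im (c * \<alpha>)"
        by (subst inverse'(1)[OF xy]) (rule subgroup.m_closed[OF im_sub])
    next
      assume z: "PA M V x \<otimes>\<^bsub>M\<^esub> PA M U y \<in> im (c * \<alpha> * \<beta>)" and w: "x \<otimes>\<^bsub>M\<^esub> inv\<^bsub>M\<^esub> y \<in> im c"
      have "PA M V (x \<otimes>\<^bsub>M\<^esub> inv\<^bsub>M\<^esub> y) \<in> im (c * \<beta>)"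
        using im_mult[OF w, of V] im_mono[of "c * \<beta>"] unfolding V' by (auto simp: mult.assoc)
      moreover have "PA M V x \<otimes>\<^bsub>M\<^esub> PA M U y \<in> im (c * \<beta>)"
        using z im_mono[of "c * \<beta>" \<alpha>] by (auto simp: mult_ac)
      ultimately show "y \<in> im (c * \<beta>)"
        by (subst inverse'(2)[OF xy]) (intro subgroup.m_closed[OF im_sub _ subgroup.m_inv_closed[OF im_sub]])
    qed
    then show ?thesis using a(3) b(3) l(3) d(3) by (auto simp: kernel_def t_def t0_def)
  qed
  then show ?thesis
    using gmodule_iso_of_same_kernel[OF gmodule_direct_sum[OF M M]
        gmodule_direct_sum[OF gmodule_PQ[OF M c(2)] gmodule_PQ[OF M c(3)]]
        gmodule_direct_sum[OF gmodule_PQ[OF M c(4)] gmodule_PQ[OF M c(1)]] s s_surj t t_surj] by simp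
qed

end

section \<open>Quotients of invertible lattices\<close>

lemma functional_descend:
  assumes W: "gmodule G W" and X: "gmodule G X"
    and s: "s \<in> gmodule_hom G W X" "s ` carrier W = carrier X"
    and \<phi>: "\<phi> \<in> functional W" and ker: "\<And>w. w \<in> carrier W \<Longrightarrow> s w = \<one>\<^bsub>X\<^esub> \<Longrightarrow> \<phi> w = 0"
  obtains \<psi> where "\<psi> \<in> functional X" "\<And>w. w \<in> carrier W \<Longrightarrow> \<psi> (s w) = \<phi> w"
proof -
  interpret W: gmodule G W by fact
  interpret s: group_hom W X s by (rule gmodule_hom_group_hom[OF W X s(1)])
  define \<psi> where "\<psi> y = \<phi> (SOME w. w \<in> carrier W \<and> s w = y)" for y
  have \<psi>: "\<psi> (s w) = \<phi> w" if w: "w \<in> carrier W" for w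
  proof -
    let ?v = "SOME v. v \<in> carrier W \<and> s v = s w"
    have v: "?v \<in> carrier W" "s ?v = s w"
      using someI[of "\<lambda>v. v \<in> carrier W \<and> s v = s w" w] w by auto
    have "s (?v \<otimes>\<^bsub>W\<^esub> inv\<^bsub>W\<^esub> w) = \<one>\<^bsub>X\<^esub>"
      using group_hom_kernel_eq[OF s.group_hom_axioms v(1) w] v(2) by simp
    then have "\<phi> (?v \<otimes>\<^bsub>W\<^esub> inv\<^bsub>W\<^esub> w) = 0" using v(1) w by (intro ker) simp_all
    then show ?thesis
      unfolding \<psi>_def using v(1) w by (simp add: functional_mult[OF \<phi>] W.M.functional_inv[OF \<phi>])
  qed
  have "\<psi> \<in> functional X"
  proof (rule functionalI)
    fix x y assume "x \<in> carrier X" "y \<in> carrier X"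
    then obtain v w where "v \<in> carrier W" "x = s v" "w \<in> carrier W" "y = s w"
      unfolding s(2)[symmetric] by blast
    then show "\<psi> (x \<otimes>\<^bsub>X\<^esub> y) = \<psi> x + \<psi> y"
      by (simp add: \<psi> functional_mult[OF \<phi>] del: s.hom_mult add: s.hom_mult[symmetric])
  qed
  with \<psi> show ?thesis using that by blast
qed

context cyclic_normal
begin

lemmas grp_fin = group_axioms fin

lemma xpow1_dvd_invert_var:
  assumes "n dvd m"
  shows "xpow1 n dvd invert_var m (xpow1 n)"
proof -
  have n: "n > 0" using assms m by (rule dvd_pos_nat[rotated])
  show ?thesis
    unfolding cyclotomic_prod_divisors[OF n, symmetric]
    by (rule cyclotomic_prod_dvd_invert_var[OF m]) (use assms in \<open>auto intro: dvd_trans\<close>)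
qed

text \<open>\<open>(\<sigma>\<^sup>n - 1)P\<close> is the augmentation image of \<open>\<langle>\<sigma>\<^sup>n\<rangle>\<close>, so \<open>P/(\<sigma>\<^sup>n - 1)P\<close> has the orbits of
  \<open>\<langle>\<sigma>\<^sup>n\<rangle>\<close> on the basis of \<open>P\<close> as a basis.\<close>

lemma permutation_PQ_xpow1:
  assumes P: "permutation_lattice G P" and n: "n dvd m"
  shows "permutation_lattice G (PQ P (xpow1 n))"
proof -
  note Pm = permutation_lattice_gmodule[OF P]
  note st = xpow1_dvd_invert_var[OF n]
  note Qm = gmodule_PQ[OF Pm st]
  interpret P: gmodule G P by fact
  interpret Q: gmodule G "PQ P (xpow1 n)" by fact
  define H where "H = {\<sigma> [^] (n * k) | k :: nat. True}"
  have H: "subgroup H G"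
  proof (rule subgroupI)
    show "H \<subseteq> carrier G" using \<sigma> by (auto simp: H_def)
    show "H \<noteq> {}" by (auto simp: H_def)
    fix a assume "a \<in> H"
    then obtain k where a: "a = \<sigma> [^] (n * k)" by (auto simp: H_def)
    have "\<sigma> [^] (n * (k * (m - 1))) \<otimes> a = \<sigma> [^] (m * (n * k))"
      unfolding a using m \<sigma> by (cases m) (simp_all add: nat_pow_mult algebra_simps)
    also have "\<dots> = \<one>" using \<sigma>_pow \<sigma> by (simp add: nat_pow_pow[symmetric])
    finally have "inv a = \<sigma> [^] (n * (k * (m - 1)))" using \<sigma> by (intro inv_equality) (simp_all add: a)
    then show "inv a \<in> H" unfolding H_def by blast
    fix b assume "b \<in> H"
    then obtain l where b: "b = \<sigma> [^] (n * l)" by (auto simp: H_def)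
    have "a \<otimes> b = \<sigma> [^] (n * (k + l))" unfolding a b using \<sigma> by (simp add: nat_pow_mult algebra_simps)
    then show "a \<otimes> b \<in> H" unfolding H_def by blast
  qed
  note HG = subgroup.subset[OF H]
  interpret x: group_hom P P "PA P (xpow1 n)" by (rule P.poly_act_group_hom[OF \<sigma>])
  have im: "PA P (xpow1 n) ` carrier P = augmentation_image H P"
  proof
    have "\<sigma> [^] n = \<sigma> [^] (n * 1)" by simp
    then have nH: "\<sigma> [^] n \<in> H" unfolding H_def by blast
    show "PA P (xpow1 n) ` carrier P \<subseteq> augmentation_image H P"
      using P.augmentation_incl[OF nH] by (auto simp: P.poly_act_xpow1[OF \<sigma>])
    show "augmentation_image H P \<subseteq> PA P (xpow1 n) ` carrier P"
      unfolding augmentation_image_def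
    proof (rule P.M.generate_subgroup_incl[OF _ x.img_is_subgroup], rule subsetI)
      fix z assume "z \<in> {act P h x \<otimes>\<^bsub>P\<^esub> inv\<^bsub>P\<^esub> x | h x. h \<in> H \<and> x \<in> carrier P}"
      then obtain k x where x: "x \<in> carrier P" and z: "z = act P (\<sigma> [^] (n * k)) x \<otimes>\<^bsub>P\<^esub> inv\<^bsub>P\<^esub> x"
        unfolding H_def by blast
      obtain w where "xpow1 (n * k) = xpow1 n * w"
        using xpow1_dvd_monom_diff[of n 1 k 0] by (auto simp: monom_eq_1 elim: dvdE)
      then have "z = PA P (xpow1 n) (PA P w x)"
        unfolding z P.poly_act_xpow1[OF \<sigma> x, symmetric] P.poly_act_mult[OF \<sigma> x, symmetric] by simp
      then show "z \<in> PA P (xpow1 n) ` carrier P" using P.poly_act_closed[OF \<sigma> x] by blast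
    qed
  qed
  obtain p where p: "p \<in> gmodule_hom G P (PQ P (xpow1 n))" "p ` carrier P = carrier (PQ P (xpow1 n))"
    "\<And>x. x \<in> carrier P \<Longrightarrow> p x = \<one>\<^bsub>PQ P (xpow1 n)\<^esub> \<longleftrightarrow> x \<in> augmentation_image H P"
    by (rule PQ_projE[OF Pm st, unfolded im]) (rule that)
  interpret p: group_hom P "PQ P (xpow1 n)" p by (rule gmodule_hom_group_hom[OF Pm Qm p(1)])
  obtain B \<phi> where B: "finite B" "B \<subseteq> carrier P" "generate P B = carrier P"
    and \<phi>: "\<And>b. b \<in> B \<Longrightarrow> \<phi> b \<in> functional P"
    "\<And>b b'. b \<in> B \<Longrightarrow> b' \<in> B \<Longrightarrow> \<phi> b b' = (if b' = b then 1 else 0)"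
    and B_st: "\<And>g b. g \<in> carrier G \<Longrightarrow> b \<in> B \<Longrightarrow> act P g b \<in> B"
    using P by (rule permutation_latticeE) (rule that)
  have BP: "b \<in> carrier P" if "b \<in> B" for b using that B by blast
  define orb where "orb b = (\<lambda>h. act P h b) ` H" for b
  have orb_B: "orb b \<subseteq> B" if "b \<in> B" for b using B_st HG that by (auto simp: orb_def)
  have finH: "finite H" using HG fin finite_subset by blast
  \<comment> \<open>The functionals dual to the classes of the orbits.\<close>
  define S where "S b x = (\<Sum>a\<in>orb b. \<phi> a x)" for b x
  have S_fun: "S b \<in> functional P" if b: "b \<in> B" for b
    unfolding S_def using orb_B[OF b] \<phi>(1)
    by (intro functionalI) (auto simp: functional_mult subset_iff sum.distrib[symmetric] intro!: sum.cong)
  have S_act: "S b (act P h x) = S b x" if b: "b \<in> B" and h: "h \<in> H" and x: "x \<in> carrier P" for b h x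
  proof -
    have hG: "h \<in> carrier G" using h HG by blast
    have "S b (act P h x) = (\<Sum>a\<in>orb b. \<phi> (act P (inv h) a) x)"
      unfolding S_def using orb_B[OF b]
      by (intro sum.cong refl P.coord_act[OF B(2,3) \<phi> B_st hG _ x]) auto
    also have "\<dots> = (\<Sum>a\<in>orb b. \<phi> a x)"
    proof (rule sum.reindex_bij_witness[of _ "act P h" "act P (inv h)"])
      have stab: "act P k a \<in> orb b" if "k \<in> H" "a \<in> orb b" for k a
      proof -
        have "act P k a \<in> (\<lambda>h. act P h a) ` H" using that(1) by blast
        then show ?thesis
          using P.orbit_in_orbit[OF H BP[OF b], of a] that(2) unfolding orb_def by blast
      qed
      fix a assume a: "a \<in> orb b"
      then have aP: "a \<in> carrier P" using orb_B[OF b] BP by blast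
      show "act P h (act P (inv h) a) = a" "act P (inv h) (act P h a) = a" using aP hG by simp_all
      show "act P (inv h) a \<in> orb b" "act P h a \<in> orb b"
        using stab a h subgroup.m_inv_closed[OF H h] by blast+
    qed simp
    finally show ?thesis by (simp add: S_def)
  qed
  have S_zero: "S b x = 0" if b: "b \<in> B" and x: "x \<in> augmentation_image H P" for b x
  proof (rule P.M.functional_eq_on_generate[OF S_fun[OF b] _ P.augmentation_gens[OF HG] x[unfolded augmentation_image_def],
        where \<psi> = "\<lambda>_. 0"])
    show "(\<lambda>_. 0) \<in> functional P" by (intro functionalI) simp
    fix s assume "s \<in> {act P h x \<otimes>\<^bsub>P\<^esub> inv\<^bsub>P\<^esub> x | h x. h \<in> H \<and> x \<in> carrier P}"
    then obtain h x where hx: "h \<in> H" "x \<in> carrier P" "s = act P h x \<otimes>\<^bsub>P\<^esub> inv\<^bsub>P\<^esub> x" by blast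
    then have "act P h x \<in> carrier P" using HG P.act_closed by blast
    then show "S b s = 0"
      using hx S_act[OF b hx(1,2)] by (simp add: functional_mult[OF S_fun[OF b]] P.M.functional_inv[OF S_fun[OF b]])
  qed
  have "\<exists>\<psi>. \<psi> \<in> functional (PQ P (xpow1 n)) \<and> (\<forall>x\<in>carrier P. \<psi> (p x) = S b x)" if b: "b \<in> B" for b
  proof -
    obtain \<psi> where "\<psi> \<in> functional (PQ P (xpow1 n))" "\<And>x. x \<in> carrier P \<Longrightarrow> \<psi> (p x) = S b x"
      by (rule functional_descend[OF Pm Qm p(1,2) S_fun[OF b]]) (use p(3) S_zero[OF b] that in auto)
    then show ?thesis by blast
  qed
  then have "\<forall>b\<in>B. \<exists>\<psi>. \<psi> \<in> functional (PQ P (xpow1 n)) \<and> (\<forall>x\<in>carrier P. \<psi> (p x) = S b x)" by blast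
  then obtain \<psi> where "\<forall>b\<in>B. \<psi> b \<in> functional (PQ P (xpow1 n)) \<and> (\<forall>x\<in>carrier P. \<psi> b (p x) = S b x)"
    by (rule bchoice[THEN exE])
  then have \<psi>: "\<psi> b \<in> functional (PQ P (xpow1 n))" "\<And>x. x \<in> carrier P \<Longrightarrow> \<psi> b (p x) = S b x" if "b \<in> B" for b
    using that by blast+
  have S_B: "S b b' = (if b' \<in> orb b then 1 else 0)" if b: "b \<in> B" "b' \<in> B" for b b'
  proof -
    have "S b b' = (\<Sum>a\<in>orb b. if b' = a then 1 else 0)"
      unfolding S_def using orb_B[OF b(1)] b(2) \<phi>(2) by (intro sum.cong) (auto simp: subset_iff)
    then show ?thesis using finH by (simp add: orb_def)
  qed
  have same: "p b' = p b \<longleftrightarrow> b' \<in> orb b" if b: "b \<in> B" "b' \<in> B" for b b'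
  proof
    assume "p b' = p b"
    then have "S b b' = S b b" using \<psi>(2)[OF b(1)] BP b by metis
    moreover have "b \<in> orb b" unfolding orb_def using subgroup.one_closed[OF H] P.act_one[OF BP[OF b(1)]] by force
    ultimately show "b' \<in> orb b" using S_B b by (simp split: if_splits)
  next
    assume "b' \<in> orb b"
    then obtain h where h: "h \<in> H" "b' = act P h b" unfolding orb_def by blast
    have "p (b' \<otimes>\<^bsub>P\<^esub> inv\<^bsub>P\<^esub> b) = \<one>\<^bsub>PQ P (xpow1 n)\<^esub>"
      using p(3)[of "b' \<otimes>\<^bsub>P\<^esub> inv\<^bsub>P\<^esub> b"] P.augmentation_incl[OF h(1) BP[OF b(1)]] h(2) BP b by simp
    then show "p b' = p b" using group_hom_kernel_eq[OF p.group_hom_axioms BP BP] b by simp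
  qed
  define \<beta> where "\<beta> c = (SOME b. b \<in> B \<and> p b = c)" for c
  have \<beta>: "\<beta> c \<in> B \<and> p (\<beta> c) = c" if "c \<in> p ` B" for c
    unfolding \<beta>_def by (rule someI_ex) (use that in blast)
  have "int_basis (PQ P (xpow1 n)) (p ` B)"
  proof (rule Q.M.int_basisI[where \<phi> = "\<lambda>c. \<psi> (\<beta> c)"])
    show "finite (p ` B)" using B(1) by simp
    show "p ` B \<subseteq> carrier (PQ P (xpow1 n))" using BP p.hom_closed by blast
    show "generate (PQ P (xpow1 n)) (p ` B) = carrier (PQ P (xpow1 n))"
      unfolding p.generate_img[OF B(2)] B(3) p(2) by (rule refl)
    fix c assume c: "c \<in> p ` B"
    show "\<psi> (\<beta> c) \<in> functional (PQ P (xpow1 n))" using \<beta>[OF c] \<psi>(1) by blast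
    fix c' assume "c' \<in> p ` B"
    then obtain b' where b': "b' \<in> B" "c' = p b'" by blast
    have "\<psi> (\<beta> c) c' = S (\<beta> c) b'" unfolding b'(2) using \<beta>[OF c] b'(1) by (intro \<psi>(2) BP) auto
    also have "\<dots> = (if c' = c then 1 else 0)"
      using S_B[of "\<beta> c" b'] same[of "\<beta> c" b'] \<beta>[OF c] b' by simp
    finally show "\<psi> (\<beta> c) c' = (if c' = c then 1 else 0)" .
  qed
  then show ?thesis
  proof (rule permutation_latticeI[OF fin Qm])
    fix g c assume g: "g \<in> carrier G" and "c \<in> p ` B"
    then obtain b where b: "b \<in> B" "c = p b" by blast
    have "act (PQ P (xpow1 n)) g c = p (act P g b)"
      unfolding b(2) using gmodule_homD(3)[OF p(1) g BP[OF b(1)]] by simp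
    then show "act (PQ P (xpow1 n)) g c \<in> p ` B" using B_st[OF g b(1)] by blast
  qed
qed

lemma PA_direct_sum:
  assumes M: "gmodule G M" and N: "gmodule G N" and x: "x \<in> carrier M" and y: "y \<in> carrier N"
  shows "PA (direct_sum M N) f (x, y) = (PA M f x, PA N f y)"
proof (rule prod_eqI)
  note S = gmodule_direct_sum[OF M N]
  have xy: "(x, y) \<in> carrier (direct_sum M N)" using x y by simp
  show "fst (PA (direct_sum M N) f (x, y)) = fst (PA M f x, PA N f y)"
    using hom_poly_act[OF S M fst_gmodule_hom \<sigma> xy] by simp
  show "snd (PA (direct_sum M N) f (x, y)) = snd (PA M f x, PA N f y)"
    using hom_poly_act[OF S N snd_gmodule_hom \<sigma> xy] by simp
qed

text \<open>If \<open>M \<oplus> N\<close> is a permutation lattice \<open>P\<close>, then \<open>M/(\<sigma>\<^sup>n - 1)M \<oplus> N/(\<sigma>\<^sup>n - 1)N\<close> is the permutation lattice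
  \<open>P/(\<sigma>\<^sup>n - 1)P\<close>.\<close>

lemma invertible_PQ_xpow1:
  assumes M: "invertible_lattice G M" and n: "n dvd m"
  shows "invertible_lattice G (PQ M (xpow1 n))"
proof -
  obtain N P :: "('g, univ) gmodule" where N: "pi_lattice G N" and P: "permutation_lattice G P"
    and iso: "gmodule_iso G (direct_sum M N) P"
    using M by (rule invertible_latticeE[OF grp_fin]) (rule that)
  note Mm = invertible_gmodule[OF grp_fin M] and Nm = pi_latticeD(1)[OF N] and Pm = permutation_lattice_gmodule[OF P]
  note Sm = gmodule_direct_sum[OF Mm Nm]
  note st = xpow1_dvd_invert_var[OF n]
  let ?f = "xpow1 n"
  obtain a where a: "a \<in> gmodule_hom G M (PQ M ?f)" "a ` carrier M = carrier (PQ M ?f)"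
    "\<And>x. x \<in> carrier M \<Longrightarrow> a x = \<one>\<^bsub>PQ M ?f\<^esub> \<longleftrightarrow> x \<in> PA M ?f ` carrier M"
    by (rule PQ_projE[OF Mm st]) (rule that)
  obtain b where b: "b \<in> gmodule_hom G N (PQ N ?f)" "b ` carrier N = carrier (PQ N ?f)"
    "\<And>x. x \<in> carrier N \<Longrightarrow> b x = \<one>\<^bsub>PQ N ?f\<^esub> \<longleftrightarrow> x \<in> PA N ?f ` carrier N"
    by (rule PQ_projE[OF Nm st]) (rule that)
  obtain p where p: "p \<in> gmodule_hom G P (PQ P ?f)" "p ` carrier P = carrier (PQ P ?f)"
    "\<And>x. x \<in> carrier P \<Longrightarrow> p x = \<one>\<^bsub>PQ P ?f\<^esub> \<longleftrightarrow> x \<in> PA P ?f ` carrier P"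
    by (rule PQ_projE[OF Pm st]) (rule that)
  obtain f h where f: "f \<in> gmodule_hom G (direct_sum M N) P" and h: "h \<in> gmodule_hom G P (direct_sum M N)"
    and hf: "\<And>x. x \<in> carrier (direct_sum M N) \<Longrightarrow> h (f x) = x" and fh: "\<And>x. x \<in> carrier P \<Longrightarrow> f (h x) = x"
    using iso Sm by (rule gmodule_isoE) (rule that)
  note fP = gmodule_homD(1)[OF f] and hS = gmodule_homD(1)[OF h]
  define t where "t z = p (f z)" for z
  have s: "map_prod a b \<in> gmodule_hom G (direct_sum M N) (direct_sum (PQ M ?f) (PQ N ?f))"
    by (intro gmodule_hom_map_prod a b)
  have s_surj: "map_prod a b ` carrier (direct_sum M N) = carrier (direct_sum (PQ M ?f) (PQ N ?f))"
    using a(2) b(2) by (simp add: map_prod_surj_on)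
  have t: "t \<in> gmodule_hom G (direct_sum M N) (PQ P ?f)"
    unfolding t_def by (rule gmodule_hom_comp[OF f p(1)])
  have "f ` carrier (direct_sum M N) = carrier P"
  proof (intro equalityI subsetI)
    fix x assume x: "x \<in> carrier P"
    show "x \<in> f ` carrier (direct_sum M N)" using fh[OF x] hS[OF x] by (intro image_eqI[of _ _ "h x"]) simp_all
  qed (use fP in blast)
  then have t_surj: "t ` carrier (direct_sum M N) = carrier (PQ P ?f)"
    unfolding t_def p(2)[symmetric] image_image[of p f, symmetric] by simp
  have eq: "(x \<in> PA M ?f ` carrier M \<and> y \<in> PA N ?f ` carrier N) \<longleftrightarrow> f (x, y) \<in> PA P ?f ` carrier P"
    if xy: "x \<in> carrier M" "y \<in> carrier N" for x y
  proof
    assume "x \<in> PA M ?f ` carrier M \<and> y \<in> PA N ?f ` carrier N"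
    then obtain x' y' where x': "x' \<in> carrier M" "x = PA M ?f x'" and y': "y' \<in> carrier N" "y = PA N ?f y'" by blast
    have m: "(x', y') \<in> carrier (direct_sum M N)" using x' y' by simp
    have "f (x, y) = PA P ?f (f (x', y'))"
      unfolding x'(2) y'(2) PA_direct_sum[OF Mm Nm x'(1) y'(1), symmetric]
      by (rule hom_poly_act[OF Sm Pm f \<sigma> m])
    then show "f (x, y) \<in> PA P ?f ` carrier P" using fP[OF m] by blast
  next
    assume "f (x, y) \<in> PA P ?f ` carrier P"
    then obtain w where w: "w \<in> carrier P" "f (x, y) = PA P ?f w" by blast
    obtain x' y' where hw: "h w = (x', y')" "x' \<in> carrier M" "y' \<in> carrier N" using hS[OF w(1)] by auto
    have "(x, y) = h (f (x, y))" using xy by (simp add: hf)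
    also have "\<dots> = PA (direct_sum M N) ?f (h w)"
      unfolding w(2) by (rule hom_poly_act[OF Pm Sm h \<sigma> w(1)])
    also have "\<dots> = (PA M ?f x', PA N ?f y')" unfolding hw(1) by (rule PA_direct_sum[OF Mm Nm hw(2,3)])
    finally show "x \<in> PA M ?f ` carrier M \<and> y \<in> PA N ?f ` carrier N" using hw by simp
  qed
  have "a x = \<one>\<^bsub>PQ M ?f\<^esub> \<and> b y = \<one>\<^bsub>PQ N ?f\<^esub> \<longleftrightarrow> t (x, y) = \<one>\<^bsub>PQ P ?f\<^esub>"
    if xy: "x \<in> carrier M" "y \<in> carrier N" for x y
  proof -
    have "f (x, y) \<in> carrier P" using fP[of "(x, y)"] xy by simp
    then show ?thesis unfolding t_def a(3)[OF xy(1)] b(3)[OF xy(2)] using p(3) eq[OF xy] by blast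
  qed
  then have "kernel (direct_sum M N) (direct_sum (PQ M ?f) (PQ N ?f)) (map_prod a b) = kernel (direct_sum M N) (PQ P ?f) t"
    by (auto simp: kernel_def)
  then have "gmodule_iso G (direct_sum (PQ M ?f) (PQ N ?f)) (PQ P ?f)"
    by (rule gmodule_iso_of_same_kernel[OF Sm gmodule_direct_sum[OF gmodule_PQ[OF Mm st] gmodule_PQ[OF Nm st]]
          gmodule_PQ[OF Pm st] s s_surj t t_surj])
  then show ?thesis
    by (rule invertible_summand_permutation[OF grp_fin gmodule_PQ[OF Mm st] gmodule_PQ[OF Nm st]
          permutation_PQ_xpow1[OF P n]])
qed

lemma permutation_PQ_1:
  assumes M: "gmodule G M"
  shows "permutation_lattice G (PQ M 1)"
proof -
  have st: "(1::int poly) dvd invert_var m 1" by simp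
  note Qm = gmodule_PQ[OF M st]
  interpret M: gmodule G M by fact
  interpret Q: gmodule G "PQ M 1" by fact
  obtain p where p: "p ` carrier M = carrier (PQ M 1)"
    "\<And>x. x \<in> carrier M \<Longrightarrow> p x = \<one>\<^bsub>PQ M 1\<^esub> \<longleftrightarrow> x \<in> PA M 1 ` carrier M"
    by (rule PQ_projE[OF M st]) (rule that)
  have "p x = \<one>\<^bsub>PQ M 1\<^esub>" if x: "x \<in> carrier M" for x
    unfolding p(2)[OF x] using M.poly_act_one[OF \<sigma> x] x by (intro image_eqI[of _ _ x]) simp_all
  then have "carrier (PQ M 1) \<subseteq> {\<one>\<^bsub>PQ M 1\<^esub>}" unfolding p(1)[symmetric] by blast
  then have "carrier (PQ M 1) = {\<one>\<^bsub>PQ M 1\<^esub>}" using Q.M.one_closed by blast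
  then have "int_basis (PQ M 1) {}"
    using Q.M.generate_empty by (intro Q.M.int_basisI[where \<phi> = "\<lambda>_ _. 0"]) simp_all
  then show ?thesis by (rule permutation_latticeI[OF fin Qm]) simp
qed

definition proper_poly :: "nat \<Rightarrow> int poly" where
  "proper_poly n = cyclotomic_prod {d. d dvd n \<and> d < n}"

text \<open>The flabby class of the \<open>\<Phi>\<^sub>n\<close>-part of \<open>M\<close>, read off from the sequence
  \<open>0 \<rightarrow> L \<rightarrow> M/(\<sigma>\<^sup>n - 1)M \<rightarrow> M/g(\<sigma>)M \<rightarrow> 0\<close> with \<open>g = (X\<^sup>n - 1)/\<Phi>\<^sub>n\<close>.\<close>

definition phi_class :: "('g, 'a) gmodule \<Rightarrow> nat \<Rightarrow> ('g, univ) gmodule set" where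
  "phi_class M n = sim_class G (PQ M (proper_poly n)) \<otimes>\<^bsub>flabby_monoid G\<^esub>
     inv\<^bsub>flabby_monoid G\<^esub> sim_class G (PQ M (xpow1 n))"

text \<open>Adding a maximal element \<open>n\<close> to a divisor-closed set \<open>D\<close> adds the same class to \<open>M/\<Psi>\<^sub>DM\<close> as it
  does when \<open>D\<close> consists of the proper divisors of \<open>n\<close>, because \<open>\<Phi>\<^sub>n\<close> generates the unit ideal
  together with each \<open>\<Phi>\<^sub>e\<close>, \<open>e \<in> D\<close> not a divisor of \<open>n\<close>.\<close>

lemma divisor_closed_quotient:
  assumes M: "invertible_lattice G M" and D: "\<And>d. d \<in> D \<Longrightarrow> d dvd m"
    and closed: "\<And>d e. d \<in> D \<Longrightarrow> e dvd d \<Longrightarrow> e \<in> D"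
  shows "invertible_lattice G (PQ M (cyclotomic_prod D)) \<and>
    (\<forall>d\<in>D. phi_class M d \<in> Units (flabby_monoid G)) \<and>
    sim_class G (PQ M (cyclotomic_prod D)) \<otimes>\<^bsub>flabby_monoid G\<^esub> (\<Otimes>\<^bsub>flabby_monoid G\<^esub>d\<in>D. phi_class M d)
      = \<one>\<^bsub>flabby_monoid G\<^esub>"
  using D closed
proof (induction "card D" arbitrary: D rule: less_induct)
  case less
  let ?F = "flabby_monoid G"
  interpret F: comm_monoid ?F by (rule comm_monoid_flabby_monoid[OF grp_fin])
  note Mm = invertible_gmodule[OF grp_fin M]
  note D = less.prems(1) and closed = less.prems(2)
  have finD: "finite D" using D m by (intro finite_subset[OF _ finite_divisors_nat[of m]]) auto
  show ?case
  proof (cases "D = {}")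
    case True
    have "sim_class G (PQ M 1) = \<one>\<^bsub>?F\<^esub>" by (rule sim_class_permutation[OF grp_fin permutation_PQ_1[OF Mm]])
    then show ?thesis
      using True invertible_permutation[OF grp_fin permutation_PQ_1[OF Mm]] by simp
  next
    case False
    define n where "n = Max D"
    have nD: "n \<in> D" and n_max: "\<And>d. d \<in> D \<Longrightarrow> d \<le> n" using finD False by (simp_all add: n_def)
    have nm: "n dvd m" using D nD by blast
    have n0: "n > 0" using nm m by (rule dvd_pos_nat[rotated])
    define D' where "D' = D - {n}"
    define P where "P = {d. d dvd n \<and> d < n}"
    have finD': "finite D'" using finD by (simp add: D'_def)
    have cardD': "card D' < card D" using finD nD unfolding D'_def by (rule card_Diff1_less)
    have PD': "P \<subseteq> D'" using closed[OF nD] by (auto simp: P_def D'_def)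
    have cardP: "card P < card D" using card_mono[OF finD' PD'] cardD' by simp
    have finP: "finite P" using PD' finD' by (rule finite_subset)
    have D'_closed: "e \<in> D'" if "d \<in> D'" "e dvd d" for d e
    proof -
      have "d \<in> D" "d \<noteq> n" using that(1) by (auto simp: D'_def)
      then have "d < n" using n_max[of d] by simp
      moreover have "d > 0" using D[OF \<open>d \<in> D\<close>] m by (rule dvd_pos_nat[rotated])
      then have "e \<le> d" using that(2) by (rule dvd_imp_le[rotated])
      ultimately show ?thesis using closed[OF \<open>d \<in> D\<close> that(2)] by (simp add: D'_def)
    qed
    have D'_dvd: "d dvd m" if "d \<in> D'" for d using D that by (simp add: D'_def)
    have P_dvd: "d dvd m" if "d \<in> P" for d using nm that by (auto simp: P_def intro: dvd_trans)
    have P_closed: "e \<in> P" if "d \<in> P" "e dvd d" for d e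
    proof -
      have "d dvd n" "d < n" using that(1) by (auto simp: P_def)
      then have "e \<le> d" using that(2) n0 by (intro dvd_imp_le) (auto intro: dvd_pos_nat)
      then show ?thesis using \<open>d dvd n\<close> \<open>d < n\<close> that(2) by (auto simp: P_def intro: dvd_trans)
    qed
    define E where "E = D' - P"
    have "ideal_const (cyclotomic n) (cyclotomic e) 1" if e: "e \<in> E" for e
    proof (rule ideal_const_cyclotomic_coprime[OF n0])
      have eD: "e \<in> D" "e \<noteq> n" "e \<notin> P" using e by (auto simp: E_def D'_def)
      show "e > 0" using D[OF eD(1)] m by (rule dvd_pos_nat[rotated])
      have "e < n" using n_max[OF eD(1)] eD(2) by simp
      then show "\<not> e dvd n" using eD(3) by (simp add: P_def)
      show "\<not> n dvd e" using \<open>e < n\<close> \<open>e > 0\<close> by (auto dest: dvd_imp_le)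
    qed
    then have "ideal_const (cyclotomic n) (cyclotomic_prod E) 1" by (rule ideal_const_prod)
    then have one: "ideal_const (cyclotomic_prod E) (cyclotomic n) 1"
      unfolding ideal_const_def by (metis add.commute)
    have split: "cyclotomic_prod P * cyclotomic_prod E = cyclotomic_prod D'"
      "cyclotomic_prod P * cyclotomic n = xpow1 n"
      "cyclotomic_prod D' * cyclotomic n = cyclotomic_prod D"
    proof -
      show 1: "cyclotomic_prod P * cyclotomic_prod E = cyclotomic_prod D'"
        unfolding E_def using prod.subset_diff[OF PD' finD', of cyclotomic] by (simp add: mult.commute)
      show "cyclotomic_prod P * cyclotomic n = xpow1 n"
        unfolding P_def xpow1_split[OF n0] by (rule mult.commute)
      show "cyclotomic_prod D' * cyclotomic n = cyclotomic_prod D"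
        unfolding D'_def using prod.remove[OF finD nD, of cyclotomic] by (simp add: mult.commute)
    qed
    have E_dvd: "d dvd m" if "d \<in> E" for d using that D'_dvd by (simp add: E_def)
    note stable = cyclotomic_prod_dvd_invert_var[OF m]
    have stD: "cyclotomic_prod D dvd invert_var m (cyclotomic_prod D)" by (rule stable[OF D])
    have stD': "cyclotomic_prod D' dvd invert_var m (cyclotomic_prod D')" by (rule stable[OF D'_dvd])
    have stE: "cyclotomic_prod E dvd invert_var m (cyclotomic_prod E)" by (rule stable[OF E_dvd])
    have stP: "cyclotomic_prod P dvd invert_var m (cyclotomic_prod P)" by (rule stable[OF P_dvd])
    have iso: "gmodule_iso G (direct_sum (PQ M (cyclotomic_prod D')) (PQ M (xpow1 n)))
        (direct_sum (PQ M (cyclotomic_prod D)) (PQ M (cyclotomic_prod P)))"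
      by (rule quotient_splitting[OF Mm one stE stP, unfolded split, OF stD' xpow1_dvd_invert_var[OF nm] stD])
    let ?Q = "\<lambda>D. invertible_lattice G (PQ M (cyclotomic_prod D)) \<and> (\<forall>d\<in>D. phi_class M d \<in> Units ?F) \<and>
      sim_class G (PQ M (cyclotomic_prod D)) \<otimes>\<^bsub>?F\<^esub> (\<Otimes>\<^bsub>?F\<^esub>d\<in>D. phi_class M d) = \<one>\<^bsub>?F\<^esub>"
    have "?Q D'" by (rule less.hyps[OF cardD']) (erule D'_dvd, erule (1) D'_closed)
    then have IH': "invertible_lattice G (PQ M (cyclotomic_prod D'))" "\<forall>d\<in>D'. phi_class M d \<in> Units ?F"
      "sim_class G (PQ M (cyclotomic_prod D')) \<otimes>\<^bsub>?F\<^esub> (\<Otimes>\<^bsub>?F\<^esub>d\<in>D'. phi_class M d) = \<one>\<^bsub>?F\<^esub>"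
      by blast+
    have "?Q P" by (rule less.hyps[OF cardP]) (erule P_dvd, erule (1) P_closed)
    then have IHP: "invertible_lattice G (PQ M (cyclotomic_prod P))" by blast
    have inv_n: "invertible_lattice G (PQ M (xpow1 n))" by (rule invertible_PQ_xpow1[OF M nm])
    note Dm = gmodule_PQ[OF Mm stD] and Pm = gmodule_PQ[OF Mm stP]
    have iso': "gmodule_iso G (direct_sum (PQ M (cyclotomic_prod D)) (PQ M (cyclotomic_prod P)))
        (direct_sum (PQ M (cyclotomic_prod D')) (PQ M (xpow1 n)))"
      by (rule gmodule_iso_sym[OF iso gmodule_direct_sum]) (intro invertible_gmodule[OF grp_fin] IH' inv_n)+
    have inv_D: "invertible_lattice G (PQ M (cyclotomic_prod D))"
      by (rule invertible_summand[OF grp_fin Dm Pm invertible_direct_sum[OF grp_fin IH'(1) inv_n] iso'])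
    let ?c = "\<lambda>f. sim_class G (PQ M f)"
    note unit = sim_class_invertible_Units[OF grp_fin] and fl = invertible_flabby[OF grp_fin]
    have u: "?c (cyclotomic_prod D) \<in> Units ?F" "?c (cyclotomic_prod D') \<in> Units ?F"
      "?c (cyclotomic_prod P) \<in> Units ?F" "?c (xpow1 n) \<in> Units ?F"
      by (intro unit inv_D IH' IHP inv_n)+
    note uc = u[THEN F.Units_closed]
    have phi_n: "phi_class M n = ?c (cyclotomic_prod P) \<otimes>\<^bsub>?F\<^esub> inv\<^bsub>?F\<^esub> ?c (xpow1 n)"
      by (simp add: phi_class_def proper_poly_def P_def)
    have phi_unit: "phi_class M n \<in> Units ?F"
      unfolding phi_n using u by simp
    have all_units: "\<forall>d\<in>D. phi_class M d \<in> Units ?F"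
      using phi_unit IH'(2) by (auto simp: D'_def)
    have add: "?c (cyclotomic_prod D) \<otimes>\<^bsub>?F\<^esub> ?c (cyclotomic_prod P) = ?c (cyclotomic_prod D') \<otimes>\<^bsub>?F\<^esub> ?c (xpow1 n)"
    proof -
      have "?c (cyclotomic_prod D) \<otimes>\<^bsub>?F\<^esub> ?c (cyclotomic_prod P) =
          sim_class G (direct_sum (PQ M (cyclotomic_prod D)) (PQ M (cyclotomic_prod P)))"
        by (rule sim_class_mult[OF grp_fin fl[OF inv_D] fl[OF IHP]])
      also have "\<dots> = sim_class G (direct_sum (PQ M (cyclotomic_prod D')) (PQ M (xpow1 n)))"
        by (intro sim_class_eqI[OF grp_fin] similar_of_iso[OF grp_fin] gmodule_direct_sum Dm Pm iso'
            invertible_gmodule[OF grp_fin] IH' inv_n)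
      also have "\<dots> = ?c (cyclotomic_prod D') \<otimes>\<^bsub>?F\<^esub> ?c (xpow1 n)"
        by (rule sim_class_mult[OF grp_fin fl[OF IH'(1)] fl[OF inv_n], symmetric])
      finally show ?thesis .
    qed
    let ?R = "\<Otimes>\<^bsub>?F\<^esub>d\<in>D'. phi_class M d"
    have R: "?R \<in> carrier ?F" using IH'(2) by (intro F.finprod_closed) auto
    have "(\<Otimes>\<^bsub>?F\<^esub>d\<in>D. phi_class M d) = (\<Otimes>\<^bsub>?F\<^esub>d\<in>insert n D'. phi_class M d)"
      using nD by (simp add: D'_def insert_absorb)
    also have "\<dots> = phi_class M n \<otimes>\<^bsub>?F\<^esub> ?R"
      using finD' IH'(2) phi_unit by (intro F.finprod_insert) (auto simp: D'_def)
    finally have prod: "(\<Otimes>\<^bsub>?F\<^esub>d\<in>D. phi_class M d) = phi_class M n \<otimes>\<^bsub>?F\<^esub> ?R" .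
    have "?c (cyclotomic_prod D) \<otimes>\<^bsub>?F\<^esub> (phi_class M n \<otimes>\<^bsub>?F\<^esub> ?R) =
        (?c (cyclotomic_prod D) \<otimes>\<^bsub>?F\<^esub> ?c (cyclotomic_prod P)) \<otimes>\<^bsub>?F\<^esub> (inv\<^bsub>?F\<^esub> ?c (xpow1 n) \<otimes>\<^bsub>?F\<^esub> ?R)"
      unfolding phi_n using uc u R by (simp add: F.m_assoc)
    also have "\<dots> = (?c (cyclotomic_prod D') \<otimes>\<^bsub>?F\<^esub> (?c (xpow1 n) \<otimes>\<^bsub>?F\<^esub> inv\<^bsub>?F\<^esub> ?c (xpow1 n))) \<otimes>\<^bsub>?F\<^esub> ?R"
      unfolding add using uc u R by (simp add: F.m_assoc del: F.Units_r_inv)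
    also have "\<dots> = \<one>\<^bsub>?F\<^esub>" using u uc IH'(3) by simp
    finally show ?thesis using inv_D all_units prod by simp
  qed
qed

lemma all_divisors_quotient:
  assumes M: "invertible_lattice G M" and n: "n dvd m"
  shows "(\<forall>d\<in>{d. d dvd n}. phi_class M d \<in> Units (flabby_monoid G)) \<and>
    sim_class G (PQ M (xpow1 n)) \<otimes>\<^bsub>flabby_monoid G\<^esub> (\<Otimes>\<^bsub>flabby_monoid G\<^esub>d\<in>{d. d dvd n}. phi_class M d)
      = \<one>\<^bsub>flabby_monoid G\<^esub>"
proof -
  have n0: "n > 0" using n m by (rule dvd_pos_nat[rotated])
  show ?thesis
    unfolding cyclotomic_prod_divisors[OF n0, symmetric]
    by (rule conjunct2[OF divisor_closed_quotient[OF M]]) (use n in \<open>auto intro: dvd_trans\<close>)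
qed

lemma phi_class_Units:
  assumes M: "invertible_lattice G M" and n: "n dvd m"
  shows "phi_class M n \<in> Units (flabby_monoid G)"
  using bspec[OF conjunct1[OF all_divisors_quotient[OF M n]], of n] by simp

lemma invertible_PQ_proper:
  assumes M: "invertible_lattice G M" and n: "n dvd m"
  shows "invertible_lattice G (PQ M (proper_poly n))"
proof -
  have n0: "n > 0" using n m by (rule dvd_pos_nat[rotated])
  have "invertible_lattice G (PQ M (cyclotomic_prod {d. d dvd n \<and> d < n})) \<and>
    (\<forall>d\<in>{d. d dvd n \<and> d < n}. phi_class M d \<in> Units (flabby_monoid G)) \<and>
    sim_class G (PQ M (cyclotomic_prod {d. d dvd n \<and> d < n})) \<otimes>\<^bsub>flabby_monoid G\<^esub>
      (\<Otimes>\<^bsub>flabby_monoid G\<^esub>d\<in>{d. d dvd n \<and> d < n}. phi_class M d) = \<one>\<^bsub>flabby_monoid G\<^esub>"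
  proof (rule divisor_closed_quotient[OF M])
    fix d e assume "d \<in> {d. d dvd n \<and> d < n}" "e dvd d"
    then show "e \<in> {d. d dvd n \<and> d < n}"
      using n0 dvd_imp_le[of e d] dvd_pos_nat[of n d] by (auto intro: dvd_trans)
  qed (use n in \<open>auto intro: dvd_trans\<close>)
  then show ?thesis unfolding proper_poly_def by blast
qed

lemma prod_phi_class:
  assumes M: "invertible_lattice G M" and n: "n dvd m"
  shows "inv\<^bsub>flabby_monoid G\<^esub> sim_class G (PQ M (xpow1 n)) = (\<Otimes>\<^bsub>flabby_monoid G\<^esub>d\<in>{d. d dvd n}. phi_class M d)"
proof -
  let ?F = "flabby_monoid G"
  interpret F: comm_monoid ?F by (rule comm_monoid_flabby_monoid[OF grp_fin])
  have 1: "sim_class G (PQ M (xpow1 n)) \<otimes>\<^bsub>?F\<^esub> (\<Otimes>\<^bsub>?F\<^esub>d\<in>{d. d dvd n}. phi_class M d) = \<one>\<^bsub>?F\<^esub>"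
    by (rule conjunct2[OF all_divisors_quotient[OF M n]])
  have "phi_class M d \<in> carrier ?F" if "d dvd n" for d
    using phi_class_Units[OF M dvd_trans[OF that n]] by (rule F.Units_closed)
  then have R: "(\<Otimes>\<^bsub>?F\<^esub>d\<in>{d. d dvd n}. phi_class M d) \<in> carrier ?F" by (intro F.finprod_closed) auto
  show ?thesis
    by (rule F.comm_inv_char[OF F.Units_closed[OF sim_class_invertible_Units[OF grp_fin invertible_PQ_xpow1[OF M n]]] R 1])
qed

section \<open>The flabby classes\<close>

text \<open>This is the case \<open>C = 0\<close> of a sequence \<open>0 \<rightarrow> L \<rightarrow> I \<rightarrow> C \<rightarrow> 0\<close> of invertible lattices.\<close>

lemma flabby_class_PQ_xpow1:
  assumes M: "invertible_lattice G M" and n: "n dvd m"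
  shows "flabby_class G (PQ M (xpow1 n)) = inv\<^bsub>flabby_monoid G\<^esub> sim_class G (PQ M (xpow1 n))"
proof -
  let ?F = "flabby_monoid G" and ?B = "PQ M (xpow1 n)"
  interpret F: comm_monoid ?F by (rule comm_monoid_flabby_monoid[OF grp_fin])
  have B: "invertible_lattice G ?B" by (rule invertible_PQ_xpow1[OF M n])
  note Bm = invertible_gmodule[OF grp_fin B]
  interpret B: gmodule G ?B by fact
  let ?Z = "zero_lattice :: ('g, univ) gmodule"
  have Z: "permutation_lattice G ?Z" by (rule zero_permutation[OF grp_fin])
  note Zm = permutation_lattice_gmodule[OF Z]
  interpret Z: gmodule G ?Z by fact
  have q: "(\<lambda>x. \<one>\<^bsub>?Z\<^esub>) \<in> gmodule_hom G ?B ?Z" by (rule Z.zero_hom[OF Bm])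
  have carrier_Z: "carrier ?Z = {\<one>\<^bsub>?Z\<^esub>}" by (simp add: zero_lattice_def)
  have "flabby_class G ?B = sim_class G ?Z \<otimes>\<^bsub>?F\<^esub> inv\<^bsub>?F\<^esub> sim_class G ?B"
    by (rule flabby_class_invertible_resolution[OF grp_fin Bm Bm B invertible_permutation[OF grp_fin Z]
          gmodule_hom_id _ gmodule_hom_id refl q])
      (use carrier_Z B.M.one_closed in \<open>auto simp: kernel_def\<close>)
  then show ?thesis
    using sim_class_permutation[OF grp_fin Z] sim_class_invertible_Units[OF grp_fin B] by simp
qed

lemma flabby_class_xpow1_Units:
  assumes M: "invertible_lattice G M" and n: "n dvd m"
  shows "flabby_class G (PQ M (xpow1 n)) \<in> Units (flabby_monoid G)"
proof -
  interpret F: comm_monoid "flabby_monoid G" by (rule comm_monoid_flabby_monoid[OF grp_fin])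
  show ?thesis
    unfolding flabby_class_PQ_xpow1[OF M n]
    by (rule F.Units_inv_Units[OF sim_class_invertible_Units[OF grp_fin invertible_PQ_xpow1[OF M n]]])
qed

lemma flabby_class_xpow1_prod:
  assumes M: "invertible_lattice G M" and n: "n dvd m"
  shows "flabby_class G (PQ M (xpow1 n)) = (\<Otimes>\<^bsub>flabby_monoid G\<^esub>d\<in>{d. d dvd n}. phi_class M d)"
  unfolding flabby_class_PQ_xpow1[OF M n] by (rule prod_phi_class[OF M n])

text \<open>\<open>W\<close> is \<open>M\<close> or its twist.  The map \<open>x \<mapsto> h(\<sigma>)x\<close> with \<open>h = X\<^sup>e g\<close>, \<open>g = (X\<^sup>n - 1)/\<Phi>\<^sub>n\<close>, identifies the
  torsion-free quotient of \<open>W/\<Phi>\<^sub>n(\<sigma>)W\<close> with the kernel of \<open>M/(\<sigma>\<^sup>n - 1)M \<rightarrow> M/g(\<sigma>)M\<close>; the sign by which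
  \<open>h\<close> fails to be symmetric is the character \<open>\<chi>\<close> of the twist.\<close>

lemma flabby_class_phi_part:
  assumes M: "invertible_lattice G M" and n: "n dvd m" and W: "gmodule G W" and L: "gmodule G L"
    and W_carrier: "carrier W = carrier M"
    and W_mult: "\<And>x y. x \<in> carrier M \<Longrightarrow> y \<in> carrier M \<Longrightarrow> x \<otimes>\<^bsub>W\<^esub> y = x \<otimes>\<^bsub>M\<^esub> y"
    and W_act: "\<And>g x. g \<in> carrier G \<Longrightarrow> x \<in> carrier M \<Longrightarrow> act W g x = act M g x [^]\<^bsub>M\<^esub> \<chi> g"
    and s: "s \<in> gmodule_hom G W L" "s ` carrier W = carrier L"
    and ker: "\<And>x. x \<in> carrier M \<Longrightarrow>
      s x = \<one>\<^bsub>L\<^esub> \<longleftrightarrow> (\<exists>k>0. x [^]\<^bsub>M\<^esub> (k::nat) \<in> PA M (cyclotomic n) ` carrier M)"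
    and sym: "\<And>g. g \<in> carrier G \<Longrightarrow> \<epsilon> g = 1 \<and> \<chi> g = 1 \<or> \<epsilon> g \<noteq> 1 \<and>
      xpow1 n dvd invert_var m (proper_poly n * Polynomial.monom 1 e) - [:\<chi> g:] * (proper_poly n * Polynomial.monom 1 e)"
  shows "flabby_class G L = phi_class M n"
proof -
  have n0: "n > 0" using n m by (rule dvd_pos_nat[rotated])
  note Mm = invertible_gmodule[OF grp_fin M]
  define g where "g = proper_poly n"
  define h where "h = g * Polynomial.monom 1 e"
  let ?\<Phi> = "cyclotomic n"
  have B: "invertible_lattice G (PQ M (xpow1 n))" by (rule invertible_PQ_xpow1[OF M n])
  have C: "invertible_lattice G (PQ M g)" unfolding g_def by (rule invertible_PQ_proper[OF M n])
  note Bm = invertible_gmodule[OF grp_fin B] and Cm = invertible_gmodule[OF grp_fin C]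
  interpret M: gmodule G M by fact
  interpret W: gmodule G W by fact
  interpret B: gmodule G "PQ M (xpow1 n)" by fact
  interpret C: gmodule G "PQ M g" by fact
  have st_g: "g dvd invert_var m g"
    unfolding g_def proper_poly_def
    by (rule cyclotomic_prod_dvd_invert_var[OF m]) (use n in \<open>auto intro: dvd_trans\<close>)
  note st_B = xpow1_dvd_invert_var[OF n]
  have g\<Phi>: "g * ?\<Phi> = xpow1 n" unfolding g_def proper_poly_def xpow1_split[OF n0] by (rule mult.commute)
  note PAc = M.poly_act_closed[OF \<sigma>] and PAm = M.poly_act_mult[OF \<sigma>]
  have PA_hom: "group_hom M M (PA M f)" for f by (rule M.poly_act_group_hom[OF \<sigma>])
  let ?e = "Polynomial.monom 1 e :: int poly" and ?e' = "Polynomial.monom 1 ((m - 1) * e) :: int poly"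
  \<comment> \<open>\<open>X\<^sup>e\<close> acts invertibly.\<close>
  have unshift: "PA M (f * ?e * ?e') x = PA M f x" if x: "x \<in> carrier M" for f x
  proof (rule PA_cong[OF Mm x])
    have "e + (m - 1) * e = m * e + 0" using m by (cases m) simp_all
    then have "f * ?e * ?e' - f = f * (Polynomial.monom 1 (m * e + 0) - Polynomial.monom 1 0)"
      by (simp add: mult.assoc mult_monom algebra_simps monom_eq_1)
    then show "xpow1 m dvd f * ?e * ?e' - f" using xpow1_dvd_monom_diff[of m 1 e 0] by simp
  qed
  obtain p where p: "p \<in> gmodule_hom G M (PQ M (xpow1 n))" "p ` carrier M = carrier (PQ M (xpow1 n))"
    "\<And>x. x \<in> carrier M \<Longrightarrow> p x = \<one>\<^bsub>PQ M (xpow1 n)\<^esub> \<longleftrightarrow> x \<in> PA M (xpow1 n) ` carrier M"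
    by (rule PQ_projE[OF Mm st_B]) (rule that)
  obtain r where r: "r \<in> gmodule_hom G M (PQ M g)" "r ` carrier M = carrier (PQ M g)"
    "\<And>x. x \<in> carrier M \<Longrightarrow> r x = \<one>\<^bsub>PQ M g\<^esub> \<longleftrightarrow> x \<in> PA M g ` carrier M"
    by (rule PQ_projE[OF Mm st_g]) (rule that)
  interpret p: group_hom M "PQ M (xpow1 n)" p by (rule gmodule_hom_group_hom[OF Mm Bm p(1)])
  interpret h: group_hom M M "PA M h" by (rule PA_hom)
  have "kernel M (PQ M (xpow1 n)) p \<subseteq> kernel M (PQ M g) r"
  proof
    fix x assume "x \<in> kernel M (PQ M (xpow1 n)) p"
    then have x: "x \<in> carrier M" "x \<in> PA M (xpow1 n) ` carrier M" using p(3) by (auto simp: kernel_def)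
    then obtain y where y: "y \<in> carrier M" "x = PA M (g * ?\<Phi>) y" unfolding g\<Phi> by blast
    then have "x = PA M g (PA M ?\<Phi> y)" using PAm by simp
    then show "x \<in> kernel M (PQ M g) r" using r(3)[OF x(1)] x(1) PAc[OF y(1)] by (simp add: kernel_def)
  qed
  then obtain q where q: "q \<in> gmodule_hom G (PQ M (xpow1 n)) (PQ M g)" "\<And>x. x \<in> carrier M \<Longrightarrow> q (p x) = r x"
    by (rule gmodule_hom_factor[OF Mm Bm Cm p(1,2) r(1)]) (rule that)
  have q_surj: "q ` carrier (PQ M (xpow1 n)) = carrier (PQ M g)"
    unfolding p(2)[symmetric] r(2)[symmetric] image_image by (rule image_cong) (simp_all add: q(2))
  define j where "j x = p (PA M h x)" for x
  have j: "j \<in> gmodule_hom G W (PQ M (xpow1 n))"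
  proof (rule gmodule_homI)
    fix x y assume "x \<in> carrier W" "y \<in> carrier W"
    then show "j (x \<otimes>\<^bsub>W\<^esub> y) = j x \<otimes>\<^bsub>PQ M (xpow1 n)\<^esub> j y"
      unfolding W_carrier by (simp add: W_mult j_def)
  next
    fix \<kappa> x assume \<kappa>: "\<kappa> \<in> carrier G" and "x \<in> carrier W"
    then have x: "x \<in> carrier M" by (simp add: W_carrier)
    then have \<kappa>x: "act M \<kappa> x \<in> carrier M" using M.act_closed[OF \<kappa>] by blast
    note hx = PAc[OF x] and h\<kappa>x = PAc[OF \<kappa>x]
    have "p (PA M (if \<epsilon> \<kappa> = 1 then h else invert_var m h) (act M \<kappa> x)) = p (PA M h (act M \<kappa> x) [^]\<^bsub>M\<^esub> \<chi> \<kappa>)"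
      using sym[OF \<kappa>]
    proof (elim disjE conjE)
      assume "\<epsilon> \<kappa> = 1" "\<chi> \<kappa> = 1"
      then show ?thesis using h\<kappa>x by simp
    next
      assume \<epsilon>: "\<epsilon> \<kappa> \<noteq> 1"
        and "xpow1 n dvd invert_var m (proper_poly n * ?e) - [:\<chi> \<kappa>:] * (proper_poly n * ?e)"
      then obtain w where w: "invert_var m h = [:\<chi> \<kappa>:] * h + xpow1 n * w"
        unfolding h_def g_def by (metis dvdE diff_eq_eq add.commute)
      have "PA M (invert_var m h) (act M \<kappa> x) =
          PA M h (act M \<kappa> x) [^]\<^bsub>M\<^esub> \<chi> \<kappa> \<otimes>\<^bsub>M\<^esub> PA M (xpow1 n) (PA M w (act M \<kappa> x))"
        unfolding w M.poly_act_add[OF \<sigma> \<kappa>x] PAm[OF \<kappa>x] M.poly_act_const[OF \<sigma> h\<kappa>x] by (rule refl)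
      moreover have "p (PA M (xpow1 n) (PA M w (act M \<kappa> x))) = \<one>\<^bsub>PQ M (xpow1 n)\<^esub>"
        using p(3)[OF PAc[OF PAc[OF \<kappa>x]]] PAc[OF \<kappa>x] by blast
      ultimately show ?thesis using \<epsilon> h\<kappa>x PAc[OF PAc[OF \<kappa>x]] by simp
    qed
    then show "j (act W \<kappa> x) = act (PQ M (xpow1 n)) \<kappa> (j x)"
      unfolding j_def W_act[OF \<kappa> x] gmodule_homD(3)[OF p(1) \<kappa> hx, symmetric] act_PA[OF Mm \<kappa> x]
      using h.hom_int_pow[OF \<kappa>x] by simp
  qed (simp add: j_def W_carrier)
  have exact: "kernel (PQ M (xpow1 n)) (PQ M g) q = j ` carrier W"
  proof (intro equalityI subsetI)
    fix b assume "b \<in> kernel (PQ M (xpow1 n)) (PQ M g) q"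
    then have b: "b \<in> carrier (PQ M (xpow1 n))" "q b = \<one>\<^bsub>PQ M g\<^esub>" by (simp_all add: kernel_def)
    then obtain x where x: "x \<in> carrier M" "b = p x" unfolding p(2)[symmetric] by blast
    then obtain y where y: "y \<in> carrier M" "x = PA M g y" using b(2) q(2) r(3) by auto
    have "x = PA M h (PA M ?e' y)"
      unfolding y(2) h_def PAm[OF y(1), symmetric] unshift[OF y(1)] by (rule refl)
    then show "b \<in> j ` carrier W" unfolding x(2) j_def W_carrier using PAc[OF y(1)] by blast
  next
    fix b assume "b \<in> j ` carrier W"
    then obtain x where x: "x \<in> carrier M" "b = p (PA M h x)" unfolding j_def W_carrier by blast
    have "r (PA M h x) = \<one>\<^bsub>PQ M g\<^esub>"
      unfolding h_def PAm[OF x(1)]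
      by (rule iffD2[OF r(3)[OF PAc[OF PAc[OF x(1)]]]]) (rule imageI[OF PAc[OF x(1)]])
    then show "b \<in> kernel (PQ M (xpow1 n)) (PQ M g) q"
      using x q(2)[OF PAc[OF x(1)]] p.hom_closed[OF PAc[OF x(1)]] by (simp add: kernel_def)
  qed
  \<comment> \<open>A positive integer \<open>k\<close> in \<open>(\<Phi>\<^sub>n, g)\<close> turns \<open>g(\<sigma>)z = 0\<close> into \<open>kz \<in> \<Phi>\<^sub>n(\<sigma>)M\<close>.\<close>
  have "\<exists>k>0. ideal_const ?\<Phi> g k"
    unfolding g_def proper_poly_def
    by (rule ideal_const_prod_pos) (use ideal_const_cyclotomic_divisor[OF n0] in blast)
  then obtain k where k: "k > 0" and "ideal_const ?\<Phi> g k" by blast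
  then obtain u v where uv: "u * ?\<Phi> + v * g = [:k:]" unfolding ideal_const_def by blast
  have "kernel W L s = kernel W (PQ M (xpow1 n)) j"
  proof -
    have "s x = \<one>\<^bsub>L\<^esub> \<longleftrightarrow> j x = \<one>\<^bsub>PQ M (xpow1 n)\<^esub>" if x: "x \<in> carrier M" for x
      unfolding ker[OF x]
    proof
      assume "\<exists>k>0. x [^]\<^bsub>M\<^esub> (k::nat) \<in> PA M ?\<Phi> ` carrier M"
      then obtain l y where l: "l > 0" and y: "y \<in> carrier M" "x [^]\<^bsub>M\<^esub> (l::nat) = PA M ?\<Phi> y" by blast
      have "PA M h x [^]\<^bsub>M\<^esub> l = PA M (h * ?\<Phi>) y"
        unfolding h.hom_nat_pow[OF x, symmetric] y(2) PAm[OF y(1)] by (rule refl)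
      also have "h * ?\<Phi> = xpow1 n * ?e" unfolding h_def g\<Phi>[symmetric] by (simp add: mult_ac)
      finally have "PA M h x [^]\<^bsub>M\<^esub> l \<in> PA M (xpow1 n) ` carrier M"
        unfolding PAm[OF y(1)] using PAc[OF y(1)] by blast
      then have "p (PA M h x [^]\<^bsub>M\<^esub> l) = \<one>\<^bsub>PQ M (xpow1 n)\<^esub>"
        using p(3)[OF M.M.nat_pow_closed[OF PAc[OF x]]] by blast
      then have "j x [^]\<^bsub>PQ M (xpow1 n)\<^esub> l = \<one>\<^bsub>PQ M (xpow1 n)\<^esub>"
        unfolding j_def p.hom_nat_pow[OF PAc[OF x]] .
      then show "j x = \<one>\<^bsub>PQ M (xpow1 n)\<^esub>"
        using pi_latticeD(2)[OF invertible_pi_lattice[OF grp_fin B] _ l] p.hom_closed[OF PAc[OF x]] unfolding j_def by blast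
    next
      assume "j x = \<one>\<^bsub>PQ M (xpow1 n)\<^esub>"
      then have "PA M h x \<in> PA M (xpow1 n) ` carrier M" using p(3)[OF PAc[OF x]] by (simp add: j_def)
      then obtain y where y: "y \<in> carrier M" "PA M h x = PA M (g * ?\<Phi>) y" unfolding g\<Phi> by blast
      define y' where "y' = PA M ?e' y"
      have y': "y' \<in> carrier M" using PAc[OF y(1)] by (simp add: y'_def)
      have "PA M g x = PA M ?e' (PA M h x)"
        unfolding PAm[OF x, symmetric] h_def using unshift[OF x, of g] by (simp add: mult_ac)
      also have "\<dots> = PA M g (PA M ?\<Phi> y')"
        unfolding y(2) y'_def PAm[OF y(1), symmetric] PAm[OF PAc[OF y(1)], symmetric] by (simp add: mult_ac)
      finally have gx: "PA M g x = PA M g (PA M ?\<Phi> y')" .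
      define z where "z = x \<otimes>\<^bsub>M\<^esub> inv\<^bsub>M\<^esub> PA M ?\<Phi> y'"
      have z: "z \<in> carrier M" using x PAc[OF y'] by (simp add: z_def)
      have gz: "PA M g z = \<one>\<^bsub>M\<^esub>"
        unfolding z_def using group_hom_kernel_eq[OF PA_hom x PAc[OF y']] gx by blast
      have "z [^]\<^bsub>M\<^esub> k = PA M (?\<Phi> * u + v * g) z"
        using M.poly_act_const[OF \<sigma> z, of k] uv by (simp add: mult.commute)
      also have "\<dots> = PA M ?\<Phi> (PA M u z)"
        unfolding M.poly_act_add[OF \<sigma> z] PAm[OF z] gz using PAc[OF PAc[OF z]] group_hom.hom_one[OF PA_hom] by simp
      finally have zk: "z [^]\<^bsub>M\<^esub> k = PA M ?\<Phi> (PA M u z)" .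
      interpret \<Phi>: group_hom M M "PA M ?\<Phi>" by (rule PA_hom)
      have "x = z \<otimes>\<^bsub>M\<^esub> PA M ?\<Phi> y'" using x PAc[OF y'] by (simp add: z_def M.M.m_assoc)
      then have "x [^]\<^bsub>M\<^esub> k = z [^]\<^bsub>M\<^esub> k \<otimes>\<^bsub>M\<^esub> PA M ?\<Phi> y' [^]\<^bsub>M\<^esub> k"
        using z PAc[OF y'] M.M.int_pow_mult_distrib[OF M.M.m_comm] by simp
      also have "\<dots> = PA M ?\<Phi> (PA M u z \<otimes>\<^bsub>M\<^esub> y' [^]\<^bsub>M\<^esub> k)"
        unfolding zk using PAc[OF z] y' by (simp add: \<Phi>.hom_int_pow)
      finally have "x [^]\<^bsub>M\<^esub> nat k = PA M ?\<Phi> (PA M u z \<otimes>\<^bsub>M\<^esub> y' [^]\<^bsub>M\<^esub> k)"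
        using k int_pow_int[of M x "nat k"] by simp
      moreover have "PA M u z \<otimes>\<^bsub>M\<^esub> y' [^]\<^bsub>M\<^esub> k \<in> carrier M" using PAc[OF z] y' by simp
      ultimately show "\<exists>k>0. x [^]\<^bsub>M\<^esub> (k::nat) \<in> PA M ?\<Phi> ` carrier M"
        using k by (intro exI[of _ "nat k"]) auto
    qed
    then show ?thesis by (auto simp: kernel_def W_carrier)
  qed
  from flabby_class_invertible_resolution[OF grp_fin L W B C s j this q(1) q_surj exact]
  show ?thesis unfolding phi_class_def g_def .
qed

text \<open>For \<open>n \<le> 2\<close> no sign occurs: \<open>g = 1\<close> for \<open>n = 1\<close>, and for \<open>n = 2\<close> the sign of \<open>g = X - 1\<close> is absorbed
  by \<open>\<sigma> = -1\<close> on \<open>g(\<sigma>)M/(\<sigma>\<^sup>2 - 1)M\<close>.  The factors \<open>X\<^sup>0\<close> and \<open>1\<close> are the shift \<open>X\<^sup>e\<close> and the sign in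
  \<open>flabby_class_phi_part\<close>.\<close>

lemma proper_poly_symmetric:
  assumes n: "n = 1 \<or> n = 2" "n dvd m"
  shows "xpow1 n dvd invert_var m (proper_poly n * Polynomial.monom 1 0) - [:1:] * (proper_poly n * Polynomial.monom 1 0)"
  using n(1)
proof
  assume "n = 1"
  then have "{d. d dvd n \<and> d < n} = {}" by auto
  then have "proper_poly n = 1" by (simp only: proper_poly_def prod.empty)
  then show ?thesis by (simp add: monom_eq_1 invert_var_1 one_pCons[symmetric])
next
  assume n2: "n = 2"
  have "{d::nat. d dvd 2 \<and> d < 2} = {1}" by (auto simp: less_2_cases_iff)
  then have g: "proper_poly n = xpow1 1" using cyclotomic_1 by (simp add: proper_poly_def n2)
  have "invert_var m (Polynomial.monom 1 1 :: int poly) = Polynomial.monom 1 (m - 1)"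
    unfolding invert_var_def pcompose_monom
    by (subst sum.mono_neutral_right[of _ "{1}"]) (auto simp: degree_monom_eq)
  then have eq: "invert_var m (xpow1 1) - xpow1 1 = Polynomial.monom 1 (m - 1) - Polynomial.monom 1 1"
    by (simp add: invert_var_diff invert_var_1)
  obtain l where l: "m = 2 * l" using n(2) n2 by (auto elim: dvdE)
  then have "m - 1 = 2 * (l - 1) + 1" using m by (cases l) auto
  then have "xpow1 2 dvd Polynomial.monom 1 (m - 1) - (Polynomial.monom 1 1 :: int poly)"
    using xpow1_dvd_monom_diff[of 2 1 "l - 1" 1] by simp
  then have "xpow1 n dvd invert_var m (xpow1 1) - xpow1 1" unfolding eq n2 .
  moreover have "Polynomial.monom 1 0 = (1 :: int poly)" "[:1:] = (1 :: int poly)"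
    by (simp_all add: monom_eq_1 one_pCons)
  ultimately show ?thesis unfolding g by (simp only: mult_1_right mult_1_left)
qed

text \<open>For \<open>n \<ge> 3\<close> the shift \<open>e\<close> centres \<open>g\<close>, which exists because \<open>deg g = n - \<phi>(n)\<close> has the parity of
  \<open>n\<close>; the centred \<open>g\<close> is antisymmetric.\<close>

lemma proper_poly_antisymmetric:
  assumes n: "n \<ge> 3" "n dvd m"
  obtains e where "xpow1 n dvd invert_var m (proper_poly n * Polynomial.monom 1 e) - [:- 1:] * (proper_poly n * Polynomial.monom 1 e)"
proof -
  let ?g = "proper_poly n"
  define D where "D = Polynomial.degree ?g"
  have deg: "D + totient n = n" using degree_proper_divisors[of n] n by (simp add: D_def proper_poly_def)
  have "even (totient n)" using n by (intro totient_even) simp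
  \<comment> \<open>The shift is centred when \<open>2e + D\<close> is divisible by \<open>n\<close>: it is \<open>2n\<close> in the first case, \<open>nD\<close> in the second.\<close>
  define e where "e = (if even n then n - D div 2 else D * ((n - 1) div 2))"
  have "n dvd 2 * e + D"
  proof (cases "even n")
    case True
    then have "even D" using deg \<open>even (totient n)\<close> by presburger
    moreover have "D \<le> n" using deg by simp
    ultimately have "2 * e + D = 2 * n" using True by (auto simp: e_def elim!: evenE)
    then show ?thesis by simp
  next
    case False
    then obtain l where l: "n = 2 * l + 1" by (auto elim: oddE)
    then have "2 * e + D = n * D" by (simp add: e_def algebra_simps)
    then show ?thesis by simp
  qed
  then obtain l where l: "2 * e + D = n * l" by (auto elim: dvdE)
  obtain k where mk: "m = n * k" using n(2) by (auto elim: dvdE)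
  have nm: "xpow1 n dvd xpow1 m" using xpow1_dvd[OF n(2) m] .
  have refl: "reflect_poly ?g = - ?g"
    unfolding proper_poly_def using n by (intro reflect_proper_divisors) simp
  define ig where "ig = invert_var m ?g"
  have 1: "xpow1 n dvd ig * Polynomial.monom 1 D + ?g"
    using dvd_trans[OF nm invert_var_reflect[OF m, of ?g]] unfolding refl D_def ig_def by simp
  let ?X = "\<lambda>i. Polynomial.monom 1 i :: int poly"
  have inv_e: "invert_var m (?X e) = ?X ((m - 1) * e)"
    unfolding invert_var_def pcompose_monom
    by (subst sum.mono_neutral_right[of _ "{e}"]) (auto simp: degree_monom_eq)
  \<comment> \<open>\<open>ig X\<^bsup>(m-1)e\<^esup> + g X\<^sup>e\<close> is congruent to \<open>X\<^bsup>(m-1)e - D\<^esup> (ig X\<^sup>D + g)\<close>, where the exponent is made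
    nonnegative by a multiple of \<open>n\<close>.\<close>
  have exps: "(m - 1) * e + n * D = D + ((m - 1) * e + (n - 1) * D)"
    using n by (cases n) simp_all
  have "(m - 1) * e + (n - 1) * D + (2 * e + D) = m * e + n * D + e"
    using n m by (cases m; cases n) simp_all
  then have "(m - 1) * e + (n - 1) * D + n * l = n * (k * e + D) + e"
    unfolding l by (simp add: mk algebra_simps)
  note exps2 = this
  let ?t = "(m - 1) * e + (n - 1) * D"
  have 2: "xpow1 n dvd ?X ?t * (ig * ?X D + ?g)" using 1 by (rule dvd_mult)
  have 3: "xpow1 n dvd ig * (?X (n * D + (m - 1) * e) - ?X ((m - 1) * e))"
    by (intro dvd_mult xpow1_dvd_monom_diff)
  have 4: "xpow1 n dvd ?g * (?X (n * l + ?t) - ?X ?t)"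
    by (intro dvd_mult xpow1_dvd_monom_diff)
  have 5: "xpow1 n dvd ?g * (?X (n * (k * e + D) + e) - ?X e)"
    by (intro dvd_mult xpow1_dvd_monom_diff)
  have "?X (n * D + (m - 1) * e) = ?X ?t * ?X D" using exps by (simp add: mult_monom add.commute add.left_commute)
  moreover have "?X (n * l + ?t) = ?X (n * (k * e + D) + e)" using exps2 by (simp add: add.commute)
  ultimately have "ig * ?X ((m - 1) * e) + ?g * ?X e =
      ?X ?t * (ig * ?X D + ?g) - ig * (?X (n * D + (m - 1) * e) - ?X ((m - 1) * e))
      + ?g * (?X (n * l + ?t) - ?X ?t) - ?g * (?X (n * (k * e + D) + e) - ?X e)"
    by (simp add: algebra_simps)
  then have "xpow1 n dvd ig * ?X ((m - 1) * e) + ?g * ?X e"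
    using 2 3 4 5 by (simp only: dvd_add dvd_diff)
  moreover have "invert_var m (?g * ?X e) - [:- 1:] * (?g * ?X e) = ig * ?X ((m - 1) * e) + ?g * ?X e"
    by (simp add: invert_var_mult inv_e ig_def)
  ultimately show ?thesis using that[of e] by simp
qed

lemma \<sigma>_pow_inj: "m \<ge> 3 \<Longrightarrow> ord \<sigma> = m \<Longrightarrow> a \<in> {1, -1} \<Longrightarrow> b \<in> {1, -1} \<Longrightarrow> \<sigma> [^] (a::int) = \<sigma> [^] b \<Longrightarrow> a = b"
proof (rule ccontr)
  assume m3: "m \<ge> 3" and ord: "ord \<sigma> = m" and ab: "a \<in> {1, -1}" "b \<in> {1, -1}"
    and eq: "\<sigma> [^] a = \<sigma> [^] b" and "a \<noteq> b"
  then have "\<sigma> = inv \<sigma>" using \<sigma> int_pow_neg_int[OF \<sigma>, of 1] by auto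
  then have "\<sigma> \<otimes> \<sigma> = \<one>" using \<sigma> by (metis r_inv)
  then have "\<sigma> [^] (2::nat) = \<one>" using \<sigma> by (simp add: numeral_2_eq_2)
  then have "m dvd 2" using pow_eq_id[OF \<sigma>, of 2] ord by blast
  then show False using m3 by (auto dest: dvd_imp_le)
qed

lemma \<epsilon>_\<sigma>: "m \<ge> 3 \<Longrightarrow> ord \<sigma> = m \<Longrightarrow> \<epsilon> \<sigma> = 1"
  using conj[OF \<sigma>] \<epsilon>[OF \<sigma>] \<sigma> by (intro \<sigma>_pow_inj) (auto simp: m_assoc)

text \<open>For \<open>m \<ge> 3\<close> the elements \<open>\<sigma>\<close> and \<open>\<sigma>\<^sup>-\<^sup>1\<close> differ, so \<open>\<epsilon>\<close> can be read off from the conjugation action.\<close>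

lemma \<epsilon>_mult:
  assumes m3: "m \<ge> 3" and ord: "ord \<sigma> = m" and g: "g \<in> carrier G" and h: "h \<in> carrier G"
  shows "\<epsilon> (g \<otimes> h) = \<epsilon> g * \<epsilon> h"
proof (rule \<sigma>_pow_inj[OF m3 ord])
  show "\<epsilon> (g \<otimes> h) \<in> {1, -1}" "\<epsilon> g * \<epsilon> h \<in> {1, -1}" using \<epsilon>[of "g \<otimes> h"] \<epsilon>[OF g] \<epsilon>[OF h] g h by auto
  have "\<sigma> [^] \<epsilon> (g \<otimes> h) = g \<otimes> (h \<otimes> \<sigma> \<otimes> inv h) \<otimes> inv g"
    using conj[of "g \<otimes> h"] g h \<sigma> by (simp add: inv_mult_group m_assoc)
  also have "\<dots> = g \<otimes> \<sigma> [^] \<epsilon> h \<otimes> inv g" using conj[OF h] by simp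
  also have "\<dots> = (g \<otimes> \<sigma> \<otimes> inv g) [^] \<epsilon> h"
  proof (cases "\<epsilon> h = 1")
    case True
    then show ?thesis using g \<sigma> by simp
  next
    case False
    then have "\<epsilon> h = - 1" using \<epsilon>[OF h] by simp
    then show ?thesis using g \<sigma> int_pow_neg_int[of _ 1]
      by (simp add: inv_mult_group m_assoc)
  qed
  also have "\<dots> = \<sigma> [^] (\<epsilon> g * \<epsilon> h)" using conj[OF g] \<sigma> by (simp add: int_pow_pow)
  finally show "\<sigma> [^] \<epsilon> (g \<otimes> h) = \<sigma> [^] (\<epsilon> g * \<epsilon> h)" .
qed

lemma twist_simps:
  "carrier (twist \<epsilon> M) = carrier M" "x \<otimes>\<^bsub>twist \<epsilon> M\<^esub> y = x \<otimes>\<^bsub>M\<^esub> y" "\<one>\<^bsub>twist \<epsilon> M\<^esub> = \<one>\<^bsub>M\<^esub>"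
  "act (twist \<epsilon> M) g x = act M g x [^]\<^bsub>M\<^esub> \<epsilon> g"
  by (simp_all add: twist_def)

lemma gmodule_twist:
  assumes m3: "m \<ge> 3" and ord: "ord \<sigma> = m" and M: "gmodule G M"
  shows "gmodule G (twist \<epsilon> M)"
proof -
  interpret M: gmodule G M by fact
  have "comm_group (twist \<epsilon> M)"
    using M.M.l_inv_ex by (intro comm_groupI) (auto simp: twist_simps M.M.m_ac)
  moreover have "\<epsilon> \<one> = 1"
    using conj[OF one_closed] \<epsilon>[OF one_closed] \<sigma> by (intro \<sigma>_pow_inj[OF m3 ord]) auto
  ultimately show ?thesis
    by (intro gmoduleI group_axioms)
      (auto simp: twist_simps M.act_closed M.act_add M.M.int_pow_mult_distrib[OF M.M.m_comm]
        M.act_mult M.act_int_pow M.M.int_pow_pow \<epsilon>_mult[OF m3 ord] M.act_one mult.commute)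
qed

lemma nat_pow_twist: "x [^]\<^bsub>twist \<epsilon> M\<^esub> (k::nat) = x [^]\<^bsub>M\<^esub> k"
  by (simp add: nat_pow_def twist_simps)

lemma int_pow_twist:
  assumes "gmodule G M" "gmodule G (twist \<epsilon> M)" "x \<in> carrier M"
  shows "x [^]\<^bsub>twist \<epsilon> M\<^esub> (k::int) = x [^]\<^bsub>M\<^esub> k"
proof -
  interpret M: gmodule G M by fact
  interpret T: gmodule G "twist \<epsilon> M" by fact
  interpret i: group_hom M "twist \<epsilon> M" "\<lambda>x. x"
    by unfold_locales (auto simp: hom_def twist_simps)
  show ?thesis using i.hom_int_pow[OF assms(3)] by simp
qed

text \<open>\<open>\<sigma>\<close> commutes with itself, so \<open>\<epsilon> \<sigma> = 1\<close> and the twist does not affect the action of \<open>\<langle>\<sigma>\<rangle>\<close>.\<close>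

lemma PA_twist:
  assumes m3: "m \<ge> 3" and ord: "ord \<sigma> = m" and M: "gmodule G M" and x: "x \<in> carrier M"
  shows "PA (twist \<epsilon> M) f x = PA M f x"
proof -
  note T = gmodule_twist[OF m3 ord M]
  interpret M: gmodule G M by fact
  have "\<epsilon> (\<sigma> [^] i) = 1" for i :: nat
  proof (induction i)
    case 0
    show ?case using \<epsilon>_mult[OF m3 ord one_closed one_closed] \<epsilon>[OF one_closed] by auto
  next
    case (Suc i)
    then show ?case using \<epsilon>_mult[OF m3 ord _ \<sigma>, of "\<sigma> [^] i"] \<epsilon>_\<sigma>[OF m3 ord] \<sigma> by simp
  qed
  then have act: "act (twist \<epsilon> M) (\<sigma> [^] i) x = act M (\<sigma> [^] i) x" for i :: nat
    using \<sigma> x by (simp add: twist_simps M.act_closed)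
  have "PA (twist \<epsilon> M) f x = (\<Otimes>\<^bsub>twist \<epsilon> M\<^esub>i\<in>{..Polynomial.degree f}. act M (\<sigma> [^] i) x [^]\<^bsub>M\<^esub> Polynomial.coeff f i)"
    unfolding poly_act_def act using \<sigma> x by (simp add: int_pow_twist[OF M T] M.act_closed)
  also have "\<dots> = PA M f x"
    unfolding poly_act_def
    by (rule hom_finprod_comm_group[OF M.M.comm_group_axioms _ _, symmetric, of _ "\<lambda>x. x"])
      (use \<sigma> x gmodule.axioms(2)[OF T] in \<open>auto simp: hom_def twist_simps intro!: M.M.int_pow_closed M.act_closed\<close>)
  finally show ?thesis .
qed

lemma torsion_submodule:
  assumes M: "gmodule G M"
  shows "submodule G M (torsion_part M)"
  unfolding submodule_def
proof (intro conjI ballI)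
  interpret M: gmodule G M by fact
  show "subgroup (torsion_part M) M"
  proof (rule M.M.subgroupI)
    show "torsion_part M \<subseteq> carrier M" by (auto simp: torsion_part_def)
    have "\<one>\<^bsub>M\<^esub> [^]\<^bsub>M\<^esub> (1::nat) = \<one>\<^bsub>M\<^esub>" by simp
    then have "\<one>\<^bsub>M\<^esub> \<in> torsion_part M" unfolding torsion_part_def by blast
    then show "torsion_part M \<noteq> {}" by blast
    fix x assume "x \<in> torsion_part M"
    then obtain k :: nat where x: "x \<in> carrier M" "k > 0" "x [^]\<^bsub>M\<^esub> k = \<one>\<^bsub>M\<^esub>" unfolding torsion_part_def by blast
    have "inv\<^bsub>M\<^esub> x [^]\<^bsub>M\<^esub> k = \<one>\<^bsub>M\<^esub>" unfolding M.M.nat_pow_inv[OF x(1)] x(3) by simp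
    then show "inv\<^bsub>M\<^esub> x \<in> torsion_part M" unfolding torsion_part_def using x(1,2) by blast
    fix y assume "y \<in> torsion_part M"
    then obtain l :: nat where y: "y \<in> carrier M" "l > 0" "y [^]\<^bsub>M\<^esub> l = \<one>\<^bsub>M\<^esub>" unfolding torsion_part_def by blast
    have "(x \<otimes>\<^bsub>M\<^esub> y) [^]\<^bsub>M\<^esub> (k * l) = (x [^]\<^bsub>M\<^esub> k) [^]\<^bsub>M\<^esub> l \<otimes>\<^bsub>M\<^esub> (y [^]\<^bsub>M\<^esub> l) [^]\<^bsub>M\<^esub> k"
      using x(1) y(1) by (simp add: M.M.pow_mult_distrib[OF M.M.m_comm] M.M.nat_pow_pow mult.commute)
    also have "\<dots> = \<one>\<^bsub>M\<^esub>" unfolding x(3) y(3) by simp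
    finally have "(x \<otimes>\<^bsub>M\<^esub> y) [^]\<^bsub>M\<^esub> (k * l) = \<one>\<^bsub>M\<^esub>" .
    moreover have "k * l > 0" "x \<otimes>\<^bsub>M\<^esub> y \<in> carrier M" using x(1,2) y(1,2) by simp_all
    ultimately show "x \<otimes>\<^bsub>M\<^esub> y \<in> torsion_part M" unfolding torsion_part_def by blast
  qed
  fix g x assume g: "g \<in> carrier G" and "x \<in> torsion_part M"
  then obtain k :: nat where x: "x \<in> carrier M" "k > 0" "x [^]\<^bsub>M\<^esub> k = \<one>\<^bsub>M\<^esub>" unfolding torsion_part_def by blast
  have "act M g x [^]\<^bsub>M\<^esub> k = \<one>\<^bsub>M\<^esub>" unfolding M.act_nat_pow[OF g x(1), symmetric] x(3) using g by simp
  then show "act M g x \<in> torsion_part M" unfolding torsion_part_def using x(2) M.act_closed[OF g x(1)] by blast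
qed

lemma mod_torsion_PQ:
  assumes M: "gmodule G M" and f: "f dvd invert_var m f"
  obtains s where "gmodule G (mod_torsion (PQ M f))" "s \<in> gmodule_hom G M (mod_torsion (PQ M f))"
    "s ` carrier M = carrier (mod_torsion (PQ M f))"
    "\<And>x. x \<in> carrier M \<Longrightarrow> s x = \<one>\<^bsub>mod_torsion (PQ M f)\<^esub> \<longleftrightarrow> (\<exists>k>0. x [^]\<^bsub>M\<^esub> (k::nat) \<in> PA M f ` carrier M)"
proof -
  let ?Q = "PQ M f" and ?L = "mod_torsion (PQ M f)"
  note Qm = gmodule_PQ[OF M f]
  interpret M: gmodule G M by fact
  interpret Q: gmodule G ?Q by fact
  obtain p where p: "p \<in> gmodule_hom G M ?Q" "p ` carrier M = carrier ?Q"
    "\<And>x. x \<in> carrier M \<Longrightarrow> p x = \<one>\<^bsub>?Q\<^esub> \<longleftrightarrow> x \<in> PA M f ` carrier M"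
    by (rule PQ_projE[OF M f]) (rule that)
  interpret p: group_hom M ?Q p by (rule gmodule_hom_group_hom[OF M Qm p(1)])
  define t where "t y = torsion_part ?Q #>\<^bsub>?Q\<^esub> y" for y
  have t: "gmodule G ?L" "t \<in> gmodule_hom G ?Q ?L" "t ` carrier ?Q = carrier ?L" "kernel ?Q ?L t = torsion_part ?Q"
    using Q.quot_module_proj[OF torsion_submodule[OF Qm]] unfolding mod_torsion_def t_def by simp_all
  have ker: "t (p x) = \<one>\<^bsub>?L\<^esub> \<longleftrightarrow> (\<exists>k>0. x [^]\<^bsub>M\<^esub> (k::nat) \<in> PA M f ` carrier M)" if x: "x \<in> carrier M" for x
  proof -
    have "t (p x) = \<one>\<^bsub>?L\<^esub> \<longleftrightarrow> p x \<in> torsion_part ?Q" using p.hom_closed[OF x] unfolding t(4)[symmetric] by (simp add: kernel_def)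
    also have "\<dots> \<longleftrightarrow> (\<exists>k::nat. k > 0 \<and> p x [^]\<^bsub>?Q\<^esub> k = \<one>\<^bsub>?Q\<^esub>)"
      using p.hom_closed[OF x] unfolding torsion_part_def by blast
    also have "\<dots> \<longleftrightarrow> (\<exists>k::nat. k > 0 \<and> x [^]\<^bsub>M\<^esub> k \<in> PA M f ` carrier M)"
      unfolding p.hom_nat_pow[OF x, symmetric] p(3)[OF M.M.nat_pow_closed[OF x]] by (rule refl)
    finally show ?thesis .
  qed
  have "(\<lambda>x. t (p x)) ` carrier M = carrier ?L"
    unfolding t(3)[symmetric] p(2)[symmetric] image_image by (rule refl)
  then show ?thesis by (rule that[OF t(1) gmodule_hom_comp[OF p(1) t(2)] _ ker])
qed

lemma cyclotomic_dvd_invert_var: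
  assumes "n dvd m"
  shows "cyclotomic n dvd invert_var m (cyclotomic n)"
  using cyclotomic_prod_dvd_invert_var[OF m, of "{n}"] assms by simp

lemma flabby_class_mod_torsion:
  assumes M: "invertible_lattice G M" and n: "n = 1 \<or> n = 2" "n dvd m"
  shows "flabby_class G (mod_torsion (PQ M (cyclotomic n))) = phi_class M n"
proof -
  note Mm = invertible_gmodule[OF grp_fin M]
  interpret M: gmodule G M by fact
  obtain s where s: "gmodule G (mod_torsion (PQ M (cyclotomic n)))"
    "s \<in> gmodule_hom G M (mod_torsion (PQ M (cyclotomic n)))"
    "s ` carrier M = carrier (mod_torsion (PQ M (cyclotomic n)))"
    "\<And>x. x \<in> carrier M \<Longrightarrow> s x = \<one>\<^bsub>mod_torsion (PQ M (cyclotomic n))\<^esub> \<longleftrightarrow>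
      (\<exists>k>0. x [^]\<^bsub>M\<^esub> (k::nat) \<in> PA M (cyclotomic n) ` carrier M)"
    by (rule mod_torsion_PQ[OF Mm cyclotomic_dvd_invert_var[OF n(2)]]) (rule that)
  show ?thesis
    by (rule flabby_class_phi_part[OF M n(2) Mm s(1) refl refl _ s(2,3,4), where \<chi> = "\<lambda>_. 1" and e = 0])
      (use proper_poly_symmetric[OF n] in \<open>simp_all add: M.act_closed\<close>)
qed

text \<open>For \<open>n \<ge> 3\<close> the character \<open>\<chi>\<close> in \<open>flabby_class_phi_part\<close> is \<open>\<epsilon>\<close> itself.\<close>

lemma sign_cases:
  assumes "n \<ge> 3" "n dvd m"
  obtains e where "\<And>g. g \<in> carrier G \<Longrightarrow> \<epsilon> g = 1 \<and> \<epsilon> g = 1 \<or> \<epsilon> g \<noteq> 1 \<and>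
      xpow1 n dvd invert_var m (proper_poly n * Polynomial.monom 1 e) - [:\<epsilon> g:] * (proper_poly n * Polynomial.monom 1 e)"
proof -
  obtain e where e: "xpow1 n dvd invert_var m (proper_poly n * Polynomial.monom 1 e) - [:- 1:] * (proper_poly n * Polynomial.monom 1 e)"
    using assms by (rule proper_poly_antisymmetric) (rule that)
  show ?thesis
  proof (rule that)
    fix g assume "g \<in> carrier G"
    then consider "\<epsilon> g = 1" | "\<epsilon> g = - 1" using \<epsilon> by blast
    then show "\<epsilon> g = 1 \<and> \<epsilon> g = 1 \<or> \<epsilon> g \<noteq> 1 \<and>
      xpow1 n dvd invert_var m (proper_poly n * Polynomial.monom 1 e) - [:\<epsilon> g:] * (proper_poly n * Polynomial.monom 1 e)"
    proof cases
      case 2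
      show ?thesis unfolding 2 using e by simp
    qed simp
  qed
qed

lemma flabby_class_mod_torsion_twist:
  assumes M: "invertible_lattice G M" and n: "n \<ge> 3" "n dvd m" and ord: "ord \<sigma> = m"
  shows "flabby_class G (mod_torsion (PQ (twist \<epsilon> M) (cyclotomic n))) = phi_class M n"
proof -
  have m3: "m \<ge> 3" using n m by (auto dest: dvd_imp_le)
  note Mm = invertible_gmodule[OF grp_fin M]
  note Tm = gmodule_twist[OF m3 ord Mm]
  let ?L = "mod_torsion (PQ (twist \<epsilon> M) (cyclotomic n))"
  obtain s where s: "gmodule G ?L" "s \<in> gmodule_hom G (twist \<epsilon> M) ?L" "s ` carrier (twist \<epsilon> M) = carrier ?L"
    "\<And>x. x \<in> carrier (twist \<epsilon> M) \<Longrightarrow> s x = \<one>\<^bsub>?L\<^esub> \<longleftrightarrow>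
      (\<exists>k>0. x [^]\<^bsub>twist \<epsilon> M\<^esub> (k::nat) \<in> PA (twist \<epsilon> M) (cyclotomic n) ` carrier (twist \<epsilon> M))"
    by (rule mod_torsion_PQ[OF Tm cyclotomic_dvd_invert_var[OF n(2)]]) (rule that)
  have im: "PA (twist \<epsilon> M) (cyclotomic n) ` carrier M = PA M (cyclotomic n) ` carrier M"
    by (rule image_cong[OF refl PA_twist[OF m3 ord Mm]])
  obtain e where "\<And>g. g \<in> carrier G \<Longrightarrow> \<epsilon> g = 1 \<and> \<epsilon> g = 1 \<or> \<epsilon> g \<noteq> 1 \<and>
      xpow1 n dvd invert_var m (proper_poly n * Polynomial.monom 1 e) - [:\<epsilon> g:] * (proper_poly n * Polynomial.monom 1 e)"
    using n by (rule sign_cases) (rule that)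
  note e = this
  show ?thesis
    by (rule flabby_class_phi_part[OF M n(2) Tm s(1) _ _ _ s(2,3) s(4)[unfolded twist_simps nat_pow_twist im], where \<chi> = \<epsilon>])
      (use e in \<open>simp_all add: twist_simps\<close>)
qed

text \<open>Moebius inversion needs inverses and therefore takes place in the group of units.\<close>

lemma phi_class_moebius:
  assumes M: "invertible_lattice G M" and n: "n dvd m"
  shows "phi_class M n = (\<Otimes>\<^bsub>flabby_monoid G\<^esub>d\<in>{d. d dvd n}.
    flabby_class G (PQ M (xpow1 d)) [^]\<^bsub>flabby_monoid G\<^esub> moebius_mu (n div d))"
proof -
  let ?F = "flabby_monoid G"
  let ?b = "\<lambda>d. flabby_class G (PQ M (xpow1 d))"
  interpret F: comm_monoid ?F by (rule comm_monoid_flabby_monoid[OF grp_fin])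
  interpret U: comm_group "units_of ?F" by (rule F.units_comm_group)
  have n0: "n > 0" using n m by (rule dvd_pos_nat[rotated])
  have a: "phi_class M d \<in> carrier (units_of ?F)" if "d dvd n" for d
    using phi_class_Units[OF M dvd_trans[OF that n]] by (simp add: units_of_carrier)
  have b: "?b d = (\<Otimes>\<^bsub>units_of ?F\<^esub>e\<in>{e. e dvd d}. phi_class M e)" if d: "d dvd n" for d
  proof -
    have dm: "d dvd m" using d n by (rule dvd_trans)
    have "(\<Otimes>\<^bsub>units_of ?F\<^esub>e\<in>{e. e dvd d}. phi_class M e) = (\<Otimes>\<^bsub>?F\<^esub>e\<in>{e. e dvd d}. phi_class M e)"
      by (rule F.finprod_units_of) (use phi_class_Units[OF M] dm in \<open>auto intro: dvd_trans\<close>)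
    then show ?thesis unfolding flabby_class_PQ_xpow1[OF M dm] prod_phi_class[OF M dm] by simp
  qed
  have bU: "?b d \<in> Units ?F" if "d dvd n" for d
  proof -
    have "?b d \<in> carrier (units_of ?F)"
      unfolding b[OF that] by (rule U.finprod_closed) (use a that in \<open>auto intro: dvd_trans\<close>)
    then show ?thesis by (simp add: units_of_carrier)
  qed
  have "phi_class M n = (\<Otimes>\<^bsub>units_of ?F\<^esub>d\<in>{d. d dvd n}. ?b d [^]\<^bsub>units_of ?F\<^esub> moebius_mu (n div d))"
    by (rule U.moebius_inversion[OF n0 a b])
  also have "\<dots> = (\<Otimes>\<^bsub>?F\<^esub>d\<in>{d. d dvd n}. ?b d [^]\<^bsub>units_of ?F\<^esub> moebius_mu (n div d))"
  proof (rule F.finprod_units_of, rule Pi_I)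
    fix d assume "d \<in> {d. d dvd n}"
    then have "?b d \<in> carrier (units_of ?F)" using bU by (simp add: units_of_carrier)
    then have "?b d [^]\<^bsub>units_of ?F\<^esub> moebius_mu (n div d) \<in> carrier (units_of ?F)" by (rule U.int_pow_closed)
    then show "?b d [^]\<^bsub>units_of ?F\<^esub> moebius_mu (n div d) \<in> Units ?F" by (simp add: units_of_carrier)
  qed
  also have "\<dots> = (\<Otimes>\<^bsub>?F\<^esub>d\<in>{d. d dvd n}. ?b d [^]\<^bsub>?F\<^esub> moebius_mu (n div d))"
  proof (rule F.finprod_cong'[OF refl])
    show "?b d [^]\<^bsub>units_of ?F\<^esub> moebius_mu (n div d) = ?b d [^]\<^bsub>?F\<^esub> moebius_mu (n div d)"
      if "d \<in> {d. d dvd n}" for d using bU that by (intro F.int_pow_units_of) simp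
    show "(\<lambda>d. ?b d [^]\<^bsub>?F\<^esub> moebius_mu (n div d)) \<in> {d. d dvd n} \<rightarrow> carrier ?F"
    proof
      fix d assume "d \<in> {d. d dvd n}"
      then have d: "?b d \<in> Units ?F" using bU by simp
      then have "?b d [^]\<^bsub>units_of ?F\<^esub> moebius_mu (n div d) \<in> carrier (units_of ?F)"
        by (intro U.int_pow_closed) (simp add: units_of_carrier)
      then show "?b d [^]\<^bsub>?F\<^esub> moebius_mu (n div d) \<in> carrier ?F"
        unfolding F.int_pow_units_of[OF d] units_of_carrier by (rule F.Units_closed)
    qed
  qed
  finally show ?thesis .
qed

section \<open>The group ring\<close>

lemma group_ring_module_simps:
  "carrier (group_ring_module G) = {a. \<forall>g. g \<notin> carrier G \<longrightarrow> a g = 0}"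
  "a \<otimes>\<^bsub>group_ring_module G\<^esub> b = (\<lambda>g. a g + b g)"
  "\<one>\<^bsub>group_ring_module G\<^esub> = (\<lambda>_. 0)"
  by (simp_all add: group_ring_module_def group_ring_def monoid.defs gmodule.defs)

lemma group_ring_mult: "a \<otimes>\<^bsub>group_ring G\<^esub> b =
    (\<lambda>g. if g \<in> carrier G then \<Sum>h\<in>carrier G. a h * b (inv h \<otimes> g) else 0)"
  by (simp add: group_ring_def)

lemma group_ring_act:
  assumes g: "g \<in> carrier G"
  shows "act (group_ring_module G) g a = (\<lambda>k. if k \<in> carrier G then a (inv g \<otimes> k) else 0)"
proof -
  have "act (group_ring_module G) g a = (\<lambda>h. of_bool (h = g)) \<otimes>\<^bsub>group_ring G\<^esub> a"
    by (simp add: group_ring_module_def monoid.defs gmodule.defs)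
  moreover have "(\<Sum>h\<in>carrier G. of_bool (h = g) * a (inv h \<otimes> k)) = a (inv g \<otimes> k)" for k
  proof -
    have "(\<Sum>h\<in>carrier G. of_bool (h = g) * a (inv h \<otimes> k)) = (\<Sum>h\<in>carrier G. if h = g then a (inv h \<otimes> k) else 0)"
      by (intro sum.cong) auto
    then show ?thesis using g fin by simp
  qed
  ultimately show ?thesis unfolding group_ring_mult by (simp add: fun_eq_iff)
qed

lemma gmodule_group_ring: "gmodule G (group_ring_module G)"
proof (rule gmoduleI[OF group_axioms])
  show "comm_group (group_ring_module G)"
  proof (rule comm_groupI)
    fix x assume "x \<in> carrier (group_ring_module G)"
    then show "\<exists>y\<in>carrier (group_ring_module G). y \<otimes>\<^bsub>group_ring_module G\<^esub> x = \<one>\<^bsub>group_ring_module G\<^esub>"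
      by (intro bexI[of _ "\<lambda>g. - x g"]) (auto simp: group_ring_module_simps)
  qed (auto simp: group_ring_module_simps)
qed (auto simp: group_ring_act group_ring_module_simps fun_eq_iff inv_mult_group m_assoc)

lemma group_ring_int_pow:
  assumes x: "x \<in> carrier (group_ring_module G)"
  shows "(x [^]\<^bsub>group_ring_module G\<^esub> (k::int)) g = k * x g"
proof -
  interpret Z: gmodule G "group_ring_module G" by (rule gmodule_group_ring)
  have "(\<lambda>a. a g) \<in> functional (group_ring_module G)" by (intro functionalI) (simp add: group_ring_module_simps)
  from Z.M.functional_int_pow[OF this x] show ?thesis .
qed

lemma group_ring_finprod:
  assumes "f \<in> A \<rightarrow> carrier (group_ring_module G)"
  shows "(\<Otimes>\<^bsub>group_ring_module G\<^esub>a\<in>A. f a) g = (\<Sum>a\<in>A. f a g)"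
proof -
  interpret Z: gmodule G "group_ring_module G" by (rule gmodule_group_ring)
  have "(\<lambda>a. a g) \<in> functional (group_ring_module G)" by (intro functionalI) (simp add: group_ring_module_simps)
  from Z.M.functional_finprod[OF this assms] show ?thesis .
qed

definition delta :: "'g \<Rightarrow> 'g \<Rightarrow> int" where
  "delta g = (\<lambda>h. of_bool (h = g))"

lemma delta_closed: "g \<in> carrier G \<Longrightarrow> delta g \<in> carrier (group_ring_module G)"
  by (auto simp: delta_def group_ring_module_simps)

lemma delta_act: "g \<in> carrier G \<Longrightarrow> h \<in> carrier G \<Longrightarrow> act (group_ring_module G) g (delta h) = delta (g \<otimes> h)"
  by (auto simp: group_ring_act delta_def fun_eq_iff m_assoc[symmetric])

lemma permutation_group_ring: "permutation_lattice G (group_ring_module G)"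
proof -
  let ?Z = "group_ring_module G"
  interpret Z: gmodule G ?Z by (rule gmodule_group_ring)
  have inj: "delta g = delta h \<longleftrightarrow> g = h" for g h by (auto simp: delta_def fun_eq_iff)
  have sub: "delta ` carrier G \<subseteq> carrier ?Z" using delta_closed by blast
  have "int_basis ?Z (delta ` carrier G)"
  proof (rule Z.M.int_basisI[where \<phi> = "\<lambda>b a. a (the_inv delta b)"])
    show "generate ?Z (delta ` carrier G) = carrier ?Z"
    proof
      show "generate ?Z (delta ` carrier G) \<subseteq> carrier ?Z" by (rule Z.M.generate_incl[OF sub])
      show "carrier ?Z \<subseteq> generate ?Z (delta ` carrier G)"
      proof
        fix a assume a: "a \<in> carrier ?Z"
        let ?f = "\<lambda>g. delta g [^]\<^bsub>?Z\<^esub> (a g :: int)"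
        have f: "?f \<in> carrier G \<rightarrow> carrier ?Z" using delta_closed by auto
        have "(\<Otimes>\<^bsub>?Z\<^esub>g\<in>carrier G. ?f g) h = a h" for h
        proof -
          have "(\<Otimes>\<^bsub>?Z\<^esub>g\<in>carrier G. ?f g) h = (\<Sum>g\<in>carrier G. if g = h then a g else 0)"
            unfolding group_ring_finprod[OF f]
            by (intro sum.cong refl) (simp add: group_ring_int_pow delta_closed, simp add: delta_def)
          also have "\<dots> = a h" using fin a by (auto simp: group_ring_module_simps)
          finally show ?thesis .
        qed
        then have "a = (\<Otimes>\<^bsub>?Z\<^esub>g\<in>carrier G. ?f g)" by (simp add: fun_eq_iff)
        moreover have "\<dots> \<in> generate ?Z (delta ` carrier G)"
          by (intro Z.M.finprod_in_subgroup[OF Z.M.generate_is_subgroup[OF sub]]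
              Z.M.int_pow_in_subgroup[OF Z.M.generate_is_subgroup[OF sub]] generate.incl imageI)
        ultimately show "a \<in> generate ?Z (delta ` carrier G)" by simp
      qed
    qed
    fix b assume "b \<in> delta ` carrier G"
    then obtain g where b: "b = delta g" "g \<in> carrier G" by blast
    have inj': "inj delta" using inj by (intro injI) blast
    show "(\<lambda>a. a (the_inv delta b)) \<in> functional ?Z" by (intro functionalI) (simp add: group_ring_module_simps)
    fix b' assume "b' \<in> delta ` carrier G"
    then obtain h where b': "b' = delta h" "h \<in> carrier G" by blast
    show "b' (the_inv delta b) = (if b' = b then 1 else 0)"
      unfolding b(1) b'(1) inj the_inv_f_f[OF inj'] by (simp add: delta_def)
  qed (use fin sub in simp_all)
  then show ?thesis
    by (rule permutation_latticeI[OF fin gmodule_group_ring]) (auto simp: delta_act)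
qed

lemma poly_ideal_eq: "poly_ideal G \<sigma> f = PA (group_ring_module G) f ` carrier (group_ring_module G)"
proof -
  let ?Z = "group_ring_module G"
  interpret Z: gmodule G ?Z by (rule gmodule_group_ring)
  have "poly_elem G \<sigma> f \<otimes>\<^bsub>group_ring G\<^esub> a = PA ?Z f a" if a: "a \<in> carrier ?Z" for a
  proof
    fix k
    let ?I = "{..Polynomial.degree f}"
    have t: "act ?Z (\<sigma> [^] i) a \<in> carrier ?Z" for i :: nat using \<sigma> a by (intro Z.act_closed) auto
    have R: "PA ?Z f a k = (\<Sum>i\<in>?I. Polynomial.coeff f i * act ?Z (\<sigma> [^] i) a k)"
      unfolding poly_act_def using t by (subst group_ring_finprod) (auto simp: group_ring_int_pow)
    show "(poly_elem G \<sigma> f \<otimes>\<^bsub>group_ring G\<^esub> a) k = PA ?Z f a k"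
    proof (cases "k \<in> carrier G")
      case True
      have "(poly_elem G \<sigma> f \<otimes>\<^bsub>group_ring G\<^esub> a) k =
          (\<Sum>h\<in>carrier G. \<Sum>i\<in>{i \<in> ?I. \<sigma> [^] i = h}. Polynomial.coeff f i * a (inv (\<sigma> [^] i) \<otimes> k))"
        using True by (simp add: group_ring_mult poly_elem_def sum_distrib_right)
      also have "\<dots> = (\<Sum>i\<in>?I. Polynomial.coeff f i * a (inv (\<sigma> [^] i) \<otimes> k))"
        by (rule sum.group) (use fin \<sigma> in auto)
      also have "\<dots> = PA ?Z f a k" unfolding R using \<sigma> True by (simp add: group_ring_act)
      finally show ?thesis .
    next
      case False
      then show ?thesis unfolding R using \<sigma> by (simp add: group_ring_mult group_ring_act)
    qed
  qed
  moreover have "carrier (group_ring G) = carrier ?Z" by (simp add: group_ring_module_simps) (simp add: group_ring_def)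
  ultimately show ?thesis unfolding poly_ideal_def by (metis (no_types, lifting) image_cong)
qed

lemma quot_poly_ideal: "quot_module (group_ring_module G) (poly_ideal G \<sigma> f) = PQ (group_ring_module G) f"
  unfolding poly_quot_def poly_ideal_eq by (rule refl)

text \<open>\<open>\<int>\<pi>\<close> is free over \<open>\<int>[X]/(X\<^sup>m - 1)\<close>, on representatives \<open>T\<close> of the cosets of \<open>\<langle>\<sigma>\<rangle>\<close>, and there the kernel
  of a factor \<open>w\<close> of \<open>X\<^sup>m - 1 = fw\<close> is generated by \<open>f\<close>.\<close>

lemma group_ring_kernel:
  assumes ord: "ord \<sigma> = m" and fw: "f * w = xpow1 m"
    and x: "x \<in> carrier (group_ring_module G)" and wx: "PA (group_ring_module G) w x = \<one>\<^bsub>group_ring_module G\<^esub>"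
  shows "x \<in> PA (group_ring_module G) f ` carrier (group_ring_module G)"
proof -
  let ?Z = "group_ring_module G"
  note Zm = gmodule_group_ring
  interpret Z: gmodule G ?Z by (rule Zm)
  \<comment> \<open>\<open>\<rho>\<close> chooses a representative in each coset of \<open>\<langle>\<sigma>\<rangle>\<close>.\<close>
  define \<rho> where "\<rho> t = (SOME t'. \<exists>i::nat. t' = \<sigma> [^] i \<otimes> t)" for t
  have \<rho>_ex: "\<exists>i::nat. \<rho> t = \<sigma> [^] i \<otimes> t" if "t \<in> carrier G" for t
    unfolding \<rho>_def by (rule someI[of "\<lambda>t'. \<exists>i::nat. t' = \<sigma> [^] i \<otimes> t" t], rule exI[of _ 0]) (use that in simp)
  have shift_back: "t = \<sigma> [^] ((m - 1) * i) \<otimes> (\<sigma> [^] i \<otimes> t)" if "t \<in> carrier G" for t i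
  proof -
    have "(m - 1) * i + i = m * i" using m by (cases m) simp_all
    then have "\<sigma> [^] ((m - 1) * i) \<otimes> \<sigma> [^] i = \<one>" using \<sigma> \<sigma>_pow nat_pow_pow[OF \<sigma>, of m i] by (simp add: nat_pow_mult)
    then show ?thesis using that \<sigma> by (simp add: m_assoc[symmetric])
  qed
  have \<rho>_eq: "\<rho> (\<sigma> [^] i \<otimes> t) = \<rho> t" if t: "t \<in> carrier G" for t and i :: nat
  proof -
    have "(\<exists>j::nat. t' = \<sigma> [^] j \<otimes> (\<sigma> [^] i \<otimes> t)) \<longleftrightarrow> (\<exists>j::nat. t' = \<sigma> [^] j \<otimes> t)" for t'
    proof
      assume "\<exists>j::nat. t' = \<sigma> [^] j \<otimes> (\<sigma> [^] i \<otimes> t)"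
      then obtain j :: nat where "t' = \<sigma> [^] j \<otimes> (\<sigma> [^] i \<otimes> t)" by blast
      then have "t' = \<sigma> [^] (j + i) \<otimes> t" using t \<sigma> by (simp add: m_assoc[symmetric] nat_pow_mult)
      then show "\<exists>j::nat. t' = \<sigma> [^] j \<otimes> t" by blast
    next
      assume "\<exists>j::nat. t' = \<sigma> [^] j \<otimes> t"
      then obtain j :: nat where "t' = \<sigma> [^] j \<otimes> (\<sigma> [^] ((m - 1) * i) \<otimes> (\<sigma> [^] i \<otimes> t))" using shift_back[OF t, of i] by auto
      then have "t' = \<sigma> [^] (j + (m - 1) * i) \<otimes> (\<sigma> [^] i \<otimes> t)"
        using t \<sigma> by (simp add: m_assoc[symmetric] nat_pow_mult[symmetric])
      then show "\<exists>j::nat. t' = \<sigma> [^] j \<otimes> (\<sigma> [^] i \<otimes> t)" by blast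
    qed
    then show ?thesis unfolding \<rho>_def by simp
  qed
  define T where "T = \<rho> ` carrier G"
  have finT: "finite T" using fin by (simp add: T_def)
  have TG: "t \<in> carrier G" and \<rho>T: "\<rho> t = t" if t: "t \<in> T" for t
  proof -
    from t obtain u where u: "t = \<rho> u" "u \<in> carrier G" unfolding T_def by (rule imageE)
    from \<rho>_ex[OF u(2)] obtain i :: nat where i: "\<rho> u = \<sigma> [^] i \<otimes> u" by (rule exE)
    show "t \<in> carrier G" using u \<sigma> i by simp
    show "\<rho> t = t" using \<rho>_eq[OF u(2), of i] u(1) i by simp
  qed
  have T_unique: "t = t' \<and> i = j" if "t \<in> T" "t' \<in> T" "i < m" "j < m" "\<sigma> [^] i \<otimes> t = \<sigma> [^] j \<otimes> t'" for t t' and i j :: nat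
  proof -
    have tt: "t = t'"
      using \<rho>_eq[OF TG[OF that(1)], of i] \<rho>_eq[OF TG[OF that(2)], of j] \<rho>T that by metis
    then have "\<sigma> [^] i = \<sigma> [^] j" using that(5) TG[OF that(2)] \<sigma> by simp
    then have "i = j"
      using inj_onD[OF ord_inj[OF \<sigma>], of i j] that(3,4) ord by auto
    with tt show ?thesis by simp
  qed
  have T_cover: "\<exists>t\<in>T. \<exists>i<m. k = \<sigma> [^] i \<otimes> t" if k: "k \<in> carrier G" for k
  proof -
    obtain i :: nat where i: "\<rho> k = \<sigma> [^] i \<otimes> k" using \<rho>_ex[OF k] by blast
    have "k = \<sigma> [^] ((m - 1) * i) \<otimes> \<rho> k" unfolding i by (rule shift_back[OF k])
    also have "\<sigma> [^] ((m - 1) * i) = \<sigma> [^] (((m - 1) * i) mod m)"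
    proof -
      have "\<sigma> [^] (m * q + r) = \<sigma> [^] r" for q r :: nat
        using \<sigma> \<sigma>_pow nat_pow_pow[OF \<sigma>, of m q] by (simp add: nat_pow_mult[symmetric])
      then show ?thesis using mult_div_mod_eq[of m "(m - 1) * i"] by metis
    qed
    finally show ?thesis using k m unfolding T_def by (intro bexI[of _ "\<rho> k"] exI[of _ "((m - 1) * i) mod m"]) auto
  qed
  let ?poly = "\<lambda>c. \<Sum>i<m. Polynomial.monom (c i :: int) i"
  have dZ: "delta t \<in> carrier ?Z" if "t \<in> T" for t using delta_closed TG[OF that] by blast
  note PAc = Z.poly_act_closed[OF \<sigma>]
  have eval: "(\<Otimes>\<^bsub>?Z\<^esub>t\<in>T. PA ?Z (?poly (c t)) (delta t)) (\<sigma> [^] j \<otimes> u) = c u j" if u: "u \<in> T" and j: "j < m" for c u j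
  proof -
    have uG: "u \<in> carrier G" by (rule TG[OF u])
    have "PA ?Z (?poly (c t)) (delta t) (\<sigma> [^] j \<otimes> u) = (\<Sum>i<m. if t = u \<and> i = j then c t i else 0)" if t: "t \<in> T" for t
    proof -
      have PAeq: "PA ?Z (?poly (c t)) (delta t) = (\<Otimes>\<^bsub>?Z\<^esub>i\<in>{..<m}. delta (\<sigma> [^] i \<otimes> t) [^]\<^bsub>?Z\<^esub> c t i)"
        using \<sigma> TG[OF t] by (simp add: Z.poly_act_sum[OF \<sigma> dZ[OF t]] Z.poly_act_monom[OF \<sigma> dZ[OF t]] delta_act)
      have "PA ?Z (?poly (c t)) (delta t) (\<sigma> [^] j \<otimes> u) = (\<Sum>i<m. (delta (\<sigma> [^] i \<otimes> t) [^]\<^bsub>?Z\<^esub> c t i) (\<sigma> [^] j \<otimes> u))"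
        unfolding PAeq by (rule group_ring_finprod) (use \<sigma> TG[OF t] in \<open>auto intro!: Z.M.int_pow_closed delta_closed\<close>)
      also have "\<dots> = (\<Sum>i<m. if t = u \<and> i = j then c t i else 0)"
      proof (rule sum.cong[OF refl])
        fix i assume "i \<in> {..<m}"
        then have "\<sigma> [^] j \<otimes> u = \<sigma> [^] i \<otimes> t \<longleftrightarrow> t = u \<and> i = j"
          using T_unique[OF u t j, of i] by auto
        then show "(delta (\<sigma> [^] i \<otimes> t) [^]\<^bsub>?Z\<^esub> c t i) (\<sigma> [^] j \<otimes> u) = (if t = u \<and> i = j then c t i else 0)"
          using \<sigma> TG[OF t] by (simp add: group_ring_int_pow delta_closed) (simp add: delta_def)
      qed
      finally show ?thesis .
    qed
    then have "(\<Otimes>\<^bsub>?Z\<^esub>t\<in>T. PA ?Z (?poly (c t)) (delta t)) (\<sigma> [^] j \<otimes> u) =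
        (\<Sum>t\<in>T. \<Sum>i<m. if t = u \<and> i = j then c t i else 0)"
      using dZ PAc by (subst group_ring_finprod) auto
    also have "\<dots> = (\<Sum>t\<in>T. if t = u then c t j else 0)"
      using j by (intro sum.cong refl) auto
    finally show ?thesis using finT u by simp
  qed
  \<comment> \<open>The coordinates of \<open>x\<close> over \<open>\<int>[X]/(X\<^sup>m - 1)\<close>.\<close>
  define P where "P t = ?poly (\<lambda>i. x (\<sigma> [^] i \<otimes> t))" for t
  have x_eq: "x = (\<Otimes>\<^bsub>?Z\<^esub>t\<in>T. PA ?Z (P t) (delta t))"
  proof
    fix k
    show "x k = (\<Otimes>\<^bsub>?Z\<^esub>t\<in>T. PA ?Z (P t) (delta t)) k"
    proof (cases "k \<in> carrier G")
      case True
      then obtain u j where "u \<in> T" "j < m" "k = \<sigma> [^] j \<otimes> u" using T_cover by blast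
      then show ?thesis unfolding P_def using eval[of u j "\<lambda>t i. x (\<sigma> [^] i \<otimes> t)"] by simp
    next
      case False
      have "(\<Otimes>\<^bsub>?Z\<^esub>t\<in>T. PA ?Z (P t) (delta t)) \<in> carrier ?Z" using dZ PAc by (intro Z.M.finprod_closed) auto
      then show ?thesis using False x by (simp add: group_ring_module_simps)
    qed
  qed
  \<comment> \<open>The coefficients of the remainder of a polynomial modulo \<open>X\<^sup>m - 1\<close>.\<close>
  define red :: "int poly \<Rightarrow> nat \<Rightarrow> int" where "red q = Polynomial.coeff (\<Sum>i\<le>Polynomial.degree q. Polynomial.monom (Polynomial.coeff q i) (i mod m))" for q
  have red: "xpow1 m dvd q - ?poly (red q)" for q
  proof -
    let ?r = "\<Sum>i\<le>Polynomial.degree q. Polynomial.monom (Polynomial.coeff q i) (i mod m)"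
    have "?poly (red q) = ?r"
    proof (rule poly_eqI)
      fix j
      have r0: "Polynomial.coeff ?r j = 0" if j: "\<not> j < m"
      proof -
        have "i mod m \<noteq> j" for i using j mod_less_divisor[of m i] m by linarith
        then show ?thesis unfolding coeff_sum by simp
      qed
      have co: "Polynomial.coeff (?poly (red q)) j = (\<Sum>i<m. if i = j then red q i else 0)"
        unfolding coeff_sum by (rule sum.cong) simp_all
      have co': "Polynomial.coeff (?poly (red q)) j = (if j < m then red q j else 0)" unfolding co by simp
      show "Polynomial.coeff (?poly (red q)) j = Polynomial.coeff ?r j"
      proof (cases "j < m")
        case False
        then show ?thesis unfolding co' using r0[OF False] by (simp only: if_False)
      next
        case True
        then show ?thesis unfolding co' by (simp only: red_def if_True)
      qed
    qed
    moreover have "q - ?r = (\<Sum>i\<le>Polynomial.degree q. Polynomial.monom (Polynomial.coeff q i) (m * (i div m) + i mod m) - Polynomial.monom (Polynomial.coeff q i) (i mod m))"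
      by (simp add: sum_subtractf poly_as_sum_of_monoms)
    ultimately show ?thesis by (simp only:) (intro dvd_sum xpow1_dvd_monom_diff)
  qed
  have PA_prod: "PA ?Z h (\<Otimes>\<^bsub>?Z\<^esub>t\<in>T. PA ?Z (q t) (delta t)) = (\<Otimes>\<^bsub>?Z\<^esub>t\<in>T. PA ?Z (h * q t) (delta t))" for h q
  proof -
    have "PA ?Z h (\<Otimes>\<^bsub>?Z\<^esub>t\<in>T. PA ?Z (q t) (delta t)) = (\<Otimes>\<^bsub>?Z\<^esub>t\<in>T. PA ?Z h (PA ?Z (q t) (delta t)))"
      by (rule hom_finprod_comm_group[OF Z.M.comm_group_axioms Z.M.comm_group_axioms
            group_hom.homh[OF Z.poly_act_group_hom[OF \<sigma>]]]) (use dZ PAc in auto)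
    also have "\<dots> = (\<Otimes>\<^bsub>?Z\<^esub>t\<in>T. PA ?Z (h * q t) (delta t))"
      using dZ PAc by (intro Z.M.finprod_cong') (auto simp: Z.poly_act_mult[OF \<sigma>])
    finally show ?thesis .
  qed
  have w_div: "xpow1 m dvd w * P u" if u: "u \<in> T" for u
  proof -
    have "(\<Otimes>\<^bsub>?Z\<^esub>t\<in>T. PA ?Z (?poly (red (w * P t))) (delta t)) = (\<Otimes>\<^bsub>?Z\<^esub>t\<in>T. PA ?Z (w * P t) (delta t))"
      using dZ PAc by (intro Z.M.finprod_cong') (auto intro!: PA_cong[OF Zm _ red, symmetric])
    also have "\<dots> = PA ?Z w (\<Otimes>\<^bsub>?Z\<^esub>t\<in>T. PA ?Z (P t) (delta t))" by (rule PA_prod[symmetric])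
    also have "\<dots> = PA ?Z w x" unfolding x_eq[symmetric] by (rule refl)
    finally have *: "(\<Otimes>\<^bsub>?Z\<^esub>t\<in>T. PA ?Z (?poly (red (w * P t))) (delta t)) = (\<lambda>_. 0)"
      using wx by (simp add: group_ring_module_simps)
    have "red (w * P u) j = 0" if "j < m" for j
      using eval[OF u that, of "\<lambda>t. red (w * P t)"] unfolding * by simp
    then have "?poly (red (w * P u)) = 0" by simp
    then show ?thesis using red[of "w * P u"] by simp
  qed
  have w0: "w \<noteq> 0" using fw xpow1_nonzero[OF m] by auto
  have "\<forall>t\<in>T. \<exists>u. P t = f * u"
  proof
    fix t assume "t \<in> T"
    then obtain u where "w * P t = xpow1 m * u" using w_div by (auto elim: dvdE)
    then have "w * P t = w * (f * u)" unfolding fw[symmetric] by (simp add: mult_ac)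
    then show "\<exists>u. P t = f * u" using w0 by auto
  qed
  then obtain u where u: "\<forall>t\<in>T. P t = f * u t" by (rule bchoice[THEN exE])
  have "x = (\<Otimes>\<^bsub>?Z\<^esub>t\<in>T. PA ?Z (f * u t) (delta t))"
    by (subst x_eq) (use dZ PAc u in \<open>auto intro!: Z.M.finprod_cong'\<close>)
  also have "\<dots> = PA ?Z f (\<Otimes>\<^bsub>?Z\<^esub>t\<in>T. PA ?Z (u t) (delta t))" by (rule PA_prod[symmetric])
  finally show ?thesis using dZ PAc by (auto intro!: Z.M.finprod_closed)
qed

text \<open>If \<open>kx = \<Phi>\<^sub>n(\<sigma>)y\<close> and \<open>X\<^sup>m - 1 = \<Phi>\<^sub>n w\<close>, then \<open>w(\<sigma>)\<close> kills \<open>kx\<close>, hence \<open>x\<close>, which is thus a multiple of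
  \<open>\<Phi>\<^sub>n(\<sigma>)\<close>.\<close>

lemma group_ring_pure:
  assumes ord: "ord \<sigma> = m" and n: "n dvd m" and x: "x \<in> carrier (group_ring_module G)"
  shows "x \<in> PA (group_ring_module G) (cyclotomic n) ` carrier (group_ring_module G) \<longleftrightarrow>
    (\<exists>k>0. x [^]\<^bsub>group_ring_module G\<^esub> (k::nat) \<in> PA (group_ring_module G) (cyclotomic n) ` carrier (group_ring_module G))"
    (is "?l \<longleftrightarrow> ?r")
proof
  let ?Z = "group_ring_module G"
  interpret Z: gmodule G ?Z by (rule gmodule_group_ring)
  {
    assume ?l
    then have "x [^]\<^bsub>?Z\<^esub> (1::nat) \<in> PA ?Z (cyclotomic n) ` carrier ?Z" using x by simp
    then show ?r by (intro exI[of _ 1]) simp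
  next
    assume ?r
    then obtain k y where k: "k > 0" and y: "y \<in> carrier ?Z" "x [^]\<^bsub>?Z\<^esub> (k::nat) = PA ?Z (cyclotomic n) y" by blast
    have "cyclotomic n dvd xpow1 m"
      using cyclotomic_prod_dvd_xpow1[OF m, of "{n}"] n by simp
    then obtain w where "xpow1 m = cyclotomic n * w" by (rule dvdE)
    then have w: "cyclotomic n * w = xpow1 m" by simp
    interpret w: group_hom ?Z ?Z "PA ?Z w" by (rule Z.poly_act_group_hom[OF \<sigma>])
    have "PA ?Z w x [^]\<^bsub>?Z\<^esub> k = PA ?Z (xpow1 m) y"
      unfolding w.hom_nat_pow[OF x, symmetric] y(2) Z.poly_act_mult[OF \<sigma> y(1), symmetric] w[symmetric]
      by (simp only: mult.commute)
    also have "\<dots> = \<one>\<^bsub>?Z\<^esub>" unfolding Z.poly_act_xpow1[OF \<sigma> y(1)] \<sigma>_pow Z.act_one[OF y(1)] using y(1) by simp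
    finally have "PA ?Z w x = \<one>\<^bsub>?Z\<^esub>"
      by (rule pi_latticeD(2)[OF permutation_lattice_pi_lattice[OF permutation_group_ring] w.hom_closed[OF x] k])
    then show ?l by (rule group_ring_kernel[OF ord w x])
  }
qed

text \<open>\<open>\<int>\<pi>/\<langle>\<Phi>\<^sub>n(\<sigma>)\<rangle>\<close> is its own torsion-free quotient; for \<open>n \<ge> 3\<close> it is the torsion-free quotient belonging
  to the twist of \<open>\<int>\<pi>\<close> as well.\<close>

lemma flabby_class_group_ring:
  assumes ord: "ord \<sigma> = m" and n: "n dvd m"
  shows "flabby_class G (PQ (group_ring_module G) (cyclotomic n)) = phi_class (group_ring_module G) n"
proof -
  let ?Z = "group_ring_module G" and ?L = "PQ (group_ring_module G) (cyclotomic n)"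
  note Zm = gmodule_group_ring
  have inv: "invertible_lattice G ?Z" by (rule invertible_permutation[OF grp_fin permutation_group_ring])
  interpret Z: gmodule G ?Z by (rule Zm)
  note st = cyclotomic_dvd_invert_var[OF n]
  obtain p where p: "p \<in> gmodule_hom G ?Z ?L" "p ` carrier ?Z = carrier ?L"
    "\<And>x. x \<in> carrier ?Z \<Longrightarrow> p x = \<one>\<^bsub>?L\<^esub> \<longleftrightarrow> x \<in> PA ?Z (cyclotomic n) ` carrier ?Z"
    by (rule PQ_projE[OF Zm st]) (rule that)
  have p': "p x = \<one>\<^bsub>?L\<^esub> \<longleftrightarrow> (\<exists>k>0. x [^]\<^bsub>?Z\<^esub> (k::nat) \<in> PA ?Z (cyclotomic n) ` carrier ?Z)" if "x \<in> carrier ?Z" for x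
    unfolding p(3)[OF that] by (rule group_ring_pure[OF ord n that])
  have n0: "n > 0" using n m by (rule dvd_pos_nat[rotated])
  show ?thesis
  proof (cases "n \<ge> 3")
    case False
    then have n12: "n = 1 \<or> n = 2" using n0 by auto
    show ?thesis
      by (rule flabby_class_phi_part[OF inv n Zm gmodule_PQ[OF Zm st] refl refl _ p(1,2) p', where \<chi> = "\<lambda>_. 1" and e = 0])
        (use proper_poly_symmetric[OF n12 n] in \<open>simp_all add: Z.act_closed\<close>)
  next
    case True
    then have m3: "m \<ge> 3" using n m by (auto dest: dvd_imp_le)
    note Tm = gmodule_twist[OF m3 ord Zm]
    let ?T = "twist \<epsilon> ?Z"
    \<comment> \<open>\<open>g \<mapsto> \<epsilon>(g)g\<close> identifies \<open>\<int>\<pi>\<close> with its twist.\<close>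
    define \<tau> where "\<tau> a = (\<lambda>g. \<epsilon> g * a g)" for a :: "'g \<Rightarrow> int"
    have sq: "\<epsilon> g * (\<epsilon> g * a) = a" if "g \<in> carrier G" for g a using \<epsilon>[OF that] by auto
    have \<tau>_closed: "\<tau> a \<in> carrier ?Z" if "a \<in> carrier ?Z" for a using that by (simp add: \<tau>_def group_ring_module_simps)
    have \<tau>\<tau>: "\<tau> (\<tau> a) = a" if "a \<in> carrier ?Z" for a
    proof
      fix g show "\<tau> (\<tau> a) g = a g"
        using that sq[of g] by (cases "g \<in> carrier G") (simp_all add: \<tau>_def group_ring_module_simps)
    qed
    have \<tau>: "\<tau> \<in> gmodule_hom G ?T ?Z"
    proof (rule gmodule_homI)
      fix x assume "x \<in> carrier ?T" then show "\<tau> x \<in> carrier ?Z" using \<tau>_closed by (simp add: twist_simps)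
    next
      fix x y show "\<tau> (x \<otimes>\<^bsub>?T\<^esub> y) = \<tau> x \<otimes>\<^bsub>?Z\<^esub> \<tau> y"
        by (simp add: twist_simps \<tau>_def group_ring_module_simps algebra_simps)
    next
      fix g x assume g: "g \<in> carrier G" and "x \<in> carrier ?T"
      then have x: "x \<in> carrier ?Z" by (simp add: twist_simps)
      show "\<tau> (act ?T g x) = act ?Z g (\<tau> x)"
      proof
        fix k
        show "\<tau> (act ?T g x) k = act ?Z g (\<tau> x) k"
        proof (cases "k \<in> carrier G")
          case True
          have "\<epsilon> k = \<epsilon> g * \<epsilon> (inv g \<otimes> k)"
            using \<epsilon>_mult[OF m3 ord g, of "inv g \<otimes> k"] g True by (simp add: m_assoc[symmetric])
          then have "\<epsilon> k * \<epsilon> g = \<epsilon> (inv g \<otimes> k)" using sq[OF g, of "\<epsilon> (inv g \<otimes> k)"] by (simp add: mult_ac)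
          moreover have "\<tau> (act ?T g x) k = (\<epsilon> k * \<epsilon> g) * x (inv g \<otimes> k)"
            using True g x by (simp add: \<tau>_def twist_simps group_ring_int_pow Z.act_closed) (simp add: group_ring_act)
          ultimately show ?thesis using True g by (simp add: group_ring_act \<tau>_def)
        next
          case False
          then show ?thesis
            using g x by (simp add: \<tau>_def twist_simps group_ring_int_pow Z.act_closed) (simp add: group_ring_act)
        qed
      qed
    qed
    have im: "\<tau> x \<in> PA ?Z (cyclotomic n) ` carrier ?Z \<longleftrightarrow> x \<in> PA ?Z (cyclotomic n) ` carrier ?Z"
      if x: "x \<in> carrier ?Z" for x
    proof -
      have comm: "\<tau> (PA ?Z (cyclotomic n) y) = PA ?Z (cyclotomic n) (\<tau> y)" if y: "y \<in> carrier ?Z" for y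
        using hom_poly_act[OF Tm Zm \<tau> \<sigma>, of y "cyclotomic n"] y PA_twist[OF m3 ord Zm y] by (simp add: twist_simps)
      show ?thesis
      proof
        assume "\<tau> x \<in> PA ?Z (cyclotomic n) ` carrier ?Z"
        then obtain y where y: "y \<in> carrier ?Z" "\<tau> x = PA ?Z (cyclotomic n) y" by blast
        have "x = PA ?Z (cyclotomic n) (\<tau> y)" using comm[OF y(1)] \<tau>\<tau>[OF x] y(2) by simp
        then show "x \<in> PA ?Z (cyclotomic n) ` carrier ?Z" using \<tau>_closed[OF y(1)] by blast
      next
        assume "x \<in> PA ?Z (cyclotomic n) ` carrier ?Z"
        then obtain y where y: "y \<in> carrier ?Z" "x = PA ?Z (cyclotomic n) y" by blast
        then show "\<tau> x \<in> PA ?Z (cyclotomic n) ` carrier ?Z" using comm[OF y(1)] \<tau>_closed[OF y(1)] by simp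
      qed
    qed
    have surj: "(\<lambda>x. p (\<tau> x)) ` carrier ?T = carrier ?L"
    proof -
      have "\<tau> ` carrier ?Z = carrier ?Z"
      proof (intro equalityI subsetI)
        fix x assume x: "x \<in> carrier ?Z"
        show "x \<in> \<tau> ` carrier ?Z" using \<tau>\<tau>[OF x] \<tau>_closed[OF x] by (intro image_eqI[of _ _ "\<tau> x"]) simp_all
      qed (use \<tau>_closed in blast)
      then show ?thesis unfolding twist_simps p(2)[symmetric] image_image[of p \<tau>, symmetric] by simp
    qed
    have ker: "p (\<tau> x) = \<one>\<^bsub>?L\<^esub> \<longleftrightarrow> (\<exists>k>0. x [^]\<^bsub>?Z\<^esub> (k::nat) \<in> PA ?Z (cyclotomic n) ` carrier ?Z)"
      if x: "x \<in> carrier ?Z" for x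
      unfolding p(3)[OF \<tau>_closed[OF x]] im[OF x] by (rule group_ring_pure[OF ord n x])
    obtain e where "\<And>g. g \<in> carrier G \<Longrightarrow> \<epsilon> g = 1 \<and> \<epsilon> g = 1 \<or> \<epsilon> g \<noteq> 1 \<and>
        xpow1 n dvd invert_var m (proper_poly n * Polynomial.monom 1 e) - [:\<epsilon> g:] * (proper_poly n * Polynomial.monom 1 e)"
      using True n by (rule sign_cases) (rule that)
    note e = this
    show ?thesis
      by (rule flabby_class_phi_part[OF inv n Tm gmodule_PQ[OF Zm st] _ _ _ gmodule_hom_comp[OF \<tau> p(1)] surj ker, where \<chi> = \<epsilon>])
        (use e in \<open>simp_all add: twist_simps\<close>)
  qed
qed

end

section \<open>The relations in the monoid of flabby classes\<close>

theorem theorem4p4: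
  fixes G :: "('g, 'c) monoid_scheme" and M :: "('g, 'a) gmodule"
    and \<sigma> :: 'g and \<epsilon> :: "'g \<Rightarrow> int" and m n :: nat
  assumes "group G" and "finite (carrier G)"
    and "\<sigma> \<in> carrier G" and "m \<ge> 1" and "group.ord G \<sigma> = m" and "generate G {\<sigma>} \<lhd> G"
    and "\<And>g. g \<in> carrier G \<Longrightarrow> \<epsilon> g \<in> {1, -1}"
    and "\<And>g. g \<in> carrier G \<Longrightarrow> g \<otimes>\<^bsub>G\<^esub> \<sigma> \<otimes>\<^bsub>G\<^esub> inv\<^bsub>G\<^esub> g = \<sigma> [^]\<^bsub>G\<^esub> \<epsilon> g"
    and "invertible_lattice G M"
    and "n dvd m"
  shows
    "let F = flabby_monoid G;
         M' = twist \<epsilon> M;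
         A = (\<lambda>d. flabby_class G (poly_quot G M \<sigma> (Polynomial.monom 1 d - 1)));
         B = (\<lambda>d. flabby_class G (mod_torsion (poly_quot G M \<sigma> (cyclotomic d))));
         B' = (\<lambda>d. flabby_class G (mod_torsion (poly_quot G M' \<sigma> (cyclotomic d))));
         ZG = group_ring_module G;
         R = (\<lambda>d. flabby_class G (quot_module ZG (poly_ideal G \<sigma> (Polynomial.monom 1 d - 1))));
         S = (\<lambda>d. flabby_class G (quot_module ZG (poly_ideal G \<sigma> (cyclotomic d))))
     in
       \<comment> \<open>the classes occurring with negative coefficients below are invertible\<close>
       (\<forall>d. d dvd n \<longrightarrow> A d \<in> Units F \<and> R d \<in> Units F) \<and>
       (n = 1 \<or> n = 2 \<longrightarrow>
          A n = (\<Otimes>\<^bsub>F\<^esub>d\<in>{d. d dvd n}. B d) \<and>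
          B n = (\<Otimes>\<^bsub>F\<^esub>d\<in>{d. d dvd n}. A d [^]\<^bsub>F\<^esub> moebius_mu (n div d))) \<and>
       (n \<ge> 3 \<longrightarrow>
          (odd n \<longrightarrow> A n = B 1 \<otimes>\<^bsub>F\<^esub> (\<Otimes>\<^bsub>F\<^esub>d\<in>{d. d dvd n \<and> d \<ge> 3}. B' d)) \<and>
          (even n \<longrightarrow> A n = B 1 \<otimes>\<^bsub>F\<^esub> B 2 \<otimes>\<^bsub>F\<^esub> (\<Otimes>\<^bsub>F\<^esub>d\<in>{d. d dvd n \<and> d \<ge> 3}. B' d)) \<and>
          B' n = (\<Otimes>\<^bsub>F\<^esub>d\<in>{d. d dvd n}. A d [^]\<^bsub>F\<^esub> moebius_mu (n div d))) \<and>
       R n = (\<Otimes>\<^bsub>F\<^esub>d\<in>{d. d dvd n}. S d) \<and>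
       S n = (\<Otimes>\<^bsub>F\<^esub>d\<in>{d. d dvd n}. R d [^]\<^bsub>F\<^esub> moebius_mu (n div d))"
proof -
  interpret group G by fact
  interpret cyclic_normal G \<sigma> \<epsilon> m
    by unfold_locales (use assms(2-5,7,8) pow_ord_eq_1[OF assms(3)] in auto)
  let ?F = "flabby_monoid G" and ?ZG = "group_ring_module G"
  interpret F: comm_monoid ?F by (rule comm_monoid_flabby_monoid[OF grp_fin])
  note M = assms(9) and n = assms(10)
  note ZG = invertible_permutation[OF grp_fin permutation_group_ring]
  have n0: "n > 0" using n m by (rule dvd_pos_nat[rotated])
  have dm: "d dvd m" if "d dvd n" for d using that n by (rule dvd_trans)
  let ?A = "\<lambda>d. flabby_class G (PQ M (xpow1 d))"
    and ?B = "\<lambda>d. flabby_class G (mod_torsion (PQ M (cyclotomic d)))"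
    and ?B' = "\<lambda>d. flabby_class G (mod_torsion (PQ (twist \<epsilon> M) (cyclotomic d)))"
    and ?R = "\<lambda>d. flabby_class G (PQ ?ZG (xpow1 d))"
    and ?S = "\<lambda>d. flabby_class G (PQ ?ZG (cyclotomic d))"
  have phi: "phi_class M d \<in> carrier ?F" if "d dvd n" for d
    by (rule F.Units_closed[OF phi_class_Units[OF M dm[OF that]]])
  have phi_ZG: "phi_class ?ZG d \<in> carrier ?F" if "d dvd n" for d
    by (rule F.Units_closed[OF phi_class_Units[OF ZG dm[OF that]]])
  have B: "?B d = phi_class M d" if "d = 1 \<or> d = 2" "d dvd n" for d
    by (rule flabby_class_mod_torsion[OF M that(1) dm[OF that(2)]])
  have B': "?B' d = phi_class M d" if "d \<ge> 3" "d dvd n" for d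
    by (rule flabby_class_mod_torsion_twist[OF M that(1) dm[OF that(2)] assms(5)])
  have S: "?S d = phi_class ?ZG d" if "d dvd n" for d
    by (rule flabby_class_group_ring[OF assms(5) dm[OF that]])
  note A_prod = flabby_class_xpow1_prod[OF M n]
  have units: "\<forall>d. d dvd n \<longrightarrow> ?A d \<in> Units ?F \<and> ?R d \<in> Units ?F"
    using flabby_class_xpow1_Units[OF M dm] flabby_class_xpow1_Units[OF ZG dm] by simp
  have small: "n = 1 \<or> n = 2 \<longrightarrow> ?A n = (\<Otimes>\<^bsub>?F\<^esub>d\<in>{d. d dvd n}. ?B d) \<and>
      ?B n = (\<Otimes>\<^bsub>?F\<^esub>d\<in>{d. d dvd n}. ?A d [^]\<^bsub>?F\<^esub> moebius_mu (n div d))"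
  proof (intro impI conjI)
    assume n12: "n = 1 \<or> n = 2"
    have "d = 1 \<or> d = 2" if "d dvd n" for d
      using dvd_imp_le[OF that n0] dvd_pos_nat[OF n0 that] n12 by linarith
    then show "?A n = (\<Otimes>\<^bsub>?F\<^esub>d\<in>{d. d dvd n}. ?B d)"
      unfolding A_prod using phi B by (intro F.finprod_cong') (simp_all add: Pi_def)
    show "?B n = (\<Otimes>\<^bsub>?F\<^esub>d\<in>{d. d dvd n}. ?A d [^]\<^bsub>?F\<^esub> moebius_mu (n div d))"
      unfolding B[OF n12 dvd_refl] by (rule phi_class_moebius[OF M n])
  qed
  have big: "n \<ge> 3 \<longrightarrow>
      (odd n \<longrightarrow> ?A n = ?B 1 \<otimes>\<^bsub>?F\<^esub> (\<Otimes>\<^bsub>?F\<^esub>d\<in>{d. d dvd n \<and> d \<ge> 3}. ?B' d)) \<and>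
      (even n \<longrightarrow> ?A n = ?B 1 \<otimes>\<^bsub>?F\<^esub> ?B 2 \<otimes>\<^bsub>?F\<^esub> (\<Otimes>\<^bsub>?F\<^esub>d\<in>{d. d dvd n \<and> d \<ge> 3}. ?B' d)) \<and>
      ?B' n = (\<Otimes>\<^bsub>?F\<^esub>d\<in>{d. d dvd n}. ?A d [^]\<^bsub>?F\<^esub> moebius_mu (n div d))"
  proof (intro impI conjI)
    assume n3: "n \<ge> 3"
    let ?D = "{d. d dvd n \<and> d \<ge> 3}"
    have fin_D: "finite ?D" using finite_divisors_nat[OF n0] by (rule rev_finite_subset) blast
    have phi_D: "phi_class M \<in> ?D \<rightarrow> carrier ?F" using phi by (simp add: Pi_def)
    have D: "(\<Otimes>\<^bsub>?F\<^esub>d\<in>?D. ?B' d) = (\<Otimes>\<^bsub>?F\<^esub>d\<in>?D. phi_class M d)"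
      using phi_D B' by (intro F.finprod_cong') simp_all
    have D_closed: "(\<Otimes>\<^bsub>?F\<^esub>d\<in>?D. phi_class M d) \<in> carrier ?F" by (rule F.finprod_closed[OF phi_D])
    have B1: "?B 1 = phi_class M 1" by (rule B) simp_all
    have cases: "d = 1 \<or> d = 2 \<or> d \<ge> 3" if "d dvd n" for d using dvd_pos_nat[OF n0 that] by linarith
    show "?A n = ?B 1 \<otimes>\<^bsub>?F\<^esub> (\<Otimes>\<^bsub>?F\<^esub>d\<in>?D. ?B' d)" if odd: "odd n"
    proof -
      have "{d. d dvd n} = insert 1 ?D"
        using cases odd by (intro equalityI subsetI; simp) blast+
      then show ?thesis
        unfolding A_prod B1 D using fin_D phi_D phi[of 1] by (simp add: F.finprod_insert)
    qed
    show "?A n = ?B 1 \<otimes>\<^bsub>?F\<^esub> ?B 2 \<otimes>\<^bsub>?F\<^esub> (\<Otimes>\<^bsub>?F\<^esub>d\<in>?D. ?B' d)" if even: "even n"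
    proof -
      have B2: "?B 2 = phi_class M 2" by (rule B) (use even in simp_all)
      have "{d. d dvd n} = insert 1 (insert 2 ?D)"
        using cases even by (intro equalityI subsetI; simp) blast+
      then show ?thesis
        unfolding A_prod B1 B2 D using fin_D phi_D phi[of 1] phi[of 2] even D_closed
        by (simp add: F.finprod_insert F.m_assoc)
    qed
    show "?B' n = (\<Otimes>\<^bsub>?F\<^esub>d\<in>{d. d dvd n}. ?A d [^]\<^bsub>?F\<^esub> moebius_mu (n div d))"
      unfolding B'[OF n3 dvd_refl] by (rule phi_class_moebius[OF M n])
  qed
  have R: "?R n = (\<Otimes>\<^bsub>?F\<^esub>d\<in>{d. d dvd n}. ?S d)"
    unfolding flabby_class_xpow1_prod[OF ZG n]
    using phi_ZG S by (intro F.finprod_cong') (simp_all add: Pi_def)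
  have S_n: "?S n = (\<Otimes>\<^bsub>?F\<^esub>d\<in>{d. d dvd n}. ?R d [^]\<^bsub>?F\<^esub> moebius_mu (n div d))"
    unfolding S[OF dvd_refl] by (rule phi_class_moebius[OF ZG n])
  show ?thesis
    unfolding Let_def quot_poly_ideal by (intro conjI units small big R S_n)
qed

end
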